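(* Let $1<p<\infty$, let $G:=G_{1}\times G_{2}$ be a product of locally compact second countable groups, $\Gamma\leq G$ an irreducible $p$-integrable lattice, and $(V,\rho)$ a strongly operator continuous isometric Banach $\Gamma$-module. Let $\widetilde{V}:=L^p(G/\Gamma,V)$ and let $\widetilde{\rho}:=\mathrm{Ind}_\Gamma^G(\rho):G\to\mathrm{GL}(\widetilde V)$ be the induced representation. Assume that the groups admit Baire probability measures $\mu_{1}\in\mathcal{P}_{\sigma}(G_{1})$, $\mu_{2}\in\mathcal{P}_{\sigma}(G_{2})$ and null sets $\mathcal{N}_{1}\subseteq G_{1}$, $\mathcal{N}_{2}\subseteq G_{2}$ for which $G_{1}\setminus\mathcal{N}_{1}$, $G_{2}\setminus\mathcal{N}_{2}$ are contained in compact sets, for which $\Vert\widetilde{\rho}_{\mu_{1}}\widetilde{\rho}_{\mu_{2}}\Vert<1$, and which satisfy $\widetilde{V}^{\mu_{1}}=\widetilde{V}^{G_{1}}$, $\widetilde{V}^{\mu_{2}}=\widetilde{V}^{G_{2}}$. Finally, let $b\in Z^{1}(\Gamma,\rho)$ be a 1-cocycle. Then there exists for every $i\in\{1,2\}$ a $\Gamma$-invariant closed subspace $V_{i}\subseteq V$ on which the $\Gamma$-representation extends to a strongly operator continuous isometric linear $G$-representation that factors through a representation of $G_{i}$. Furthermore, there exist 1-cocycles $b_{1}\in Z^{1}(G,V_{1})$, $b_{2}\in Z^{1}(G,V_{2})$ such that $b$ is cohomologous to $b_{1}|_{\Gamma\times\Gamma}+b_{2}|_{\Gamma\times\Gamma}$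 in $Z^{1}(\Gamma,V)$ and such that $b_{i}$ only depends on $G_{i}$ for $i\in\{1,2\}$ (i.e. $b_i(g,h)$ depends only on the $G_i$-components of $g,h\in G$).
   Context: Baire measures: the Baire $\sigma$-algebra of a topological space $X$ is the smallest $\sigma$-algebra for which all continuous functions $X\to\mathbb{R}$ are measurable; $\mathcal{P}_\sigma(X)$ is the set of probability measures on it. Lattices: let $\Gamma\le G=G_1\times G_2$ be a discrete subgroup, $\nu$ a Haar measure on $G$. A fundamental domain for $\Gamma$ is a subset $\mathcal{D}\subseteq G$ with $G=\mathcal{D}\Gamma$ and $\mathcal{D}\gamma\cap\mathcal{D}\gamma'=\emptyset$ for $\gamma\ne\gamma'$ in $\Gamma$. $\Gamma$ is a lattice if it has a Borel fundamental domain $\mathcal{D}$ with $\nu(\mathcal{D})<\infty$; $\nu$ is normalized so that the induced measure on $G/\Gamma$ has total mass one. The lattice is irreducible if its image under each coordinate projection $G\to G_i$ is dense. The cocycle $\chi_{\mathcal{D}}:G\times\mathcal{D}\to\Gamma$ is defined by letting $\chi_{\mathcal{D}}(g,x)$ be the unique $\gamma\in\Gamma$ with $gx\gamma\in\mathcal{D}$. The lattice is $p$-integrable if either $G/\Gamma$ is compact, or $\Gamma$ is finitely generated and for some finite generating set $S$ of $\Gamma$ with word length $\ell_S$ there is a Borel fundamental domain $\mathcal{D}$ with $\int_{\mathcal{D}}\ell_S^p(\chi_{\mathcal{D}}(g,x))\,d\nu(x)<\infty$ for all $g\in G$. Induction: $L^p(G/\Gamma,V)$ is the Banach space of classes of measurable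 functions $\xi:G/\Gamma\to V$ with $\Vert\xi\Vert$ $p$-integrable. Fix a Borel fundamental domain $\mathcal{D}$ for $\Gamma$ containing $e$, which is compact or satisfies the integrability condition above. For a strongly operator continuous isometric representation $\rho:\Gamma\to\mathrm{GL}(V)$, $\widetilde\rho=\mathrm{Ind}_\Gamma^G(\rho)$ is the strongly operator continuous isometric representation of $G$ on $\widetilde V$ given by $(\widetilde\rho_g(\xi))(x\Gamma):=\rho_{\chi_{\mathcal{D}}(g^{-1},x)}\big(\xi(g^{-1}x\chi_{\mathcal{D}}(g^{-1},x)\Gamma)\big)$, $x\in\mathcal{D}$. Modules: a strongly operator continuous isometric Banach $G$-module $(V,\rho)$ is a (real or complex) Banach space with a homomorphism $\rho:G\to\mathrm{GL}(V)$ by isometries such that $g\mapsto\rho_g(v)$ is norm continuous for each $v$. For $\mu_i\in\mathcal{P}_\sigma(G_i)$ as in the claim, $\widetilde\rho_{\mu_i}\in\mathcal{B}(\widetilde V)$ is determined by $\phi(\widetilde\rho_{\mu_i}(\xi))=\int_{G_i}\phi(\widetilde\rho_g(\xi))\,d\mu_i(g)$ for $\phi\in\widetilde V^*$; $\widetilde V^{\mu_i}:=\{\xi\mid\widetilde\rho_{\mu_i}(\xi)=\xi\}$ and $\widetilde V^{G_i}$ is the subspace of $G_i$-fixed vectors ($G_i$ viewed inside $G$). Cocycles: for a topological group $G$ and a strongly operator continuous Banach $G$-module $(V,\rho)$, $Z^1(G,\rho)=Z^1(G,V)$ is the space of continuous $b:G\times G\to V$ with $b(gg_1,gg_2)=\rho_g(b(g_1,g_2))$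 and $b(g_2,g_3)-b(g_1,g_3)+b(g_1,g_2)=0$. Two 1-cocycles are cohomologous if their difference is of the form $(g,h)\mapsto\rho_h(v)-\rho_g(v)$ for some $v\in V$. *)

theory Defs
  imports "HOL-Probability.Probability_Measure"
begin

text \<open>
  Groups are written additively: the class \<^class>\<open>group_add\<close> does not assume commutativity,
  so \<open>g + h\<close>, \<open>- g\<close> and \<open>0\<close> stand for the product, the inverse and the neutral element of an
  arbitrary group, and the product group is the product type.
\<close>

text \<open>
  Real and complex Banach spaces are treated together: \<open>sc\<close> is the scalar multiplication by a
  field \<open>'k\<close> of sort \<open>{real_normed_field, euclidean_space}\<close>.  Such a field is a finite-dimensional
  commutative real division algebra with multiplicative norm, i.e. a copy of the reals or of the
  complex numbers, and both are instances.  For real scalars \<open>sc\<close> is necessarily \<^term>\<open>scaleR\<close>.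
\<close>

definition scalar_mult :: "('k::{real_normed_field, euclidean_space} \<Rightarrow> 'v::banach \<Rightarrow> 'v) \<Rightarrow> bool" where
  "scalar_mult sc \<longleftrightarrow>
     vector_space sc \<and>
     (\<forall>r v. sc (of_real r) v = r *\<^sub>R v) \<and>
     (\<forall>a v. norm (sc a v) = norm a * norm v)"

definition closed_subspace :: "('k::{real_normed_field, euclidean_space} \<Rightarrow> 'v::banach \<Rightarrow> 'v) \<Rightarrow> 'v set \<Rightarrow> bool" where
  "closed_subspace sc W \<longleftrightarrow> module.subspace sc W \<and> closed W"

text \<open>
  A module of the subgroup \<open>H\<close> on the closed subspace \<open>W\<close>; the values of \<open>\<rho>\<close> outside of \<open>H\<close> and \<open>W\<close>
  are irrelevant.  Invertibility of \<open>\<rho> h\<close> on \<open>W\<close> follows from the group laws.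
\<close>

definition isometric_module ::
  "('k::{real_normed_field, euclidean_space} \<Rightarrow> 'v::banach \<Rightarrow> 'v) \<Rightarrow>
   'g::{group_add, topological_space} set \<Rightarrow> 'v set \<Rightarrow> ('g \<Rightarrow> 'v \<Rightarrow> 'v) \<Rightarrow> bool" where
  "isometric_module sc H W \<rho> \<longleftrightarrow>
     closed_subspace sc W \<and>
     (\<forall>h\<in>H. \<forall>v\<in>W. \<rho> h v \<in> W) \<and>
     (\<forall>h\<in>H. \<forall>v\<in>W. \<forall>w\<in>W. \<rho> h (v + w) = \<rho> h v + \<rho> h w) \<and>
     (\<forall>h\<in>H. \<forall>a. \<forall>v\<in>W. \<rho> h (sc a v) = sc a (\<rho> h v)) \<and>
     (\<forall>h\<in>H. \<forall>v\<in>W. norm (\<rho> h v) = norm v) \<and>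
     (\<forall>v\<in>W. \<rho> 0 v = v) \<and>
     (\<forall>g\<in>H. \<forall>h\<in>H. \<forall>v\<in>W. \<rho> (g + h) v = \<rho> g (\<rho> h v)) \<and>
     (\<forall>v\<in>W. continuous_on H (\<lambda>h. \<rho> h v))"

definition cocycles ::
  "'g::{group_add, topological_space} set \<Rightarrow> 'v::banach set \<Rightarrow> ('g \<Rightarrow> 'v \<Rightarrow> 'v) \<Rightarrow> ('g \<Rightarrow> 'g \<Rightarrow> 'v) set" where
  "cocycles H W \<rho> = {b.
     (\<forall>g\<in>H. \<forall>h\<in>H. b g h \<in> W) \<and>
     continuous_on (H \<times> H) (\<lambda>(g, h). b g h) \<and>
     (\<forall>g\<in>H. \<forall>g1\<in>H. \<forall>g2\<in>H. b (g + g1) (g + g2) = \<rho> g (b g1 g2)) \<and>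
     (\<forall>g1\<in>H. \<forall>g2\<in>H. \<forall>g3\<in>H. b g2 g3 - b g1 g3 + b g1 g2 = 0)}"

definition cohomologous ::
  "'g set \<Rightarrow> 'v::banach set \<Rightarrow> ('g \<Rightarrow> 'v \<Rightarrow> 'v) \<Rightarrow> ('g \<Rightarrow> 'g \<Rightarrow> 'v) \<Rightarrow> ('g \<Rightarrow> 'g \<Rightarrow> 'v) \<Rightarrow> bool" where
  "cohomologous H W \<rho> b c \<longleftrightarrow> (\<exists>v\<in>W. \<forall>g\<in>H. \<forall>h\<in>H. b g h - c g h = \<rho> h v - \<rho> g v)"

text \<open>
  \<open>\<sigma>\<close> is a representation of the whole group on \<open>W\<close> which extends the \<open>\<Gamma>\<close>-representation and
  factors through a representation of the quotient group given by the homomorphism \<open>\<pi>\<close>.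
\<close>

definition extends_through ::
  "('k::{real_normed_field, euclidean_space} \<Rightarrow> 'v::banach \<Rightarrow> 'v) \<Rightarrow>
   'g::{group_add, topological_space} set \<Rightarrow> ('g \<Rightarrow> 'v \<Rightarrow> 'v) \<Rightarrow>
   ('g \<Rightarrow> 'h::{group_add, topological_space}) \<Rightarrow> 'v set \<Rightarrow> ('g \<Rightarrow> 'v \<Rightarrow> 'v) \<Rightarrow> bool" where
  "extends_through sc \<Gamma> \<rho> \<pi> W \<sigma> \<longleftrightarrow>
     isometric_module sc UNIV W \<sigma> \<and>
     (\<forall>\<gamma>\<in>\<Gamma>. \<forall>v\<in>W. \<sigma> \<gamma> v = \<rho> \<gamma> v) \<and>
     (\<exists>\<tau>. isometric_module sc UNIV W \<tau> \<and> (\<forall>g. \<forall>v\<in>W. \<sigma> g v = \<tau> (\<pi> g) v))"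

definition add_subgroup :: "'g::group_add set \<Rightarrow> bool" where
  "add_subgroup \<Gamma> \<longleftrightarrow> 0 \<in> \<Gamma> \<and> (\<forall>x\<in>\<Gamma>. \<forall>y\<in>\<Gamma>. x + y \<in> \<Gamma>) \<and> (\<forall>x\<in>\<Gamma>. - x \<in> \<Gamma>)"

text \<open>
  Haar measures are taken to be right invariant.  As \<open>\<Gamma>\<close> acts on the right, this is what makes
  the mass of a fundamental domain independent of the domain.  A group with a fundamental domain of
  finite mass is then unimodular, so that the measure is left invariant as well.  (With left
  invariance instead, the subgroup generated by a dilation in the affine group of the line would
  have a fundamental domain of finite mass, although that group has no lattices.)
  Regularity is automatic, as all groups below are locally compact and second countable.
\<close>

definition haar_measure :: "'g::{group_add, topological_space} measure \<Rightarrow> bool" where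
  "haar_measure \<nu> \<longleftrightarrow>
     sets \<nu> = sets borel \<and>
     (\<forall>g. \<forall>A\<in>sets borel. emeasure \<nu> ((\<lambda>x. x + g) ` A) = emeasure \<nu> A) \<and>
     (\<forall>K. compact K \<longrightarrow> emeasure \<nu> K < \<infinity>) \<and>
     emeasure \<nu> UNIV \<noteq> 0"

definition fundamental_domain :: "'g::group_add set \<Rightarrow> 'g set \<Rightarrow> bool" where
  "fundamental_domain \<Gamma> D \<longleftrightarrow>
     (UNIV = {x + \<gamma> | x \<gamma>. x \<in> D \<and> \<gamma> \<in> \<Gamma>}) \<and>
     (\<forall>\<gamma>\<in>\<Gamma>. \<forall>\<gamma>'\<in>\<Gamma>. \<gamma> \<noteq> \<gamma>' \<longrightarrow> (\<lambda>x. x + \<gamma>) ` D \<inter> (\<lambda>x. x + \<gamma>') ` D = {})"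

definition lattice_in :: "'g::{group_add, topological_space} measure \<Rightarrow> 'g set \<Rightarrow> bool" where
  "lattice_in \<nu> \<Gamma> \<longleftrightarrow>
     add_subgroup \<Gamma> \<and> discrete \<Gamma> \<and>
     (\<exists>D\<in>sets borel. fundamental_domain \<Gamma> D \<and> emeasure \<nu> D < \<infinity>)"

definition irreducible_in_prod :: "('a::topological_space \<times> 'b::topological_space) set \<Rightarrow> bool" where
  "irreducible_in_prod \<Gamma> \<longleftrightarrow> closure (fst ` \<Gamma>) = UNIV \<and> closure (snd ` \<Gamma>) = UNIV"

definition domain_cocycle :: "'g::group_add set \<Rightarrow> 'g set \<Rightarrow> 'g \<Rightarrow> 'g \<Rightarrow> 'g" where
  "domain_cocycle \<Gamma> D g x = (THE \<gamma>. \<gamma> \<in> \<Gamma> \<and> g + x + \<gamma> \<in> D)"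

definition generates :: "'g::group_add set \<Rightarrow> 'g set \<Rightarrow> bool" where
  "generates S \<Gamma> \<longleftrightarrow> \<Gamma> = {sum_list xs | xs. set xs \<subseteq> S \<union> uminus ` S}"

definition word_length :: "'g::group_add set \<Rightarrow> 'g \<Rightarrow> nat" where
  "word_length S \<gamma> = (LEAST n. \<exists>xs. length xs = n \<and> set xs \<subseteq> S \<union> uminus ` S \<and> sum_list xs = \<gamma>)"

definition p_integrable_domain ::
  "real \<Rightarrow> 'g::{group_add, topological_space} measure \<Rightarrow> 'g set \<Rightarrow> 'g set \<Rightarrow> bool" where
  "p_integrable_domain p \<nu> \<Gamma> D \<longleftrightarrow>
     (\<exists>S. finite S \<and> generates S \<Gamma> \<and>
        (\<forall>g. (\<integral>\<^sup>+x\<in>D. ennreal (real (word_length S (domain_cocycle \<Gamma> D g x)) powr p) \<partial>\<nu>) < \<infinity>))"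

definition left_coset :: "'g::group_add set \<Rightarrow> 'g \<Rightarrow> 'g set" where
  "left_coset \<Gamma> x = (\<lambda>\<gamma>. x + \<gamma>) ` \<Gamma>"

definition coset_topology :: "'g::{group_add, topological_space} set \<Rightarrow> 'g set topology" where
  "coset_topology \<Gamma> = topology (\<lambda>U. U \<subseteq> range (left_coset \<Gamma>) \<and> open (left_coset \<Gamma> -` U))"

lemma istopology_coset_topology:
  "istopology (\<lambda>U. U \<subseteq> range (left_coset \<Gamma>) \<and> open (left_coset \<Gamma> -` U))"
  unfolding istopology_def by (auto simp: vimage_Union)

definition coset_borel :: "'g::{group_add, topological_space} set \<Rightarrow> 'g set measure" where
  "coset_borel \<Gamma> = sigma (range (left_coset \<Gamma>)) {U. openin (coset_topology \<Gamma>) U}"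

definition coset_measure ::
  "'g::{group_add, topological_space} measure \<Rightarrow> 'g set \<Rightarrow> 'g set \<Rightarrow> 'g set measure" where
  "coset_measure \<nu> \<Gamma> D = distr (restrict_space \<nu> D) (coset_borel \<Gamma>) (left_coset \<Gamma>)"

definition p_integrable_lattice ::
  "real \<Rightarrow> 'g::{group_add, topological_space} measure \<Rightarrow> 'g set \<Rightarrow> bool" where
  "p_integrable_lattice p \<nu> \<Gamma> \<longleftrightarrow>
     lattice_in \<nu> \<Gamma> \<and>
     (compact_space (coset_topology \<Gamma>) \<or>
      (\<exists>D\<in>sets borel. fundamental_domain \<Gamma> D \<and> p_integrable_domain p \<nu> \<Gamma> D))"

text \<open>
  Elements are represented by functions, classes being taken with respect to equality almost
  everywhere.  Measurability is in the sense of Bochner: a Borel function with separable range.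
\<close>

definition Lp_space :: "real \<Rightarrow> 'x measure \<Rightarrow> ('x \<Rightarrow> 'v::banach) set" where
  "Lp_space p M = {\<xi>.
     \<xi> \<in> borel_measurable M \<and>
     (\<exists>C. countable C \<and> \<xi> ` space M \<subseteq> closure C) \<and>
     integrable M (\<lambda>x. norm (\<xi> x) powr p)}"

definition Lp_norm :: "real \<Rightarrow> 'x measure \<Rightarrow> ('x \<Rightarrow> 'v::banach) \<Rightarrow> real" where
  "Lp_norm p M \<xi> = (\<integral>x. norm (\<xi> x) powr p \<partial>M) powr (1 / p)"

definition Lp_dual ::
  "('k::{real_normed_field, euclidean_space} \<Rightarrow> 'v::banach \<Rightarrow> 'v) \<Rightarrow> real \<Rightarrow> 'x measure \<Rightarrow>
   (('x \<Rightarrow> 'v) \<Rightarrow> 'k) set" where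
  "Lp_dual sc p M = {\<phi>.
     (\<forall>\<xi>\<in>Lp_space p M. \<forall>\<eta>\<in>Lp_space p M. \<phi> (\<lambda>x. \<xi> x + \<eta> x) = \<phi> \<xi> + \<phi> \<eta>) \<and>
     (\<forall>a. \<forall>\<xi>\<in>Lp_space p M. \<phi> (\<lambda>x. sc a (\<xi> x)) = a * \<phi> \<xi>) \<and>
     (\<exists>C. \<forall>\<xi>\<in>Lp_space p M. norm (\<phi> \<xi>) \<le> C * Lp_norm p M \<xi>)}"

definition Lp_opnorm :: "real \<Rightarrow> 'x measure \<Rightarrow> (('x \<Rightarrow> 'v::banach) \<Rightarrow> ('x \<Rightarrow> 'v)) \<Rightarrow> ennreal" where
  "Lp_opnorm p M T = (SUP \<xi>\<in>{\<xi>\<in>Lp_space p M. Lp_norm p M \<xi> \<le> 1}. ennreal (Lp_norm p M (T \<xi>)))"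

definition induced_rep ::
  "'g::group_add set \<Rightarrow> 'g set \<Rightarrow> ('g \<Rightarrow> 'v \<Rightarrow> 'v) \<Rightarrow> 'g \<Rightarrow> ('g set \<Rightarrow> 'v) \<Rightarrow> 'g set \<Rightarrow> 'v" where
  "induced_rep \<Gamma> D \<rho> g \<xi> c =
     (let x = (THE x. x \<in> D \<and> left_coset \<Gamma> x = c);
          \<gamma> = domain_cocycle \<Gamma> D (- g) x
      in \<rho> \<gamma> (\<xi> (left_coset \<Gamma> (- g + x + \<gamma>))))"

definition baire :: "'a::topological_space measure" where
  "baire = sigma UNIV {f -` B | (f :: 'a \<Rightarrow> real) B. continuous_on UNIV f \<and> B \<in> sets borel}"

text \<open>
  The operator which averages the family \<open>R\<close> of operators on the Lebesgue space against \<open>\<mu>\<close>.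
  The defining identity determines the value up to equality almost everywhere.
\<close>

definition average ::
  "('k::{real_normed_field, euclidean_space} \<Rightarrow> 'v::banach \<Rightarrow> 'v) \<Rightarrow> real \<Rightarrow> 'x measure \<Rightarrow>
   'a measure \<Rightarrow> ('a \<Rightarrow> ('x \<Rightarrow> 'v) \<Rightarrow> ('x \<Rightarrow> 'v)) \<Rightarrow> ('x \<Rightarrow> 'v) \<Rightarrow> ('x \<Rightarrow> 'v)" where
  "average sc p M \<mu> R \<xi> =
     (SOME \<eta>. \<eta> \<in> Lp_space p M \<and> (\<forall>\<phi>\<in>Lp_dual sc p M. \<phi> \<eta> = (\<integral>g. \<phi> (R g \<xi>) \<partial>\<mu>)))"

definition Lp_fixed :: "real \<Rightarrow> 'x measure \<Rightarrow> (('x \<Rightarrow> 'v::banach) \<Rightarrow> ('x \<Rightarrow> 'v)) set \<Rightarrow> ('x \<Rightarrow> 'v) set" where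
  "Lp_fixed p M \<T> = {\<xi>\<in>Lp_space p M. \<forall>T\<in>\<T>. AE x in M. T \<xi> x = \<xi> x}"

end

theory Submission
  imports Defs
begin

text \<open>
  The cocycle \<open>b\<close> perturbs the induced representation to an affine isometric action of \<open>G\<close> on
  \<open>L\<^sup>p(G/\<Gamma>, V)\<close>. Its averages over \<open>\<mu>1\<close> and \<open>\<mu>2\<close> commute and their product is a strict contraction,
  so its unique fixed point \<open>w\<close> is fixed by the average over \<open>\<mu>1\<close> as well. For \<open>h\<close> in the
  second factor, the difference of \<open>h w\<close> and \<open>w\<close> is then fixed by the linear average over \<open>\<mu>1\<close> and
  hence by the whole first factor. For the equivariant function \<open>F\<close> on \<open>G\<close> which represents \<open>w\<close>
  this says that \<open>F\<close> is almost everywhere a sum \<open>F1 \<circ> fst + F2 \<circ> snd\<close>.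

  Each \<open>Fi\<close> is equivariant, up to additive constants, under the dense projection of \<open>\<Gamma>\<close>. By
  Steinhaus' theorem and ergodicity it agrees almost everywhere with a uniformly continuous function,
  so that the constants form, up to a coboundary, a cocycle of \<open>\<Gamma>\<close> which is uniformly continuous for
  the topology pulled back from the factor. That cocycle extends to the factor, with values in the space \<open>Vi\<close> of all
  vectors whose orbit map is uniformly continuous for the same topology.
\<close>

section \<open>Norming functionals\<close>

text \<open>Members of \<open>Lp_space\<close> are functions, and \<open>average\<close> picks one
  with prescribed values under \<open>Lp_dual\<close>. Identities between averages therefore hold
  only almost everywhere and are tested on functionals, which calls for Hahn-Banach, for separation
  of classes by functionals, and for weak integrals, without which the choice in
  \<open>average\<close> would be empty. Measurability takes the place of continuity. Steinhaus
  bounds the displacement of 0 under the affine action on compact sets, so that averages exist. Null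
  sets are the other obstacle. Exceptional sets can be united over the countable lattice, but not
  over all translations; there Fubini supplies a single base point that is good for almost every
  translation. Since h commutes with the first factor, both h w and w are fixed by the affine
  average over \<open>\<mu>1\<close>; the inhomogeneous terms cancel in their difference. Invariance
  of h w - w under the first factor is the vanishing of a mixed second difference of F, whence the
  splitting. The subspaces Vi depend on \<open>\<rho>\<close> and the projection only, and the
  cocycle lands in them because its orbit maps are differences of its own translates.\<close>

definition sublinear :: "('v::real_vector \<Rightarrow> real) \<Rightarrow> bool" where
  "sublinear q \<longleftrightarrow> (\<forall>x y. q (x + y) \<le> q x + q y) \<and> (\<forall>t x. 0 \<le> t \<longrightarrow> q (t *\<^sub>R x) = t * q x)"

text \<open>This is the largest sublinear functional below \<open>q\<close> whose value at
  \<open>- y\<close> is at most \<open>- q y\<close>. Lowering \<open>q\<close> in this way forces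
  linearity along the line through \<open>y\<close>.\<close>

definition flatten_along :: "('v::real_vector \<Rightarrow> real) \<Rightarrow> 'v \<Rightarrow> 'v \<Rightarrow> real" where
  "flatten_along q y x = (INF t\<in>{0..}. q (x + t *\<^sub>R y) - t * q y)"

lemma sublinear_add: "sublinear q \<Longrightarrow> q (x + y) \<le> q x + q y"
  and sublinear_scale: "sublinear q \<Longrightarrow> 0 \<le> t \<Longrightarrow> q (t *\<^sub>R x) = t * q x"
  and sublinear_zero: "sublinear q \<Longrightarrow> q 0 = 0"
  unfolding sublinear_def by (blast, blast, metis mult_zero_left order_refl scaleR_zero_left)

lemma sublinear_ge: "sublinear q \<Longrightarrow> - q (- x) \<le> q x"
  using sublinear_add[of q x "- x"] sublinear_zero[of q] by simp

context
  fixes q :: "'v::real_vector \<Rightarrow> real" and y :: 'v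
  assumes q: "sublinear q"
begin

lemma flatten_along_bdd_below: "bdd_below ((\<lambda>t. q (x + t *\<^sub>R y) - t * q y) ` {0..})"
proof (rule bdd_belowI2)
  fix t :: real assume "t \<in> {0..}"
  then show "- q (- x) \<le> q (x + t *\<^sub>R y) - t * q y"
    using sublinear_add[OF q, of "x + t *\<^sub>R y" "- x"] sublinear_scale[OF q, of t y] by simp
qed

lemma flatten_along_le: "0 \<le> t \<Longrightarrow> flatten_along q y x \<le> q (x + t *\<^sub>R y) - t * q y"
  unfolding flatten_along_def by (rule cINF_lower[OF flatten_along_bdd_below]) simp

lemma flatten_along_greatest:
  "(\<And>t. 0 \<le> t \<Longrightarrow> c \<le> q (x + t *\<^sub>R y) - t * q y) \<Longrightarrow> c \<le> flatten_along q y x"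
  unfolding flatten_along_def by (rule cINF_greatest) auto

lemma flatten_along_le_self: "flatten_along q y x \<le> q x"
  using flatten_along_le[of 0 x] by simp

text \<open>Replacing the parameter \<open>t\<close> by \<open>s * t\<close> scales the whole
  expression under the infimum. Applied to \<open>inverse s\<close>, the same inequality yields its
  converse.\<close>

lemma flatten_along_scale_le:
  assumes "0 < s" shows "flatten_along q y (s *\<^sub>R x) \<le> s * flatten_along q y x"
proof -
  have "flatten_along q y (s *\<^sub>R x) / s \<le> flatten_along q y x"
  proof (rule flatten_along_greatest)
    fix t :: real assume "0 \<le> t"
    then have "flatten_along q y (s *\<^sub>R x) \<le> q (s *\<^sub>R x + (s * t) *\<^sub>R y) - (s * t) * q y"
      using assms by (intro flatten_along_le) simp
    also have "s *\<^sub>R x + (s * t) *\<^sub>R y = s *\<^sub>R (x + t *\<^sub>R y)"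
      by (simp add: scaleR_add_right)
    also have "q \<dots> = s * q (x + t *\<^sub>R y)"
      using assms by (intro sublinear_scale[OF q]) simp
    finally show "flatten_along q y (s *\<^sub>R x) / s \<le> q (x + t *\<^sub>R y) - t * q y"
      using assms by (simp add: field_simps)
  qed
  then show ?thesis using assms by (simp add: field_simps)
qed

lemma sublinear_flatten_along: "sublinear (flatten_along q y)"
  unfolding sublinear_def
proof (intro conjI allI impI)
  fix x z
  \<comment> \<open>The parameters \<open>t\<close> and \<open>s\<close> of the two infima are added
    to give an admissible parameter for \<open>x + z\<close>; the infima are then taken one after
    the other.\<close>
  have "flatten_along q y (x + z) - flatten_along q y z \<le> flatten_along q y x"
  proof (rule flatten_along_greatest)
    fix t :: real assume t: "0 \<le> t"
    have "flatten_along q y (x + z) - (q (x + t *\<^sub>R y) - t * q y) \<le> flatten_along q y z"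
    proof (rule flatten_along_greatest)
      fix s :: real assume s: "0 \<le> s"
      have "flatten_along q y (x + z) \<le> q ((x + z) + (t + s) *\<^sub>R y) - (t + s) * q y"
        using s t by (intro flatten_along_le) simp
      also have "(x + z) + (t + s) *\<^sub>R y = (x + t *\<^sub>R y) + (z + s *\<^sub>R y)"
        by (simp add: algebra_simps)
      also have "q \<dots> \<le> q (x + t *\<^sub>R y) + q (z + s *\<^sub>R y)"
        by (rule sublinear_add[OF q])
      finally show "flatten_along q y (x + z) - (q (x + t *\<^sub>R y) - t * q y)
          \<le> q (z + s *\<^sub>R y) - s * q y"
        by (simp add: algebra_simps)
    qed
    then show "flatten_along q y (x + z) - flatten_along q y z \<le> q (x + t *\<^sub>R y) - t * q y"
      by simp
  qed
  then show "flatten_along q y (x + z) \<le> flatten_along q y x + flatten_along q y z" by simp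
next
  fix s :: real and x assume "0 \<le> s"
  show "flatten_along q y (s *\<^sub>R x) = s * flatten_along q y x"
  proof (cases "s = 0")
    case True
    have "flatten_along q y 0 = (INF t\<in>{0::real..}. 0)"
      unfolding flatten_along_def
      by (rule INF_cong) (simp_all add: sublinear_scale[OF q])
    then show ?thesis using True by simp
  next
    case False
    then have s: "0 < s" using \<open>0 \<le> s\<close> by simp
    have "flatten_along q y (inverse s *\<^sub>R (s *\<^sub>R x)) \<le> inverse s * flatten_along q y (s *\<^sub>R x)"
      using s by (intro flatten_along_scale_le) simp
    then have "s * flatten_along q y x \<le> flatten_along q y (s *\<^sub>R x)"
      using s by (simp add: field_simps)
    then show ?thesis using flatten_along_scale_le[OF s, of x] by simp
  qed
qed

end

text \<open>A minimal sublinear functional is linear, because it is not changed by flattening.\<close>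

lemma ex_linear_le_sublinear:
  fixes q0 :: "'v::real_vector \<Rightarrow> real"
  assumes q0: "sublinear q0"
  shows "\<exists>f. linear f \<and> (\<forall>x. f x \<le> q0 x)"
proof -
  \<comment> \<open>The order passed to Zorn's lemma is reversed, so that its maximal elements are
    the minimal sublinear functionals.\<close>
  let ?A = "{q. sublinear q \<and> q \<le> q0}" and ?P = "\<lambda>f g :: 'v \<Rightarrow> real. g \<le> f"
  have "\<exists>m\<in>?A. \<forall>a\<in>?A. ?P m a \<longrightarrow> a = m"
  proof (rule predicate_Zorn)
    show "partial_order_on ?A (relation_of ?P ?A)"
      by (auto simp: partial_order_on_relation_ofI)
    show "\<exists>u\<in>?A. \<forall>a\<in>C. u \<le> a" if C: "C \<in> Chains (relation_of ?P ?A)" for C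
    proof (cases "C = {}")
      case True then show ?thesis using q0 by auto
    next
      case False
      have sub: "q \<in> C \<Longrightarrow> sublinear q" and le: "q \<in> C \<Longrightarrow> q \<le> q0" for q
        using C by (auto simp: Chains_def relation_of_def)
      have chain: "q \<le> r \<or> r \<le> q" if "q \<in> C" "r \<in> C" for q r
        using C that by (auto simp: Chains_def relation_of_def)
      define u where "u x = (INF q\<in>C. q x)" for x
      have bdd: "bdd_below ((\<lambda>q. q x) ` C)" for x
      proof (rule bdd_belowI2)
        fix q assume "q \<in> C"
        then show "- q0 (- x) \<le> q x"
          using sublinear_ge[OF sub, of q x] le[of q] by (auto simp: le_fun_def intro: order_trans[rotated])
      qed
      have u_le: "u x \<le> q x" if "q \<in> C" for q x
        unfolding u_def by (rule cINF_lower[OF bdd that])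
      have u_ge: "c \<le> u x" if "\<And>q. q \<in> C \<Longrightarrow> c \<le> q x" for c x
        unfolding u_def by (rule cINF_greatest[OF False that])
      have "sublinear u"
        unfolding sublinear_def
      proof (intro conjI allI impI)
        fix x y
        have "u (x + y) - u y \<le> u x"
        proof (rule u_ge)
          fix q assume q: "q \<in> C"
          have "u (x + y) - q x \<le> u y"
          proof (rule u_ge)
            fix r assume r: "r \<in> C"
            \<comment> \<open>The two infima range over different members of the chain; the smaller
              of \<open>q\<close> and \<open>r\<close> bounds both at once.\<close>
            obtain s where "s \<in> C" "s \<le> q" "s \<le> r" using chain[OF q r] q r by blast
            then show "u (x + y) - q x \<le> r y"
              using u_le[of s "x + y"] sublinear_add[OF sub, of s x y] by (auto simp: le_fun_def)
               (smt (verit))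
          qed
          then show "u (x + y) - u y \<le> q x" by simp
        qed
        then show "u (x + y) \<le> u x + u y" by simp
      next
        fix t :: real and x assume t: "0 \<le> t"
        show "u (t *\<^sub>R x) = t * u x"
        proof (cases "t = 0")
          case True
          have "u 0 = (INF q\<in>C. 0)"
            unfolding u_def by (rule INF_cong) (simp_all add: sublinear_zero[OF sub])
          with True False show ?thesis by simp
        next
          case nz: False
          with t have t: "0 < t" by simp
          have "u (t *\<^sub>R x) / t \<le> u x"
            using t u_le[of _ "t *\<^sub>R x"] by (intro u_ge) (auto simp: sublinear_scale[OF sub] field_simps)
          moreover have "t * u x \<le> u (t *\<^sub>R x)"
            using t u_le[of _ x] by (intro u_ge) (auto simp: sublinear_scale[OF sub])
          ultimately show ?thesis using t by (simp add: field_simps)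
        qed
      qed
      moreover have "u \<le> q0"
        using False u_le le by (auto simp: le_fun_def) (meson order_trans)
      ultimately show ?thesis using u_le by (auto simp: le_fun_def)
    qed
  qed
  then obtain q where q: "sublinear q" "q \<le> q0"
    and min: "\<And>r. sublinear r \<Longrightarrow> r \<le> q0 \<Longrightarrow> r \<le> q \<Longrightarrow> r = q"
    by blast
  have "flatten_along q y = q" for y
    using q flatten_along_le_self[OF q(1), of y]
    by (intro min sublinear_flatten_along) (auto simp: le_fun_def intro: order_trans)
  \<comment> \<open>Invariance under flattening, read at the parameter 1, is superadditivity of
    \<open>q\<close>.\<close>
  then have "q x \<le> q (x + y) - q y" for x y
    using flatten_along_le[OF q(1), of 1 y x] by simp
  then have add: "q (x + y) = q x + q y" for x y
    using sublinear_add[OF q(1), of x y] by (simp add: order_antisym le_diff_eq)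
  have neg: "q (- x) = - q x" for x
    using add[of x "- x"] sublinear_zero[OF q(1)] by simp
  have "q (t *\<^sub>R x) = t * q x" for t x
  proof (cases "0 \<le> t")
    case False
    then have "q (- (t *\<^sub>R x)) = - t * q x"
      using sublinear_scale[OF q(1), of "- t" x] by simp
    then show ?thesis by (simp add: neg)
  qed (rule sublinear_scale[OF q(1)])
  then have "linear q" using add by (intro linearI) simp_all
  then show ?thesis using q(2) by (auto simp: le_fun_def)
qed

text \<open>A linear functional below the norm flattened along \<open>v\<close> is at most
  \<open>- norm v\<close> at \<open>- v\<close>, hence at least \<open>norm v\<close> at
  \<open>v\<close>. Flattening thus replaces the usual extension from the line through
  \<open>v\<close>.\<close>

lemma ex_norming_functional:
  fixes v :: "'v::real_normed_vector"
  shows "\<exists>f. linear f \<and> (\<forall>x. \<bar>f x\<bar> \<le> norm x) \<and> f v = norm v"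
proof -
  have norm: "sublinear (norm :: 'v \<Rightarrow> real)"
    by (simp add: sublinear_def norm_triangle_ineq)
  then obtain f where f: "linear f" "\<And>x. f x \<le> flatten_along norm v x"
    using ex_linear_le_sublinear[OF sublinear_flatten_along[OF norm]] by blast
  have le: "f x \<le> norm x" for x
    using f(2) flatten_along_le_self[OF norm] order_trans by blast
  have "f (- v) \<le> - norm v"
    using f(2)[of "- v"] flatten_along_le[OF norm, of 1 v "- v"] by simp
  then have "f v = norm v" using le[of v] linear_neg[OF f(1), of v] by simp
  moreover have "\<bar>f x\<bar> \<le> norm x" for x
    using le[of x] le[of "- x"] linear_neg[OF f(1), of x] by simp
  ultimately show ?thesis using f(1) by blast
qed

text \<open>
  The pairing \<open>(a, z) \<mapsto> (a z) \<bullet> 1\<close> on the field of scalars is nondegenerate, so that a real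
  functional is \<open>v \<mapsto> \<phi> v \<bullet> 1\<close> for a unique functional \<open>\<phi>\<close> that is linear over that field.
\<close>

lemma ex_scalar_functional:
  fixes sc :: "'k::{real_normed_field, euclidean_space} \<Rightarrow> 'v::banach \<Rightarrow> 'v"
  assumes sc: "scalar_mult sc" and f: "linear f" and bd: "\<And>x. \<bar>f x\<bar> \<le> norm x"
  shows "\<exists>\<phi>. (\<forall>u v. \<phi> (u + v) = \<phi> u + \<phi> v) \<and> (\<forall>a v. \<phi> (sc a v) = a * \<phi> v) \<and>
    (\<exists>C. \<forall>v. norm (\<phi> v) \<le> C * norm v) \<and> (\<forall>v. \<phi> v \<bullet> 1 = f v)"
proof -
  interpret vector_space sc using sc by (simp add: scalar_mult_def)
  have nrm: "norm (sc a v) = norm a * norm v" for a v using sc by (simp add: scalar_mult_def)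
  have of_real: "sc (of_real r) v = r *\<^sub>R v" for r v using sc by (simp add: scalar_mult_def)
  \<comment> \<open>\<open>J z\<close> is the Riesz vector of the real functional that sends
    \<open>a\<close> to the inner product of \<open>a * z\<close> with 1.\<close>
  define J :: "'k \<Rightarrow> 'k" where "J z = (\<Sum>e\<in>Basis. ((e * z) \<bullet> 1) *\<^sub>R e)" for z
  have J_lin: "linear J"
    unfolding J_def by (intro linearI) (simp_all add: algebra_simps inner_add_left sum.distrib scaleR_sum_right)
  have J_inner: "J z \<bullet> a = (a * z) \<bullet> 1" for z a
  proof -
    have "a * z = (\<Sum>e\<in>Basis. (a \<bullet> e) *\<^sub>R e) * z" by (simp add: euclidean_representation)
    also have "\<dots> = (\<Sum>e\<in>Basis. (a \<bullet> e) *\<^sub>R (e * z))" by (simp add: sum_distrib_right)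
    finally show ?thesis
      by (simp add: J_def inner_sum_left inner_sum_right inner_commute mult.commute)
  qed
  have "inj J"
  proof (rule linear_injective_0[OF J_lin, THEN iffD2], intro allI impI)
    fix z assume "J z = 0"
    \<comment> \<open>For nonzero \<open>z\<close>, testing with \<open>inverse z\<close> gives the
      inner product of 1 with itself, which is positive.\<close>
    then show "z = 0" using J_inner[of z "inverse z"] by (cases "z = 0") auto
  qed
  have "surj J" by (rule eucl.linear_inj_imp_surj[OF J_lin \<open>inj J\<close>])
  define K where "K = inv J"
  have JK: "J (K w) = w" for w unfolding K_def by (rule surj_f_inv_f[OF \<open>surj J\<close>])
  have KJ: "K (J z) = z" for z unfolding K_def by (rule inv_f_f[OF \<open>inj J\<close>])
  have K_lin: "linear K"
    by (rule linearI) (metis JK KJ linear_add[OF J_lin], metis JK KJ linear_scale[OF J_lin])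
  then obtain B where B: "\<And>w. norm (K w) \<le> norm w * B"
    using linear_conv_bounded_linear bounded_linear.bounded by blast
  \<comment> \<open>The Riesz vector of the real functional that sends \<open>a\<close> to
    \<open>f (sc a v)\<close>, carried back through \<open>J\<close>. Linearity over the scalar
    field then follows by comparing these functionals.\<close>
  define \<phi> where "\<phi> v = K (\<Sum>e\<in>Basis. f (sc e v) *\<^sub>R e)" for v
  have f_sc: "(a * \<phi> v) \<bullet> 1 = f (sc a v)" for a v
  proof -
    have "linear (\<lambda>a. sc a v)"
    proof (rule linearI)
      fix r a show "sc (r *\<^sub>R a) v = r *\<^sub>R sc a v"
        by (metis of_real scale_scale scaleR_conv_of_real)
    qed (rule scale_left_distrib)
    then have lin: "linear (\<lambda>a. f (sc a v))" using linear_compose[OF _ f] by (simp add: o_def)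
    have "(a * \<phi> v) \<bullet> 1 = (\<Sum>e\<in>Basis. f (sc e v) *\<^sub>R e) \<bullet> a"
      using J_inner[of "\<phi> v" a] by (simp add: \<phi>_def JK)
    also have "\<dots> = (\<Sum>e\<in>Basis. f (sc e v) * (e \<bullet> a))"
      by (simp add: inner_sum_left)
    also have "\<dots> = (\<Sum>e\<in>Basis. (a \<bullet> e) * f (sc e v))"
      by (rule sum.cong) (simp_all add: inner_commute mult.commute)
    also have "\<dots> = f (sc (\<Sum>e\<in>Basis. (a \<bullet> e) *\<^sub>R e) v)"
      by (simp add: linear_sum[OF lin] linear_scale[OF lin])
    finally show ?thesis by (simp add: euclidean_representation)
  qed
  have uniq: "z = w" if "\<And>a. (a * z) \<bullet> 1 = (a * w) \<bullet> 1" for z w :: 'k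
    by (metis J_inner KJ that vector_eq_rdot)
  have "\<phi> (u + v) = \<phi> u + \<phi> v" for u v
    by (rule uniq) (simp add: f_sc distrib_left inner_add_left scale_right_distrib linear_add[OF f])
  moreover have "\<phi> (sc a v) = a * \<phi> v" for a v
    by (rule uniq) (simp add: f_sc mult.assoc[symmetric])
  moreover have "\<exists>C. \<forall>v. norm (\<phi> v) \<le> C * norm v"
  proof (intro exI allI)
    fix v
    have "norm (\<Sum>e\<in>Basis. f (sc e v) *\<^sub>R e) \<le> (\<Sum>e\<in>(Basis::'k set). norm (sc e v))"
      by (rule sum_norm_le) (simp add: bd)
    also have "\<dots> = real DIM('k) * norm v" by (simp add: nrm)
    finally have *: "norm (\<Sum>e\<in>Basis. f (sc e v) *\<^sub>R e) \<le> real DIM('k) * norm v" .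
    have "norm (\<phi> v) \<le> norm (\<Sum>e\<in>Basis. f (sc e v) *\<^sub>R e) * \<bar>B\<bar>"
      unfolding \<phi>_def using B by (meson abs_ge_self mult_left_mono norm_ge_zero order_trans)
    also have "\<dots> \<le> real DIM('k) * norm v * \<bar>B\<bar>"
      using * by (intro mult_right_mono) auto
    finally show "norm (\<phi> v) \<le> (real DIM('k) * \<bar>B\<bar>) * norm v" by (simp add: mult_ac)
  qed
  moreover have "\<phi> v \<bullet> 1 = f v" for v using f_sc[of 1 v] by simp
  ultimately show ?thesis by blast
qed

section \<open>Strongly measurable functions\<close>

text \<open>The measurability half of \<open>Lp_space\<close>. In a nonseparable space the sum of
  two Borel functions can fail to be Borel; a separable range restores stability under sums, limits
  and continuous operations.\<close>

definition strongly_measurable :: "'x measure \<Rightarrow> ('x \<Rightarrow> 'v::metric_space) \<Rightarrow> bool" where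
  "strongly_measurable M f \<longleftrightarrow>
     f \<in> borel_measurable M \<and> (\<exists>C. countable C \<and> f ` space M \<subseteq> closure C)"

lemma strongly_measurableD: "strongly_measurable M f \<Longrightarrow> f \<in> borel_measurable M"
  by (simp add: strongly_measurable_def)

lemma strongly_measurable_compose:
  assumes "strongly_measurable N f" "k \<in> measurable M N"
  shows "strongly_measurable M (\<lambda>x. f (k x))"
  using assms measurable_space[OF assms(2)]
  unfolding strongly_measurable_def by (auto intro!: measurable_compose[OF assms(2)])

lemma strongly_measurable_cong:
  assumes "\<And>x. x \<in> space M \<Longrightarrow> f x = g x"
  shows "strongly_measurable M f \<longleftrightarrow> strongly_measurable M g"
  unfolding strongly_measurable_def using assms measurable_cong[of M f g borel] by (simp add: image_def)

lemma strongly_measurable_cong_sets: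
  "sets M = sets N \<Longrightarrow> strongly_measurable M f \<longleftrightarrow> strongly_measurable N f"
  unfolding strongly_measurable_def
  by (metis measurable_cong_sets sets_eq_imp_space_eq)

lemma strongly_measurable_borel:
  fixes f :: "'x \<Rightarrow> 'v::{metric_space, second_countable_topology}"
  assumes "f \<in> borel_measurable M"
  shows "strongly_measurable M f"
proof -
  obtain D :: "'v set" where "countable D" "\<And>X. open X \<Longrightarrow> X \<noteq> {} \<Longrightarrow> \<exists>d\<in>D. d \<in> X"
    by (erule countable_dense_setE)
  then have "f ` space M \<subseteq> closure D"
    by (auto simp: closure_approachable) (metis centre_in_ball dist_commute emptyE mem_ball open_ball)
  with assms \<open>countable D\<close> show ?thesis unfolding strongly_measurable_def by blast
qed

lemma strongly_measurable_LIMSEQ: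
  assumes f: "\<And>i::nat. strongly_measurable M (f i)"
    and lim: "\<And>x. x \<in> space M \<Longrightarrow> (\<lambda>i. f i x) \<longlonglongrightarrow> g x"
  shows "strongly_measurable M g"
proof -
  obtain C where C: "\<And>i. countable (C i)" "\<And>i. f i ` space M \<subseteq> closure (C i)"
    using f unfolding strongly_measurable_def by metis
  have "g x \<in> closure (\<Union>i. C i)" if "x \<in> space M" for x
  proof (rule closed_sequentially[OF closed_closure _ lim[OF that]])
    show "f n x \<in> closure (\<Union>i. C i)" for n
      using C(2) that by (meson UN_upper UNIV_I closure_mono image_subset_iff subsetD)
  qed
  moreover have "g \<in> borel_measurable M"
    using strongly_measurableD[OF f] lim by (rule borel_measurable_LIMSEQ_metric)
  ultimately show ?thesis
    using C(1) unfolding strongly_measurable_def by (intro conjI exI[of _ "\<Union>i. C i"]) auto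
qed

text \<open>Countably many separable ranges still have a separable union. This is used for lifts to
  the group, which are given by one formula on each translate of the fundamental domain.\<close>

lemma strongly_measurable_cases:
  assumes f: "\<And>i. i \<in> I \<Longrightarrow> strongly_measurable M (f i)"
    and k: "k \<in> measurable M (count_space I)" and I: "countable I"
  shows "strongly_measurable M (\<lambda>x. f (k x) x)"
proof -
  obtain C where C: "\<And>i. i \<in> I \<Longrightarrow> countable (C i)" "\<And>i. i \<in> I \<Longrightarrow> f i ` space M \<subseteq> closure (C i)"
    using f unfolding strongly_measurable_def by metis
  have "f (k x) x \<in> closure (\<Union>i\<in>I. C i)" if "x \<in> space M" for x
    using C(2)[of "k x"] measurable_space[OF k that] that closure_mono[of "C (k x)" "\<Union>i\<in>I. C i"]
    by auto
  moreover have "(\<lambda>x. f (k x) x) \<in> borel_measurable M"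
    using strongly_measurableD[OF f] k I by (rule measurable_compose_countable')
  ultimately show ?thesis
    using C(1) I unfolding strongly_measurable_def by (intro conjI exI[of _ "\<Union>i\<in>I. C i"]) auto
qed

lemma strongly_measurable_simple: "simple_function M f \<Longrightarrow> strongly_measurable M f"
  unfolding strongly_measurable_def
proof (intro conjI exI)
  assume f: "simple_function M f"
  then show "f \<in> borel_measurable M" by (rule borel_measurable_simple_function)
  show "countable (f ` space M)"
    using f by (intro countable_finite) (simp add: simple_function_def)
  show "f ` space M \<subseteq> closure (f ` space M)" by (rule closure_subset)
qed

text \<open>
  Approximating \<^term>\<open>f x\<close> by the first closest point among \<open>z = e 0, \<dots>, e n\<close>, for \<open>e\<close> dense in the range,
  never makes the distance larger than that of \<open>f x\<close> to \<open>z\<close>.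
\<close>

lemma strongly_measurable_simple_approx:
  fixes f :: "'x \<Rightarrow> 'v::metric_space" and z :: 'v
  assumes f: "strongly_measurable M f"
  shows "\<exists>F. (\<forall>i. simple_function M (F i)) \<and> (\<forall>x\<in>space M. (\<lambda>i. F i x) \<longlonglongrightarrow> f x) \<and>
    (\<forall>i. \<forall>x. dist (F i x) (f x) \<le> dist (f x) z)"
proof -
  obtain C where C: "countable C" "f ` space M \<subseteq> closure C"
    using f unfolding strongly_measurable_def by blast
  define e where "e n = (case n of 0 \<Rightarrow> z | Suc m \<Rightarrow> from_nat_into (insert z C) m)" for n
  have e0: "e 0 = z" by (simp add: e_def)
  have e_dense: "c \<in> C \<Longrightarrow> \<exists>n. e n = c" for c
  proof -
    assume "c \<in> C"
    then obtain m where "from_nat_into (insert z C) m = c"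
      using from_nat_into_surj[of "insert z C" c] C(1) by auto
    then have "e (Suc m) = c" by (simp add: e_def)
    then show ?thesis ..
  qed
  define P where "P n v i \<longleftrightarrow> i \<le> n \<and> (\<forall>j\<le>n. dist v (e i) \<le> dist v (e j))" for n v and i :: nat
  define idx where "idx n v = (LEAST i. P n v i)" for n v
  have P: "P n v (idx n v)" for n v
  proof -
    have "\<exists>i. is_arg_min (\<lambda>i. dist v (e i)) (\<lambda>i. i \<in> {..n}) i"
      by (rule ex_is_arg_min_if_finite) auto
    then have "\<exists>i. P n v i" unfolding P_def is_arg_min_def by (auto simp: not_less)
    then show ?thesis unfolding idx_def by (rule LeastI_ex)
  qed
  have [measurable]: "(\<lambda>v. dist v c) \<in> borel_measurable borel" for c :: 'v
    by (intro borel_measurable_continuous_onI continuous_intros)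
  have idx_meas: "idx n \<in> measurable borel (count_space UNIV)" for n
    unfolding idx_def P_def by measurable
  define F where "F n x = e (idx n (f x))" for n x
  have "simple_function M (F n)" for n
  proof -
    have "(\<lambda>x. idx n (f x)) \<in> measurable M (count_space UNIV)"
      using idx_meas strongly_measurableD[OF f] by (rule measurable_compose[rotated])
    moreover have "finite ((\<lambda>x. idx n (f x)) ` space M)"
      by (rule finite_subset[of _ "{..n}"]) (use P in \<open>auto simp: P_def\<close>)
    ultimately have "simple_function M (\<lambda>x. idx n (f x))"
      unfolding simple_function_def by (auto intro: measurable_sets)
    then show ?thesis unfolding F_def by (rule simple_function_compose1)
  qed
  moreover have "(\<lambda>n. F n x) \<longlonglongrightarrow> f x" if "x \<in> space M" for x
  proof (rule tendstoI)
    fix r :: real assume "0 < r"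
    moreover have "f x \<in> closure C" using C(2) that by auto
    ultimately obtain m where m: "dist (f x) (e m) < r"
      using e_dense unfolding closure_approachable by (metis dist_commute)
    have "dist (F n x) (f x) < r" if "m \<le> n" for n
      using P[of n "f x"] m that unfolding P_def F_def by (auto simp: dist_commute intro: le_less_trans)
    then show "\<forall>\<^sub>F n in sequentially. dist (F n x) (f x) < r"
      by (auto simp: eventually_sequentially)
  qed
  moreover have "dist (F n x) (f x) \<le> dist (f x) z" for n x
    using P[of n "f x"] unfolding P_def F_def e0[symmetric] by (auto simp: dist_commute)
  ultimately show ?thesis by blast
qed

text \<open>The pair of two Borel functions need not be Borel into the product of nonseparable
  spaces, so continuity of \<open>H\<close> is applied to simple approximations and the limit is
  taken afterwards.\<close>

lemma strongly_measurable_compose2: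
  assumes f: "strongly_measurable M f" and g: "strongly_measurable M g"
    and H: "continuous_on UNIV (\<lambda>(u, w). H u w)"
  shows "strongly_measurable M (\<lambda>x. H (f x) (g x))"
proof -
  obtain F where F: "\<And>i. simple_function M (F i)" "\<And>x. x \<in> space M \<Longrightarrow> (\<lambda>i. F i x) \<longlonglongrightarrow> f x"
    using strongly_measurable_simple_approx[OF f] by blast
  obtain G where G: "\<And>i. simple_function M (G i)" "\<And>x. x \<in> space M \<Longrightarrow> (\<lambda>i. G i x) \<longlonglongrightarrow> g x"
    using strongly_measurable_simple_approx[OF g] by blast
  show ?thesis
  proof (rule strongly_measurable_LIMSEQ[where f = "\<lambda>i x. H (F i x) (G i x)"])
    show "strongly_measurable M (\<lambda>x. H (F i x) (G i x))" for i
      by (rule strongly_measurable_simple, rule simple_function_compose2[OF F(1) G(1)])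
    fix x assume "x \<in> space M"
    then have "(\<lambda>i. (F i x, G i x)) \<longlonglongrightarrow> (f x, g x)"
      using F(2) G(2) by (intro tendsto_Pair)
    then have "(\<lambda>i. case (F i x, G i x) of (u, w) \<Rightarrow> H u w) \<longlonglongrightarrow> (case (f x, g x) of (u, w) \<Rightarrow> H u w)"
      by (rule continuous_on_tendsto_compose[OF H]) auto
    then show "(\<lambda>i. H (F i x) (G i x)) \<longlonglongrightarrow> H (f x) (g x)"
      by simp
  qed
qed

lemma strongly_measurable_continuous:
  assumes f: "strongly_measurable M f" and H: "continuous_on UNIV H"
  shows "strongly_measurable M (\<lambda>x. H (f x))"
proof (rule strongly_measurable_compose2[OF f f, of "\<lambda>u w. H u"])
  show "continuous_on UNIV (\<lambda>(u, w). H u)"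
    unfolding case_prod_unfold by (rule continuous_on_compose2[OF H continuous_on_fst[OF continuous_on_id]]) simp
qed

lemma strongly_measurable_const [intro, simp]: "strongly_measurable M (\<lambda>x. c)"
  by (rule strongly_measurable_simple) simp

lemma
  fixes f g :: "'x \<Rightarrow> 'v::real_normed_vector"
  assumes "strongly_measurable M f" "strongly_measurable M g"
  shows strongly_measurable_add [intro]: "strongly_measurable M (\<lambda>x. f x + g x)"
    and strongly_measurable_diff [intro]: "strongly_measurable M (\<lambda>x. f x - g x)"
  by (rule strongly_measurable_compose2[OF assms, of "(+)"], unfold case_prod_unfold, intro continuous_intros)
    (rule strongly_measurable_compose2[OF assms, of "(-)"], unfold case_prod_unfold, intro continuous_intros)

lemma strongly_measurable_scaleR [intro]:
  fixes f :: "'x \<Rightarrow> 'v::real_normed_vector" and r :: "'x \<Rightarrow> real"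
  assumes "r \<in> borel_measurable M" "strongly_measurable M f"
  shows "strongly_measurable M (\<lambda>x. r x *\<^sub>R f x)"
  by (rule strongly_measurable_compose2[OF strongly_measurable_borel[OF assms(1)] assms(2), of scaleR],
      unfold case_prod_unfold, intro continuous_intros)

lemma strongly_measurable_sum [intro]:
  fixes f :: "'i \<Rightarrow> 'x \<Rightarrow> 'v::real_normed_vector"
  assumes "\<And>i. i \<in> I \<Longrightarrow> strongly_measurable M (f i)"
  shows "strongly_measurable M (\<lambda>x. \<Sum>i\<in>I. f i x)"
  using assms by (induction I rule: infinite_finite_induct) auto

lemma strongly_measurable_norm:
  fixes f :: "'x \<Rightarrow> 'v::real_normed_vector"
  assumes "strongly_measurable M f"
  shows "(\<lambda>x. norm (f x)) \<in> borel_measurable M"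
  by (rule measurable_compose[OF strongly_measurableD[OF assms]])
    (intro borel_measurable_continuous_onI continuous_intros)

section \<open>Lebesgue spaces of vector-valued functions\<close>

text \<open>Convexity is applied to positive arguments; if one of them is zero, the claim reduces to
  the fact that the p-th power of a number in the unit interval does not exceed that number.\<close>

lemma powr_convex_combination:
  fixes p s t u v :: real
  assumes p: "1 \<le> p" and st: "0 \<le> s" "0 \<le> t" "s + t = 1" and uv: "0 \<le> u" "0 \<le> v"
  shows "(s * u + t * v) powr p \<le> s * u powr p + t * v powr p"
proof -
  have small: "(r * w) powr p \<le> r * w powr p" if "0 \<le> r" "r \<le> 1" "0 \<le> w" for r w :: real
  proof -
    have "r powr p \<le> r powr 1" if "r > 0"
      using p \<open>r \<le> 1\<close> that by (intro powr_mono') auto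
    then have "r powr p \<le> r" using that \<open>0 \<le> r\<close> p by (cases "r = 0") auto
    then show ?thesis using that by (simp add: powr_mult mult_right_mono)
  qed
  consider "u = 0" | "v = 0" | "0 < u" "0 < v" using uv by linarith
  then show ?thesis
  proof cases
    case 3
    moreover have "s = 1 - t" using st by simp
    ultimately show ?thesis
      using convex_onD[OF powr_convex[OF p], of t u v] st(2) st(1) by simp
  qed (use small[of s u] small[of t v] st uv p in auto)
qed

text \<open>Young's inequality with second factor 1. On a probability space it bounds the L1 norm by
  the Lp norm.\<close>

lemma le_powr_mean:
  fixes p x :: real
  assumes p: "1 < p" and x: "0 \<le> x"
  shows "x \<le> x powr p / p + (1 - 1 / p)"
proof (cases "x = 0")
  case False
  then show ?thesis
    using Youngs_inequality_0[of "1/p" "1 - 1/p" "x powr p" 1] p x by (simp add: powr_powr field_simps)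
qed (use p in auto)

lemma Lp_space_iff:
  "f \<in> Lp_space p M \<longleftrightarrow> strongly_measurable M f \<and> integrable M (\<lambda>x. norm (f x) powr p)"
  unfolding Lp_space_def strongly_measurable_def by auto

lemma Lp_norm_nonneg [simp]: "0 \<le> Lp_norm p M f"
  by (simp add: Lp_norm_def)

locale Lebesgue_space = prob_space M for M :: "'x measure" +
  fixes p :: real
  assumes p: "1 < p"
begin

lemma Lp_norm_powr: "Lp_norm p M f powr p = (\<integral>x. norm (f x) powr p \<partial>M)"
  using p by (simp add: Lp_norm_def powr_powr integral_nonneg_AE)

lemma Lp_nn_integral:
  "f \<in> Lp_space p M \<Longrightarrow> (\<integral>\<^sup>+x. ennreal (norm (f x) powr p) \<partial>M) = ennreal (Lp_norm p M f powr p)"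
  unfolding Lp_norm_powr by (intro nn_integral_eq_integral) (auto simp: Lp_space_iff)

lemma powr_le_powrD: "0 \<le> a \<Longrightarrow> 0 \<le> b \<Longrightarrow> a powr p \<le> b powr p \<Longrightarrow> a \<le> (b :: real)"
  using p by (meson linorder_not_le powr_less_mono2 less_le_trans zero_less_one order_less_trans not_less_iff_gr_or_eq)

lemma Lp_measurable: "strongly_measurable M f \<Longrightarrow> (\<lambda>x. norm (f x) powr p) \<in> borel_measurable M"
  using strongly_measurable_norm[of M f] by measurable

text \<open>A bound stated as a nonnegative integral presupposes no integrability, so membership and
  the norm estimate come out together.\<close>

lemma Lp_bounded:
  assumes f: "strongly_measurable M f" and B: "0 \<le> B"
    and le: "(\<integral>\<^sup>+x. ennreal (norm (f x) powr p) \<partial>M) \<le> ennreal (B powr p)"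
  shows "f \<in> Lp_space p M" "Lp_norm p M f \<le> B"
proof -
  show f': "f \<in> Lp_space p M"
    unfolding Lp_space_iff using f Lp_measurable[OF f] le
    by (auto intro!: integrableI_nonneg simp: le_less_trans)
  show "Lp_norm p M f \<le> B"
  proof (rule powr_le_powrD)
    show "Lp_norm p M f powr p \<le> B powr p"
      using le unfolding Lp_nn_integral[OF f'] by (simp add: ennreal_le_iff)
  qed (use B in auto)
qed

lemma Lp_dominated:
  assumes f: "strongly_measurable M f" and g: "g \<in> Lp_space p M"
    and le: "AE x in M. norm (f x) \<le> norm (g x)"
  shows "f \<in> Lp_space p M" "Lp_norm p M f \<le> Lp_norm p M g"
proof -
  have "(\<integral>\<^sup>+x. ennreal (norm (f x) powr p) \<partial>M) \<le> (\<integral>\<^sup>+x. ennreal (norm (g x) powr p) \<partial>M)"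
    using le p by (intro nn_integral_mono_AE) (auto intro!: powr_mono2 elim!: eventually_mono)
  then have *: "(\<integral>\<^sup>+x. ennreal (norm (f x) powr p) \<partial>M) \<le> ennreal (Lp_norm p M g powr p)"
    unfolding Lp_nn_integral[OF g] .
  show "f \<in> Lp_space p M" "Lp_norm p M f \<le> Lp_norm p M g"
    by (rule Lp_bounded[OF f _ *], simp)+
qed

lemma Lp_norm_cong_AE:
  assumes "strongly_measurable M f" "strongly_measurable M g" "AE x in M. norm (f x) = norm (g x)"
  shows "Lp_norm p M f = Lp_norm p M g"
  unfolding Lp_norm_def
  using assms Lp_measurable[of f] Lp_measurable[of g] by (intro arg_cong2[where f="(powr)"] integral_cong_AE) auto

lemma Lp_const: "(\<lambda>x. c) \<in> Lp_space p M" "Lp_norm p M (\<lambda>x. c) = norm c"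
  using p by (auto simp: Lp_space_iff Lp_norm_def powr_powr prob_space)

text \<open>Minkowski's inequality: \<open>f / a\<close> and \<open>g / b\<close> are combined with
  the weights \<open>a / (a + b)\<close> and \<open>b / (a + b)\<close>, and convexity of the p-th
  power is integrated.\<close>

lemma
  assumes f: "f \<in> Lp_space p M" and g: "g \<in> Lp_space p M"
  shows Lp_add: "(\<lambda>x. f x + g x) \<in> Lp_space p M"
    and Lp_norm_add: "Lp_norm p M (\<lambda>x. f x + g x) \<le> Lp_norm p M f + Lp_norm p M g"
proof -
  have meas: "strongly_measurable M (\<lambda>x. f x + g x)"
    using f g by (auto simp: Lp_space_iff)
  have *: "(\<integral>\<^sup>+x. ennreal (norm (f x + g x) powr p) \<partial>M) \<le> ennreal ((a + b) powr p)"
    if a: "0 < a" "Lp_norm p M f \<le> a" and b: "0 < b" "Lp_norm p M g \<le> b" for a b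
  proof -
    define s t where "s = a / (a + b)" and "t = b / (a + b)"
    have st: "0 \<le> s" "0 \<le> t" "s + t = 1"
      using a b by (auto simp: s_def t_def add_divide_distrib[symmetric])
    have fI: "integrable M (\<lambda>x. norm (f x) powr p)" and gI: "integrable M (\<lambda>x. norm (g x) powr p)"
      using f g by (auto simp: Lp_space_iff)
    define R where "R x = (a + b) powr p * (s * (norm (f x) powr p / a powr p) + t * (norm (g x) powr p / b powr p))" for x
    have R: "integrable M R"
      unfolding R_def using f g by (auto simp: Lp_space_iff)
    have "norm (f x + g x) powr p \<le> R x" for x
    proof -
      have "norm (f x + g x) powr p \<le> (norm (f x) + norm (g x)) powr p"
        using p by (intro powr_mono2) (auto simp: norm_triangle_ineq)
      also have "norm (f x) + norm (g x) = (a + b) * (s * (norm (f x) / a) + t * (norm (g x) / b))"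
      proof -
        have "(a + b) * s = a" "(a + b) * t = b" using a b by (auto simp: s_def t_def)
        then have "(a + b) * (s * (norm (f x) / a)) = norm (f x)" "(a + b) * (t * (norm (g x) / b)) = norm (g x)"
          using a b by (simp_all add: mult.assoc[symmetric])
        then show ?thesis by (simp only: distrib_left)
      qed
      also have "\<dots> powr p = (a + b) powr p * (s * (norm (f x) / a) + t * (norm (g x) / b)) powr p"
        by (rule powr_mult)
      also have "\<dots> \<le> (a + b) powr p * (s * (norm (f x) / a) powr p + t * (norm (g x) / b) powr p)"
        using p st a b by (intro mult_left_mono powr_convex_combination) auto
      finally show ?thesis using a b by (simp add: R_def powr_divide)
    qed
    then have "(\<integral>\<^sup>+x. ennreal (norm (f x + g x) powr p) \<partial>M) \<le> (\<integral>\<^sup>+x. ennreal (R x) \<partial>M)"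
      by (intro nn_integral_mono ennreal_leI)
    also have "\<dots> = ennreal (\<integral>x. R x \<partial>M)"
      by (rule nn_integral_eq_integral[OF R]) (use st a b in \<open>auto simp: R_def\<close>)
    also have "(\<integral>x. R x \<partial>M) = (a + b) powr p *
        (s * (Lp_norm p M f powr p / a powr p) + t * (Lp_norm p M g powr p / b powr p))"
      using fI gI unfolding R_def Lp_norm_powr by simp
    also have "\<dots> \<le> (a + b) powr p * (s * 1 + t * 1)"
      using a b st p by (intro mult_left_mono add_mono) (auto simp: divide_le_eq_1 intro!: powr_mono2)
    finally show ?thesis using st by (simp add: ennreal_leI)
  qed
  \<comment> \<open>Convexity needs positive scales \<open>a\<close> and \<open>b\<close>, while a
    norm may vanish; both norms are enlarged by \<open>e\<close>, which tends to zero at the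
    end.\<close>
  have bd: "(\<lambda>x. f x + g x) \<in> Lp_space p M"
      "Lp_norm p M (\<lambda>x. f x + g x) \<le> Lp_norm p M f + Lp_norm p M g + (e + e)" if "0 < e" for e
  proof -
    have e: "0 < Lp_norm p M f + e" "0 < Lp_norm p M g + e"
      using that Lp_norm_nonneg[of p M f] Lp_norm_nonneg[of p M g] by linarith+
    note ** = *[OF e(1) _ e(2)]
    show "(\<lambda>x. f x + g x) \<in> Lp_space p M"
      by (rule Lp_bounded(1)[OF meas _ **]) (use that e in auto)
    have "Lp_norm p M (\<lambda>x. f x + g x) \<le> (Lp_norm p M f + e) + (Lp_norm p M g + e)"
      by (rule Lp_bounded(2)[OF meas _ **]) (use that e in auto)
    then show "Lp_norm p M (\<lambda>x. f x + g x) \<le> Lp_norm p M f + Lp_norm p M g + (e + e)" by simp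
  qed
  show "(\<lambda>x. f x + g x) \<in> Lp_space p M" by (rule bd(1)[of 1]) simp
  show "Lp_norm p M (\<lambda>x. f x + g x) \<le> Lp_norm p M f + Lp_norm p M g"
  proof (rule field_le_epsilon)
    fix e :: real assume "0 < e"
    then show "Lp_norm p M (\<lambda>x. f x + g x) \<le> Lp_norm p M f + Lp_norm p M g + e"
      using bd(2)[of "e/2"] by simp
  qed
qed

lemma Lp_scaled:
  assumes f: "f \<in> Lp_space p M" and g: "strongly_measurable M g"
    and eq: "\<And>x. norm (g x) = c * norm (f x)" and c: "0 \<le> c"
  shows "g \<in> Lp_space p M" "Lp_norm p M g = c * Lp_norm p M f"
proof -
  have *: "norm (g x) powr p = c powr p * norm (f x) powr p" for x
    using c by (simp add: eq powr_mult)
  show "g \<in> Lp_space p M" using f g by (simp add: Lp_space_iff *)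
  show "Lp_norm p M g = c * Lp_norm p M f"
    using c p by (simp add: Lp_norm_def * powr_mult integral_nonneg_AE powr_powr)
qed

lemma Lp_scaleR:
  assumes "f \<in> Lp_space p M"
  shows "(\<lambda>x. r *\<^sub>R f x) \<in> Lp_space p M" "Lp_norm p M (\<lambda>x. r *\<^sub>R f x) = \<bar>r\<bar> * Lp_norm p M f"
  by (rule Lp_scaled[OF assms, where c = "\<bar>r\<bar>"];
      use assms in \<open>auto intro!: strongly_measurable_scaleR simp: Lp_space_iff\<close>)+

lemma Lp_minus:
  assumes "f \<in> Lp_space p M"
  shows "(\<lambda>x. - f x) \<in> Lp_space p M" "Lp_norm p M (\<lambda>x. - f x) = Lp_norm p M f"
  using Lp_scaleR[OF assms, of "-1"] by auto

lemma Lp_diff: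
  assumes "f \<in> Lp_space p M" "g \<in> Lp_space p M"
  shows "(\<lambda>x. f x - g x) \<in> Lp_space p M"
    and "Lp_norm p M (\<lambda>x. f x - g x) \<le> Lp_norm p M f + Lp_norm p M g"
  using Lp_add[OF assms(1) Lp_minus(1)[OF assms(2)]] Lp_norm_add[OF assms(1) Lp_minus(1)[OF assms(2)]]
    Lp_minus(2)[OF assms(2)] by auto

lemma Lp_norm_minus_commute:
  "Lp_norm p M (\<lambda>x. f x - g x) = Lp_norm p M (\<lambda>x. g x - f x)"
  by (simp add: Lp_norm_def norm_minus_commute)

lemma Lp_norm_triangle_diff:
  assumes "f \<in> Lp_space p M" "g \<in> Lp_space p M" "h \<in> Lp_space p M"
  shows "Lp_norm p M (\<lambda>x. f x - h x) \<le> Lp_norm p M (\<lambda>x. f x - g x) + Lp_norm p M (\<lambda>x. g x - h x)"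
  using Lp_norm_add[OF Lp_diff(1)[OF assms(1,2)] Lp_diff(1)[OF assms(2,3)]] by simp

lemma Lp_sum:
  assumes "\<And>i. i \<in> I \<Longrightarrow> f i \<in> Lp_space p M"
  shows "(\<lambda>x. \<Sum>i\<in>I. f i x) \<in> Lp_space p M"
    and "Lp_norm p M (\<lambda>x. \<Sum>i\<in>I. f i x) \<le> (\<Sum>i\<in>I. Lp_norm p M (f i))"
proof -
  have "(\<lambda>x. \<Sum>i\<in>I. f i x) \<in> Lp_space p M \<and>
      Lp_norm p M (\<lambda>x. \<Sum>i\<in>I. f i x) \<le> (\<Sum>i\<in>I. Lp_norm p M (f i))"
    using assms
  proof (induction I rule: infinite_finite_induct)
    case (insert i I)
    then show ?case using Lp_add[of "f i"] Lp_norm_add[of "f i" "\<lambda>x. \<Sum>i\<in>I. f i x"] by force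
  qed (simp_all add: Lp_const)
  then show "(\<lambda>x. \<Sum>i\<in>I. f i x) \<in> Lp_space p M"
    "Lp_norm p M (\<lambda>x. \<Sum>i\<in>I. f i x) \<le> (\<Sum>i\<in>I. Lp_norm p M (f i))" by auto
qed

lemma Lp_norm_eq_0_iff:
  assumes "f \<in> Lp_space p M"
  shows "Lp_norm p M f = 0 \<longleftrightarrow> (AE x in M. f x = 0)"
proof -
  have "Lp_norm p M f = 0 \<longleftrightarrow> (\<integral>x. norm (f x) powr p \<partial>M) = 0"
    by (simp add: Lp_norm_def)
  also have "\<dots> \<longleftrightarrow> (AE x in M. norm (f x) powr p = 0)"
    using assms by (intro integral_nonneg_eq_0_iff_AE) (auto simp: Lp_space_iff)
  finally show ?thesis by simp
qed

text \<open>Jensen's inequality for the p-th power, obtained by integrating Young's inequality at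
  the scale \<open>a\<close>, with \<open>a\<close> slightly above the norm.\<close>

lemma nn_integral_norm_le_Lp_norm:
  assumes f: "f \<in> Lp_space p M"
  shows "(\<integral>\<^sup>+x. ennreal (norm (f x)) \<partial>M) \<le> ennreal (Lp_norm p M f)"
proof (rule ennreal_le_epsilon)
  fix e :: real assume e: "0 < e"
  define a where "a = Lp_norm p M f + e"
  have a: "0 < a" "Lp_norm p M f \<le> a" using e Lp_norm_nonneg[of p M f] unfolding a_def by linarith+
  \<comment> \<open>Young's bound for \<open>norm (f x) / a\<close>, multiplied by \<open>a\<close>.
    Its integral is at most \<open>a * (1 / p + (1 - 1 / p))\<close>, which is
    \<open>a\<close>.\<close>
  define R where "R x = a * (norm (f x) powr p / (a powr p * p) + (1 - 1 / p))" for x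
  have R: "integrable M R" unfolding R_def using f by (auto simp: Lp_space_iff)
  have "norm (f x) \<le> R x" for x
  proof -
    have "norm (f x) / a \<le> (norm (f x) / a) powr p / p + (1 - 1 / p)"
      using a p by (intro le_powr_mean) auto
    then show ?thesis using a by (simp add: R_def powr_divide field_simps)
  qed
  then have "(\<integral>\<^sup>+x. ennreal (norm (f x)) \<partial>M) \<le> (\<integral>\<^sup>+x. ennreal (R x) \<partial>M)"
    by (intro nn_integral_mono ennreal_leI)
  also have "\<dots> = ennreal (\<integral>x. R x \<partial>M)"
    by (rule nn_integral_eq_integral[OF R]) (use a p in \<open>auto simp: R_def\<close>)
  also have "(\<integral>x. R x \<partial>M) = a * (Lp_norm p M f powr p / (a powr p * p) + (1 - 1 / p))"
    using f unfolding R_def Lp_norm_powr by (auto simp: Lp_space_iff prob_space)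
  also have "\<dots> \<le> a * (1 / p + (1 - 1 / p))"
  proof (intro mult_left_mono add_right_mono)
    have "Lp_norm p M f powr p \<le> a powr p" using a p by (intro powr_mono2) auto
    then show "Lp_norm p M f powr p / (a powr p * p) \<le> 1 / p" using a p by (simp add: field_simps)
  qed (use a in auto)
  finally show "(\<integral>\<^sup>+x. ennreal (norm (f x)) \<partial>M) \<le> ennreal (Lp_norm p M f) + ennreal e"
    using e by (simp add: a_def ennreal_leI flip: ennreal_plus)
qed

lemma Lp_norm_tendsto_dominated:
  assumes f: "\<And>n. strongly_measurable M (f n)" and g: "g \<in> Lp_space p M"
    and le: "\<And>n. AE x in M. norm (f n x) \<le> norm (g x)"
    and lim: "AE x in M. (\<lambda>n. f n x) \<longlonglongrightarrow> 0"
  shows "(\<lambda>n. Lp_norm p M (f n)) \<longlonglongrightarrow> 0"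
proof -
  have "(\<lambda>n. \<integral>x. norm (f n x) powr p \<partial>M) \<longlonglongrightarrow> (\<integral>x. 0 \<partial>M)"
  proof (rule integral_dominated_convergence)
    show "integrable M (\<lambda>x. norm (g x) powr p)" using g by (simp add: Lp_space_iff)
    show "AE x in M. (\<lambda>n. norm (f n x) powr p) \<longlonglongrightarrow> 0"
      using lim
    proof eventually_elim
      case (elim x)
      then have "(\<lambda>n. norm (f n x)) \<longlonglongrightarrow> 0" by (rule tendsto_norm_zero)
      then have "(\<lambda>n. norm (f n x) powr p) \<longlonglongrightarrow> 0 powr p"
        using p by (intro tendsto_powr') auto
      then show ?case by simp
    qed
    show "AE x in M. norm (norm (f n x) powr p) \<le> norm (g x) powr p" for n
      using le[of n] by eventually_elim (use p in \<open>auto intro!: powr_mono2\<close>)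
  qed (use Lp_measurable[OF f] in auto)
  then have "(\<lambda>n. (\<integral>x. norm (f n x) powr p \<partial>M) powr (1 / p)) \<longlonglongrightarrow> 0 powr (1 / p)"
    using p by (intro tendsto_powr') (auto simp: integral_nonneg_AE)
  then show ?thesis by (simp add: Lp_norm_def)
qed

end

section \<open>Completeness of the Lebesgue spaces and their functionals\<close>

context Lebesgue_space
begin

text \<open>Riesz-Fischer. Summability of the Lp norms bounds the L1 norm of the sum of pointwise
  norms, so that the series converges absolutely almost everywhere; Fatou turns this into
  convergence in norm.\<close>

lemma Lp_complete_series:
  fixes \<xi> :: "nat \<Rightarrow> 'x \<Rightarrow> 'v::banach"
  assumes \<xi>: "\<And>n. \<xi> n \<in> Lp_space p M" and sm: "summable (\<lambda>n. Lp_norm p M (\<xi> n))"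
  shows "\<exists>\<eta>\<in>Lp_space p M. (\<lambda>n. Lp_norm p M (\<lambda>x. \<eta> x - (\<Sum>k<n. \<xi> k x))) \<longlonglongrightarrow> 0"
proof -
  have meas: "strongly_measurable M (\<xi> n)" for n using \<xi> by (simp add: Lp_space_iff)
  have [measurable]: "(\<lambda>x. norm (\<xi> n x)) \<in> borel_measurable M" for n
    by (rule strongly_measurable_norm[OF meas])
  define u where "u x = (\<Sum>n. ennreal (norm (\<xi> n x)))" for x
  have u_meas[measurable]: "u \<in> borel_measurable M" unfolding u_def by measurable
  have "(\<integral>\<^sup>+x. u x \<partial>M) = (\<Sum>n. \<integral>\<^sup>+x. ennreal (norm (\<xi> n x)) \<partial>M)"
    unfolding u_def by (intro nn_integral_suminf) measurable
  also have "\<dots> \<le> (\<Sum>n. ennreal (Lp_norm p M (\<xi> n)))"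
    by (intro suminf_le nn_integral_norm_le_Lp_norm \<xi>) auto
  also have "\<dots> = ennreal (\<Sum>n. Lp_norm p M (\<xi> n))"
    by (rule suminf_ennreal2[OF Lp_norm_nonneg sm])
  finally have "(\<integral>\<^sup>+x. u x \<partial>M) \<noteq> \<infinity>" by (auto simp: top_unique)
  then have fin: "AE x in M. u x \<noteq> \<infinity>" by (intro nn_integral_noteq_infinite) auto
  define S where "S n x = (\<Sum>k<n. \<xi> k x)" for n x
  define A where "A = {x\<in>space M. u x \<noteq> \<infinity>}"
  have A[measurable]: "A \<in> sets M" unfolding A_def by measurable
  \<comment> \<open>The value 0 off the set of absolute convergence makes \<open>\<eta>\<close> an
    everywhere limit of strongly measurable functions.\<close>
  define \<eta> where "\<eta> x = (if x \<in> A then (\<Sum>n. \<xi> n x) else 0)" for x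
  have S_lim: "(\<lambda>n. S n x) \<longlonglongrightarrow> \<eta> x" if "x \<in> A" for x
  proof -
    have "summable (\<lambda>n. norm (\<xi> n x))"
      using that by (intro summable_suminf_not_top) (auto simp: A_def u_def)
    then have "summable (\<lambda>n. \<xi> n x)" by (rule summable_norm_cancel)
    then show ?thesis using that summable_LIMSEQ by (simp add: \<eta>_def S_def)
  qed
  have "strongly_measurable M \<eta>"
  proof (rule strongly_measurable_LIMSEQ)
    show "strongly_measurable M (\<lambda>x. indicator A x *\<^sub>R S n x)" for n
      unfolding S_def using meas by (intro strongly_measurable_scaleR strongly_measurable_sum) auto
    show "(\<lambda>n. indicator A x *\<^sub>R S n x) \<longlonglongrightarrow> \<eta> x" for x
      using S_lim by (cases "x \<in> A") (auto simp: \<eta>_def)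
  qed
  moreover have S: "S n \<in> Lp_space p M" for n
    unfolding S_def using \<xi> by (intro Lp_sum)
  ultimately have meas_diff: "strongly_measurable M (\<lambda>x. \<eta> x - S n x)" for n
    by (auto simp: Lp_space_iff)
  define t where "t n = (\<Sum>k. Lp_norm p M (\<xi> (k + n)))" for n
  have t: "0 \<le> t n" for n
    unfolding t_def using sm by (intro suminf_nonneg summable_ignore_initial_segment) auto
  \<comment> \<open>Fatou applied to the tails: the partial sums beyond \<open>n\<close> differ from
    \<open>S n\<close> by at most the remainder \<open>t n\<close> of the series of norms.\<close>
  have *: "(\<integral>\<^sup>+x. ennreal (norm (\<eta> x - S n x) powr p) \<partial>M) \<le> ennreal (t n powr p)" for n
  proof -
    have "(\<integral>\<^sup>+x. ennreal (norm (\<eta> x - S n x) powr p) \<partial>M) =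
        (\<integral>\<^sup>+x. liminf (\<lambda>m. ennreal (norm (S (m + n) x - S n x) powr p)) \<partial>M)"
    proof (rule nn_integral_cong_AE)
      show "AE x in M. ennreal (norm (\<eta> x - S n x) powr p) =
          liminf (\<lambda>m. ennreal (norm (S (m + n) x - S n x) powr p))"
        using fin AE_space
      proof eventually_elim
        case (elim x)
        then have "x \<in> A" by (simp add: A_def)
        then have "(\<lambda>m. norm (S (m + n) x - S n x)) \<longlonglongrightarrow> norm (\<eta> x - S n x)"
          using S_lim by (intro tendsto_intros LIMSEQ_ignore_initial_segment)
        then have "(\<lambda>m. norm (S (m + n) x - S n x) powr p) \<longlonglongrightarrow> norm (\<eta> x - S n x) powr p"
          using p by (intro tendsto_powr') auto
        then have "(\<lambda>m. ennreal (norm (S (m + n) x - S n x) powr p)) \<longlonglongrightarrow> ennreal (norm (\<eta> x - S n x) powr p)"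
          by (rule tendsto_ennrealI)
        then show ?case by (intro lim_imp_Liminf[symmetric]) auto
      qed
    qed
    also have "\<dots> \<le> liminf (\<lambda>m. \<integral>\<^sup>+x. ennreal (norm (S (m + n) x - S n x) powr p) \<partial>M)"
      using S by (intro nn_integral_liminf measurable_compose[OF Lp_measurable measurable_ennreal])
        (auto simp: Lp_space_iff)
    also have "\<dots> \<le> ennreal (t n powr p)"
    proof (rule Liminf_le)
      show "\<forall>\<^sub>F m in sequentially. (\<integral>\<^sup>+x. ennreal (norm (S (m + n) x - S n x) powr p) \<partial>M) \<le> ennreal (t n powr p)"
      proof (rule always_eventually, rule allI)
        fix m
        have eq: "S (m + n) x - S n x = (\<Sum>k<m. \<xi> (k + n) x)" for x
          unfolding S_def by (induction m) (auto simp: algebra_simps)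
        have "Lp_norm p M (\<lambda>x. S (m + n) x - S n x) \<le> (\<Sum>k<m. Lp_norm p M (\<xi> (k + n)))"
          unfolding eq using \<xi> by (intro Lp_sum)
        also have "\<dots> \<le> t n"
          unfolding t_def using sm by (intro sum_le_suminf summable_ignore_initial_segment) auto
        finally have "Lp_norm p M (\<lambda>x. S (m + n) x - S n x) powr p \<le> t n powr p"
          using p by (intro powr_mono2) auto
        then show "(\<integral>\<^sup>+x. ennreal (norm (S (m + n) x - S n x) powr p) \<partial>M) \<le> ennreal (t n powr p)"
          by (subst Lp_nn_integral) (auto intro!: Lp_diff S ennreal_leI)
      qed
    qed simp
    finally show ?thesis .
  qed
  have "(\<lambda>x. \<eta> x - S 0 x) \<in> Lp_space p M"
    by (rule Lp_bounded(1)[OF meas_diff t *])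
  then have "\<eta> \<in> Lp_space p M" by (simp add: S_def)
  moreover have "(\<lambda>n. Lp_norm p M (\<lambda>x. \<eta> x - S n x)) \<longlonglongrightarrow> 0"
  proof (rule tendsto_sandwich[where f = "\<lambda>_. 0" and h = t])
    show "t \<longlonglongrightarrow> 0" unfolding t_def by (rule suminf_exist_split2[OF sm])
    show "\<forall>\<^sub>F n in sequentially. Lp_norm p M (\<lambda>x. \<eta> x - S n x) \<le> t n"
      using Lp_bounded(2)[OF meas_diff t *] by simp
  qed auto
  ultimately show ?thesis unfolding S_def by blast
qed

context
  fixes sc :: "'k::{real_normed_field, euclidean_space} \<Rightarrow> 'v::banach \<Rightarrow> 'v"
  assumes sc: "scalar_mult sc"
begin

lemma dual_add:
  "\<phi> \<in> Lp_dual sc p M \<Longrightarrow> f \<in> Lp_space p M \<Longrightarrow> g \<in> Lp_space p M \<Longrightarrow> \<phi> (\<lambda>x. f x + g x) = \<phi> f + \<phi> g"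
  by (simp add: Lp_dual_def)

lemma dual_scaleR:
  assumes "\<phi> \<in> Lp_dual sc p M" "f \<in> Lp_space p M"
  shows "\<phi> (\<lambda>x. r *\<^sub>R f x) = r *\<^sub>R \<phi> f"
proof -
  have "(\<lambda>x. r *\<^sub>R f x) = (\<lambda>x. sc (of_real r) (f x))" using sc by (simp add: scalar_mult_def)
  then show ?thesis using assms by (simp add: Lp_dual_def scaleR_conv_of_real)
qed

lemma dual_diff:
  assumes "\<phi> \<in> Lp_dual sc p M" "f \<in> Lp_space p M" "g \<in> Lp_space p M"
  shows "\<phi> (\<lambda>x. f x - g x) = \<phi> f - \<phi> g"
  using dual_add[OF assms(1,2) Lp_minus(1)[OF assms(3)]] dual_scaleR[OF assms(1,3), of "-1"] by simp

lemma dual_zero: "\<phi> \<in> Lp_dual sc p M \<Longrightarrow> \<phi> (\<lambda>x. 0) = 0"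
  using dual_scaleR[of \<phi> "\<lambda>x. 0" 0] Lp_const(1)[of 0] by simp

lemma dual_sum:
  assumes \<phi>: "\<phi> \<in> Lp_dual sc p M" and f: "\<And>i. i \<in> I \<Longrightarrow> f i \<in> Lp_space p M"
  shows "\<phi> (\<lambda>x. \<Sum>i\<in>I. f i x) = (\<Sum>i\<in>I. \<phi> (f i))"
  using f
proof (induction I rule: infinite_finite_induct)
  case (insert i I)
  then show ?case using dual_add[OF \<phi>, of "f i" "\<lambda>x. \<Sum>i\<in>I. f i x"] Lp_sum(1)[of I f] by simp
qed (simp_all add: dual_zero[OF \<phi>])

lemma dual_bound:
  assumes "\<phi> \<in> Lp_dual sc p M"
  obtains C where "0 \<le> C" "\<And>f. f \<in> Lp_space p M \<Longrightarrow> norm (\<phi> f) \<le> C * Lp_norm p M f"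
proof -
  obtain C where C: "\<And>f. f \<in> Lp_space p M \<Longrightarrow> norm (\<phi> f) \<le> C * Lp_norm p M f"
    using assms unfolding Lp_dual_def by blast
  have "norm (\<phi> f) \<le> \<bar>C\<bar> * Lp_norm p M f" if "f \<in> Lp_space p M" for f
    using C[OF that] by (smt (verit) Lp_norm_nonneg mult_right_mono)
  then show ?thesis using that[of "\<bar>C\<bar>"] by simp
qed

lemma dual_cong_AE:
  assumes "\<phi> \<in> Lp_dual sc p M" "f \<in> Lp_space p M" "g \<in> Lp_space p M" "AE x in M. f x = g x"
  shows "\<phi> f = \<phi> g"
proof -
  obtain C where C: "\<And>f. f \<in> Lp_space p M \<Longrightarrow> norm (\<phi> f) \<le> C * Lp_norm p M f"
    using dual_bound[OF assms(1)] by blast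
  have "Lp_norm p M (\<lambda>x. f x - g x) = 0"
    using assms by (subst Lp_norm_eq_0_iff) (auto intro: Lp_diff)
  then show ?thesis
    using C[OF Lp_diff(1)[OF assms(2,3)]] dual_diff[OF assms(1-3)] by simp
qed

lemma dual_tendsto:
  assumes \<phi>: "\<phi> \<in> Lp_dual sc p M" and f: "\<And>n. f n \<in> Lp_space p M" "g \<in> Lp_space p M"
    and lim: "(\<lambda>n. Lp_norm p M (\<lambda>x. f n x - g x)) \<longlonglongrightarrow> 0"
  shows "(\<lambda>n. \<phi> (f n)) \<longlonglongrightarrow> \<phi> g"
proof -
  obtain C where C: "\<And>f. f \<in> Lp_space p M \<Longrightarrow> norm (\<phi> f) \<le> C * Lp_norm p M f"
    using dual_bound[OF \<phi>] by blast
  have null: "(\<lambda>n. C * Lp_norm p M (\<lambda>x. f n x - g x)) \<longlonglongrightarrow> 0"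
    using tendsto_mult_left[OF lim, of C] by simp
  have "norm (\<phi> (f n) - \<phi> g) \<le> C * Lp_norm p M (\<lambda>x. f n x - g x)" for n
    using C[OF Lp_diff(1)[OF f(1) f(2)], of n] dual_diff[OF \<phi> f(1) f(2), of n] by simp
  then have "(\<lambda>n. \<phi> (f n) - \<phi> g) \<longlonglongrightarrow> 0"
    by (intro Lim_null_comparison[OF always_eventually null] allI)
  then show ?thesis by (rule LIM_zero_cancel)
qed

text \<open>These localized integrals are the only members of \<open>Lp_dual\<close> that are ever
  constructed from scratch; they are rich enough to separate classes.\<close>

lemma dual_integral_functional:
  assumes add: "\<And>u v. \<psi> (u + v) = \<psi> u + \<psi> v" and scale: "\<And>a v. \<psi> (sc a v) = a * \<psi> v"
    and bd: "\<And>v. norm (\<psi> v) \<le> C * norm v" and E: "E \<in> sets M"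
  shows "(\<lambda>f. \<integral>x. indicator E x *\<^sub>R \<psi> (f x) \<partial>M) \<in> Lp_dual sc p M"
    and "f \<in> Lp_space p M \<Longrightarrow> integrable M (\<lambda>x. indicator E x *\<^sub>R \<psi> (f x))"
proof -
  have "bounded_linear \<psi>"
  proof (rule bounded_linear_intro[where K=C])
    show "\<psi> (r *\<^sub>R v) = r *\<^sub>R \<psi> v" for r v
      using scale[of "of_real r" v] sc by (simp add: scalar_mult_def scaleR_conv_of_real)
  qed (use add bd in \<open>auto simp: mult.commute\<close>)
  then have cont: "continuous_on UNIV \<psi>" by (rule linear_continuous_on)
  have C: "0 \<le> C * norm v" for v :: 'v using order_trans[OF norm_ge_zero bd] .
  have meas: "(\<lambda>x. indicator E x *\<^sub>R \<psi> (f x)) \<in> borel_measurable M" if "f \<in> Lp_space p M" for f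
  proof -
    have [measurable]: "(\<lambda>x. \<psi> (f x)) \<in> borel_measurable M"
      by (rule strongly_measurableD[OF strongly_measurable_continuous[OF _ cont]]) (use that in \<open>simp add: Lp_space_iff\<close>)
    show ?thesis using E by measurable
  qed
  have nn: "(\<integral>\<^sup>+x. ennreal (norm (indicator E x *\<^sub>R \<psi> (f x))) \<partial>M) \<le> ennreal (\<bar>C\<bar> * Lp_norm p M f)"
    if f: "f \<in> Lp_space p M" for f
  proof -
    have "(\<integral>\<^sup>+x. ennreal (norm (indicator E x *\<^sub>R \<psi> (f x))) \<partial>M) \<le> (\<integral>\<^sup>+x. ennreal \<bar>C\<bar> * ennreal (norm (f x)) \<partial>M)"
    proof (intro nn_integral_mono)
      fix x
      have "norm (indicator E x *\<^sub>R \<psi> (f x)) \<le> C * norm (f x)"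
        using bd[of "f x"] C[of "f x"] by (auto simp: indicator_def)
      also have "\<dots> \<le> \<bar>C\<bar> * norm (f x)" by (intro mult_right_mono) auto
      finally show "ennreal (norm (indicator E x *\<^sub>R \<psi> (f x))) \<le> ennreal \<bar>C\<bar> * ennreal (norm (f x))"
        by (simp add: ennreal_leI flip: ennreal_mult)
    qed
    also have "\<dots> = ennreal \<bar>C\<bar> * (\<integral>\<^sup>+x. ennreal (norm (f x)) \<partial>M)"
      using f by (intro nn_integral_cmult measurable_compose[OF strongly_measurable_norm measurable_ennreal])
        (simp add: Lp_space_iff)
    also have "\<dots> \<le> ennreal \<bar>C\<bar> * ennreal (Lp_norm p M f)"
      by (intro mult_left_mono nn_integral_norm_le_Lp_norm[OF f]) simp
    finally show ?thesis by (simp add: ennreal_mult)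
  qed
  show int: "integrable M (\<lambda>x. indicator E x *\<^sub>R \<psi> (f x))" if "f \<in> Lp_space p M" for f
    using nn[OF that] by (intro integrableI_bounded meas[OF that]) (auto simp: le_less_trans)
  have bound: "norm (\<integral>x. indicator E x *\<^sub>R \<psi> (f x) \<partial>M) \<le> \<bar>C\<bar> * Lp_norm p M f" if "f \<in> Lp_space p M" for f
  proof -
    have "ennreal (norm (\<integral>x. indicator E x *\<^sub>R \<psi> (f x) \<partial>M)) \<le> (\<integral>\<^sup>+x. ennreal (norm (indicator E x *\<^sub>R \<psi> (f x))) \<partial>M)"
      by (rule integral_norm_bound_ennreal[OF int[OF that]])
    then have "ennreal (norm (\<integral>x. indicator E x *\<^sub>R \<psi> (f x) \<partial>M)) \<le> ennreal (\<bar>C\<bar> * Lp_norm p M f)"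
      using nn[OF that] by (rule order_trans)
    then show ?thesis by (simp add: ennreal_le_iff)
  qed
  show "(\<lambda>f. \<integral>x. indicator E x *\<^sub>R \<psi> (f x) \<partial>M) \<in> Lp_dual sc p M"
    unfolding Lp_dual_def
  proof (intro CollectI conjI ballI allI exI)
    fix f g :: "'x \<Rightarrow> 'v" assume "f \<in> Lp_space p M" "g \<in> Lp_space p M"
    then show "(\<integral>x. indicator E x *\<^sub>R \<psi> (f x + g x) \<partial>M) =
        (\<integral>x. indicator E x *\<^sub>R \<psi> (f x) \<partial>M) + (\<integral>x. indicator E x *\<^sub>R \<psi> (g x) \<partial>M)"
      by (simp add: add scaleR_add_right Bochner_Integration.integral_add[OF int int])
  next
    fix a and f :: "'x \<Rightarrow> 'v" assume "f \<in> Lp_space p M"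
    then show "(\<integral>x. indicator E x *\<^sub>R \<psi> (sc a (f x)) \<partial>M) = a * (\<integral>x. indicator E x *\<^sub>R \<psi> (f x) \<partial>M)"
      by (simp add: scale flip: integral_mult_right_zero)
  qed (rule bound)
qed

text \<open>The nonzero values of the difference lie in countably many balls that avoid 0, because
  the range is separable. On the preimage of each ball a norming functional of its centre is bounded
  away from zero, while its integral there vanishes.\<close>

lemma dual_separates:
  assumes f: "f \<in> Lp_space p M" and g: "g \<in> Lp_space p M"
    and eq: "\<And>\<phi>. \<phi> \<in> Lp_dual sc p M \<Longrightarrow> \<phi> f = \<phi> g"
  shows "AE x in M. f x = g x"
proof -
  define h where "h x = f x - g x" for x
  have h: "h \<in> Lp_space p M" unfolding h_def by (rule Lp_diff(1)[OF f g])
  then have meas: "strongly_measurable M h" by (simp add: Lp_space_iff)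
  then obtain C where C: "countable C" "h ` space M \<subseteq> closure C"
    unfolding strongly_measurable_def by blast
  \<comment> \<open>With radius half the norm of the centre, a functional norming \<open>c\<close>
    stays at or above \<open>norm c / 2\<close> on the ball.\<close>
  define B where "B c = {x\<in>space M. norm (h x - c) < norm c / 2}" for c
  have B: "B c \<in> sets M" for c
    unfolding B_def using strongly_measurable_norm[OF strongly_measurable_diff[OF meas strongly_measurable_const]]
    by measurable
  have null: "B c \<in> null_sets M" for c
  proof -
    obtain l where l: "linear l" "\<And>x. \<bar>l x\<bar> \<le> norm x" "l c = norm c"
      using ex_norming_functional[of c] by blast
    obtain \<psi> K where \<psi>: "\<And>u v. \<psi> (u + v) = \<psi> u + \<psi> v" "\<And>a v. \<psi> (sc a v) = a * \<psi> v"
        "\<And>v. norm (\<psi> v) \<le> K * norm v" and l_eq: "\<And>v. \<psi> v \<bullet> 1 = l v"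
      using ex_scalar_functional[OF sc l(1,2)] by blast
    note dual = dual_integral_functional[OF \<psi> B[of c]]
    have "(\<integral>x. indicator (B c) x *\<^sub>R \<psi> (h x) \<partial>M) = 0"
      using eq[OF dual(1)] dual_diff[OF dual(1) f g] by (simp add: h_def)
    then have "(\<integral>x. (indicator (B c) x *\<^sub>R \<psi> (h x)) \<bullet> 1 \<partial>M) = 0"
      by (subst integral_inner_left) (use dual(2)[OF h] in auto)
    then have int0: "(\<integral>x. indicator (B c) x * l (h x) \<partial>M) = 0"
      by (simp add: l_eq)
    have int: "integrable M (\<lambda>x. indicator (B c) x * l (h x))"
      using integrable_inner_left[OF dual(2)[OF h], of 1] by (simp add: l_eq)
    have pos: "norm c / 2 \<le> l (h x)" "0 < l (h x)" if "x \<in> B c" for x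
    proof -
      have "l (h x) = l c + l (h x - c)" using linear_add[OF l(1), of c "h x - c"] by simp
      then show "norm c / 2 \<le> l (h x)" "0 < l (h x)"
        using l(2)[of "h x - c"] l(3) that unfolding B_def by auto
    qed
    have "AE x in M. indicator (B c) x * l (h x) = 0"
      using int int0 pos(2) by (subst integral_nonneg_eq_0_iff_AE[symmetric])
        (auto simp: indicator_def intro!: less_imp_le)
    then have "AE x in M. x \<notin> B c"
      by eventually_elim (use pos(2) in \<open>force simp: indicator_def\<close>)
    then show ?thesis using B AE_iff_null_sets by blast
  qed
  have "{x\<in>space M. h x \<noteq> 0} \<subseteq> (\<Union>c\<in>C. B c)"
  proof
    fix x assume x: "x \<in> {x\<in>space M. h x \<noteq> 0}"
    then have "h x \<in> closure C" "0 < norm (h x) / 3" using C(2) by auto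
    then obtain c where c: "c \<in> C" "dist c (h x) < norm (h x) / 3"
      unfolding closure_approachable by blast
    \<comment> \<open>From a distance below a third of \<open>norm (h x)\<close> it follows that
      \<open>norm c\<close> exceeds two thirds of it, so \<open>h x\<close> lies in the ball around
      \<open>c\<close>.\<close>
    have "norm (h x) \<le> norm c + norm (h x - c)" by (metis norm_triangle_sub)
    then have "norm (h x - c) < norm c / 2"
      using c(2) unfolding dist_norm norm_minus_commute[of c] by linarith
    then show "x \<in> (\<Union>c\<in>C. B c)" using x c(1) by (auto simp: B_def)
  qed
  moreover have "(\<Union>c\<in>C. B c) \<in> null_sets M"
    by (intro null_sets_UN' C(1) null)
  ultimately have "AE x in M. h x = 0" by (intro AE_I') auto
  then show ?thesis by (simp add: h_def)
qed

end

end

section \<open>Weak integrals of families in a Lebesgue space\<close>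

context Lebesgue_space
begin

context
  fixes sc :: "'k::{real_normed_field, euclidean_space} \<Rightarrow> 'v::banach \<Rightarrow> 'v"
    and Y :: "'y measure"
  assumes sc: "scalar_mult sc" and Y: "prob_space Y"
begin

interpretation Y: Lebesgue_space Y p
  using Y p by (simp add: Lebesgue_space_def Lebesgue_space_axioms_def)

interpretation YM: pair_sigma_finite Y M ..

text \<open>An abstract functional carries no integral formula, so Fubini cannot be applied to it
  directly. The exchange is evident on rectangles and extends to all measurable sets by a Dynkin
  argument, using continuity of the functional under bounded convergence.\<close>

lemma dual_section:
  fixes v :: 'v
  assumes \<phi>: "\<phi> \<in> Lp_dual sc p M" and E: "E \<in> sets (Y \<Otimes>\<^sub>M M)"
  shows "(\<lambda>y. \<phi> (\<lambda>x. indicator E (y, x) *\<^sub>R v)) \<in> borel_measurable Y \<and>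
    \<phi> (\<lambda>x. (\<integral>y. indicator E (y, x) \<partial>Y) *\<^sub>R v) = (\<integral>y. \<phi> (\<lambda>x. indicator E (y, x) *\<^sub>R v) \<partial>Y)"
proof -
  obtain C where C: "0 \<le> C" "\<And>f. f \<in> Lp_space p M \<Longrightarrow> norm (\<phi> f) \<le> C * Lp_norm p M f"
    using dual_bound[OF sc \<phi>] by blast
  \<comment> \<open>Boundedness by a constant, together with finite total mass, keeps every section
    and every average in the Lebesgue space throughout the Dynkin argument.\<close>
  define bm where "bm h B \<longleftrightarrow> h \<in> borel_measurable (Y \<Otimes>\<^sub>M M) \<and> (\<forall>z. \<bar>h z\<bar> \<le> B)" for h :: "'y \<times> 'x \<Rightarrow> real" and B
  have sec: "(\<lambda>x. h (y, x) *\<^sub>R v) \<in> Lp_space p M" "norm (\<phi> (\<lambda>x. h (y, x) *\<^sub>R v)) \<le> C * (B * norm v)"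
    if h: "bm h B" and y: "y \<in> space Y" for h B y
  proof -
    have B: "0 \<le> B" using h unfolding bm_def by (meson abs_ge_zero order_trans)
    have [measurable]: "h \<in> borel_measurable (Y \<Otimes>\<^sub>M M)" using h by (simp add: bm_def)
    have 1: "strongly_measurable M (\<lambda>x. h (y, x) *\<^sub>R v)"
      using y by (intro strongly_measurable_scaleR strongly_measurable_const) measurable
    have 2: "AE x in M. norm (h (y, x) *\<^sub>R v) \<le> norm (B *\<^sub>R v)"
      using h B by (auto simp: bm_def intro!: mult_right_mono)
    note * = Lp_dominated[OF 1 Lp_const(1) 2]
    show "(\<lambda>x. h (y, x) *\<^sub>R v) \<in> Lp_space p M" by (rule *(1))
    show "norm (\<phi> (\<lambda>x. h (y, x) *\<^sub>R v)) \<le> C * (B * norm v)"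
      using C(2)[OF *(1)] mult_left_mono[OF *(2) C(1)] B by (simp add: Lp_const)
  qed
  have int: "integrable Y (\<lambda>y. h (y, x))" if h: "bm h B" and x: "x \<in> space M" for h B x
    using h x unfolding bm_def by (intro Y.integrable_const_bound[where B=B]) auto
  have avg: "(\<lambda>x. (\<integral>y. h (y, x) \<partial>Y) *\<^sub>R v) \<in> Lp_space p M" if h: "bm h B" for h B
  proof (rule Lp_dominated(1)[OF _ Lp_const(1)[of "B *\<^sub>R v"]])
    have B: "0 \<le> B" using h unfolding bm_def by (meson abs_ge_zero order_trans)
    have [measurable]: "h \<in> borel_measurable (Y \<Otimes>\<^sub>M M)" using h by (simp add: bm_def)
    show "strongly_measurable M (\<lambda>x. (\<integral>y. h (y, x) \<partial>Y) *\<^sub>R v)"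
      by (intro strongly_measurable_scaleR strongly_measurable_const) measurable
    have "\<bar>\<integral>y. h (y, x) \<partial>Y\<bar> \<le> B" if "x \<in> space M" for x
    proof -
      have "\<bar>\<integral>y. h (y, x) \<partial>Y\<bar> \<le> (\<integral>y. \<bar>h (y, x)\<bar> \<partial>Y)" by (rule integral_abs_bound)
      also have "\<dots> \<le> (\<integral>y. B \<partial>Y)"
        using int[OF h that] h by (intro integral_mono) (auto simp: bm_def)
      finally show ?thesis by (simp add: Y.prob_space)
    qed
    then show "AE x in M. norm ((\<integral>y. h (y, x) \<partial>Y) *\<^sub>R v) \<le> norm (B *\<^sub>R v)"
      using B by (auto intro!: AE_I2 mult_right_mono)
  qed
  define good where "good h \<longleftrightarrow> (\<lambda>y. \<phi> (\<lambda>x. h (y, x) *\<^sub>R v)) \<in> borel_measurable Y \<and>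
    \<phi> (\<lambda>x. (\<integral>y. h (y, x) \<partial>Y) *\<^sub>R v) = (\<integral>y. \<phi> (\<lambda>x. h (y, x) *\<^sub>R v) \<partial>Y)" for h
  have int\<phi>: "integrable Y (\<lambda>y. \<phi> (\<lambda>x. h (y, x) *\<^sub>R v))" if "bm h B" "good h" for h B
    using sec(2)[OF that(1)] that(2) unfolding good_def
    by (intro Y.integrable_const_bound[where B = "C * (B * norm v)"]) (auto intro!: AE_I2)
  have lin: "good (\<lambda>z. h z + r * k z)" if h: "bm h B" "good h" and k: "bm k B'" "good k" for h B k B' r
  proof -
    have eq: "\<phi> (\<lambda>x. (h (y, x) + r * k (y, x)) *\<^sub>R v) = \<phi> (\<lambda>x. h (y, x) *\<^sub>R v) + r *\<^sub>R \<phi> (\<lambda>x. k (y, x) *\<^sub>R v)"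
      if y: "y \<in> space Y" for y
      using dual_add[OF sc \<phi> sec(1)[OF h(1) y] Lp_scaleR(1)[OF sec(1)[OF k(1) y]]]
        dual_scaleR[OF sc \<phi> sec(1)[OF k(1) y]] by (simp add: scaleR_add_left)
    have meas: "(\<lambda>y. \<phi> (\<lambda>x. (h (y, x) + r * k (y, x)) *\<^sub>R v)) \<in> borel_measurable Y"
      using h(2) k(2) unfolding good_def by (subst measurable_cong[OF eq]) auto
    have "(\<integral>y. \<phi> (\<lambda>x. (h (y, x) + r * k (y, x)) *\<^sub>R v) \<partial>Y) =
        (\<integral>y. \<phi> (\<lambda>x. h (y, x) *\<^sub>R v) + r *\<^sub>R \<phi> (\<lambda>x. k (y, x) *\<^sub>R v) \<partial>Y)"
      by (intro Bochner_Integration.integral_cong eq) auto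
    also have "\<dots> = \<phi> (\<lambda>x. (\<integral>y. h (y, x) \<partial>Y) *\<^sub>R v) + r *\<^sub>R \<phi> (\<lambda>x. (\<integral>y. k (y, x) \<partial>Y) *\<^sub>R v)"
      using int\<phi>[OF h] int\<phi>[OF k] h(2) k(2) by (simp add: good_def)
    also have "\<dots> = \<phi> (\<lambda>x. (\<integral>y. h (y, x) \<partial>Y) *\<^sub>R v + r *\<^sub>R (\<integral>y. k (y, x) \<partial>Y) *\<^sub>R v)"
      using dual_add[OF sc \<phi> avg[OF h(1)] Lp_scaleR(1)[OF avg[OF k(1)]]]
        dual_scaleR[OF sc \<phi> avg[OF k(1)]] by simp
    also have "\<dots> = \<phi> (\<lambda>x. (\<integral>y. h (y, x) + r * k (y, x) \<partial>Y) *\<^sub>R v)"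
    proof (rule dual_cong_AE[OF sc \<phi>])
      have "bm (\<lambda>z. h z + r * k z) (B + \<bar>r\<bar> * B')"
        unfolding bm_def
      proof (intro conjI allI)
        fix z
        have "\<bar>h z + r * k z\<bar> \<le> \<bar>h z\<bar> + \<bar>r\<bar> * \<bar>k z\<bar>"
          using abs_triangle_ineq[of "h z" "r * k z"] by (simp add: abs_mult)
        also have "\<dots> \<le> B + \<bar>r\<bar> * B'"
          using h(1) k(1) by (intro add_mono mult_left_mono) (auto simp: bm_def simp del: split_paired_All)
        finally show "\<bar>h z + r * k z\<bar> \<le> B + \<bar>r\<bar> * B'" .
      qed (use h(1) k(1) in \<open>auto simp: bm_def\<close>)
      then show "(\<lambda>x. (\<integral>y. h (y, x) + r * k (y, x) \<partial>Y) *\<^sub>R v) \<in> Lp_space p M" by (rule avg)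
      show "AE x in M. (\<integral>y. h (y, x) \<partial>Y) *\<^sub>R v + r *\<^sub>R (\<integral>y. k (y, x) \<partial>Y) *\<^sub>R v =
          (\<integral>y. h (y, x) + r * k (y, x) \<partial>Y) *\<^sub>R v"
        using int[OF h(1)] int[OF k(1)] by (auto intro!: AE_I2 simp: scaleR_add_left)
    qed (intro Lp_add Lp_scaleR avg[OF h(1)] avg[OF k(1)])
    finally show ?thesis using meas by (simp add: good_def)
  qed
  have limit: "good h" if hn: "\<And>n::nat. bm (hn n) B" "\<And>n. good (hn n)" and h: "bm h B"
    and lim: "\<And>z. (\<lambda>n. hn n z) \<longlonglongrightarrow> h z" for hn h B
  proof -
    \<comment> \<open>Bounded pointwise convergence of the coefficients implies norm convergence,
      hence convergence under \<open>\<phi>\<close>. It is applied once to the sections and once to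
      the averages.\<close>
    have dom: "(\<lambda>n. \<phi> (\<lambda>x. a n x *\<^sub>R v)) \<longlonglongrightarrow> \<phi> (\<lambda>x. b x *\<^sub>R v)"
      if a: "\<And>n. (\<lambda>x. a n x *\<^sub>R v) \<in> Lp_space p M" and b: "(\<lambda>x. b x *\<^sub>R v) \<in> Lp_space p M"
        and le: "\<And>n x. x \<in> space M \<Longrightarrow> \<bar>a n x - b x\<bar> \<le> K"
        and lim: "\<And>x. x \<in> space M \<Longrightarrow> (\<lambda>n. a n x) \<longlonglongrightarrow> b x" for a b and K :: real
    proof (rule dual_tendsto[OF sc \<phi> a b], rule Lp_norm_tendsto_dominated[OF _ Lp_const(1)[of "K *\<^sub>R v"]])
      show "strongly_measurable M (\<lambda>x. a n x *\<^sub>R v - b x *\<^sub>R v)" for n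
        using Lp_diff(1)[OF a b] by (simp add: Lp_space_iff)
      have "norm (a n x *\<^sub>R v - b x *\<^sub>R v) \<le> norm (K *\<^sub>R v)" if "x \<in> space M" for n x
        using le[OF that, of n] by (simp add: mult_right_mono flip: scaleR_diff_left)
      then show "AE x in M. norm (a n x *\<^sub>R v - b x *\<^sub>R v) \<le> norm (K *\<^sub>R v)" for n by auto
      have "(\<lambda>n. a n x *\<^sub>R v - b x *\<^sub>R v) \<longlonglongrightarrow> b x *\<^sub>R v - b x *\<^sub>R v" if "x \<in> space M" for x
        using lim[OF that] by (intro tendsto_intros)
      then show "AE x in M. (\<lambda>n. a n x *\<^sub>R v - b x *\<^sub>R v) \<longlonglongrightarrow> 0" by auto
    qed
    have le: "\<bar>hn n z - h z\<bar> \<le> 2 * B" for n z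
    proof -
      have "\<bar>hn n z\<bar> \<le> B" "\<bar>h z\<bar> \<le> B" using hn(1)[of n] h by (auto simp: bm_def simp del: split_paired_All)
      then show ?thesis by linarith
    qed
    have 1: "(\<lambda>n. \<phi> (\<lambda>x. hn n (y, x) *\<^sub>R v)) \<longlonglongrightarrow> \<phi> (\<lambda>x. h (y, x) *\<^sub>R v)" if "y \<in> space Y" for y
      using sec(1)[OF hn(1) that] sec(1)[OF h that] le lim by (rule dom)
    have meas: "(\<lambda>y. \<phi> (\<lambda>x. h (y, x) *\<^sub>R v)) \<in> borel_measurable Y"
      by (rule borel_measurable_LIMSEQ_metric[OF _ 1]) (use hn(2) in \<open>auto simp: good_def\<close>)
    have "(\<lambda>n. \<integral>y. \<phi> (\<lambda>x. hn n (y, x) *\<^sub>R v) \<partial>Y) \<longlonglongrightarrow> (\<integral>y. \<phi> (\<lambda>x. h (y, x) *\<^sub>R v) \<partial>Y)"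
      by (rule integral_dominated_convergence[where w = "\<lambda>_. C * (B * norm v)"])
        (use meas hn(2) 1 sec(2)[OF hn(1)] in \<open>auto simp: good_def\<close>)
    moreover have "(\<lambda>n. \<phi> (\<lambda>x. (\<integral>y. hn n (y, x) \<partial>Y) *\<^sub>R v)) \<longlonglongrightarrow> \<phi> (\<lambda>x. (\<integral>y. h (y, x) \<partial>Y) *\<^sub>R v)"
    proof (rule dom[OF avg[OF hn(1)] avg[OF h]])
      fix x assume x: "x \<in> space M"
      note i = int[OF hn(1) x] int[OF h x]
      show "(\<lambda>n. \<integral>y. hn n (y, x) \<partial>Y) \<longlonglongrightarrow> (\<integral>y. h (y, x) \<partial>Y)"
        by (rule integral_dominated_convergence[where w = "\<lambda>_. B"])
          (use i lim hn(1) in \<open>auto simp: bm_def\<close>)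
      fix n
      have "\<bar>(\<integral>y. hn n (y, x) \<partial>Y) - (\<integral>y. h (y, x) \<partial>Y)\<bar> = \<bar>\<integral>y. hn n (y, x) - h (y, x) \<partial>Y\<bar>"
        using i by simp
      also have "\<dots> \<le> (\<integral>y. \<bar>hn n (y, x) - h (y, x)\<bar> \<partial>Y)" by (rule integral_abs_bound)
      also have "\<dots> \<le> (\<integral>y. 2 * B \<partial>Y)" using i le by (intro integral_mono) auto
      finally show "\<bar>(\<integral>y. hn n (y, x) \<partial>Y) - (\<integral>y. h (y, x) \<partial>Y)\<bar> \<le> 2 * B" by (simp add: Y.prob_space)
    qed
    moreover have "\<phi> (\<lambda>x. (\<integral>y. hn n (y, x) \<partial>Y) *\<^sub>R v) = (\<integral>y. \<phi> (\<lambda>x. hn n (y, x) *\<^sub>R v) \<partial>Y)" for n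
      using hn(2) by (simp add: good_def)
    ultimately have "\<phi> (\<lambda>x. (\<integral>y. h (y, x) \<partial>Y) *\<^sub>R v) = (\<integral>y. \<phi> (\<lambda>x. h (y, x) *\<^sub>R v) \<partial>Y)"
      by (simp add: LIMSEQ_unique)
    then show ?thesis using meas by (simp add: good_def)
  qed
  let ?G = "{a \<times> b | a b. a \<in> sets Y \<and> b \<in> sets M}"
  have bm_ind: "bm (indicator E) 1" if "E \<in> sets (Y \<Otimes>\<^sub>M M)" for E
    using that by (auto simp: bm_def indicator_def)
  have rect: "good (indicator (a \<times> b))" if [measurable]: "a \<in> sets Y" "b \<in> sets M" for a b
  proof -
    have b: "(\<lambda>x. indicator b x *\<^sub>R v) \<in> Lp_space p M"
      by (rule Lp_dominated(1)[OF _ Lp_const(1)[of v]])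
        (auto simp: indicator_def intro!: strongly_measurable_scaleR)
    have "\<phi> (\<lambda>x. indicator (a \<times> b) (y, x) *\<^sub>R v) = indicator a y *\<^sub>R \<phi> (\<lambda>x. indicator b x *\<^sub>R v)" for y
      using dual_scaleR[OF sc \<phi> b, of "indicator a y"] by (simp add: indicator_times)
    moreover have "\<phi> (\<lambda>x. (\<integral>y. indicator (a \<times> b) (y, x) \<partial>Y) *\<^sub>R v) = measure Y a *\<^sub>R \<phi> (\<lambda>x. indicator b x *\<^sub>R v)"
      using dual_scaleR[OF sc \<phi> b, of "measure Y a"] by (simp add: indicator_times)
    moreover have "(\<integral>y. indicator a y *\<^sub>R c \<partial>Y) = measure Y a *\<^sub>R c" for c :: 'k
      by (subst integral_scaleR_left) (auto simp: Y.emeasure_eq_measure)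
    ultimately show ?thesis unfolding good_def by simp
  qed
  have "good (indicator E)"
    using Int_stable_pair_measure_generator pair_measure_closed E[unfolded sets_pair_measure]
  proof (induction rule: sigma_sets_induct_disjoint)
    case (basic A) then show ?case using rect by auto
  next
    case empty
    show ?case using rect[OF sets.empty_sets sets.empty_sets] by (simp only: Sigma_empty1)
  next
    case (compl A)
    then have A: "A \<in> sets (Y \<Otimes>\<^sub>M M)" by (simp add: sets_pair_measure)
    have eq: "indicator (space Y \<times> space M - A) = (\<lambda>z. indicator (space Y \<times> space M) z + (- 1) * indicator A z :: real)"
      using sets.sets_into_space[OF A] by (auto simp: indicator_def space_pair_measure fun_eq_iff)
    show ?case unfolding eq
      by (rule lin[OF bm_ind rect bm_ind[OF A] compl.IH]) auto
  next
    case (union A)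
    then have A: "A i \<in> sets (Y \<Otimes>\<^sub>M M)" for i by (auto simp: sets_pair_measure)
    \<comment> \<open>Countable disjoint unions are reached through their finite partial unions,
      whose indicators are finite sums.\<close>
    have part: "good (indicator (\<Union>i<n. A i))" for n
    proof (induction n)
      case 0 show ?case using rect[OF sets.empty_sets sets.empty_sets] by (simp only: Sigma_empty1 lessThan_0 UN_empty)
    next
      case (Suc n)
      have "A i \<inter> A n = {}" if "i < n" for i
        using union(1) that unfolding disjoint_family_on_def by (metis UNIV_I less_irrefl)
      then have "(\<Union>i<n. A i) \<inter> A n = {}" by blast
      then have eq: "indicator (\<Union>i<Suc n. A i) = (\<lambda>z. indicator (\<Union>i<n. A i) z + 1 * indicator (A n) z :: real)"
        by (auto simp: indicator_def lessThan_Suc fun_eq_iff)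
      show ?case unfolding eq
        by (rule lin[OF bm_ind Suc.IH bm_ind[OF A] union.IH]) (use A in auto)
    qed
    show ?case
    proof (rule limit[OF bm_ind part bm_ind])
      show "(\<lambda>n. indicator (\<Union>i<n. A i) z :: real) \<longlonglongrightarrow> indicator (\<Union>i. A i) z" for z
        by (rule LIMSEQ_indicator_UN)
    qed (use A in auto)
  qed
  then show ?thesis by (simp add: good_def)
qed

text \<open>A simple function is a finite combination of indicators of its level sets, so linearity
  of the functional reduces everything to \<open>dual_section\<close>.\<close>

lemma dual_simple_section:
  fixes F :: "'y \<times> 'x \<Rightarrow> 'v"
  assumes F: "simple_function (Y \<Otimes>\<^sub>M M) F"
  shows "y \<in> space Y \<Longrightarrow> (\<lambda>x. F (y, x)) \<in> Lp_space p M"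
    and "(\<lambda>x. Bochner_Integration.simple_bochner_integral Y (\<lambda>y. F (y, x))) \<in> Lp_space p M"
    and "\<phi> \<in> Lp_dual sc p M \<Longrightarrow> (\<lambda>y. \<phi> (\<lambda>x. F (y, x))) \<in> borel_measurable Y"
    and "\<phi> \<in> Lp_dual sc p M \<Longrightarrow>
      \<phi> (\<lambda>x. Bochner_Integration.simple_bochner_integral Y (\<lambda>y. F (y, x))) = (\<integral>y. \<phi> (\<lambda>x. F (y, x)) \<partial>Y)"
proof -
  let ?R = "F ` space (Y \<Otimes>\<^sub>M M)"
  define E where "E c = F -` {c} \<inter> space (Y \<Otimes>\<^sub>M M)" for c
  have fin: "finite ?R" and E[measurable]: "E c \<in> sets (Y \<Otimes>\<^sub>M M)" for c
    using F unfolding E_def by (auto simp: simple_function_def) (metis (no_types) vimage_singleton_eq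
      measurable_sets measurable_simple_function[OF F] sets_count_space Pow_UNIV UNIV_I)
  have F_eq: "F (y, x) = (\<Sum>c\<in>?R. indicator (E c) (y, x) *\<^sub>R c)" if "y \<in> space Y" "x \<in> space M" for y x
  proof -
    have "(\<Sum>c\<in>?R. indicator (E c) (y, x) *\<^sub>R c) = (\<Sum>c\<in>?R. if c = F (y, x) then F (y, x) else 0)"
      using that by (intro sum.cong) (auto simp: indicator_def E_def space_pair_measure)
    also have "\<dots> = F (y, x)" using that fin by (subst sum.delta) (auto simp: space_pair_measure)
    finally show ?thesis by simp
  qed
  \<comment> \<open>For fixed \<open>x\<close> the average is a sum over the values taken on that
    section only. Adding the remaining values of \<open>F\<close> with weight zero gives an index
    set that does not depend on \<open>x\<close>.\<close>
  have I_eq: "Bochner_Integration.simple_bochner_integral Y (\<lambda>y. F (y, x)) = (\<Sum>c\<in>?R. (\<integral>y. indicator (E c) (y, x) \<partial>Y) *\<^sub>R c)"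
    if x: "x \<in> space M" for x
  proof -
    have "(\<integral>y. indicator (E c) (y, x) \<partial>Y) = (measure Y {y\<in>space Y. F (y, x) = c} :: real)" for c
    proof -
      have "(\<integral>y. indicator (E c) (y, x) \<partial>Y) = (\<integral>y. indicator {y\<in>space Y. F (y, x) = c} y \<partial>Y :: real)"
        using x by (intro Bochner_Integration.integral_cong) (auto simp: indicator_def E_def space_pair_measure)
      then show ?thesis by (simp add: Int_absorb2 Collect_restrict)
    qed
    then have "(\<Sum>c\<in>?R. (\<integral>y. indicator (E c) (y, x) \<partial>Y) *\<^sub>R c) =
        (\<Sum>c\<in>?R. measure Y {y\<in>space Y. F (y, x) = c} *\<^sub>R c)" by simp
    also have "\<dots> = (\<Sum>c\<in>(\<lambda>y. F (y, x)) ` space Y. measure Y {y\<in>space Y. F (y, x) = c} *\<^sub>R c)"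
    proof (rule sum.mono_neutral_right[OF fin])
      show "(\<lambda>y. F (y, x)) ` space Y \<subseteq> ?R" using x by (auto simp: space_pair_measure)
      show "\<forall>c\<in>?R - (\<lambda>y. F (y, x)) ` space Y. measure Y {y\<in>space Y. F (y, x) = c} *\<^sub>R c = 0"
      proof
        fix c assume "c \<in> ?R - (\<lambda>y. F (y, x)) ` space Y"
        then have "F (y, x) \<noteq> c" if "y \<in> space Y" for y using that by blast
        then have "{y\<in>space Y. F (y, x) = c} = {}" by blast
        then show "measure Y {y\<in>space Y. F (y, x) = c} *\<^sub>R c = 0" by (simp only: measure_empty scaleR_zero_left)
      qed
    qed
    finally show ?thesis by (simp only: simple_bochner_integral_def)
  qed
  have ind: "(\<lambda>x. indicator (E c) (y, x) *\<^sub>R c) \<in> Lp_space p M" if "y \<in> space Y" for c y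
    by (rule Lp_dominated(1)[OF _ Lp_const(1)[of c]])
      (use that in \<open>auto simp: indicator_def intro!: strongly_measurable_scaleR\<close>)
  have avg: "(\<lambda>x. (\<integral>y. indicator (E c) (y, x) \<partial>Y) *\<^sub>R c) \<in> Lp_space p M" for c
  proof (rule Lp_dominated(1)[OF _ Lp_const(1)[of c]])
    show "strongly_measurable M (\<lambda>x. (\<integral>y. indicator (E c) (y, x) \<partial>Y) *\<^sub>R c)"
      by (intro strongly_measurable_scaleR strongly_measurable_const) measurable
    have "\<bar>\<integral>y. indicator (E c) (y, x) \<partial>Y\<bar> \<le> (1::real)" for x
      using Y.integral_le_const[of "\<lambda>y. indicator (E c) (y, x)" 1]
      by (cases "integrable Y (\<lambda>y. indicator (E c) (y, x) :: real)")
        (auto simp: not_integrable_integral_eq integral_nonneg_AE intro!: AE_I2)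
    then show "AE x in M. norm ((\<integral>y. indicator (E c) (y, x) \<partial>Y) *\<^sub>R c) \<le> norm c"
      by (auto intro!: AE_I2 mult_left_le_one_le)
  qed
  have sumF: "(\<lambda>x. \<Sum>c\<in>?R. indicator (E c) (y, x) *\<^sub>R c) \<in> Lp_space p M" if "y \<in> space Y" for y
    by (rule Lp_sum(1)) (rule ind[OF that])
  have cong: "f \<in> Lp_space p M \<longleftrightarrow> g \<in> Lp_space p M" if "\<And>x. x \<in> space M \<Longrightarrow> f x = g x" for f g :: "'x \<Rightarrow> 'v"
    using strongly_measurable_cong[of M f g, OF that] Bochner_Integration.integrable_cong[of M M "\<lambda>x. norm (f x) powr p" "\<lambda>x. norm (g x) powr p"] that
    by (simp add: Lp_space_iff)
  show FX: "(\<lambda>x. F (y, x)) \<in> Lp_space p M" if "y \<in> space Y" for y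
    using sumF[OF that] cong[of "\<lambda>x. F (y, x)", OF F_eq[OF that]] by simp
  have sumI: "(\<lambda>x. \<Sum>c\<in>?R. (\<integral>y. indicator (E c) (y, x) \<partial>Y) *\<^sub>R c) \<in> Lp_space p M"
    by (rule Lp_sum(1)) (rule avg)
  show IX: "(\<lambda>x. Bochner_Integration.simple_bochner_integral Y (\<lambda>y. F (y, x))) \<in> Lp_space p M"
    using sumI cong[OF I_eq] by simp
  assume \<phi>: "\<phi> \<in> Lp_dual sc p M"
  have \<phi>F: "\<phi> (\<lambda>x. F (y, x)) = (\<Sum>c\<in>?R. \<phi> (\<lambda>x. indicator (E c) (y, x) *\<^sub>R c))" if y: "y \<in> space Y" for y
  proof -
    have "\<phi> (\<lambda>x. F (y, x)) = \<phi> (\<lambda>x. \<Sum>c\<in>?R. indicator (E c) (y, x) *\<^sub>R c)"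
      by (rule dual_cong_AE[OF sc \<phi> FX[OF y] sumF[OF y]]) (use F_eq[OF y] in auto)
    also have "\<dots> = (\<Sum>c\<in>?R. \<phi> (\<lambda>x. indicator (E c) (y, x) *\<^sub>R c))"
      by (rule dual_sum[OF sc \<phi> ind[OF y]])
    finally show ?thesis .
  qed
  note sect = dual_section[OF \<phi> E]
  show "(\<lambda>y. \<phi> (\<lambda>x. F (y, x))) \<in> borel_measurable Y"
  proof (subst measurable_cong[OF \<phi>F])
    show "(\<lambda>y. \<Sum>c\<in>?R. \<phi> (\<lambda>x. indicator (E c) (y, x) *\<^sub>R c)) \<in> borel_measurable Y"
      using sect by (intro borel_measurable_sum) blast
  qed
  obtain C where C: "0 \<le> C" "\<And>f. f \<in> Lp_space p M \<Longrightarrow> norm (\<phi> f) \<le> C * Lp_norm p M f"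
    using dual_bound[OF sc \<phi>] by blast
  have int: "integrable Y (\<lambda>y. \<phi> (\<lambda>x. indicator (E c) (y, x) *\<^sub>R c))" for c
  proof (rule Y.integrable_const_bound[where B = "C * norm c"])
    have "norm (\<phi> (\<lambda>x. indicator (E c) (y, x) *\<^sub>R c)) \<le> C * norm c" if y: "y \<in> space Y" for y
    proof -
      have "Lp_norm p M (\<lambda>x. indicator (E c) (y, x) *\<^sub>R c) \<le> norm c"
        using Lp_dominated(2)[OF _ Lp_const(1)[of c], of "\<lambda>x. indicator (E c) (y, x) *\<^sub>R c"] ind[OF y]
        by (auto simp: Lp_const Lp_space_iff indicator_def)
      then show ?thesis using C(2)[OF ind[OF y]] mult_left_mono[OF _ C(1)] order_trans by blast
    qed
    then show "AE y in Y. norm (\<phi> (\<lambda>x. indicator (E c) (y, x) *\<^sub>R c)) \<le> C * norm c" by auto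
  qed (use sect in auto)
  have "\<phi> (\<lambda>x. Bochner_Integration.simple_bochner_integral Y (\<lambda>y. F (y, x))) =
      \<phi> (\<lambda>x. \<Sum>c\<in>?R. (\<integral>y. indicator (E c) (y, x) \<partial>Y) *\<^sub>R c)"
    by (rule dual_cong_AE[OF sc \<phi> IX sumI]) (use I_eq in auto)
  also have "\<dots> = (\<Sum>c\<in>?R. \<phi> (\<lambda>x. (\<integral>y. indicator (E c) (y, x) \<partial>Y) *\<^sub>R c))"
    by (rule dual_sum[OF sc \<phi> avg])
  also have "\<dots> = (\<Sum>c\<in>?R. \<integral>y. \<phi> (\<lambda>x. indicator (E c) (y, x) *\<^sub>R c) \<partial>Y)"
    using sect by simp
  also have "\<dots> = (\<integral>y. (\<Sum>c\<in>?R. \<phi> (\<lambda>x. indicator (E c) (y, x) *\<^sub>R c)) \<partial>Y)"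
    using int by simp
  also have "\<dots> = (\<integral>y. \<phi> (\<lambda>x. F (y, x)) \<partial>Y)"
    by (intro Bochner_Integration.integral_cong) (use \<phi>F in auto)
  finally show "\<phi> (\<lambda>x. Bochner_Integration.simple_bochner_integral Y (\<lambda>y. F (y, x))) = (\<integral>y. \<phi> (\<lambda>x. F (y, x)) \<partial>Y)" .
qed

text \<open>The weak integral is realized by a function: for almost every \<open>x\<close> the
  section in \<open>y\<close> has finite Lp norm, so the averages of its simple approximations form
  a Cauchy sequence. Their pointwise limit is also a limit in norm, through which any functional
  passes.\<close>

lemma
  fixes H :: "'y \<Rightarrow> 'x \<Rightarrow> 'v"
  assumes H: "strongly_measurable (Y \<Otimes>\<^sub>M M) (\<lambda>(y, x). H y x)"
    and HX: "\<And>y. y \<in> space Y \<Longrightarrow> H y \<in> Lp_space p M"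
  shows dual_measurable: "\<phi> \<in> Lp_dual sc p M \<Longrightarrow> (\<lambda>y. \<phi> (H y)) \<in> borel_measurable Y"
    and weak_integral_exists: "(AE y in Y. Lp_norm p M (H y) \<le> B) \<Longrightarrow>
      \<exists>\<eta>\<in>Lp_space p M. \<forall>\<phi>\<in>Lp_dual sc p M. \<phi> \<eta> = (\<integral>y. \<phi> (H y) \<partial>Y)"
proof -
  obtain F where F: "\<And>n. simple_function (Y \<Otimes>\<^sub>M M) (F n)"
    and F_lim: "\<And>y x. y \<in> space Y \<Longrightarrow> x \<in> space M \<Longrightarrow> (\<lambda>n. F n (y, x)) \<longlonglongrightarrow> H y x"
    and F_le: "\<And>n y x. norm (F n (y, x) - H y x) \<le> norm (H y x)"
    using strongly_measurable_simple_approx[OF H, of 0] by (force simp: dist_norm space_pair_measure)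
  note FX = dual_simple_section(1)[OF F]
  have diffX: "(\<lambda>x. F n (y, x) - H y x) \<in> Lp_space p M" if "y \<in> space Y" for n y
    by (rule Lp_diff(1)[OF FX[OF that] HX[OF that]])
  have diff_le: "Lp_norm p M (\<lambda>x. F n (y, x) - H y x) \<le> Lp_norm p M (H y)" if "y \<in> space Y" for n y
    using diffX[OF that, of n] F_le by (intro Lp_dominated(2)[OF _ HX[OF that]]) (auto simp: Lp_space_iff)
  have diff_powr_le: "Lp_norm p M (\<lambda>x. F n (y, x) - H y x) powr p \<le> Lp_norm p M (H y) powr p"
    if "y \<in> space Y" for n y
    using diff_le[OF that] p by (intro powr_mono2) auto
  have F_norm: "(\<lambda>n. Lp_norm p M (\<lambda>x. F n (y, x) - H y x)) \<longlonglongrightarrow> 0" if y: "y \<in> space Y" for y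
  proof (rule Lp_norm_tendsto_dominated[OF _ HX[OF y]])
    show "strongly_measurable M (\<lambda>x. F n (y, x) - H y x)" for n
      using diffX[OF y] by (simp add: Lp_space_iff)
    show "AE x in M. (\<lambda>n. F n (y, x) - H y x) \<longlonglongrightarrow> 0"
      using F_lim[OF y] by (auto intro!: AE_I2 LIM_zero)
  qed (use F_le in auto)
  have \<phi>_lim: "(\<lambda>n. \<phi> (\<lambda>x. F n (y, x))) \<longlonglongrightarrow> \<phi> (H y)" if "\<phi> \<in> Lp_dual sc p M" "y \<in> space Y" for \<phi> y
    by (rule dual_tendsto[OF sc that(1) FX[OF that(2)] HX[OF that(2)] F_norm[OF that(2)]])
  show meas: "(\<lambda>y. \<phi> (H y)) \<in> borel_measurable Y" if \<phi>: "\<phi> \<in> Lp_dual sc p M" for \<phi>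
    by (rule borel_measurable_LIMSEQ_metric[OF dual_simple_section(3)[OF F \<phi>] \<phi>_lim[OF \<phi>]])
  assume B: "AE y in Y. Lp_norm p M (H y) \<le> B"
  have diff_meas: "strongly_measurable (Y \<Otimes>\<^sub>M M) (\<lambda>(y, x). F n (y, x) - H y x)" for n
    using strongly_measurable_diff[OF strongly_measurable_simple[OF F[of n]] H] by (simp add: case_prod_unfold)
  have joint[measurable]: "(\<lambda>(y, x). ennreal (norm (F n (y, x) - H y x) powr p)) \<in> borel_measurable (Y \<Otimes>\<^sub>M M)"
    "(\<lambda>(y, x). ennreal (norm (H y x) powr p)) \<in> borel_measurable (Y \<Otimes>\<^sub>M M)" for n
    using strongly_measurable_norm[OF diff_meas[of n]] strongly_measurable_norm[OF H]
    by (auto simp: case_prod_unfold)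
  \<comment> \<open>\<open>e\<close> measures the error of the approximation along the section over
    \<open>x\<close>, \<open>K\<close> the size of that section, and \<open>\<epsilon>\<close> the
    total error. The norm bound \<open>B\<close> makes the latter two quantities finite, almost
    everywhere or in total.\<close>
  define e where "e n x = (\<integral>\<^sup>+y. ennreal (norm (F n (y, x) - H y x) powr p) \<partial>Y)" for n x
  define K where "K x = (\<integral>\<^sup>+y. ennreal (norm (H y x) powr p) \<partial>Y)" for x
  have [measurable]: "e n \<in> borel_measurable M" "K \<in> borel_measurable M" for n
    unfolding e_def K_def by measurable
  define \<epsilon> where "\<epsilon> n = (\<integral>\<^sup>+x. e n x \<partial>M)" for n
  have Bp: "AE y in Y. ennreal (Lp_norm p M (H y) powr p) \<le> ennreal (B powr p)"
    using B by eventually_elim (use p in \<open>auto intro!: ennreal_leI powr_mono2\<close>)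
  have "(\<integral>\<^sup>+x. K x \<partial>M) = (\<integral>\<^sup>+y. \<integral>\<^sup>+x. ennreal (norm (H y x) powr p) \<partial>M \<partial>Y)"
    unfolding K_def by (rule YM.Fubini') simp
  also have "\<dots> = (\<integral>\<^sup>+y. ennreal (Lp_norm p M (H y) powr p) \<partial>Y)"
    by (intro nn_integral_cong Lp_nn_integral HX)
  also have "\<dots> \<le> (\<integral>\<^sup>+y. ennreal (B powr p) \<partial>Y)"
    by (rule nn_integral_mono_AE[OF Bp])
  finally have "(\<integral>\<^sup>+x. K x \<partial>M) \<noteq> \<infinity>" by (auto simp: Y.emeasure_space_1 top_unique)
  then have K_fin: "AE x in M. K x \<noteq> \<infinity>" by (intro nn_integral_noteq_infinite) auto
  have \<epsilon>_eq: "\<epsilon> n = (\<integral>\<^sup>+y. ennreal (Lp_norm p M (\<lambda>x. F n (y, x) - H y x) powr p) \<partial>Y)" for n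
  proof -
    have "\<epsilon> n = (\<integral>\<^sup>+y. \<integral>\<^sup>+x. ennreal (norm (F n (y, x) - H y x) powr p) \<partial>M \<partial>Y)"
      unfolding e_def \<epsilon>_def by (rule YM.Fubini') simp
    also have "\<dots> = (\<integral>\<^sup>+y. ennreal (Lp_norm p M (\<lambda>x. F n (y, x) - H y x) powr p) \<partial>Y)"
      by (intro nn_integral_cong Lp_nn_integral diffX)
    finally show ?thesis .
  qed
  have N_meas: "(\<lambda>y. ennreal (Lp_norm p M (\<lambda>x. F n (y, x) - H y x) powr p)) \<in> borel_measurable Y" for n
    by (subst measurable_cong[OF Lp_nn_integral[symmetric, OF diffX]]) auto
  have "\<epsilon> \<longlonglongrightarrow> (\<integral>\<^sup>+y. 0 \<partial>Y)"
    unfolding \<epsilon>_eq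
  proof (rule nn_integral_dominated_convergence)
    show "AE y in Y. ennreal (Lp_norm p M (\<lambda>x. F n (y, x) - H y x) powr p) \<le> ennreal (B powr p)" for n
      using Bp AE_space
      by eventually_elim (use order_trans[OF ennreal_leI[OF diff_powr_le]] in blast)
    have "(\<lambda>n. ennreal (Lp_norm p M (\<lambda>x. F n (y, x) - H y x) powr p)) \<longlonglongrightarrow> 0" if "y \<in> space Y" for y
    proof -
      have "(\<lambda>n. Lp_norm p M (\<lambda>x. F n (y, x) - H y x) powr p) \<longlonglongrightarrow> 0 powr p"
        using p by (intro tendsto_powr'[OF F_norm[OF that]]) auto
      then show ?thesis using tendsto_ennrealI by fastforce
    qed
    then show "AE y in Y. (\<lambda>n. ennreal (Lp_norm p M (\<lambda>x. F n (y, x) - H y x) powr p)) \<longlonglongrightarrow> 0" by auto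
  qed (use N_meas in \<open>auto simp: Y.emeasure_space_1 ennreal_less_top\<close>)
  then have \<epsilon>_lim: "\<epsilon> \<longlonglongrightarrow> 0" by simp
  have \<epsilon>_fin: "\<epsilon> n < \<infinity>" for n
  proof -
    have "\<epsilon> n \<le> (\<integral>\<^sup>+y. ennreal (B powr p) \<partial>Y)"
      unfolding \<epsilon>_eq
    proof (rule nn_integral_mono_AE)
      show "AE y in Y. ennreal (Lp_norm p M (\<lambda>x. F n (y, x) - H y x) powr p) \<le> ennreal (B powr p)"
        using Bp AE_space
        by eventually_elim (use order_trans[OF ennreal_leI[OF diff_powr_le]] in blast)
    qed
    then show ?thesis by (auto simp: Y.emeasure_space_1 le_less_trans)
  qed
  define A where "A = {x\<in>space M. K x \<noteq> \<infinity>}"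
  have A[measurable]: "A \<in> sets M" unfolding A_def by measurable
  define I where "I n x = Bochner_Integration.simple_bochner_integral Y (\<lambda>y. F n (y, x))" for n x
  have IX: "I n \<in> Lp_space p M" for n unfolding I_def by (rule dual_simple_section(2)[OF F])
  \<comment> \<open>On the set \<open>A\<close> where the section has finite size this bounds the Lp
    distance, in the variable \<open>y\<close>, of the simple approximation from
    \<open>H\<close>.\<close>
  define r where "r n x = enn2real (e n x) powr (1 / p)" for n x
  have r: "0 \<le> r n x" for n x by (simp add: r_def)
  have AM: "x \<in> space M" if "x \<in> A" for x using that by (simp add: A_def)
  have e_le: "e n x \<le> K x" for n x
    unfolding e_def K_def using p F_le by (intro nn_integral_mono ennreal_leI powr_mono2) auto
  have e_r: "e n x = ennreal (r n x powr p)" if "x \<in> A" for n x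
  proof -
    have "e n x < \<infinity>" using e_le[of n x] that by (auto simp: A_def less_top[symmetric] top_unique)
    then show ?thesis using p by (simp add: r_def powr_powr less_top)
  qed
  have r_lim: "(\<lambda>n. r n x) \<longlonglongrightarrow> 0" if x: "x \<in> A" for x
  proof -
    have [measurable]: "(\<lambda>y. ennreal (norm (F n (y, x) - H y x) powr p)) \<in> borel_measurable Y"
      "(\<lambda>y. ennreal (norm (H y x) powr p)) \<in> borel_measurable Y" for n
      using measurable_compose[OF measurable_Pair2'[OF AM[OF x]] joint(1)[of n]]
        measurable_compose[OF measurable_Pair2'[OF AM[OF x]] joint(2)] by simp_all
    have "(\<lambda>n. e n x) \<longlonglongrightarrow> (\<integral>\<^sup>+y. 0 \<partial>Y)"
      unfolding e_def
    proof (rule nn_integral_dominated_convergence)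
      show "AE y in Y. ennreal (norm (F n (y, x) - H y x) powr p) \<le> ennreal (norm (H y x) powr p)" for n
        using p F_le by (intro AE_I2 ennreal_leI powr_mono2) auto
      show "(\<integral>\<^sup>+y. ennreal (norm (H y x) powr p) \<partial>Y) < \<infinity>"
        using x by (simp add: A_def K_def less_top)
      have "(\<lambda>n. ennreal (norm (F n (y, x) - H y x) powr p)) \<longlonglongrightarrow> 0" if "y \<in> space Y" for y
      proof -
        have "(\<lambda>n. norm (F n (y, x) - H y x)) \<longlonglongrightarrow> 0"
          using F_lim[OF that AM[OF x]] by (intro tendsto_norm_zero LIM_zero)
        then have "(\<lambda>n. norm (F n (y, x) - H y x) powr p) \<longlonglongrightarrow> 0 powr p"
          using p by (intro tendsto_powr') auto
        then show ?thesis using tendsto_ennrealI by fastforce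
      qed
      then show "AE y in Y. (\<lambda>n. ennreal (norm (F n (y, x) - H y x) powr p)) \<longlonglongrightarrow> 0" by auto
      show "(\<lambda>y. ennreal (norm (F n (y, x) - H y x) powr p)) \<in> borel_measurable Y"
        "(\<lambda>y. ennreal (norm (H y x) powr p)) \<in> borel_measurable Y" for n by measurable
    qed simp
    then have "(\<lambda>n. enn2real (e n x)) \<longlonglongrightarrow> 0" by (intro tendsto_enn2real) simp_all
    then have "(\<lambda>n. r n x) \<longlonglongrightarrow> 0 powr (1 / p)"
      unfolding r_def using p by (intro tendsto_powr') auto
    then show ?thesis by simp
  qed
  \<comment> \<open>Averaging over a probability measure does not increase the norm beyond the L1
    norm, hence not beyond the Lp norm; the triangle inequality through \<open>H\<close> then gives
    the two errors.\<close>
  have I_diff: "norm (I n x - I m x) \<le> r n x + r m x" if x: "x \<in> A" for n m x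
  proof -
    note xM = AM[OF x]
    have sf: "simple_function Y (\<lambda>y. F n (y, x))" for n
    proof -
      have "(\<lambda>y. F n (y, x)) ` space Y \<subseteq> F n ` space (Y \<Otimes>\<^sub>M M)"
        using xM by (auto simp: space_pair_measure)
      moreover have "(\<lambda>y. F n (y, x)) \<in> measurable Y (count_space UNIV)"
        by (rule measurable_compose[OF measurable_Pair2'[OF xM] measurable_simple_function[OF F[of n]]])
      ultimately show ?thesis
        using F[of n] unfolding simple_function_def by (auto intro: finite_subset measurable_sets)
    qed
    then have sbi: "Bochner_Integration.simple_bochner_integrable Y (\<lambda>y. F n (y, x))" for n
      by (auto intro!: simple_bochner_integrable.intros simp: Y.emeasure_eq_measure)
    have NX: "(\<lambda>y. F n (y, x) - H y x) \<in> Lp_space p Y" "Lp_norm p Y (\<lambda>y. F n (y, x) - H y x) \<le> r n x" for n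
    proof -
      have sm: "strongly_measurable Y (\<lambda>y. F n (y, x) - H y x)"
        using strongly_measurable_compose[OF diff_meas measurable_Pair2'[OF xM]] by simp
      have le: "(\<integral>\<^sup>+y. ennreal (norm (F n (y, x) - H y x) powr p) \<partial>Y) \<le> ennreal (r n x powr p)"
        using e_r[OF x, of n] by (simp add: e_def)
      show "(\<lambda>y. F n (y, x) - H y x) \<in> Lp_space p Y" "Lp_norm p Y (\<lambda>y. F n (y, x) - H y x) \<le> r n x"
        by (rule Y.Lp_bounded[OF sm r le])+
    qed
    have eq: "(\<lambda>y. F n (y, x) - F m (y, x)) = (\<lambda>y. (F n (y, x) - H y x) - (F m (y, x) - H y x))"
      by simp
    have "norm (I n x - I m x) = norm (Bochner_Integration.simple_bochner_integral Y (\<lambda>y. F n (y, x) - F m (y, x)))"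
      unfolding I_def by (simp add: simple_bochner_integral_diff sbi)
    also have "\<dots> \<le> Bochner_Integration.simple_bochner_integral Y (\<lambda>y. norm (F n (y, x) - F m (y, x)))"
      by (intro simple_bochner_integral_norm_bound simple_bochner_integrable_compose2[where p = "(-)"] sbi) simp
    finally have "ennreal (norm (I n x - I m x)) \<le> ennreal (Bochner_Integration.simple_bochner_integral Y (\<lambda>y. norm (F n (y, x) - F m (y, x))))"
      by (rule ennreal_leI)
    also have "\<dots> = (\<integral>\<^sup>+y. ennreal (norm (F n (y, x) - F m (y, x))) \<partial>Y)"
      by (intro simple_bochner_integral_eq_nn_integral simple_bochner_integrable_compose2[where p = "\<lambda>u v. norm (u - v)"] sbi) auto
    also have "\<dots> \<le> ennreal (Lp_norm p Y (\<lambda>y. F n (y, x) - F m (y, x)))"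
      by (rule Y.nn_integral_norm_le_Lp_norm) (subst eq, rule Y.Lp_diff(1)[OF NX(1) NX(1)])
    also have "\<dots> \<le> ennreal (r n x + r m x)"
    proof (rule ennreal_leI)
      show "Lp_norm p Y (\<lambda>y. F n (y, x) - F m (y, x)) \<le> r n x + r m x"
        unfolding eq using Y.Lp_diff(2)[OF NX(1)[of n] NX(1)[of m]] NX(2)[of n] NX(2)[of m] by linarith
    qed
    finally show ?thesis using r by (subst (asm) ennreal_le_iff) (auto intro: add_nonneg_nonneg)
  qed
  have conv: "convergent (\<lambda>n. I n x)" if x: "x \<in> A" for x
  proof (rule Cauchy_convergent, rule CauchyI)
    fix d :: real assume "0 < d"
    then obtain N where N: "\<And>n. n \<ge> N \<Longrightarrow> r n x < d / 2"
      using order_tendstoD(2)[OF r_lim[OF x], of "d / 2"] by (auto simp: eventually_sequentially)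
    show "\<exists>N. \<forall>m\<ge>N. \<forall>n\<ge>N. norm (I m x - I n x) < d"
    proof (intro exI allI impI)
      fix m n assume "N \<le> m" "N \<le> n"
      then show "norm (I m x - I n x) < d" using I_diff[OF x, of m n] N[of m] N[of n] by linarith
    qed
  qed
  define \<eta> where "\<eta> x = (if x \<in> A then lim (\<lambda>n. I n x) else 0)" for x
  have \<eta>_lim: "(\<lambda>n. I n x) \<longlonglongrightarrow> \<eta> x" if "x \<in> A" for x
    using conv[OF that] that by (simp add: \<eta>_def convergent_LIMSEQ_iff)
  have \<eta>_diff: "norm (\<eta> x - I n x) \<le> r n x" if x: "x \<in> A" for n x
  proof (rule tendsto_le[OF sequentially_bot])
    show "(\<lambda>m. norm (I m x - I n x)) \<longlonglongrightarrow> norm (\<eta> x - I n x)"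
      by (intro tendsto_intros \<eta>_lim[OF x])
    show "(\<lambda>m. r m x + r n x) \<longlonglongrightarrow> r n x"
      using tendsto_add[OF r_lim[OF x] tendsto_const[of "r n x"]] by simp
  qed (use I_diff[OF x] in auto)
  have "strongly_measurable M \<eta>"
  proof (rule strongly_measurable_LIMSEQ)
    show "strongly_measurable M (\<lambda>x. indicator A x *\<^sub>R I n x)" for n
      using IX[of n] by (intro strongly_measurable_scaleR) (auto simp: Lp_space_iff)
    show "(\<lambda>n. indicator A x *\<^sub>R I n x) \<longlonglongrightarrow> \<eta> x" for x
      using \<eta>_lim by (cases "x \<in> A") (auto simp: \<eta>_def)
  qed
  then have \<eta>_meas: "strongly_measurable M (\<lambda>x. \<eta> x - I n x)" for n
    using IX[of n] by (auto simp: Lp_space_iff)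
  define t where "t n = enn2real (\<epsilon> n) powr (1 / p)" for n
  have \<epsilon>_t: "\<epsilon> n = ennreal (t n powr p)" for n
    using \<epsilon>_fin[of n] p by (simp add: t_def powr_powr less_top)
  have "(\<integral>\<^sup>+x. ennreal (norm (\<eta> x - I n x) powr p) \<partial>M) \<le> ennreal (t n powr p)" for n
    unfolding \<epsilon>_t[symmetric] \<epsilon>_def
  proof (rule nn_integral_mono_AE)
    show "AE x in M. ennreal (norm (\<eta> x - I n x) powr p) \<le> e n x"
      using K_fin AE_space
    proof eventually_elim
      case (elim x)
      then have x: "x \<in> A" by (simp add: A_def)
      show ?case unfolding e_r[OF x] using \<eta>_diff[OF x] p by (intro ennreal_leI powr_mono2) auto
    qed
  qed
  note \<eta>_bd = Lp_bounded[OF \<eta>_meas _ this]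
  have \<eta>X: "\<eta> \<in> Lp_space p M"
    using Lp_add[OF \<eta>_bd(1)[of 0] IX[of 0]] by (simp add: t_def)
  have "(\<lambda>n. enn2real (\<epsilon> n)) \<longlonglongrightarrow> 0" using \<epsilon>_lim by (intro tendsto_enn2real) simp_all
  then have "t \<longlonglongrightarrow> 0 powr (1 / p)"
    unfolding t_def using p by (intro tendsto_powr') auto
  then have t: "t \<longlonglongrightarrow> 0" by simp
  have I_lim: "(\<lambda>n. Lp_norm p M (\<lambda>x. I n x - \<eta> x)) \<longlonglongrightarrow> 0"
  proof (rule tendsto_sandwich[where f = "\<lambda>_. 0" and h = t])
    show "\<forall>\<^sub>F n in sequentially. Lp_norm p M (\<lambda>x. I n x - \<eta> x) \<le> t n"
      using \<eta>_bd(2) by (subst Lp_norm_minus_commute) (simp add: t_def)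
  qed (use t in auto)
  have "\<phi> \<eta> = (\<integral>y. \<phi> (H y) \<partial>Y)" if \<phi>: "\<phi> \<in> Lp_dual sc p M" for \<phi>
  proof (rule LIMSEQ_unique)
    show "(\<lambda>n. \<phi> (I n)) \<longlonglongrightarrow> \<phi> \<eta>" by (rule dual_tendsto[OF sc \<phi> IX \<eta>X I_lim])
    obtain C where C: "0 \<le> C" "\<And>f. f \<in> Lp_space p M \<Longrightarrow> norm (\<phi> f) \<le> C * Lp_norm p M f"
      using dual_bound[OF sc \<phi>] by blast
    have "(\<lambda>n. \<integral>y. \<phi> (\<lambda>x. F n (y, x)) \<partial>Y) \<longlonglongrightarrow> (\<integral>y. \<phi> (H y) \<partial>Y)"
    \<comment> \<open>The factor 2 occurs because the approximation differs from \<open>H y\<close>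
      by at most the norm of \<open>H y\<close>.\<close>
    proof (rule integral_dominated_convergence[where w = "\<lambda>_. C * (2 * B)"])
      show "AE y in Y. (\<lambda>n. \<phi> (\<lambda>x. F n (y, x))) \<longlonglongrightarrow> \<phi> (H y)" using \<phi>_lim[OF \<phi>] by auto
      show "AE y in Y. norm (\<phi> (\<lambda>x. F n (y, x))) \<le> C * (2 * B)" for n
        using B AE_space
      proof eventually_elim
        case (elim y)
        have "Lp_norm p M (\<lambda>x. F n (y, x)) \<le> Lp_norm p M (\<lambda>x. F n (y, x) - H y x) + Lp_norm p M (H y)"
          using Lp_norm_add[OF diffX[OF elim(2)] HX[OF elim(2)]] by simp
        then have "Lp_norm p M (\<lambda>x. F n (y, x)) \<le> 2 * B" using diff_le[OF elim(2), of n] elim(1) by linarith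
        then show ?case using C(2)[OF FX[OF elim(2), of n]] mult_left_mono[OF _ C(1)] order_trans by blast
      qed
    qed (use meas[OF \<phi>] dual_simple_section(3)[OF F \<phi>] in auto)
    then show "(\<lambda>n. \<phi> (I n)) \<longlonglongrightarrow> (\<integral>y. \<phi> (H y) \<partial>Y)"
      unfolding I_def using dual_simple_section(4)[OF F \<phi>] by simp
  qed
  then show "\<exists>\<eta>\<in>Lp_space p M. \<forall>\<phi>\<in>Lp_dual sc p M. \<phi> \<eta> = (\<integral>y. \<phi> (H y) \<partial>Y)"
    using \<eta>X by blast
qed

end

end

section \<open>Haar measures\<close>

instance prod :: (topological_group_add, topological_group_add) topological_group_add
proof
  fix a b :: "'a \<times> 'b"
  show "((\<lambda>x. fst x + snd x) \<longlongrightarrow> a + b) (nhds a \<times>\<^sub>F nhds b)"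
  proof -
    have 1: "(fst \<longlongrightarrow> a) (nhds a \<times>\<^sub>F nhds b)" "(snd \<longlongrightarrow> b) (nhds a \<times>\<^sub>F nhds b)"
      by (rule filterlim_fst, rule filterlim_snd)
    have "((\<lambda>x. (fst (fst x) + fst (snd x), snd (fst x) + snd (snd x))) \<longlongrightarrow> (fst a + fst b, snd a + snd b))
        (nhds a \<times>\<^sub>F nhds b)"
      by (intro tendsto_intros 1)
    then show ?thesis by (simp add: plus_prod_def)
  qed
  show "(uminus \<longlongrightarrow> - a) (nhds a)"
  proof -
    have 1: "((\<lambda>x. x) \<longlongrightarrow> a) (nhds a)" by (rule filterlim_ident)
    have "((\<lambda>x. (- fst x, - snd x)) \<longlongrightarrow> (- fst a, - snd a)) (nhds a)"
      by (intro tendsto_intros 1)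
    then show ?thesis by (simp add: uminus_prod_def[abs_def])
  qed
qed

lemma locally_compact_nhd:
  fixes x :: "'g::t2_space"
  assumes lc: "locally_compact_space (euclidean :: 'g topology)" and "open U" "x \<in> U"
  shows "\<exists>V K. open V \<and> compact K \<and> x \<in> V \<and> V \<subseteq> K \<and> K \<subseteq> U"
proof -
  have "Hausdorff_space (euclidean :: 'g topology)"
    unfolding Hausdorff_space_def disjnt_def by simp (metis hausdorff)
  then have "neighbourhood_base_of (compactin euclidean) (euclidean :: 'g topology)"
    using lc locally_compact_space_neighbourhood_base by blast
  then show ?thesis
    using assms(2,3) unfolding neighbourhood_base_of by (simp add: compactin_euclidean_iff)
qed

text \<open>Local compactness places each point of \<open>U\<close> in an open set with a compact
  hull inside \<open>U\<close>, and Lindelof selects countably many of them.\<close>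

lemma open_sigma_compact:
  fixes U :: "'g::{t2_space, second_countable_topology} set"
  assumes lc: "locally_compact_space (euclidean :: 'g topology)" and U: "open U"
  shows "\<exists>C :: nat \<Rightarrow> 'g set. (\<forall>n. compact (C n)) \<and> (\<Union>n. C n) = U"
proof -
  define \<F> where "\<F> = {V. open V \<and> (\<exists>K. compact K \<and> V \<subseteq> K \<and> K \<subseteq> U)}"
  obtain \<F>' where \<F>': "\<F>' \<subseteq> \<F>" "countable \<F>'" "\<Union>\<F>' = \<Union>\<F>"
    using Lindelof[of \<F>] unfolding \<F>_def by blast
  have "\<exists>K. compact K \<and> V \<subseteq> K \<and> K \<subseteq> U" if "V \<in> \<F>'" for V using that \<F>'(1) by (auto simp: \<F>_def)
  then obtain K where K: "\<And>V. V \<in> \<F>' \<Longrightarrow> compact (K V) \<and> V \<subseteq> K V \<and> K V \<subseteq> U" by metis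
  have "U \<subseteq> \<Union>\<F>"
    using locally_compact_nhd[OF lc U] by (force simp: \<F>_def)
  \<comment> \<open>The extra member \<open>{}\<close> keeps the family nonempty, so that it can be
    enumerated by the natural numbers even when \<open>U\<close> is empty.\<close>
  then have U_eq: "U = (\<Union>V\<in>insert {} \<F>'. if V = {} then {} else K V)"
  proof (intro equalityI subsetI)
    fix x assume "x \<in> U"
    then obtain V where "V \<in> \<F>'" "x \<in> V" using \<open>U \<subseteq> \<Union>\<F>\<close> \<F>'(3) by blast
    then show "x \<in> (\<Union>V\<in>insert {} \<F>'. if V = {} then {} else K V)" using K by force
  qed (use K in \<open>auto split: if_splits\<close>)
  define L where "L V = (if V = {} then {} else K V)" for V
  have L: "compact (L V)" if "V \<in> insert {} \<F>'" for V using that K by (auto simp: L_def)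
  have rng: "range (from_nat_into (insert {} \<F>')) = insert {} \<F>'"
    using \<F>'(2) by (intro range_from_nat_into) auto
  have "(\<Union>n. L (from_nat_into (insert {} \<F>') n)) = (\<Union>V\<in>range (from_nat_into (insert {} \<F>')). L V)"
    by simp
  also have "\<dots> = U" unfolding rng U_eq L_def ..
  finally show ?thesis
    using L from_nat_into[of "insert {} \<F>'"] by (intro exI[of _ "\<lambda>n. L (from_nat_into (insert {} \<F>') n)"]) auto
qed

lemma compact_borel: "compact K \<Longrightarrow> K \<in> sets (borel :: 'g::t2_space measure)"
  by (simp add: compact_imp_closed)

lemma borel_translations [measurable]:
  "(\<lambda>x. x + g) \<in> borel_measurable (borel :: 'g::topological_group_add measure)"
  "(\<lambda>x. g + x) \<in> borel_measurable (borel :: 'g::topological_group_add measure)"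
  "uminus \<in> borel_measurable (borel :: 'g::topological_group_add measure)"
  by (intro borel_measurable_continuous_onI continuous_intros)+

lemma borel_group_ops:
  fixes f g :: "'x \<Rightarrow> 'g::{topological_group_add, second_countable_topology}"
  assumes f: "f \<in> borel_measurable M" and g: "g \<in> borel_measurable M"
  shows "(\<lambda>x. f x + g x) \<in> borel_measurable M" "(\<lambda>x. - f x) \<in> borel_measurable M"
proof -
  show "(\<lambda>x. f x + g x) \<in> borel_measurable M"
    by (rule borel_measurable_continuous_Pair[OF f g]) (intro continuous_intros)
  show "(\<lambda>x. - f x) \<in> borel_measurable M"
    by (rule measurable_compose[OF f borel_translations(3)])
qed

locale haar =
  fixes \<nu> :: "'g::{topological_group_add, t2_space, second_countable_topology} measure"
  assumes haar: "haar_measure \<nu>" and lc: "locally_compact_space (euclidean :: 'g topology)"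
begin

lemma sets_haar [measurable_cong, simp]: "sets \<nu> = sets borel"
  using haar by (simp add: haar_measure_def)

lemma space_haar [simp]: "space \<nu> = UNIV"
  using sets_eq_imp_space_eq[OF sets_haar] by simp

lemma compact_finite: "compact K \<Longrightarrow> emeasure \<nu> K < \<infinity>"
  using haar by (simp add: haar_measure_def)

lemma distr_right: "distr \<nu> \<nu> (\<lambda>x. x + g) = \<nu>"
proof (rule measure_eqI)
  fix A assume "A \<in> sets (distr \<nu> \<nu> (\<lambda>x. x + g))"
  then have A[measurable]: "A \<in> sets borel" by simp
  have "emeasure (distr \<nu> \<nu> (\<lambda>x. x + g)) A = emeasure \<nu> ((\<lambda>x. x + g) -` A)"
    by (subst emeasure_distr) auto
  also have "(\<lambda>x. x + g) -` A = (\<lambda>x. x + - g) ` A"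
  proof safe
    fix x assume "x + g \<in> A"
    then show "x \<in> (\<lambda>x. x + - g) ` A" by (intro image_eqI[of _ _ "x + g"]) (simp_all add: add.assoc)
  qed (simp add: add.assoc)
  also have "emeasure \<nu> \<dots> = emeasure \<nu> A"
    using haar A by (simp only: haar_measure_def)
  finally show "emeasure (distr \<nu> \<nu> (\<lambda>x. x + g)) A = emeasure \<nu> A" .
qed simp

sublocale sigma_finite_measure \<nu>
proof
  obtain C :: "nat \<Rightarrow> 'g set" where C: "\<And>n. compact (C n)" "(\<Union>n. C n) = UNIV"
    using open_sigma_compact[OF lc open_UNIV] by blast
  show "\<exists>A. countable A \<and> A \<subseteq> sets \<nu> \<and> \<Union>A = space \<nu> \<and> (\<forall>a\<in>A. emeasure \<nu> a \<noteq> \<infinity>)"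
    using C compact_finite[OF C(1)] by (intro exI[of _ "range C"]) (auto simp: compact_borel less_top)
qed

sublocale pair: pair_sigma_finite \<nu> \<nu> ..

text \<open>A Haar measure is nonzero, so that a property valid almost everywhere has a witness.
  Combined with a Fubini swap this is how base points are found.\<close>

lemma AE_ex: "(AE x in \<nu>. P x) \<Longrightarrow> \<exists>x. P x"
  using haar ae_filter_eq_bot_iff[of \<nu>] eventually_happens'[of "ae_filter \<nu>" P]
  by (auto simp: haar_measure_def)

lemma AE_right:
  assumes "AE x in \<nu>. P x" shows "AE x in \<nu>. P (x + g)"
proof -
  have "AE x in distr \<nu> \<nu> (\<lambda>x. x + g). P x" using assms by (subst distr_right)
  then show ?thesis by (rule AE_distrD[rotated]) simp
qed

lemma AE_swap:
  assumes [measurable]: "Measurable.pred (borel \<Otimes>\<^sub>M borel) (\<lambda>(x, y). P x y)"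
    and ae: "\<And>x. AE y in \<nu>. P x y"
  shows "AE y in \<nu>. AE x in \<nu>. P x y"
proof -
  have "sets (\<nu> \<Otimes>\<^sub>M \<nu>) = sets (borel \<Otimes>\<^sub>M (borel :: 'g measure))"
    by (intro sets_pair_measure_cong) simp_all
  then have "{z \<in> space (\<nu> \<Otimes>\<^sub>M \<nu>). P (fst z) (snd z)} \<in> sets (\<nu> \<Otimes>\<^sub>M \<nu>)"
    using assms(1) by (simp add: pred_def case_prod_unfold space_pair_measure)
  then show ?thesis using ae by (subst pair.AE_commute[symmetric]) auto
qed

text \<open>Under right invariance alone inversion may change the measure, but it preserves null
  sets. For every \<open>y\<close> almost all \<open>x\<close> satisfy
  \<open>x + - y \<notin> N\<close>; Fubini fixes one \<open>x\<close>, and the right translation of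
  \<open>y\<close> by \<open>x\<close> turns \<open>x + - y\<close> into \<open>- y\<close>.\<close>

lemma AE_uminus:
  assumes "AE x in \<nu>. P x" shows "AE x in \<nu>. P (- x)"
proof -
  obtain N where N: "N \<in> null_sets \<nu>" "{x. \<not> P x} \<subseteq> N"
    using assms unfolding eventually_ae_filter by auto
  then have [measurable]: "N \<in> sets borel" by auto
  have notN: "AE x in \<nu>. x \<notin> N" using N(1) by (rule AE_not_in)
  have "AE x in \<nu>. AE y in \<nu>. x + - y \<notin> N"
  proof (rule AE_swap)
    show "Measurable.pred (borel \<Otimes>\<^sub>M borel) (\<lambda>(y, x). x + - y \<notin> N)"
    proof -
      define d where "d z = snd z + - fst z" for z :: "'g \<times> 'g"
      have [measurable]: "d \<in> borel \<Otimes>\<^sub>M borel \<rightarrow>\<^sub>M borel"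
        unfolding d_def by (intro borel_group_ops) auto
      have "Measurable.pred (borel \<Otimes>\<^sub>M borel) (\<lambda>z. d z \<notin> N)" by measurable
      then show ?thesis by (simp add: d_def case_prod_unfold)
    qed
  qed (rule AE_right[OF notN])
  then obtain x where "AE y in \<nu>. x + - y \<notin> N" using AE_ex by blast
  then have "AE y in \<nu>. x + - (y + x) \<notin> N" by (rule AE_right)
  moreover have "x + - (y + x) = - y" for y
    by (metis add.assoc add.left_neutral add.right_inverse minus_add)
  ultimately have "AE y in \<nu>. - y \<notin> N" by (simp only:)
  then show ?thesis by eventually_elim (use N(2) in auto)
qed

text \<open>Inversion conjugates left translations into right translations, so left translations
  preserve null sets before left invariance of the measure is known.\<close>

lemma AE_left:
  assumes "AE x in \<nu>. P x" shows "AE x in \<nu>. P (g + x)"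
proof -
  have "AE x in \<nu>. P (- (- x + - g))"
    by (rule AE_uminus[where P = "\<lambda>x. P (- (x + - g))"], rule AE_right[where P = "\<lambda>x. P (- x)"],
      rule AE_uminus[where P = P], rule assms)
  moreover have "- (- x + - g) = g + x" for x
    by (simp only: minus_add minus_minus)
  ultimately show ?thesis by (simp only:)
qed

text \<open>
  The density of a left translate of \<open>\<nu>\<close> with respect to \<open>\<nu>\<close> is invariant under right translations,
  hence almost everywhere constant.
\<close>

lemma left_translate_scales:
  "\<exists>k. \<forall>A\<in>sets borel. emeasure \<nu> ((\<lambda>x. - g + x) -` A) = k * emeasure \<nu> A"
proof -
  define m where "m = distr \<nu> \<nu> (\<lambda>x. - g + x)"
  have m: "emeasure m A = emeasure \<nu> ((\<lambda>x. - g + x) -` A)" if "A \<in> sets borel" for A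
    unfolding m_def using that by (subst emeasure_distr) auto
  have sets_m [simp]: "sets m = sets borel" by (simp add: m_def)
  have "absolutely_continuous \<nu> m"
    unfolding absolutely_continuous_def
  proof
    fix N assume N: "N \<in> null_sets \<nu>"
    then have [measurable]: "N \<in> sets borel" by auto
    have "AE x in \<nu>. - g + x \<notin> N" by (rule AE_left[OF AE_not_in[OF N]])
    then have "emeasure \<nu> ((\<lambda>x. - g + x) -` N) = 0"
    proof (subst (asm) AE_iff_measurable[where N = "(\<lambda>x. - g + x) -` N"])
      show "(\<lambda>x. - g + x) -` N \<in> sets \<nu>"
        using measurable_sets_borel[OF borel_translations(2) \<open>N \<in> sets borel\<close>] by simp
    qed auto
    then show "N \<in> null_sets m" by (auto simp: m)
  qed
  then have dens: "density \<nu> (RN_deriv \<nu> m) = m"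
    by (rule density_RN_deriv) simp
  define r where "r = RN_deriv \<nu> m"
  have [measurable]: "r \<in> borel_measurable borel"
    using borel_measurable_RN_deriv[of \<nu> m] by (simp add: r_def cong: measurable_cong_sets)
  have emeasure_m: "emeasure m A = (\<integral>\<^sup>+x. r x * indicator A x \<partial>\<nu>)" if "A \<in> sets borel" for A
    using that by (subst dens[symmetric]) (auto simp: emeasure_density r_def)
  have inv: "AE x in \<nu>. r (x + h) = r x" for h
  proof (rule density_unique)
    show "density \<nu> (\<lambda>x. r (x + h)) = density \<nu> r"
    proof (rule measure_eqI)
      fix A assume "A \<in> sets (density \<nu> (\<lambda>x. r (x + h)))"
      then have A[measurable]: "A \<in> sets borel" by simp
      define B where "B = (\<lambda>x. x + - h) -` A"
      have B[measurable]: "B \<in> sets borel" unfolding B_def by (rule measurable_sets_borel[OF borel_translations(1) A])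
      have "emeasure (density \<nu> (\<lambda>x. r (x + h))) A = (\<integral>\<^sup>+x. r (x + h) * indicator A x \<partial>\<nu>)"
        by (subst emeasure_density) auto
      also have "\<dots> = (\<integral>\<^sup>+x. r (x + h) * indicator B (x + h) \<partial>\<nu>)"
        by (intro nn_integral_cong) (auto simp: indicator_def B_def add.assoc)
      also have "\<dots> = (\<integral>\<^sup>+y. r y * indicator B y \<partial>distr \<nu> \<nu> (\<lambda>x. x + h))"
        by (subst nn_integral_distr) auto
      also have "\<dots> = emeasure m B" by (simp add: distr_right emeasure_m)
      also have "\<dots> = emeasure \<nu> ((\<lambda>x. x + - h) -` ((\<lambda>x. - g + x) -` A))"
        unfolding m[OF B] by (simp only: B_def vimage_def mem_Collect_eq add.assoc)
      also have "\<dots> = emeasure (distr \<nu> \<nu> (\<lambda>x. x + - h)) ((\<lambda>x. - g + x) -` A)"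
      proof -
        have "(\<lambda>x. x + - h) \<in> \<nu> \<rightarrow>\<^sub>M \<nu>"
          by (simp only: measurable_cong_sets[OF sets_haar sets_haar] borel_translations)
        moreover have "(\<lambda>x. - g + x) -` A \<in> sets \<nu>"
          using measurable_sets_borel[OF borel_translations(2) A] by (simp only: sets_haar)
        ultimately show ?thesis by (simp only: emeasure_distr space_haar Int_UNIV_right)
      qed
      also have "\<dots> = emeasure m A" by (simp only: distr_right m[OF A])
      also have "\<dots> = emeasure (density \<nu> r) A" using dens by (simp add: r_def)
      finally show "emeasure (density \<nu> (\<lambda>x. r (x + h))) A = emeasure (density \<nu> r) A" .
    qed simp
  qed auto
  \<comment> \<open>The exceptional set depends on \<open>h\<close>. Fubini yields one
    \<open>x\<close> for which almost every \<open>h\<close> is admissible, and replacing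
    \<open>h\<close> by \<open>- x + h\<close> makes the density constant.\<close>
  have "AE x in \<nu>. AE h in \<nu>. r (x + h) = r x"
  proof (rule AE_swap)
    have "(\<lambda>(h, x). r (x + h)) \<in> borel_measurable (borel \<Otimes>\<^sub>M (borel :: 'g measure))"
      unfolding case_prod_unfold
      by (rule measurable_compose[OF borel_group_ops(1)[OF measurable_snd measurable_fst]]) measurable
    then show "Measurable.pred (borel \<Otimes>\<^sub>M borel) (\<lambda>(h, x). r (x + h) = r x)"
      unfolding case_prod_unfold by measurable
  qed (rule inv)
  then obtain x where "AE h in \<nu>. r (x + h) = r x" using AE_ex by blast
  then have "AE h in \<nu>. r (x + (- x + h)) = r x" by (rule AE_left)
  then have "AE h in \<nu>. r h = r x" by (simp add: add.assoc[symmetric])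
  then have "emeasure m A = r x * emeasure \<nu> A" if "A \<in> sets borel" for A
    unfolding emeasure_m[OF that] using that
    by (subst nn_integral_cmult_indicator[symmetric]) (auto intro!: nn_integral_cong_AE elim!: eventually_mono)
  then show ?thesis using m by auto
qed

end

locale biinvariant_haar = haar \<nu>
  for \<nu> :: "'g::{topological_group_add, t2_space, second_countable_topology} measure" +
  assumes left_invariant: "\<And>g A. A \<in> sets borel \<Longrightarrow> emeasure \<nu> ((\<lambda>x. g + x) -` A) = emeasure \<nu> A"

section \<open>Regularity\<close>

context haar
begin

text \<open>The sets that can be approximated form a sigma-algebra containing the open sets. The
  error is measured inside a compact set, since the Haar measure itself may be infinite.\<close>

lemma closed_open_approx:
  assumes A: "A \<in> sets borel" and K: "compact K" and e: "0 < (e::real)"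
  shows "\<exists>C U. closed C \<and> open U \<and> C \<subseteq> A \<and> A \<subseteq> U \<and> emeasure \<nu> ((U - C) \<inter> K) \<le> ennreal e"
proof -
  have KM: "K \<in> sets borel" using K by (rule compact_borel)
  have fin: "emeasure \<nu> (B \<inter> K) \<noteq> \<infinity>" for B
    using emeasure_mono[of "B \<inter> K" K \<nu>] compact_finite[OF K] KM by (auto simp: less_top top_unique)
  \<comment> \<open>Continuity from above, legitimate because all sets are cut down to the compact
    set \<open>K\<close> of finite measure.\<close>
  have small: "\<exists>n. emeasure \<nu> (B n \<inter> K) \<le> ennreal d"
    if B: "\<And>n::nat. B n \<in> sets borel" "decseq B" "(\<Inter>n. B n) = {}" and d: "0 < d" for B d
  proof -
    have "(\<lambda>n. emeasure \<nu> (B n \<inter> K)) \<longlonglongrightarrow> emeasure \<nu> (\<Inter>n. B n \<inter> K)"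
      using B(1,2) KM fin by (intro Lim_emeasure_decseq) (auto simp: decseq_def)
    moreover have "(\<Inter>n. B n \<inter> K) = {}" using B(3) by auto
    ultimately have "(\<lambda>n. emeasure \<nu> (B n \<inter> K)) \<longlonglongrightarrow> 0" by simp
    then have "\<forall>\<^sub>F n in sequentially. emeasure \<nu> (B n \<inter> K) < ennreal d"
      using d by (intro order_tendstoD(2)) auto
    then obtain n where "emeasure \<nu> (B n \<inter> K) < ennreal d"
      using eventually_happens'[OF sequentially_bot] by blast
    then show ?thesis by (intro exI less_imp_le)
  qed
  have "A \<in> sigma_sets UNIV {S. open S}" using A by (simp add: borel_def)
  then show ?thesis using e
  proof (induction arbitrary: e rule: sigma_sets.induct)
    case (Basic A)
    then have A: "open A" by simp
    obtain C :: "nat \<Rightarrow> 'g set" where C: "\<And>n. compact (C n)" "(\<Union>n. C n) = A"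
      using open_sigma_compact[OF lc A] by blast
    define P where "P n = (\<Union>i<n. C i)" for n
    have P: "closed (P n)" for n unfolding P_def using C(1) by (intro closed_UN) (auto intro: compact_imp_closed)
    have "\<exists>n. emeasure \<nu> ((A - P n) \<inter> K) \<le> ennreal e"
    proof (rule small)
      show "(\<Inter>n. A - P n) = {}" unfolding P_def using C(2) by blast
      show "decseq (\<lambda>n. A - P n)" unfolding P_def decseq_def by force
    qed (use A P Basic in auto)
    then show ?case using A P C(2) unfolding P_def by blast
  next
    case Empty
    show ?case by (intro exI[of _ "{}"]) auto
  next
    case (Compl A)
    obtain C U where "closed C" "open U" "C \<subseteq> A" "A \<subseteq> U" "emeasure \<nu> ((U - C) \<inter> K) \<le> ennreal e"
      using Compl.IH[OF Compl.prems] by blast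
    moreover have "- C - - U = U - C" by auto
    ultimately show ?case
      by (intro exI[of _ "- U"] exI[of _ "- C"]) auto
  next
    case (Union A)
    \<comment> \<open>The errors of the individual approximations add up to \<open>e / 2\<close>;
      the other half pays for replacing a countable union of closed sets by a finite one.\<close>
    define d where "d i = e / 2 * (1 / 2) ^ Suc i" for i
    have d: "0 < d i" for i using Union.prems by (simp add: d_def)
    have "\<forall>i. \<exists>C U. closed C \<and> open U \<and> C \<subseteq> A i \<and> A i \<subseteq> U \<and> emeasure \<nu> ((U - C) \<inter> K) \<le> ennreal (d i)"
      using Union.IH d by blast
    then obtain C U where CU: "\<And>i. closed (C i)" "\<And>i. open (U i)" "\<And>i. C i \<subseteq> A i" "\<And>i. A i \<subseteq> U i"
        "\<And>i. emeasure \<nu> ((U i - C i) \<inter> K) \<le> ennreal (d i)"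
      by metis
    define P where "P n = (\<Union>i<n. C i)" for n
    have P: "closed (P n)" for n unfolding P_def using CU(1) by (intro closed_UN) auto
    have "\<exists>n. emeasure \<nu> (((\<Union>i. C i) - P n) \<inter> K) \<le> ennreal (e / 2)"
    proof (rule small)
      show "(\<Inter>n. (\<Union>i. C i) - P n) = {}" unfolding P_def by blast
      show "decseq (\<lambda>n. (\<Union>i. C i) - P n)" unfolding P_def decseq_def by force
    qed (use CU(1) P Union.prems in auto)
    then obtain n where n: "emeasure \<nu> (((\<Union>i. C i) - P n) \<inter> K) \<le> ennreal (e / 2)" by blast
    have meas: "(U i - C i) \<inter> K \<in> sets \<nu>" "((\<Union>i. C i) - P n) \<inter> K \<in> sets \<nu>" for i
      using CU(1,2) P KM by auto
    have measU: "(\<Union>i. (U i - C i) \<inter> K) \<in> sets \<nu>"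
      using meas(1) by (intro sets.countable_UN) blast
    have "emeasure \<nu> (((\<Union>i. U i) - P n) \<inter> K) \<le> emeasure \<nu> ((\<Union>i. (U i - C i) \<inter> K) \<union> ((\<Union>i. C i) - P n) \<inter> K)"
      by (rule emeasure_mono[OF _ sets.Un[OF measU meas(2)]]) blast
    also have "\<dots> \<le> emeasure \<nu> (\<Union>i. (U i - C i) \<inter> K) + emeasure \<nu> (((\<Union>i. C i) - P n) \<inter> K)"
      by (rule emeasure_subadditive[OF measU meas(2)])
    also have "\<dots> \<le> (\<Sum>i. emeasure \<nu> ((U i - C i) \<inter> K)) + ennreal (e / 2)"
      using meas(1) n by (intro add_mono emeasure_subadditive_countably) blast+
    also have "\<dots> \<le> (\<Sum>i. ennreal (d i)) + ennreal (e / 2)"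
      using CU(5) by (intro add_right_mono suminf_le) auto
    also have "(\<Sum>i. ennreal (d i)) = ennreal (e / 2)"
    proof -
      have "d sums (e / 2 * 1)"
        unfolding d_def by (intro sums_mult power_half_series)
      then show ?thesis using d by (subst suminf_ennreal2) (auto simp: sums_iff less_imp_le)
    qed
    also have "ennreal (e / 2) + ennreal (e / 2) = ennreal e"
      using Union.prems by (simp flip: ennreal_plus)
    finally have "emeasure \<nu> (((\<Union>i. U i) - P n) \<inter> K) \<le> ennreal e" .
    moreover have "P n \<subseteq> (\<Union>i. A i)" "(\<Union>i. A i) \<subseteq> (\<Union>i. U i)" "open (\<Union>i. U i)"
      using CU(2-4) unfolding P_def by blast+
    ultimately show ?case using P[of n] by blast
  qed
qed

text \<open>Some compact part of \<open>A\<close> has finite positive mass \<open>r\<close>; a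
  closed subset that misses at most \<open>r / 2\<close> of it remains positive and, cut with the
  compact set, is compact.\<close>

lemma ex_compact_positive:
  assumes A: "A \<in> sets borel" and pos: "emeasure \<nu> A \<noteq> 0"
  shows "\<exists>C. compact C \<and> C \<subseteq> A \<and> emeasure \<nu> C \<noteq> 0"
proof -
  obtain K :: "nat \<Rightarrow> 'g set" where K: "\<And>n. compact (K n)" "(\<Union>n. K n) = UNIV"
    using open_sigma_compact[OF lc open_UNIV] by blast
  have "\<exists>n. emeasure \<nu> (A \<inter> K n) \<noteq> 0"
  proof (rule ccontr)
    assume "\<not> ?thesis"
    then have "(\<Union>n. A \<inter> K n) \<in> null_sets \<nu>"
      using A K(1)[THEN compact_borel] by (intro null_sets_UN) auto
    moreover have "(\<Union>n. A \<inter> K n) = A" using K(2) by blast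
    ultimately show False using pos by auto
  qed
  then obtain n where n: "emeasure \<nu> (A \<inter> K n) \<noteq> 0" by blast
  define r where "r = measure \<nu> (A \<inter> K n)"
  have KM: "K n \<in> sets borel" using K by (simp add: compact_borel)
  have "emeasure \<nu> (A \<inter> K n) \<noteq> \<infinity>"
    using emeasure_mono[of "A \<inter> K n" "K n" \<nu>] compact_finite[OF K(1)[of n]] KM by (auto simp: less_top top_unique)
  then have r: "emeasure \<nu> (A \<inter> K n) = ennreal r" "0 < r"
    using n by (auto simp: r_def emeasure_eq_ennreal_measure less_top zero_less_measure_iff)
  obtain C U where C: "closed C" "open U" "C \<subseteq> A" "A \<subseteq> U" "emeasure \<nu> ((U - C) \<inter> K n) \<le> ennreal (r / 2)"
    using closed_open_approx[OF A K(1)[of n], of "r / 2"] r by auto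
  have "emeasure \<nu> (C \<inter> K n) \<noteq> 0"
  proof
    assume 0: "emeasure \<nu> (C \<inter> K n) = 0"
    have "emeasure \<nu> (A \<inter> K n) \<le> emeasure \<nu> ((C \<inter> K n) \<union> ((U - C) \<inter> K n))"
      using C KM by (intro emeasure_mono) auto
    also have "\<dots> \<le> emeasure \<nu> (C \<inter> K n) + emeasure \<nu> ((U - C) \<inter> K n)"
      using C KM by (intro emeasure_subadditive) auto
    also have "\<dots> \<le> ennreal (r / 2)" using 0 C(5) by simp
    finally show False using r by (simp add: ennreal_le_iff)
  qed
  moreover have "compact (C \<inter> K n)" using K(1) C(1) by (simp add: closed_Int_compact)
  ultimately show ?thesis using C(3) by blast
qed

text \<open>A finite subcover gives an open \<open>V\<close> of finite measure around
  \<open>C\<close>. Exhausting the open set \<open>V - C\<close> by compact sets and removing them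
  produces open sets that decrease to \<open>C\<close>.\<close>

lemma ex_open_measure_less:
  assumes C: "compact C" and less: "emeasure \<nu> C < t"
  shows "\<exists>U. open U \<and> C \<subseteq> U \<and> emeasure \<nu> U < t"
proof -
  have "\<exists>V. open V \<and> C \<subseteq> V \<and> emeasure \<nu> V < \<infinity>"
  proof -
    define \<F> where "\<F> = {V :: 'g set. open V \<and> (\<exists>K. compact K \<and> V \<subseteq> K)}"
    have "\<And>V. V \<in> \<F> \<Longrightarrow> open V" by (simp add: \<F>_def)
    moreover have "C \<subseteq> \<Union>\<F>"
    proof
      fix x assume "x \<in> C"
      obtain V K where "open V" "compact K" "x \<in> V" "V \<subseteq> K"
        using locally_compact_nhd[OF lc open_UNIV, of x] by blast
      then show "x \<in> \<Union>\<F>" unfolding \<F>_def by blast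
    qed
    ultimately obtain \<F>' where \<F>': "\<F>' \<subseteq> \<F>" "finite \<F>'" "C \<subseteq> \<Union>\<F>'"
      using compactE[OF C] by metis
    have "emeasure \<nu> V < \<infinity>" if "V \<in> \<F>'" for V
    proof -
      have "V \<in> {V. open V \<and> (\<exists>K. compact K \<and> V \<subseteq> K)}"
        using subsetD[OF \<F>'(1) that] by (simp only: \<F>_def)
      then obtain K where "compact K" "V \<subseteq> K" by blast
      have "emeasure \<nu> V \<le> emeasure \<nu> K"
        by (rule emeasure_mono[OF \<open>V \<subseteq> K\<close>]) (simp add: compact_borel[OF \<open>compact K\<close>])
      also have "\<dots> < \<infinity>" by (rule compact_finite[OF \<open>compact K\<close>])
      finally show ?thesis .
    qed
    then have "(\<Sum>V\<in>\<F>'. emeasure \<nu> V) < \<infinity>" using \<F>'(2) by (induction \<F>' rule: infinite_finite_induct) auto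
    moreover have "emeasure \<nu> (\<Union>\<F>') \<le> (\<Sum>V\<in>\<F>'. emeasure \<nu> V)"
    proof -
      have "\<F>' \<subseteq> sets \<nu>" using \<F>'(1) unfolding \<F>_def by auto
      then show ?thesis using emeasure_subadditive_finite[of \<F>' "\<lambda>V. V" \<nu>] \<F>'(2) by simp
    qed
    moreover have "open (\<Union>\<F>')" using \<F>'(1) unfolding \<F>_def by auto
    ultimately show ?thesis using \<F>'(3) by (meson le_less_trans)
  qed
  then obtain V where V: "open V" "C \<subseteq> V" "emeasure \<nu> V < \<infinity>" by blast
  have "open (V - C)" using V(1) compact_imp_closed[OF C] by auto
  then obtain K :: "nat \<Rightarrow> 'g set" where K: "\<And>n. compact (K n)" "(\<Union>n. K n) = V - C"
    using open_sigma_compact[OF lc] by blast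
  define O' where "O' n = V - (\<Union>i<n. K i)" for n
  have O': "open (O' n)" for n
    unfolding O'_def using V(1) K(1) by (intro open_Diff closed_UN) (auto intro: compact_imp_closed)
  have "(\<lambda>n. emeasure \<nu> (O' n)) \<longlonglongrightarrow> emeasure \<nu> (\<Inter>n. O' n)"
  proof (rule Lim_emeasure_decseq)
    show "decseq O'" unfolding O'_def decseq_def by force
    show "emeasure \<nu> (O' n) \<noteq> \<infinity>" for n
      using emeasure_mono[of "O' n" V \<nu>] V by (auto simp: O'_def top_unique)
  qed (use O' in auto)
  moreover have "(\<Inter>n. O' n) = C"
  proof -
    have "(\<Inter>n. O' n) = V - (\<Union>n. K n)" unfolding O'_def by blast
    then show ?thesis using K(2) V(2) by auto
  qed
  ultimately have "\<forall>\<^sub>F n in sequentially. emeasure \<nu> (O' n) < t"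
    using less by (intro order_tendstoD(2)) auto
  then obtain n where "emeasure \<nu> (O' n) < t" by (auto simp: eventually_sequentially)
  moreover have "C \<subseteq> O' n" unfolding O'_def using V(2) K(2) by blast
  ultimately show ?thesis using O' by blast
qed

end

section \<open>Overlaps of translates and Steinhaus' theorem\<close>

lemma compact_translate_nhd:
  fixes C :: "'g::topological_group_add set"
  assumes C: "compact C" and U: "open U" "C \<subseteq> U"
  shows "\<exists>W. open W \<and> 0 \<in> W \<and> (\<forall>w\<in>W. \<forall>x\<in>C. w + x \<in> U)"
proof -
  have "\<exists>W V. open W \<and> open V \<and> 0 \<in> W \<and> x \<in> V \<and> (\<forall>w\<in>W. \<forall>y\<in>V. w + y \<in> U)" if x: "x \<in> C" for x
  proof -
    have "open ((\<lambda>(w, y). w + y) -` U)"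
      using U(1) by (intro open_vimage) (auto simp: case_prod_unfold intro!: continuous_intros)
    moreover have "(0, x) \<in> (\<lambda>(w, y). w + y) -` U" using U(2) x by auto
    ultimately obtain W V where "open W" "open V" "(0, x) \<in> W \<times> V" "W \<times> V \<subseteq> (\<lambda>(w, y). w + y) -` U"
      by (rule open_prod_elim)
    then show ?thesis by (intro exI[of _ W] exI[of _ V]) auto
  qed
  then obtain W V where WV: "\<And>x. x \<in> C \<Longrightarrow> open (W x) \<and> open (V x) \<and> 0 \<in> W x \<and> x \<in> V x \<and>
      (\<forall>w\<in>W x. \<forall>y\<in>V x. w + y \<in> U)"
    by metis
  have "open (V x)" if "x \<in> C" for x using WV[OF that] by simp
  moreover have "C \<subseteq> (\<Union>x\<in>C. V x)" using WV by fast
  ultimately obtain T where T: "T \<subseteq> C" "finite T" "C \<subseteq> (\<Union>x\<in>T. V x)"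
    by (rule compactE_image[OF C])
  have "open (\<Inter>x\<in>T. W x)" using T WV by (intro open_INT) auto
  moreover have "0 \<in> (\<Inter>x\<in>T. W x)" using T WV by auto
  moreover have "w + y \<in> U" if "w \<in> (\<Inter>x\<in>T. W x)" "y \<in> C" for w y
  proof -
    obtain x where "x \<in> T" "y \<in> V x" using T(3) \<open>y \<in> C\<close> by blast
    then show ?thesis using WV[of x] T(1) that(1) by blast
  qed
  ultimately show ?thesis by blast
qed

context biinvariant_haar
begin

text \<open>Take a compact \<open>C\<close> of positive measure in the intersection and an open
  \<open>U\<close> around it of measure below twice that of \<open>C\<close>. A translate of
  \<open>C\<close> that stays in \<open>U\<close> cannot be disjoint from \<open>C\<close> up to
  null sets, for lack of room.\<close>

lemma overlap_open:
  assumes A: "A \<in> sets borel" and B: "B \<in> sets borel" and pos: "emeasure \<nu> (A \<inter> B) \<noteq> 0"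
  shows "\<exists>W. open W \<and> 0 \<in> W \<and> (\<forall>w\<in>W. emeasure \<nu> {x\<in>B. - w + x \<in> A} \<noteq> 0)"
proof -
  obtain C where C: "compact C" "C \<subseteq> A \<inter> B" "emeasure \<nu> C \<noteq> 0"
    using ex_compact_positive[of "A \<inter> B"] A B pos by auto
  have CM: "C \<in> sets borel" using C(1) by (rule compact_borel)
  have fin: "emeasure \<nu> C < \<infinity>" by (rule compact_finite[OF C(1)])
  then have "emeasure \<nu> C < emeasure \<nu> C + emeasure \<nu> C"
    using C(3) by (cases "emeasure \<nu> C") (auto simp: ennreal_plus[symmetric] ennreal_less_iff simp del: ennreal_plus)
  then obtain U where U: "open U" "C \<subseteq> U" "emeasure \<nu> U < emeasure \<nu> C + emeasure \<nu> C"
    using ex_open_measure_less[OF C(1)] by blast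
  obtain W where W: "open W" "0 \<in> W" "\<And>w x. w \<in> W \<Longrightarrow> x \<in> C \<Longrightarrow> w + x \<in> U"
    using compact_translate_nhd[OF C(1) U(1,2)] by blast
  have "emeasure \<nu> {x\<in>B. - w + x \<in> A} \<noteq> 0" if w: "w \<in> W" for w
  proof
    assume 0: "emeasure \<nu> {x\<in>B. - w + x \<in> A} = 0"
    \<comment> \<open>The translate of \<open>C\<close> by \<open>w\<close>.\<close>
    define D where "D = (\<lambda>x. - w + x) -` C"
    have DM: "D \<in> sets borel" unfolding D_def by (rule measurable_sets_borel[OF borel_translations(2) CM])
    have "{x\<in>B. - w + x \<in> A} = B \<inter> (\<lambda>x. - w + x) -` A" by auto
    then have BA: "{x\<in>B. - w + x \<in> A} \<in> sets \<nu>"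
      using B measurable_sets_borel[OF borel_translations(2) A] by simp
    have "C \<inter> D \<subseteq> {x\<in>B. - w + x \<in> A}" using C(2) by (auto simp: D_def)
    then have "emeasure \<nu> (C \<inter> D) = 0" using emeasure_mono[OF _ BA] 0 by (metis le_zero_eq)
    moreover have "emeasure \<nu> D = emeasure \<nu> C" unfolding D_def by (rule left_invariant[OF CM])
    ultimately have "emeasure \<nu> C + emeasure \<nu> C = emeasure \<nu> (C \<union> D)"
      using emeasure_Un_Int[of C \<nu> D] CM DM by simp
    also have "C \<union> D \<subseteq> U"
      using U(2) W(3)[OF w] by (auto simp: D_def) (metis add.assoc add.left_neutral add.right_inverse)
    then have "emeasure \<nu> (C \<union> D) \<le> emeasure \<nu> U" using U(1) by (intro emeasure_mono) auto
    finally show False using U(3) by simp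
  qed
  then show ?thesis using W by blast
qed

lemma steinhaus:
  assumes A: "A \<in> sets borel" and pos: "emeasure \<nu> A \<noteq> 0"
  shows "\<exists>W. open W \<and> 0 \<in> W \<and> (\<forall>w\<in>W. \<exists>x\<in>A. - w + x \<in> A)"
proof -
  have "emeasure \<nu> (A \<inter> A) \<noteq> 0" using pos by simp
  from overlap_open[OF A A this]
  obtain W where W: "open W" "0 \<in> W" "\<And>w. w \<in> W \<Longrightarrow> emeasure \<nu> {x\<in>A. - w + x \<in> A} \<noteq> 0"
    by blast
  have "\<exists>x\<in>A. - w + x \<in> A" if "w \<in> W" for w
  proof (rule ccontr)
    assume "\<not> ?thesis"
    then have empty: "{x\<in>A. - w + x \<in> A} = {}" by blast
    show False using W(3)[OF that] unfolding empty emeasure_empty by simp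
  qed
  then show ?thesis using W by blast
qed

text \<open>Ergodicity of right translations by a dense set. Fubini first finds some translation in
  the whole group that creates a positive overlap; by \<open>overlap_open\<close> the overlap
  persists for nearby translations, among which there is an element of \<open>S\<close>.\<close>

lemma dense_translates_overlap:
  assumes A: "A \<in> sets borel" "emeasure \<nu> A \<noteq> 0" and B: "B \<in> sets borel" "emeasure \<nu> B \<noteq> 0"
    and S: "closure S = UNIV"
  shows "\<exists>s\<in>S. emeasure \<nu> {x\<in>B. x + s \<in> A} \<noteq> 0"
proof -
  \<comment> \<open>Inversion turns the right translations of the claim into the left translations
    that \<open>overlap_open\<close> handles.\<close>
  define A' B' where "A' = uminus -` A" and "B' = uminus -` B"
  have A'M[measurable]: "A' \<in> sets borel" and B'M[measurable]: "B' \<in> sets borel"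
    unfolding A'_def B'_def by (rule measurable_sets_borel[OF borel_translations(3)], fact A B)+
  have nz: "emeasure \<nu> X \<noteq> 0 \<longleftrightarrow> \<not> (AE x in \<nu>. x \<notin> X)" if "X \<in> sets borel" for X
    using that by (subst AE_iff_measurable[where N = X]) auto
  have "\<exists>g. \<not> (AE x in \<nu>. \<not> (x \<in> B' \<and> - g + x \<in> A'))"
  proof (rule ccontr)
    assume "\<not> ?thesis"
    then have all: "AE x in \<nu>. \<not> (x \<in> B' \<and> - g + x \<in> A')" for g by blast
    have ae: "AE x in \<nu>. AE g in \<nu>. \<not> (x \<in> B' \<and> - g + x \<in> A')"
    proof (rule AE_swap)
      define d where "d z = - fst z + snd z" for z :: "'g \<times> 'g"
      have [measurable]: "d \<in> borel \<Otimes>\<^sub>M borel \<rightarrow>\<^sub>M borel"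
        unfolding d_def by (intro borel_group_ops) auto
      have "Measurable.pred (borel \<Otimes>\<^sub>M borel) (\<lambda>z. \<not> (snd z \<in> B' \<and> d z \<in> A'))" by measurable
      then show "Measurable.pred (borel \<Otimes>\<^sub>M borel) (\<lambda>(g, x). \<not> (x \<in> B' \<and> - g + x \<in> A'))"
        by (simp add: d_def case_prod_unfold)
    qed (rule all)
    have B': "\<not> (AE x in \<nu>. x \<notin> B')"
    proof
      assume "AE x in \<nu>. x \<notin> B'"
      then have "AE x in \<nu>. - x \<notin> B'" by (rule AE_uminus)
      then show False using nz[OF B(1)] B(2) by (simp add: B'_def)
    qed
    have "\<exists>x\<in>B'. AE g in \<nu>. \<not> (x \<in> B' \<and> - g + x \<in> A')"
    proof (rule ccontr)
      assume *: "\<not> ?thesis"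
      have "AE x in \<nu>. x \<notin> B'"
        using ae by (rule eventually_mono) (use * in blast)
      then show False using B' by simp
    qed
    then obtain x where "x \<in> B'" "AE g in \<nu>. \<not> (x \<in> B' \<and> - g + x \<in> A')" by blast
    then have "AE g in \<nu>. - g + x \<notin> A'" by simp
    then have "AE g in \<nu>. - (x + g) + x \<notin> A'" by (rule AE_left)
    moreover have "- (x + g) + x = - g" for g by (simp only: minus_add add.assoc left_minus add_0_right)
    ultimately show False using nz[OF A(1)] A(2) by (simp add: A'_def)
  qed
  then obtain g where g: "\<not> (AE x in \<nu>. \<not> (x \<in> B' \<and> - g + x \<in> A'))" by blast
  define A'' where "A'' = (\<lambda>x. - g + x) -` A'"
  have A'': "A'' \<in> sets borel" unfolding A''_def by (rule measurable_sets_borel[OF borel_translations(2) A'M])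
  have "emeasure \<nu> (A'' \<inter> B') \<noteq> 0"
    using g A'' by (subst nz) (auto simp: A''_def conj_commute)
  then obtain W where W: "open W" "0 \<in> W" "\<And>w. w \<in> W \<Longrightarrow> emeasure \<nu> {x\<in>B'. - w + x \<in> A''} \<noteq> 0"
    using overlap_open[OF A'' B'M] by blast
  \<comment> \<open>The elements obtained from \<open>g\<close> by the small left translations in
    \<open>W\<close>; this open set contains \<open>g\<close> and so meets \<open>S\<close>.\<close>
  define V where "V = (\<lambda>s. s + - g) -` W"
  have "open V" unfolding V_def by (intro open_vimage W(1) continuous_intros)
  moreover have "g \<in> V \<inter> closure S" using W(2) S by (simp add: V_def)
  ultimately have "V \<inter> S \<noteq> {}" using open_Int_closure_eq_empty[of V S] by blast
  then obtain s where s: "s \<in> S" "s + - g \<in> W" unfolding V_def by blast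
  have eq: "- g + (- (s + - g) + x) = - s + x" for x
    by (simp only: minus_add minus_minus add.assoc minus_add_cancel)
  have BM: "{x\<in>B'. - s + x \<in> A'} \<in> sets borel"
  proof -
    have "{x\<in>B'. - s + x \<in> A'} = B' \<inter> (\<lambda>x. - s + x) -` A'" by auto
    then show ?thesis using measurable_sets_borel[OF borel_translations(2) A'M] by simp
  qed
  have B2: "{x\<in>B. x + s \<in> A} \<in> sets borel"
  proof -
    have "{x\<in>B. x + s \<in> A} = B \<inter> (\<lambda>x. x + s) -` A" by auto
    then show ?thesis using measurable_sets_borel[OF borel_translations(1) A(1)] B(1) by simp
  qed
  have "\<not> (AE x in \<nu>. x \<notin> {x\<in>B'. - s + x \<in> A'})"
    using W(3)[OF s(2)] BM unfolding A''_def vimage_def mem_Collect_eq eq by (simp add: nz)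
  moreover have "AE x in \<nu>. x \<notin> {x\<in>B'. - s + x \<in> A'}" if "AE x in \<nu>. x \<notin> {x\<in>B. x + s \<in> A}"
  proof -
    have "AE x in \<nu>. - x \<notin> {x\<in>B. x + s \<in> A}" using that by (rule AE_uminus)
    moreover have "- (- s + x) = - x + s" for x by (simp only: minus_add minus_minus)
    ultimately show ?thesis by (simp add: A'_def B'_def)
  qed
  ultimately show ?thesis using nz[OF B2] s(1) by blast
qed

end

section \<open>Baire sets\<close>

text \<open>Second countability and local compactness make the space regular and Lindelof, hence
  completely regular. Every open set is then a countable union of sublevel sets of continuous
  functions.\<close>

lemma baire_eq_borel:
  assumes lc: "locally_compact_space (euclidean :: 'g::{t2_space, second_countable_topology} topology)"
  shows "sets (baire :: 'g measure) = sets borel"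
proof
  have sub: "{f -` B | (f :: 'g \<Rightarrow> real) B. continuous_on UNIV f \<and> B \<in> sets borel} \<subseteq> sets borel"
    using borel_measurable_continuous_onI measurable_sets_borel by blast
  then show "sets (baire :: 'g measure) \<subseteq> sets borel"
    unfolding baire_def using sets.sigma_sets_subset[OF sub] by simp
  have "Hausdorff_space (euclidean :: 'g topology)"
    unfolding Hausdorff_space_def disjnt_def by simp (metis hausdorff)
  moreover have "Lindelof_space (euclidean :: 'g topology)"
    unfolding Lindelof_space_def
  proof (intro allI impI, elim conjE)
    fix \<U> :: "'g set set" assume \<U>: "\<forall>U\<in>\<U>. openin euclidean U" "\<Union>\<U> = topspace euclidean"
    have "\<And>U. U \<in> \<U> \<Longrightarrow> open U" using \<U>(1) by simp
    then obtain \<V> where "\<V> \<subseteq> \<U>" "countable \<V>" "\<Union>\<V> = \<Union>\<U>"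
      by (rule Lindelof)
    then show "\<exists>\<V>. countable \<V> \<and> \<V> \<subseteq> \<U> \<and> \<Union>\<V> = topspace euclidean" using \<U>(2) by metis
  qed
  ultimately have "completely_regular_space (euclidean :: 'g topology)"
    using lc locally_compact_Hausdorff_imp_regular_space regular_Lindelof_imp_normal_space
      normal_imp_completely_regular_space by blast
  then have sep: "\<exists>f :: 'g \<Rightarrow> real. continuous_on UNIV f \<and> f x = 0 \<and> (\<forall>y\<in>S. f y = 1)"
    if "closed S" "x \<notin> S" for S x
    using that unfolding completely_regular_space_def continuous_map_in_subtopology by fastforce
  have "U \<in> sets (baire :: 'g measure)" if U: "open U" for U :: "'g set"
  proof -
    \<comment> \<open>A function that is 0 at the chosen point and 1 off \<open>U\<close> has its
      sublevel set at 1/2 inside \<open>U\<close> and around the point.\<close>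
    define \<F> where "\<F> = {f -` {..<1/2} | f :: 'g \<Rightarrow> real. continuous_on UNIV f \<and> f -` {..<1/2} \<subseteq> U}"
    have op: "\<And>V. V \<in> \<F> \<Longrightarrow> open V" by (auto simp: \<F>_def intro: open_vimage)
    have "U \<subseteq> \<Union>\<F>"
    proof
      fix x assume "x \<in> U"
      then obtain f :: "'g \<Rightarrow> real" where f: "continuous_on UNIV f" "f x = 0" "\<forall>y\<in>- U. f y = 1"
        using sep[of "- U" x] U by auto
      have "f -` {..<1/2} \<subseteq> U"
      proof (rule subsetI, rule ccontr)
        fix y assume "y \<in> f -` {..<1/2}" "y \<notin> U"
        then show False using f(3) by simp
      qed
      then have "f -` {..<1/2} \<in> \<F>" unfolding \<F>_def using f(1) by blast
      moreover have "x \<in> f -` {..<1/2}" using f(2) by simp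
      ultimately show "x \<in> \<Union>\<F>" by blast
    qed
    moreover obtain \<F>' where \<F>': "\<F>' \<subseteq> \<F>" "countable \<F>'" "\<Union>\<F>' = \<Union>\<F>"
      by (rule Lindelof[OF op])
    ultimately have "U = \<Union>\<F>'" unfolding \<F>_def by blast
    moreover have "V \<in> sets baire" if "V \<in> \<F>'" for V
    proof -
      have "V \<in> \<F>" using \<F>'(1) that by (rule subsetD)
      then obtain f :: "'g \<Rightarrow> real" where "continuous_on UNIV f" "V = f -` {..<1/2}"
        unfolding \<F>_def by blast
      then have "V \<in> {f -` B | (f :: 'g \<Rightarrow> real) B. continuous_on UNIV f \<and> B \<in> sets borel}"
        by (intro CollectI exI[of _ f] exI[of _ "{..<1/2}"]) auto
      then show ?thesis unfolding baire_def by simp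
    qed
    ultimately show ?thesis using \<F>'(2) sets.countable_Union[of \<F>' baire] by auto
  qed
  then have "sigma_sets UNIV {S. open S} \<subseteq> sets (baire :: 'g measure)"
    using sets.sigma_sets_subset[of "{S. open S}" "baire :: 'g measure"] by (auto simp: baire_def space_measure_of_conv)
  then show "sets borel \<subseteq> sets (baire :: 'g measure)" by (simp add: borel_def)
qed

section \<open>Extension from a dense image\<close>

lemma scalar_mult_continuous:
  assumes sc: "scalar_mult sc"
  shows "continuous_on UNIV (sc a)"
proof -
  interpret vector_space sc using sc by (simp add: scalar_mult_def)
  have "bounded_linear (sc a)"
  proof (rule bounded_linear_intro[where K="norm a"])
    show "sc a (r *\<^sub>R v) = r *\<^sub>R sc a v" for r v
      using sc unfolding scalar_mult_def by (metis scale_left_commute)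
  qed (use sc in \<open>auto simp: scalar_mult_def scale_right_distrib mult.commute\<close>)
  then show ?thesis by (rule linear_continuous_on)
qed

lemma open_group_vimage:
  fixes U :: "'h::topological_group_add set"
  assumes "open U"
  shows "open ((\<lambda>x. a + x) -` U)" "open ((\<lambda>x. x + a) -` U)" "open ((\<lambda>x. - a + x + a) -` U)"
  by (intro open_vimage[OF assms] continuous_intros)+

lemma small_difference_nhd:
  fixes U :: "'h::topological_group_add set"
  assumes U: "open U" "0 \<in> U"
  shows "\<exists>A. open A \<and> x \<in> A \<and> (\<forall>a\<in>A. \<forall>b\<in>A. - a + b \<in> U)"
proof -
  have "open ((\<lambda>(a, b). - a + b) -` U)"
    by (rule open_vimage[OF U(1)]) (simp add: case_prod_unfold, intro continuous_intros)
  moreover have "(x, x) \<in> (\<lambda>(a, b). - a + b) -` U" using U(2) by simp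
  ultimately obtain A B where AB: "open A" "open B" "(x, x) \<in> A \<times> B" "A \<times> B \<subseteq> (\<lambda>(a, b). - a + b) -` U"
    by (rule open_prod_elim)
  show ?thesis
  proof (intro exI conjI ballI)
    show "open (A \<inter> B)" using AB by blast
    show "x \<in> A \<inter> B" using AB(3) by blast
    show "- a + b \<in> U" if "a \<in> A \<inter> B" "b \<in> A \<inter> B" for a b
      using subsetD[OF AB(4), of "(a, b)"] that by simp
  qed
qed

locale dense_subgroup =
  fixes \<Gamma> :: "'g::{group_add, topological_space} set"
    and \<pi> :: "'g \<Rightarrow> 'h::{topological_group_add, t2_space, second_countable_topology}"
  assumes subgroup: "add_subgroup \<Gamma>" and hom: "\<And>x y. \<pi> (x + y) = \<pi> x + \<pi> y"
    and dense: "closure (\<pi> ` \<Gamma>) = UNIV"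
begin

lemma \<pi>_zero: "\<pi> 0 = 0" using hom[of 0 0] by (metis add.right_neutral add_left_cancel)

lemma \<pi>_minus: "\<pi> (- x) = - \<pi> x"
  using hom[of "- x" x] \<pi>_zero by (simp add: eq_neg_iff_add_eq_0)

lemma zero_mem: "0 \<in> \<Gamma>" and add_mem: "x \<in> \<Gamma> \<Longrightarrow> y \<in> \<Gamma> \<Longrightarrow> x + y \<in> \<Gamma>"
  and minus_mem: "x \<in> \<Gamma> \<Longrightarrow> - x \<in> \<Gamma>"
  using subgroup by (auto simp: add_subgroup_def)

text \<open>The trace on \<open>\<Gamma>\<close> of the pulled back neighbourhood filter of
  \<open>x\<close>. Density makes it proper, so that limits along it are unique.\<close>

definition near :: "'h \<Rightarrow> 'g filter" where
  "near x = inf (filtercomap \<pi> (nhds x)) (principal \<Gamma>)"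

lemma eventually_near:
  "eventually P (near x) \<longleftrightarrow> (\<exists>S. open S \<and> x \<in> S \<and> (\<forall>\<gamma>\<in>\<Gamma>. \<pi> \<gamma> \<in> S \<longrightarrow> P \<gamma>))"
  unfolding near_def eventually_inf_principal eventually_filtercomap_nhds by blast

lemma near_nontrivial: "near x \<noteq> bot"
proof
  assume "near x = bot"
  then have "eventually (\<lambda>_. False) (near x)" by simp
  then obtain S where S: "open S" "x \<in> S" "\<forall>\<gamma>\<in>\<Gamma>. \<pi> \<gamma> \<notin> S" unfolding eventually_near by blast
  then have "S \<inter> closure (\<pi> ` \<Gamma>) = {}" using open_Int_closure_eq_empty[OF S(1)] by blast
  then show False using S(2) dense by simp
qed

lemma eventually_near_mem: "eventually (\<lambda>\<gamma>. \<gamma> \<in> \<Gamma>) (near x)"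
  unfolding eventually_near by (rule exI[of _ UNIV]) simp

text \<open>Uniform continuity for the left uniformity pulled back along \<open>\<pi>\<close>.
  Unlike plain continuity on \<open>\<Gamma>\<close>, it ensures limits at every point of the
  closure, where no element of \<open>\<Gamma>\<close> may lie.\<close>

definition unif :: "('g \<Rightarrow> 'v::banach) \<Rightarrow> bool" where
  "unif f \<longleftrightarrow> (\<forall>e>0. \<exists>U. open U \<and> 0 \<in> U \<and>
     (\<forall>\<gamma>\<in>\<Gamma>. \<forall>\<delta>\<in>\<Gamma>. - \<pi> \<gamma> + \<pi> \<delta> \<in> U \<longrightarrow> norm (f \<gamma> - f \<delta>) \<le> e))"

lemma unifD:
  assumes "unif f" "0 < e"
  shows "\<exists>A. open A \<and> x \<in> A \<and>
    (\<forall>\<gamma>\<in>\<Gamma>. \<forall>\<delta>\<in>\<Gamma>. \<pi> \<gamma> \<in> A \<longrightarrow> \<pi> \<delta> \<in> A \<longrightarrow> norm (f \<gamma> - f \<delta>) \<le> e)"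
proof -
  obtain U where U: "open U" "0 \<in> U"
    "\<And>\<gamma> \<delta>. \<gamma> \<in> \<Gamma> \<Longrightarrow> \<delta> \<in> \<Gamma> \<Longrightarrow> - \<pi> \<gamma> + \<pi> \<delta> \<in> U \<Longrightarrow> norm (f \<gamma> - f \<delta>) \<le> e"
    using assms unfolding unif_def by meson
  obtain A where A: "open A" "x \<in> A" "\<And>a b. a \<in> A \<Longrightarrow> b \<in> A \<Longrightarrow> - a + b \<in> U"
    using small_difference_nhd[OF U(1,2), of x] by meson
  then show ?thesis using U(3) by (intro exI[of _ A] conjI ballI impI) blast+
qed

lemma unif_add:
  assumes f: "unif f" and g: "unif g" shows "unif (\<lambda>x. f x + g x)"
  unfolding unif_def
proof (intro allI impI)
  fix e :: real assume "0 < e"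
  then have e: "0 < e / 2" by simp
  obtain U where U: "open U" "0 \<in> U"
    "\<And>\<gamma> \<delta>. \<gamma> \<in> \<Gamma> \<Longrightarrow> \<delta> \<in> \<Gamma> \<Longrightarrow> - \<pi> \<gamma> + \<pi> \<delta> \<in> U \<Longrightarrow> norm (f \<gamma> - f \<delta>) \<le> e / 2"
    using f e unfolding unif_def by meson
  obtain W where W: "open W" "0 \<in> W"
    "\<And>\<gamma> \<delta>. \<gamma> \<in> \<Gamma> \<Longrightarrow> \<delta> \<in> \<Gamma> \<Longrightarrow> - \<pi> \<gamma> + \<pi> \<delta> \<in> W \<Longrightarrow> norm (g \<gamma> - g \<delta>) \<le> e / 2"
    using g e unfolding unif_def by meson
  show "\<exists>U. open U \<and> 0 \<in> U \<and> (\<forall>\<gamma>\<in>\<Gamma>. \<forall>\<delta>\<in>\<Gamma>. - \<pi> \<gamma> + \<pi> \<delta> \<in> U \<longrightarrow> norm (f \<gamma> + g \<gamma> - (f \<delta> + g \<delta>)) \<le> e)"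
  proof (intro exI[of _ "U \<inter> W"] conjI ballI impI)
    fix \<gamma> \<delta> assume "\<gamma> \<in> \<Gamma>" "\<delta> \<in> \<Gamma>" "- \<pi> \<gamma> + \<pi> \<delta> \<in> U \<inter> W"
    then have "norm (f \<gamma> - f \<delta>) \<le> e / 2" "norm (g \<gamma> - g \<delta>) \<le> e / 2" using U(3) W(3) by blast+
    then have "norm ((f \<gamma> - f \<delta>) + (g \<gamma> - g \<delta>)) \<le> e" by norm
    then show "norm (f \<gamma> + g \<gamma> - (f \<delta> + g \<delta>)) \<le> e" by (simp add: algebra_simps)
  qed (use U W in auto)
qed

lemma unif_scale:
  assumes f: "unif f" and T: "\<And>v w. norm (T v - T w) = K * norm (v - w)"
  shows "unif (\<lambda>x. T (f x))"
  unfolding unif_def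
proof (intro allI impI)
  fix e :: real assume e: "0 < e"
  \<comment> \<open>The added 1 avoids division by zero when \<open>K\<close> is 0.\<close>
  then have "0 < e / (\<bar>K\<bar> + 1)" by (intro divide_pos_pos) auto
  then obtain U where U: "open U" "0 \<in> U"
    "\<And>\<gamma> \<delta>. \<gamma> \<in> \<Gamma> \<Longrightarrow> \<delta> \<in> \<Gamma> \<Longrightarrow> - \<pi> \<gamma> + \<pi> \<delta> \<in> U \<Longrightarrow> norm (f \<gamma> - f \<delta>) \<le> e / (\<bar>K\<bar> + 1)"
    using f unfolding unif_def by meson
  have "norm (T (f \<gamma>) - T (f \<delta>)) \<le> e" if "\<gamma> \<in> \<Gamma>" "\<delta> \<in> \<Gamma>" "- \<pi> \<gamma> + \<pi> \<delta> \<in> U" for \<gamma> \<delta>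
  proof -
    have "K * norm (f \<gamma> - f \<delta>) \<le> (\<bar>K\<bar> + 1) * norm (f \<gamma> - f \<delta>)" by (intro mult_right_mono) auto
    also have "\<dots> \<le> (\<bar>K\<bar> + 1) * (e / (\<bar>K\<bar> + 1))" using U(3)[OF that] by (intro mult_left_mono) auto
    also have "\<dots> = e" by simp
    finally show ?thesis by (simp add: T)
  qed
  then show "\<exists>U. open U \<and> 0 \<in> U \<and> (\<forall>\<gamma>\<in>\<Gamma>. \<forall>\<delta>\<in>\<Gamma>. - \<pi> \<gamma> + \<pi> \<delta> \<in> U \<longrightarrow> norm (T (f \<gamma>) - T (f \<delta>)) \<le> e)"
    using U by blast
qed

lemma unif_minus: "unif f \<Longrightarrow> unif (\<lambda>x. - f x)"
  by (rule unif_scale[of f uminus 1]) (simp_all add: norm_minus_commute)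

lemma unif_cong: "(\<And>\<gamma>. \<gamma> \<in> \<Gamma> \<Longrightarrow> f \<gamma> = g \<gamma>) \<Longrightarrow> unif f \<longleftrightarrow> unif g"
  unfolding unif_def by simp

text \<open>A right translation by \<open>\<eta>\<close> conjugates the left difference by
  \<open>\<pi> \<eta>\<close>, which is a homeomorphism fixing 0. This gives invariance of the
  subspace \<open>V\<close> constructed below.\<close>

lemma unif_right:
  assumes f: "unif f" and \<eta>: "\<eta> \<in> \<Gamma>" shows "unif (\<lambda>\<gamma>. f (\<gamma> + \<eta>))"
  unfolding unif_def
proof (intro allI impI)
  fix e :: real assume "0 < e"
  then obtain U where U: "open U" "0 \<in> U"
    "\<And>\<gamma> \<delta>. \<gamma> \<in> \<Gamma> \<Longrightarrow> \<delta> \<in> \<Gamma> \<Longrightarrow> - \<pi> \<gamma> + \<pi> \<delta> \<in> U \<Longrightarrow> norm (f \<gamma> - f \<delta>) \<le> e"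
    using f unfolding unif_def by meson
  show "\<exists>U. open U \<and> 0 \<in> U \<and> (\<forall>\<gamma>\<in>\<Gamma>. \<forall>\<delta>\<in>\<Gamma>. - \<pi> \<gamma> + \<pi> \<delta> \<in> U \<longrightarrow> norm (f (\<gamma> + \<eta>) - f (\<delta> + \<eta>)) \<le> e)"
  proof (intro exI[of _ "(\<lambda>x. - \<pi> \<eta> + x + \<pi> \<eta>) -` U"] conjI ballI impI)
    show "open ((\<lambda>x. - \<pi> \<eta> + x + \<pi> \<eta>) -` U)" by (rule open_group_vimage(3)[OF U(1)])
    show "0 \<in> (\<lambda>x. - \<pi> \<eta> + x + \<pi> \<eta>) -` U" using U(2) by simp
    fix \<gamma> \<delta> assume "\<gamma> \<in> \<Gamma>" "\<delta> \<in> \<Gamma>" and *: "- \<pi> \<gamma> + \<pi> \<delta> \<in> (\<lambda>x. - \<pi> \<eta> + x + \<pi> \<eta>) -` U"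
    have "- \<pi> (\<gamma> + \<eta>) + \<pi> (\<delta> + \<eta>) = - \<pi> \<eta> + (- \<pi> \<gamma> + \<pi> \<delta>) + \<pi> \<eta>"
      by (simp only: hom minus_add add.assoc)
    then show "norm (f (\<gamma> + \<eta>) - f (\<delta> + \<eta>)) \<le> e"
      using * \<open>\<gamma> \<in> \<Gamma>\<close> \<open>\<delta> \<in> \<Gamma>\<close> \<eta> by (intro U(3) add_mem) simp_all
  qed
qed

text \<open>A sequence from the dense image that tends to \<open>x\<close> already determines the
  limit: completeness gives convergence along it, and uniform smallness carries the limit over to
  the whole filter.\<close>

lemma unif_convergent:
  assumes f: "unif f" shows "\<exists>l. (f \<longlongrightarrow> l) (near x)"
proof -
  have "x \<in> closure (\<pi> ` \<Gamma>)" using dense by simp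
  then obtain s where s: "\<And>n. s n \<in> \<pi> ` \<Gamma>" "s \<longlonglongrightarrow> x"
    unfolding closure_sequential by blast
  then have "\<forall>n. \<exists>\<gamma>. \<gamma> \<in> \<Gamma> \<and> s n = \<pi> \<gamma>" by blast
  then obtain c where c: "\<And>n. c n \<in> \<Gamma>" "\<And>n. s n = \<pi> (c n)" by metis
  have ev: "\<exists>N. \<forall>n\<ge>N. \<pi> (c n) \<in> A" if "open A" "x \<in> A" for A
    using topological_tendstoD[OF s(2) that] by (simp add: c(2) eventually_sequentially)
  have "Cauchy (\<lambda>n. f (c n))"
  proof (rule CauchyI)
    fix e :: real assume "0 < e"
    then have e: "0 < e / 2" by simp
    obtain A where A: "open A" "x \<in> A"
      "\<And>\<gamma> \<delta>. \<gamma> \<in> \<Gamma> \<Longrightarrow> \<delta> \<in> \<Gamma> \<Longrightarrow> \<pi> \<gamma> \<in> A \<Longrightarrow> \<pi> \<delta> \<in> A \<Longrightarrow> norm (f \<gamma> - f \<delta>) \<le> e / 2"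
      using unifD[OF f e, of x] by meson
    obtain N where N: "\<And>n. n \<ge> N \<Longrightarrow> \<pi> (c n) \<in> A" using ev[OF A(1,2)] by blast
    have "norm (f (c m) - f (c n)) < e" if "m \<ge> N" "n \<ge> N" for m n
      using A(3)[OF c(1) c(1) N[OF that(1)] N[OF that(2)]] \<open>0 < e\<close> by linarith
    then show "\<exists>N. \<forall>m\<ge>N. \<forall>n\<ge>N. norm (f (c m) - f (c n)) < e" by blast
  qed
  then obtain l where l: "(\<lambda>n. f (c n)) \<longlonglongrightarrow> l" using Cauchy_convergent convergent_def by blast
  have "(f \<longlongrightarrow> l) (near x)"
  proof (rule tendstoI)
    fix e :: real assume "0 < e"
    then have e: "0 < e / 2" by simp
    obtain A where A: "open A" "x \<in> A"
      "\<And>\<gamma> \<delta>. \<gamma> \<in> \<Gamma> \<Longrightarrow> \<delta> \<in> \<Gamma> \<Longrightarrow> \<pi> \<gamma> \<in> A \<Longrightarrow> \<pi> \<delta> \<in> A \<Longrightarrow> norm (f \<gamma> - f \<delta>) \<le> e / 2"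
      using unifD[OF f e, of x] by meson
    obtain N where N: "\<And>n. n \<ge> N \<Longrightarrow> \<pi> (c n) \<in> A" using ev[OF A(1,2)] by blast
    have "dist (f \<gamma>) l < e" if "\<gamma> \<in> \<Gamma>" "\<pi> \<gamma> \<in> A" for \<gamma>
    proof -
      have "norm (f \<gamma> - l) \<le> e / 2"
      proof (rule LIMSEQ_le_const2)
        show "(\<lambda>n. norm (f \<gamma> - f (c n))) \<longlonglongrightarrow> norm (f \<gamma> - l)" by (intro tendsto_intros l)
        show "\<exists>N. \<forall>n\<ge>N. norm (f \<gamma> - f (c n)) \<le> e / 2"
          using A(3)[OF that(1) c(1) that(2) N] by blast
      qed
      then show ?thesis using \<open>0 < e\<close> by (simp add: dist_norm)
    qed
    then show "\<forall>\<^sub>F \<gamma> in near x. dist (f \<gamma>) l < e" unfolding eventually_near using A(1,2) by blast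
  qed
  then show ?thesis ..
qed

definition ext :: "('g \<Rightarrow> 'v::banach) \<Rightarrow> 'h \<Rightarrow> 'v" where
  "ext f x = Lim (near x) f"

lemma ext_tendsto: "unif f \<Longrightarrow> (f \<longlongrightarrow> ext f x) (near x)"
  using unif_convergent[of f x] tendsto_Lim[OF near_nontrivial] unfolding ext_def by metis

lemma ext_unique: "(f \<longlongrightarrow> l) (near x) \<Longrightarrow> ext f x = l"
  unfolding ext_def by (rule tendsto_Lim[OF near_nontrivial])

lemma ext_eq:
  assumes f: "unif f" and \<gamma>: "\<gamma> \<in> \<Gamma>" shows "ext f (\<pi> \<gamma>) = f \<gamma>"
proof (rule ext_unique, rule tendstoI)
  fix e :: real assume "0 < e"
  then have e: "0 < e / 2" by simp
  obtain A where A: "open A" "\<pi> \<gamma> \<in> A"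
    "\<And>\<gamma> \<delta>. \<gamma> \<in> \<Gamma> \<Longrightarrow> \<delta> \<in> \<Gamma> \<Longrightarrow> \<pi> \<gamma> \<in> A \<Longrightarrow> \<pi> \<delta> \<in> A \<Longrightarrow> norm (f \<gamma> - f \<delta>) \<le> e / 2"
    using unifD[OF f e, of "\<pi> \<gamma>"] by meson
  have "dist (f \<delta>) (f \<gamma>) < e" if "\<delta> \<in> \<Gamma>" "\<pi> \<delta> \<in> A" for \<delta>
    using A(3)[OF that(1) \<gamma> that(2) A(2)] \<open>0 < e\<close> by (simp add: dist_norm)
  then show "\<forall>\<^sub>F \<delta> in near (\<pi> \<gamma>). dist (f \<delta>) (f \<gamma>) < e" unfolding eventually_near using A(1,2) by blast
qed

lemma ext_continuous:
  assumes f: "unif f" shows "continuous_on UNIV (ext f)"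
  unfolding continuous_on_def
proof (intro ballI tendstoI)
  fix x and e :: real assume "0 < e"
  then have e: "0 < e / 2" by simp
  obtain A where A: "open A" "x \<in> A"
    "\<And>\<gamma> \<delta>. \<gamma> \<in> \<Gamma> \<Longrightarrow> \<delta> \<in> \<Gamma> \<Longrightarrow> \<pi> \<gamma> \<in> A \<Longrightarrow> \<pi> \<delta> \<in> A \<Longrightarrow> norm (f \<gamma> - f \<delta>) \<le> e / 2"
    using unifD[OF f e, of x] by meson
  have evA: "\<forall>\<^sub>F \<gamma> in near y. \<gamma> \<in> \<Gamma> \<and> \<pi> \<gamma> \<in> A" if "y \<in> A" for y
    unfolding eventually_near using A(1) that by blast
  have 1: "norm (ext f y - f \<delta>) \<le> e / 2" if y: "y \<in> A" and \<delta>: "\<delta> \<in> \<Gamma>" "\<pi> \<delta> \<in> A" for y \<delta>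
  proof (rule tendsto_upperbound[OF _ _ near_nontrivial])
    show "((\<lambda>\<gamma>. norm (f \<gamma> - f \<delta>)) \<longlongrightarrow> norm (ext f y - f \<delta>)) (near y)"
      by (intro tendsto_intros ext_tendsto[OF f])
    show "\<forall>\<^sub>F \<gamma> in near y. norm (f \<gamma> - f \<delta>) \<le> e / 2"
      using evA[OF y] by (rule eventually_mono) (use A(3) \<delta> in blast)
  qed
  have "norm (ext f y - ext f x) \<le> e / 2" if y: "y \<in> A" for y
  proof (rule tendsto_upperbound[OF _ _ near_nontrivial])
    show "((\<lambda>\<delta>. norm (ext f y - f \<delta>)) \<longlongrightarrow> norm (ext f y - ext f x)) (near x)"
      by (intro tendsto_intros ext_tendsto[OF f])
    show "\<forall>\<^sub>F \<delta> in near x. norm (ext f y - f \<delta>) \<le> e / 2"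
      using evA[OF A(2)] by (rule eventually_mono) (use 1[OF y] in blast)
  qed
  then have "dist (ext f y) (ext f x) < e" if "y \<in> A" for y
    using that \<open>0 < e\<close> by (fastforce simp: dist_norm)
  then show "\<forall>\<^sub>F y in at x within UNIV. dist (ext f y) (ext f x) < e"
    unfolding eventually_at_topological using A(1,2) by blast
qed

lemma dense_eqI:
  fixes f g :: "'h \<Rightarrow> 'v::banach"
  assumes f: "continuous_on UNIV f" and g: "continuous_on UNIV g"
    and eq: "\<And>\<gamma>. \<gamma> \<in> \<Gamma> \<Longrightarrow> f (\<pi> \<gamma>) = g (\<pi> \<gamma>)"
  shows "f x = g x"
proof -
  have "closed {x. f x = g x}" by (rule closed_Collect_eq[OF f g])
  then have "closure (\<pi> ` \<Gamma>) \<subseteq> {x. f x = g x}" by (intro closure_minimal) (use eq in auto)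
  then show ?thesis using dense by auto
qed

text \<open>The space consists of all vectors whose orbit map satisfies \<open>unif\<close>, so it
  depends on \<open>\<rho>\<close> and \<open>\<pi>\<close> only. Representation and cocycle extend
  as limits along \<open>near\<close>, and all algebraic identities pass to the limit by
  density.\<close>

lemma extension_exists:
  fixes sc :: "'k::{real_normed_field, euclidean_space} \<Rightarrow> 'v::banach \<Rightarrow> 'v"
  assumes sc: "scalar_mult sc" and \<rho>: "isometric_module sc \<Gamma> UNIV \<rho>"
    and \<pi>_cont: "continuous_on UNIV \<pi>"
    and c: "unif c" and coc: "\<And>\<gamma> \<delta>. \<gamma> \<in> \<Gamma> \<Longrightarrow> \<delta> \<in> \<Gamma> \<Longrightarrow> c (\<gamma> + \<delta>) = c \<gamma> + \<rho> \<gamma> (c \<delta>)"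
  shows "\<exists>V \<sigma> b. closed_subspace sc V \<and> (\<forall>\<gamma>\<in>\<Gamma>. \<rho> \<gamma> ` V \<subseteq> V) \<and> extends_through sc \<Gamma> \<rho> \<pi> V \<sigma> \<and>
    b \<in> cocycles UNIV V \<sigma> \<and> (\<forall>g\<in>\<Gamma>. \<forall>h\<in>\<Gamma>. b g h = c h - c g) \<and>
    (\<forall>g h g' h'. \<pi> g = \<pi> g' \<and> \<pi> h = \<pi> h' \<longrightarrow> b g h = b g' h')"
proof -
  interpret vs: vector_space sc using sc by (simp add: scalar_mult_def)
  note \<rho>' = \<rho>[unfolded isometric_module_def]
  have \<rho>_add: "\<rho> \<gamma> (v + w) = \<rho> \<gamma> v + \<rho> \<gamma> w" and \<rho>_sc: "\<rho> \<gamma> (sc a v) = sc a (\<rho> \<gamma> v)"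
    and \<rho>_norm: "norm (\<rho> \<gamma> v) = norm v" if "\<gamma> \<in> \<Gamma>" for \<gamma> v w a
    using \<rho>' that by auto
  have \<rho>_mult: "\<rho> (\<gamma> + \<delta>) v = \<rho> \<gamma> (\<rho> \<delta> v)" if "\<gamma> \<in> \<Gamma>" "\<delta> \<in> \<Gamma>" for \<gamma> \<delta> v
    using \<rho>' that by blast
  have \<rho>_zero: "\<rho> 0 v = v" for v using \<rho>' by blast
  have \<rho>_diff: "\<rho> \<gamma> (v - w) = \<rho> \<gamma> v - \<rho> \<gamma> w" if "\<gamma> \<in> \<Gamma>" for \<gamma> v w
    using \<rho>_add[OF that, of "v - w" w] by (simp add: algebra_simps)
  \<comment> \<open>For an isometric action the norm of
    \<open>\<rho> \<gamma> v - \<rho> \<delta> v\<close> depends only on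
    \<open>- \<gamma> + \<delta>\<close>, which is the reason for choosing the left
    uniformity.\<close>
  define V where "V = {v. unif (\<lambda>\<gamma>. \<rho> \<gamma> v)}"
  define \<tau> where "\<tau> x v = ext (\<lambda>\<gamma>. \<rho> \<gamma> v) x" for x v
  have V_unif: "v \<in> V \<Longrightarrow> unif (\<lambda>\<gamma>. \<rho> \<gamma> v)" for v by (simp add: V_def)
  have V_add: "v + w \<in> V" if "v \<in> V" "w \<in> V" for v w
    using unif_add[OF V_unif[OF that(1)] V_unif[OF that(2)]] unif_cong[of "\<lambda>\<gamma>. \<rho> \<gamma> (v + w)" "\<lambda>\<gamma>. \<rho> \<gamma> v + \<rho> \<gamma> w"] \<rho>_add
    by (simp add: V_def)
  have V_sc: "sc a v \<in> V" if "v \<in> V" for a v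
  proof -
    have "norm (sc a u - sc a w) = norm a * norm (u - w)" for u w
      using sc by (simp add: scalar_mult_def flip: vs.scale_right_diff_distrib)
    from unif_scale[OF V_unif[OF that] this]
    show ?thesis using unif_cong[of "\<lambda>\<gamma>. \<rho> \<gamma> (sc a v)" "\<lambda>\<gamma>. sc a (\<rho> \<gamma> v)"] \<rho>_sc by (simp add: V_def)
  qed
  have V_zero: "0 \<in> V"
  proof -
    have "\<rho> \<gamma> 0 = 0" if "\<gamma> \<in> \<Gamma>" for \<gamma> using \<rho>_add[OF that, of 0 0] by simp
    then have "unif (\<lambda>\<gamma>. \<rho> \<gamma> 0) \<longleftrightarrow> unif (\<lambda>\<gamma>. 0 :: 'v)" by (intro unif_cong) simp
    moreover have "unif (\<lambda>\<gamma>. 0 :: 'v)" unfolding unif_def by (auto intro!: exI[of _ UNIV])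
    ultimately show ?thesis by (simp add: V_def)
  qed
  have V_diff: "v - w \<in> V" if "v \<in> V" "w \<in> V" for v w
    using V_add[OF that(1) V_sc[OF that(2), of "-1"]] by simp
  have V_inv: "\<rho> \<delta> v \<in> V" if "v \<in> V" "\<delta> \<in> \<Gamma>" for v \<delta>
    using unif_right[OF V_unif[OF that(1)] that(2)]
      unif_cong[of "\<lambda>\<gamma>. \<rho> \<gamma> (\<rho> \<delta> v)" "\<lambda>\<gamma>. \<rho> (\<gamma> + \<delta>) v"] \<rho>_mult[OF _ that(2)] by (simp add: V_def)
  have V_closed: "closed V"
    unfolding closed_sequential_limits
  proof (intro allI impI, elim conjE)
    fix w v assume w: "\<forall>n. w n \<in> V" and lim: "w \<longlonglongrightarrow> v"
    show "v \<in> V"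
      unfolding V_def unif_def
    proof (intro CollectI allI impI)
      fix e :: real assume "0 < e"
      then have e: "0 < e / 3" by simp
      then obtain n where n: "norm (w n - v) < e / 3"
        using LIMSEQ_D[OF lim e] by blast
      obtain U where U: "open U" "0 \<in> U"
        "\<And>\<gamma> \<delta>. \<gamma> \<in> \<Gamma> \<Longrightarrow> \<delta> \<in> \<Gamma> \<Longrightarrow> - \<pi> \<gamma> + \<pi> \<delta> \<in> U \<Longrightarrow> norm (\<rho> \<gamma> (w n) - \<rho> \<delta> (w n)) \<le> e / 3"
        using V_unif[OF w[rule_format, of n]] e unfolding unif_def by meson
      \<comment> \<open>Three errors of a third each; isometry makes the outer two independent of
        the group elements, so a norm limit stays in \<open>V\<close>.\<close>
      have "norm (\<rho> \<gamma> v - \<rho> \<delta> v) \<le> e" if "\<gamma> \<in> \<Gamma>" "\<delta> \<in> \<Gamma>" "- \<pi> \<gamma> + \<pi> \<delta> \<in> U" for \<gamma> \<delta>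
      proof -
        have "norm (\<rho> \<gamma> (w n) - \<rho> \<gamma> v) < e / 3" "norm (\<rho> \<delta> (w n) - \<rho> \<delta> v) < e / 3"
          using n \<rho>_norm[OF that(1), of "w n - v"] \<rho>_norm[OF that(2), of "w n - v"]
          by (simp_all add: \<rho>_diff that)
        moreover have "norm (\<rho> \<gamma> (w n) - \<rho> \<delta> (w n)) \<le> e / 3" by (rule U(3)[OF that])
        ultimately show ?thesis by norm
      qed
      then show "\<exists>U. open U \<and> 0 \<in> U \<and> (\<forall>\<gamma>\<in>\<Gamma>. \<forall>\<delta>\<in>\<Gamma>. - \<pi> \<gamma> + \<pi> \<delta> \<in> U \<longrightarrow> norm (\<rho> \<gamma> v - \<rho> \<delta> v) \<le> e)"
        using U(1,2) by blast
    qed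
  qed
  have V_sub: "closed_subspace sc V"
    unfolding closed_subspace_def vs.subspace_def using V_add V_sc V_zero V_closed by blast
  have ext_V: "ext f x \<in> V" if f: "unif f" "\<And>\<gamma>. \<gamma> \<in> \<Gamma> \<Longrightarrow> f \<gamma> \<in> V" for f x
    by (rule Lim_in_closed_set[OF V_closed _ near_nontrivial ext_tendsto[OF f(1)]])
      (rule eventually_mono[OF eventually_near_mem f(2)])
  have \<tau>_lim: "((\<lambda>\<gamma>. \<rho> \<gamma> v) \<longlongrightarrow> \<tau> x v) (near x)" if "v \<in> V" for x v
    unfolding \<tau>_def by (rule ext_tendsto[OF V_unif[OF that]])
  have \<tau>_V: "\<tau> x v \<in> V" if "v \<in> V" for x v
    unfolding \<tau>_def using V_inv[OF that] by (rule ext_V[OF V_unif[OF that]])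
  have tendsto_cong_near: "(f \<longlongrightarrow> l) (near x)" if "(g \<longlongrightarrow> l) (near x)" "\<And>\<gamma>. \<gamma> \<in> \<Gamma> \<Longrightarrow> f \<gamma> = g \<gamma>"
    for f g :: "'g \<Rightarrow> 'v" and l x
    using that(1) by (rule Lim_transform_eventually)
      (rule eventually_mono[OF eventually_near_mem], simp add: that(2))
  have \<tau>_add: "\<tau> x (v + w) = \<tau> x v + \<tau> x w" if "v \<in> V" "w \<in> V" for x v w
    unfolding \<tau>_def[of x "v + w"]
    by (rule ext_unique, rule tendsto_cong_near[OF tendsto_add[OF \<tau>_lim[OF that(1)] \<tau>_lim[OF that(2)]]])
      (rule \<rho>_add)
  have \<tau>_sc: "\<tau> x (sc a v) = sc a (\<tau> x v)" if "v \<in> V" for x a v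
    unfolding \<tau>_def[of x "sc a v"]
  proof (rule ext_unique, rule tendsto_cong_near)
    show "((\<lambda>\<gamma>. sc a (\<rho> \<gamma> v)) \<longlongrightarrow> sc a (\<tau> x v)) (near x)"
      by (rule continuous_on_tendsto_compose[OF scalar_mult_continuous[OF sc] \<tau>_lim[OF that]]) auto
  qed (rule \<rho>_sc)
  have \<tau>_norm: "norm (\<tau> x v) = norm v" if "v \<in> V" for x v
  proof (rule tendsto_unique[OF near_nontrivial tendsto_norm[OF \<tau>_lim[OF that]]])
    show "((\<lambda>\<gamma>. norm (\<rho> \<gamma> v)) \<longlongrightarrow> norm v) (near x)"
      by (rule Lim_transform_eventually[OF tendsto_const])
        (rule eventually_mono[OF eventually_near_mem], simp add: \<rho>_norm)
  qed
  have \<tau>_diff: "\<tau> x (v - w) = \<tau> x v - \<tau> x w" if "v \<in> V" "w \<in> V" for x v w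
    using \<tau>_add[OF V_diff[OF that] that(2), of x] by (simp add: algebra_simps)
  have \<tau>_\<Gamma>: "\<tau> (\<pi> \<gamma>) v = \<rho> \<gamma> v" if "\<gamma> \<in> \<Gamma>" "v \<in> V" for \<gamma> v
    unfolding \<tau>_def by (rule ext_eq[OF V_unif[OF that(2)] that(1)])
  have \<tau>_zero: "\<tau> 0 v = v" if "v \<in> V" for v
    using \<tau>_\<Gamma>[OF zero_mem that] by (simp add: \<pi>_zero \<rho>_zero)
  have \<tau>_cont: "continuous_on UNIV (\<lambda>x. \<tau> x v)" if "v \<in> V" for v
    unfolding \<tau>_def by (rule ext_continuous[OF V_unif[OF that]])
  \<comment> \<open>For fixed \<open>x\<close> the operator \<open>\<tau> x\<close> is isometric on
    \<open>V\<close>, hence preserves continuity of a function with values in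
    \<open>V\<close>.\<close>
  have \<tau>_cont2: "continuous_on UNIV (\<lambda>y. \<tau> x (f y))"
    if f: "continuous_on UNIV f" "\<And>y. f y \<in> V" for x and f :: "'h \<Rightarrow> 'v"
    unfolding continuous_on_def
  proof (intro ballI)
    fix y
    have "((\<lambda>z. norm (f z - f y)) \<longlongrightarrow> 0) (at y within UNIV)"
      using f(1) unfolding continuous_on_def by (intro tendsto_norm_zero LIM_zero) blast
    then have "((\<lambda>z. norm (\<tau> x (f z) - \<tau> x (f y))) \<longlongrightarrow> 0) (at y within UNIV)"
      by (simp add: \<tau>_norm V_diff f(2) flip: \<tau>_diff)
    then show "((\<lambda>z. \<tau> x (f z)) \<longlongrightarrow> \<tau> x (f y)) (at y within UNIV)"
      by (rule LIM_zero_cancel[OF tendsto_norm_zero_cancel])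
  qed
  have cont_left: "continuous_on UNIV (\<lambda>y. f (x + y))" and cont_right: "continuous_on UNIV (\<lambda>y. f (y + x))"
    if f: "continuous_on UNIV f" for f :: "'h \<Rightarrow> 'v" and x
  proof -
    show "continuous_on UNIV (\<lambda>y. f (x + y))" "continuous_on UNIV (\<lambda>y. f (y + x))"
      by (rule continuous_on_compose2[OF f], intro continuous_intros, simp)+
  qed
  \<comment> \<open>Joint continuity is avoided: first \<open>y\<close> is moved into the dense
    image with \<open>x\<close> fixed, then \<open>x\<close> with \<open>y\<close> fixed in the
    image.\<close>
  have \<tau>_mult: "\<tau> (x + y) v = \<tau> x (\<tau> y v)" if v: "v \<in> V" for x y v
  proof (rule dense_eqI[where f = "\<lambda>y. \<tau> (x + y) v"])
    show "continuous_on UNIV (\<lambda>y. \<tau> (x + y) v)" by (rule cont_left[OF \<tau>_cont[OF v]])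
    show "continuous_on UNIV (\<lambda>y. \<tau> x (\<tau> y v))" by (rule \<tau>_cont2[OF \<tau>_cont[OF v] \<tau>_V[OF v]])
    fix \<delta> assume \<delta>: "\<delta> \<in> \<Gamma>"
    have "\<tau> (x + \<pi> \<delta>) v = \<tau> x (\<rho> \<delta> v)"
    proof (rule dense_eqI[where f = "\<lambda>x. \<tau> (x + \<pi> \<delta>) v"])
      show "continuous_on UNIV (\<lambda>x. \<tau> (x + \<pi> \<delta>) v)" by (rule cont_right[OF \<tau>_cont[OF v]])
      show "continuous_on UNIV (\<lambda>x. \<tau> x (\<rho> \<delta> v))" by (rule \<tau>_cont[OF V_inv[OF v \<delta>]])
      fix \<gamma> assume \<gamma>: "\<gamma> \<in> \<Gamma>"
      show "\<tau> (\<pi> \<gamma> + \<pi> \<delta>) v = \<tau> (\<pi> \<gamma>) (\<rho> \<delta> v)"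
        using \<tau>_\<Gamma>[OF add_mem[OF \<gamma> \<delta>] v] \<tau>_\<Gamma>[OF \<gamma> V_inv[OF v \<delta>]] \<rho>_mult[OF \<gamma> \<delta>] by (simp add: hom)
    qed
    then show "\<tau> (x + \<pi> \<delta>) v = \<tau> x (\<tau> (\<pi> \<delta>) v)" by (simp add: \<tau>_\<Gamma> \<delta> v)
  qed
  have mod_\<tau>: "isometric_module sc UNIV V \<tau>"
    unfolding isometric_module_def
    using V_sub \<tau>_V \<tau>_add \<tau>_sc \<tau>_norm \<tau>_zero \<tau>_mult \<tau>_cont by simp
  define \<sigma> where "\<sigma> g v = \<tau> (\<pi> g) v" for g v
  have mod_\<sigma>: "isometric_module sc UNIV V \<sigma>"
    unfolding isometric_module_def \<sigma>_def
    using V_sub \<tau>_V \<tau>_add \<tau>_sc \<tau>_norm \<tau>_zero \<tau>_mult continuous_on_compose2[OF \<tau>_cont \<pi>_cont]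
    by (simp add: hom \<pi>_zero)
  have ext_through: "extends_through sc \<Gamma> \<rho> \<pi> V \<sigma>"
    unfolding extends_through_def
    using mod_\<sigma> mod_\<tau> by (auto simp: \<sigma>_def \<tau>_\<Gamma>)
  \<comment> \<open>By the cocycle identity the orbit map of \<open>c \<delta>\<close> is the
    difference of a right translate of \<open>c\<close> and \<open>c\<close> itself, both of which
    satisfy \<open>unif\<close>.\<close>
  have c_V: "c \<delta> \<in> V" if \<delta>: "\<delta> \<in> \<Gamma>" for \<delta>
  proof -
    have "unif (\<lambda>\<gamma>. c (\<gamma> + \<delta>) + - c \<gamma>)"
      by (rule unif_add[OF unif_right[OF c \<delta>] unif_minus[OF c]])
    then show ?thesis
      using unif_cong[of "\<lambda>\<gamma>. \<rho> \<gamma> (c \<delta>)" "\<lambda>\<gamma>. c (\<gamma> + \<delta>) + - c \<gamma>"] coc[OF _ \<delta>] by (simp add: V_def)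
  qed
  define k where "k = ext c"
  have k_V: "k x \<in> V" for x unfolding k_def by (rule ext_V[OF c c_V])
  have k_cont: "continuous_on UNIV k" unfolding k_def by (rule ext_continuous[OF c])
  have k_\<Gamma>: "k (\<pi> \<gamma>) = c \<gamma>" if "\<gamma> \<in> \<Gamma>" for \<gamma> unfolding k_def by (rule ext_eq[OF c that])
  have k_coc: "k (x + y) = k x + \<tau> x (k y)" for x y
  proof (rule dense_eqI[where f = "\<lambda>y. k (x + y)"])
    show "continuous_on UNIV (\<lambda>y. k (x + y))" by (rule cont_left[OF k_cont])
    show "continuous_on UNIV (\<lambda>y. k x + \<tau> x (k y))"
      by (intro continuous_on_add continuous_on_const \<tau>_cont2[OF k_cont k_V])
    fix \<delta> assume \<delta>: "\<delta> \<in> \<Gamma>"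
    have "k (x + \<pi> \<delta>) = k x + \<tau> x (c \<delta>)"
    proof (rule dense_eqI[where f = "\<lambda>x. k (x + \<pi> \<delta>)"])
      show "continuous_on UNIV (\<lambda>x. k (x + \<pi> \<delta>))" by (rule cont_right[OF k_cont])
      show "continuous_on UNIV (\<lambda>x. k x + \<tau> x (c \<delta>))"
        by (intro continuous_on_add k_cont \<tau>_cont[OF c_V[OF \<delta>]])
      fix \<gamma> assume \<gamma>: "\<gamma> \<in> \<Gamma>"
      show "k (\<pi> \<gamma> + \<pi> \<delta>) = k (\<pi> \<gamma>) + \<tau> (\<pi> \<gamma>) (c \<delta>)"
        using k_\<Gamma>[OF add_mem[OF \<gamma> \<delta>]] coc[OF \<gamma> \<delta>] by (simp add: hom k_\<Gamma> \<tau>_\<Gamma> c_V \<gamma> \<delta>)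
    qed
    then show "k (x + \<pi> \<delta>) = k x + \<tau> x (k (\<pi> \<delta>))" by (simp add: k_\<Gamma> \<delta>)
  qed
  \<comment> \<open>Passage from the inhomogeneous cocycle \<open>k\<close> on the factor to the
    homogeneous form required by \<open>cocycles\<close>; it visibly factors through
    \<open>\<pi>\<close>.\<close>
  define b where "b g h = k (\<pi> h) - k (\<pi> g)" for g h
  have "b \<in> cocycles UNIV V \<sigma>"
    unfolding cocycles_def
  proof (intro CollectI conjI ballI)
    show "b g h \<in> V" for g h unfolding b_def by (rule V_diff[OF k_V k_V])
    have "continuous_on UNIV (\<lambda>z. k (\<pi> (snd z)) - k (\<pi> (fst z)))"
      by (intro continuous_on_diff continuous_on_compose2[OF k_cont] continuous_on_compose2[OF \<pi>_cont]
          continuous_on_fst continuous_on_snd continuous_on_id) simp_all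
    then show "continuous_on (UNIV \<times> UNIV) (\<lambda>(g, h). b g h)"
      by (simp add: b_def case_prod_unfold)
    show "b (g + g1) (g + g2) = \<sigma> g (b g1 g2)" for g g1 g2
      by (simp add: b_def \<sigma>_def hom k_coc \<tau>_diff k_V)
    show "b g2 g3 - b g1 g3 + b g1 g2 = 0" for g1 g2 g3 by (simp add: b_def)
  qed
  moreover have "\<forall>g\<in>\<Gamma>. \<forall>h\<in>\<Gamma>. b g h = c h - c g" by (simp add: b_def k_\<Gamma>)
  moreover have "\<forall>g h g' h'. \<pi> g = \<pi> g' \<and> \<pi> h = \<pi> h' \<longrightarrow> b g h = b g' h'" by (simp add: b_def)
  moreover have "\<forall>\<gamma>\<in>\<Gamma>. \<rho> \<gamma> ` V \<subseteq> V" using V_inv by blast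
  ultimately show ?thesis using V_sub ext_through by blast
qed

end

section \<open>Lattices and fundamental domains\<close>

lemma (in haar) emeasure_right:
  assumes "A \<in> sets borel" shows "emeasure \<nu> ((\<lambda>x. x + g) -` A) = emeasure \<nu> A"
proof -
  have "(\<lambda>x. x + g) \<in> \<nu> \<rightarrow>\<^sub>M \<nu>"
    by (simp only: measurable_cong_sets[OF sets_haar sets_haar] borel_translations)
  then have "emeasure (distr \<nu> \<nu> (\<lambda>x. x + g)) A = emeasure \<nu> ((\<lambda>x. x + g) -` A)"
    using assms by (simp only: emeasure_distr sets_haar space_haar Int_UNIV_right)
  then show ?thesis by (simp only: distr_right)
qed

lemma fundamental_domain_unique:
  assumes sub: "add_subgroup \<Gamma>" and fd: "fundamental_domain \<Gamma> D"
  shows "\<exists>!\<gamma>. \<gamma> \<in> \<Gamma> \<and> x + \<gamma> \<in> D"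
proof -
  have "x \<in> {x + \<gamma> | x \<gamma>. x \<in> D \<and> \<gamma> \<in> \<Gamma>}" using fd by (simp add: fundamental_domain_def)
  then obtain d \<gamma> where d: "x = d + \<gamma>" "d \<in> D" "\<gamma> \<in> \<Gamma>" by blast
  have ex: "- \<gamma> \<in> \<Gamma> \<and> x + - \<gamma> \<in> D"
    using d sub by (simp add: add_subgroup_def add.assoc)
  have "\<gamma>1 = \<gamma>2" if "\<gamma>1 \<in> \<Gamma>" "x + \<gamma>1 \<in> D" "\<gamma>2 \<in> \<Gamma>" "x + \<gamma>2 \<in> D" for \<gamma>1 \<gamma>2
  proof (rule ccontr)
    assume "\<gamma>1 \<noteq> \<gamma>2"
    then have "- \<gamma>1 \<noteq> - \<gamma>2" by simp
    moreover have "- \<gamma>1 \<in> \<Gamma>" "- \<gamma>2 \<in> \<Gamma>" using that sub by (auto simp: add_subgroup_def)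
    ultimately have "(\<lambda>x. x + - \<gamma>1) ` D \<inter> (\<lambda>x. x + - \<gamma>2) ` D = {}"
      using fd unfolding fundamental_domain_def by blast
    moreover have "x \<in> (\<lambda>x. x + - \<gamma>1) ` D"
      by (rule image_eqI[of _ _ "x + \<gamma>1"]) (simp_all only: add.assoc right_minus add_0_right that)
    moreover have "x \<in> (\<lambda>x. x + - \<gamma>2) ` D"
      by (rule image_eqI[of _ _ "x + \<gamma>2"]) (simp_all only: add.assoc right_minus add_0_right that)
    ultimately show False by blast
  qed
  then show ?thesis using ex by blast
qed

lemma fundamental_domain_translate:
  assumes fd: "fundamental_domain \<Gamma> D"
  shows "fundamental_domain \<Gamma> ((\<lambda>x. - g + x) -` D)"
  unfolding fundamental_domain_def
proof (intro conjI ballI impI)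
  show "UNIV = {x + \<gamma> | x \<gamma>. x \<in> (\<lambda>x. - g + x) -` D \<and> \<gamma> \<in> \<Gamma>}"
  proof (intro equalityI subsetI)
    fix x :: 'a
    have "- g + x \<in> {x + \<gamma> | x \<gamma>. x \<in> D \<and> \<gamma> \<in> \<Gamma>}" using fd by (simp add: fundamental_domain_def)
    then obtain d \<gamma> where d: "- g + x = d + \<gamma>" "d \<in> D" "\<gamma> \<in> \<Gamma>" by blast
    then have "x = (g + d) + \<gamma>" by (metis add.assoc add_minus_cancel)
    moreover have "g + d \<in> (\<lambda>x. - g + x) -` D" using d(2) by simp
    ultimately show "x \<in> {x + \<gamma> | x \<gamma>. x \<in> (\<lambda>x. - g + x) -` D \<and> \<gamma> \<in> \<Gamma>}" using d(3) by blast
  qed simp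
  fix \<gamma> \<gamma>' assume *: "\<gamma> \<in> \<Gamma>" "\<gamma>' \<in> \<Gamma>" "\<gamma> \<noteq> \<gamma>'"
  have dis: "(\<lambda>x. x + \<gamma>) ` D \<inter> (\<lambda>x. x + \<gamma>') ` D = {}"
    using fd * unfolding fundamental_domain_def by blast
  show "(\<lambda>x. x + \<gamma>) ` (\<lambda>x. - g + x) -` D \<inter> (\<lambda>x. x + \<gamma>') ` (\<lambda>x. - g + x) -` D = {}"
  proof (rule equals0I, elim IntE imageE)
    fix z x y assume xy: "z = x + \<gamma>" "z = y + \<gamma>'" "x \<in> (\<lambda>x. - g + x) -` D" "y \<in> (\<lambda>x. - g + x) -` D"
    have "- g + z = (- g + x) + \<gamma>" using xy(1) by (simp only: add.assoc)
    moreover have "- g + z = (- g + y) + \<gamma>'" using xy(2) by (simp only: add.assoc)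
    ultimately have "- g + z \<in> (\<lambda>x. x + \<gamma>) ` D \<inter> (\<lambda>x. x + \<gamma>') ` D" using xy(3,4) by blast
    then show False using dis by blast
  qed
qed

lemma left_coset_measurable: "left_coset \<Gamma> \<in> borel \<rightarrow>\<^sub>M coset_borel \<Gamma>"
  unfolding coset_borel_def coset_topology_def
  by (rule measurable_measure_of) (auto simp: topology_inverse'[OF istopology_coset_topology])

text \<open>The normalization is imposed on the quotient; this converts it into a statement about
  the fundamental domain.\<close>

lemma emeasure_space_coset_measure:
  assumes sets: "sets \<nu> = sets borel" and D: "D \<in> sets borel"
  shows "emeasure (coset_measure \<nu> \<Gamma> D) (space (coset_measure \<nu> \<Gamma> D)) = emeasure \<nu> D"
proof -
  have q: "left_coset \<Gamma> \<in> restrict_space \<nu> D \<rightarrow>\<^sub>M coset_borel \<Gamma>"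
    by (rule measurable_restrict_space1) (simp only: measurable_cong_sets[OF sets refl] left_coset_measurable)
  have "left_coset \<Gamma> -` space (coset_borel \<Gamma>) \<inter> space (restrict_space \<nu> D) = space (restrict_space \<nu> D)"
    using measurable_space[OF q] by blast
  then have "emeasure (coset_measure \<nu> \<Gamma> D) (space (coset_measure \<nu> \<Gamma> D)) =
      emeasure (restrict_space \<nu> D) (space (restrict_space \<nu> D))"
    unfolding coset_measure_def space_distr by (simp only: emeasure_distr[OF q sets.top])
  also have "\<dots> = emeasure \<nu> D"
    using D sets sets_eq_imp_space_eq[OF sets] by (simp add: space_restrict_space emeasure_restrict_space)
  finally show ?thesis .
qed

locale lattice_domain = haar \<nu>
  for \<nu> :: "'g::{topological_group_add, t2_space, second_countable_topology} measure" +
  fixes \<Gamma> D :: "'g set"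
  assumes subgroup: "add_subgroup \<Gamma>" and discrete: "discrete \<Gamma>"
    and D_borel [measurable]: "D \<in> sets borel" and fd: "fundamental_domain \<Gamma> D"
    and D_measure: "emeasure \<nu> D = 1"
begin

lemma zero_mem: "0 \<in> \<Gamma>" and add_mem: "x \<in> \<Gamma> \<Longrightarrow> y \<in> \<Gamma> \<Longrightarrow> x + y \<in> \<Gamma>"
  and minus_mem: "x \<in> \<Gamma> \<Longrightarrow> - x \<in> \<Gamma>"
  using subgroup by (auto simp: add_subgroup_def)

text \<open>Discreteness isolates 0 in the lattice, and \<open>W\<close> is chosen so small that its
  differences meet the lattice in 0 only. Each left translate of \<open>W\<close> thus embeds into
  the quotient.\<close>

lemma injective_nhd:
  "\<exists>W. open W \<and> 0 \<in> W \<and> (\<forall>x a b. - x + a \<in> W \<longrightarrow> - x + b \<in> W \<longrightarrow> - a + b \<in> \<Gamma> \<longrightarrow> a = b)"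
proof -
  obtain U where U: "open U" "U \<inter> \<Gamma> = {0}"
    using discreteD[OF discrete zero_mem] unfolding isolated_in_def by blast
  then have "0 \<in> U" by blast
  then obtain W where W: "open W" "0 \<in> W" "\<forall>a\<in>W. \<forall>b\<in>W. - a + b \<in> U"
    using small_difference_nhd[OF U(1), of 0] by blast
  have "a = b" if "- x + a \<in> W" "- x + b \<in> W" "- a + b \<in> \<Gamma>" for x a b
  proof -
    have "- (- x + a) + (- x + b) \<in> U" using W(3) that(1,2) by blast
    also have "- (- x + a) + (- x + b) = - a + b"
      by (simp only: minus_add minus_minus add.assoc add_minus_cancel)
    finally have "- a + b = 0" using U(2) that(3) by blast
    then show ?thesis by (metis add_minus_cancel add.right_neutral)
  qed
  then show ?thesis using W(1,2) by blast
qed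

text \<open>Finitely many translates of the neighbourhood from \<open>injective_nhd\<close> cover
  the compact set, and each contains at most one lattice point.\<close>

lemma finite_Int_compact:
  assumes C: "compact C" shows "finite (\<Gamma> \<inter> C)"
proof -
  obtain W where W: "open W" "0 \<in> W"
    and inj: "\<And>x a b. - x + a \<in> W \<Longrightarrow> - x + b \<in> W \<Longrightarrow> - a + b \<in> \<Gamma> \<Longrightarrow> a = b"
    using injective_nhd by blast
  define V where "V x = (\<lambda>y. - x + y) -` W" for x
  have V: "open (V x)" for x unfolding V_def by (rule open_group_vimage(1)[OF W(1)])
  have "C \<subseteq> (\<Union>x\<in>C. V x)" using W(2) by (auto simp: V_def)
  then obtain T where T: "T \<subseteq> C" "finite T" "C \<subseteq> (\<Union>x\<in>T. V x)"
    by (rule compactE_image[OF C V])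
  have "finite (\<Gamma> \<inter> V x)" for x
  proof (cases "\<Gamma> \<inter> V x = {}")
    case False
    then obtain a where a: "a \<in> \<Gamma>" "a \<in> V x" by blast
    have "b = a" if "b \<in> \<Gamma>" "b \<in> V x" for b
      using inj[of x a b] a that by (simp add: V_def add_mem minus_mem)
    then have "\<Gamma> \<inter> V x \<subseteq> {a}" by blast
    then show ?thesis by (rule finite_subset) simp
  qed simp
  then have "finite (\<Union>x\<in>T. \<Gamma> \<inter> V x)" using T(2) by blast
  moreover have "\<Gamma> \<inter> C \<subseteq> (\<Union>x\<in>T. \<Gamma> \<inter> V x)" using T(3) by blast
  ultimately show ?thesis by (rule rev_finite_subset)
qed

lemma countable_lattice: "countable \<Gamma>"
proof -
  obtain C :: "nat \<Rightarrow> 'g set" where C: "\<And>n. compact (C n)" "(\<Union>n. C n) = UNIV"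
    using open_sigma_compact[OF lc open_UNIV] by blast
  have "countable (\<Union>n. \<Gamma> \<inter> C n)"
    by (intro countable_UN[OF countableI_type] countable_finite[OF finite_Int_compact[OF C(1)]])
  moreover have "\<Gamma> \<subseteq> (\<Union>n. \<Gamma> \<inter> C n)" using C(2) by blast
  ultimately show ?thesis by (rule countable_subset[rotated])
qed

text \<open>\<open>domain_cocycle\<close> depends on its two group arguments only through their sum;
  \<open>\<kappa>\<close> is this function of one variable, taken on the whole group.\<close>

definition \<kappa> :: "'g \<Rightarrow> 'g" where "\<kappa> x = (THE \<gamma>. \<gamma> \<in> \<Gamma> \<and> x + \<gamma> \<in> D)"

lemma \<kappa>_mem: "\<kappa> x \<in> \<Gamma>" and \<kappa>_D: "x + \<kappa> x \<in> D"
  using theI'[OF fundamental_domain_unique[OF subgroup fd, of x]] by (simp_all add: \<kappa>_def)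

lemma \<kappa>_eq: "\<gamma> \<in> \<Gamma> \<Longrightarrow> x + \<gamma> \<in> D \<Longrightarrow> \<kappa> x = \<gamma>"
  using fundamental_domain_unique[OF subgroup fd, of x] \<kappa>_mem[of x] \<kappa>_D[of x] by blast

lemma \<kappa>_zero: "x \<in> D \<Longrightarrow> \<kappa> x = 0" by (rule \<kappa>_eq) (simp_all add: zero_mem)

lemma \<kappa>_shift:
  assumes "\<gamma> \<in> \<Gamma>" shows "\<kappa> (x + \<gamma>) = - \<gamma> + \<kappa> x"
proof (rule \<kappa>_eq)
  show "- \<gamma> + \<kappa> x \<in> \<Gamma>" by (intro add_mem minus_mem assms \<kappa>_mem)
  have "x + \<gamma> + (- \<gamma> + \<kappa> x) = x + \<kappa> x" by (simp only: add.assoc add_minus_cancel)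
  then show "x + \<gamma> + (- \<gamma> + \<kappa> x) \<in> D" using \<kappa>_D[of x] by simp
qed

lemma domain_cocycle_eq: "domain_cocycle \<Gamma> D g x = \<kappa> (g + x)"
  by (simp add: domain_cocycle_def \<kappa>_def)

lemma vimage_right_borel: "A \<in> sets borel \<Longrightarrow> (\<lambda>x. x + (g::'g)) -` A \<in> sets borel"
  by (rule measurable_sets_borel[OF borel_translations(1)])

lemma vimage_left_borel: "A \<in> sets borel \<Longrightarrow> (\<lambda>x. (g::'g) + x) -` A \<in> sets borel"
  by (rule measurable_sets_borel[OF borel_translations(2)])

lemma \<kappa>_measurable: "\<kappa> \<in> borel \<rightarrow>\<^sub>M count_space \<Gamma>"
proof (rule measurableI)
  fix A assume "A \<in> sets (count_space \<Gamma>)"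
  then have A: "A \<subseteq> \<Gamma>" by simp
  have "\<kappa> -` A \<inter> space borel = (\<Union>\<gamma>\<in>A. (\<lambda>x. x + \<gamma>) -` D)"
  proof (intro equalityI subsetI)
    fix x assume "x \<in> (\<Union>\<gamma>\<in>A. (\<lambda>x. x + \<gamma>) -` D)"
    then obtain \<gamma> where "\<gamma> \<in> A" "x + \<gamma> \<in> D" by blast
    then show "x \<in> \<kappa> -` A \<inter> space borel" using \<kappa>_eq[of \<gamma> x] A by auto
  qed (use \<kappa>_D in auto)
  also have "\<dots> \<in> sets borel"
    using vimage_right_borel[OF D_borel]
    by (intro sets.countable_UN' countable_subset[OF A countable_lattice]) blast
  finally show "\<kappa> -` A \<inter> space borel \<in> sets borel" .
qed (simp add: \<kappa>_mem)

lemma emeasure_domain_decomposition: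
  assumes A: "A \<in> sets borel" and D': "D' \<in> sets borel" "fundamental_domain \<Gamma> D'"
  shows "emeasure \<nu> A = (\<integral>\<^sup>+\<gamma>. emeasure \<nu> (A \<inter> (\<lambda>x. x + \<gamma>) -` D') \<partial>count_space \<Gamma>)"
proof -
  note un = fundamental_domain_unique[OF subgroup D'(2)]
  have "(\<Union>\<gamma>\<in>\<Gamma>. A \<inter> (\<lambda>x. x + \<gamma>) -` D') = A"
  proof (intro equalityI subsetI)
    fix x assume "x \<in> A"
    moreover obtain \<gamma> where "\<gamma> \<in> \<Gamma>" "x + \<gamma> \<in> D'" using ex1_implies_ex[OF un[of x]] by blast
    ultimately show "x \<in> (\<Union>\<gamma>\<in>\<Gamma>. A \<inter> (\<lambda>x. x + \<gamma>) -` D')" by blast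
  qed blast
  moreover have "disjoint_family_on (\<lambda>\<gamma>. A \<inter> (\<lambda>x. x + \<gamma>) -` D') \<Gamma>"
    unfolding disjoint_family_on_def
  proof (intro ballI impI equals0I, elim IntE vimageE)
    fix \<gamma> \<delta> x y z assume "\<gamma> \<in> \<Gamma>" "\<delta> \<in> \<Gamma>" "\<gamma> \<noteq> \<delta>" "x + \<gamma> = y" "y \<in> D'" "x + \<delta> = z" "z \<in> D'"
    then show False using ex1E[OF un[of x], of False] by blast
  qed
  moreover have "A \<inter> (\<lambda>x. x + \<gamma>) -` D' \<in> sets \<nu>" for \<gamma>
    using A vimage_right_borel[OF D'(1)] by simp
  ultimately show ?thesis
    using emeasure_UN_countable[of \<Gamma> "\<lambda>\<gamma>. A \<inter> (\<lambda>x. x + \<gamma>) -` D'" \<nu>] countable_lattice by simp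
qed

text \<open>Cut \<open>D'\<close> by the translates of \<open>D\<close>, and \<open>D\<close> by
  those of \<open>D'\<close>. The piece for \<open>\<gamma>\<close> of the first is a right
  translate of the piece for \<open>- \<gamma>\<close> of the second, also inside an invariant set
  \<open>X\<close>. The choice of \<open>UNIV\<close> for \<open>X\<close> compares total masses,
  and general \<open>X\<close> gives invariance on the quotient.\<close>

lemma domain_measure_unique:
  assumes D': "D' \<in> sets borel" "fundamental_domain \<Gamma> D'"
    and X: "X \<in> sets borel" "\<And>x \<gamma>. \<gamma> \<in> \<Gamma> \<Longrightarrow> x + \<gamma> \<in> X \<longleftrightarrow> x \<in> X"
  shows "emeasure \<nu> (D' \<inter> X) = emeasure \<nu> (D \<inter> X)"
proof -
  have eq: "emeasure \<nu> (D' \<inter> X \<inter> (\<lambda>x. x + \<gamma>) -` D) = emeasure \<nu> (D \<inter> X \<inter> (\<lambda>x. x + - \<gamma>) -` D')"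
    if \<gamma>: "\<gamma> \<in> \<Gamma>" for \<gamma>
  proof -
    have "D' \<inter> X \<inter> (\<lambda>x. x + \<gamma>) -` D = (\<lambda>x. x + \<gamma>) -` (D \<inter> X \<inter> (\<lambda>x. x + - \<gamma>) -` D')"
      using X(2)[OF \<gamma>] by (auto simp: add.assoc)
    also have "emeasure \<nu> \<dots> = emeasure \<nu> (D \<inter> X \<inter> (\<lambda>x. x + - \<gamma>) -` D')"
      by (rule emeasure_right[OF sets.Int[OF sets.Int[OF D_borel X(1)] vimage_right_borel[OF D'(1)]]])
    finally show ?thesis .
  qed
  have bij: "bij_betw uminus \<Gamma> \<Gamma>"
    by (rule bij_betwI[where g = uminus]) (auto simp: minus_mem)
  have "emeasure \<nu> (D' \<inter> X) = (\<integral>\<^sup>+\<gamma>. emeasure \<nu> (D' \<inter> X \<inter> (\<lambda>x. x + \<gamma>) -` D) \<partial>count_space \<Gamma>)"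
    using D'(1) X(1) by (intro emeasure_domain_decomposition fd) auto
  also have "\<dots> = (\<integral>\<^sup>+\<gamma>. emeasure \<nu> (D \<inter> X \<inter> (\<lambda>x. x + - \<gamma>) -` D') \<partial>count_space \<Gamma>)"
    by (rule nn_integral_cong) (use eq in simp)
  also have "\<dots> = (\<integral>\<^sup>+\<gamma>. emeasure \<nu> (D \<inter> X \<inter> (\<lambda>x. x + \<gamma>) -` D') \<partial>count_space \<Gamma>)"
    by (rule nn_integral_bij_count_space[OF bij])
  also have "\<dots> = emeasure \<nu> (D \<inter> X)"
    using X(1) by (intro emeasure_domain_decomposition[symmetric] D') auto
  finally show ?thesis .
qed

text \<open>The left translates of a fundamental domain have the same mass, so that \<open>\<nu>\<close> is unimodular.\<close>

sublocale biinvariant_haar \<nu>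
proof
  fix g :: 'g and A :: "'g set" assume A: "A \<in> sets borel"
  obtain k where k: "\<And>A. A \<in> sets borel \<Longrightarrow> emeasure \<nu> ((\<lambda>x. - (- g) + x) -` A) = k * emeasure \<nu> A"
    using left_translate_scales[of "- g"] by blast
  have "emeasure \<nu> ((\<lambda>x. - (- g) + x) -` D) = emeasure \<nu> D"
    using domain_measure_unique[OF vimage_left_borel[OF D_borel] fundamental_domain_translate[OF fd], of UNIV "- g"] by simp
  then have "k = 1" using k[OF D_borel] D_measure by simp
  then show "emeasure \<nu> ((\<lambda>x. g + x) -` A) = emeasure \<nu> A" using k[OF A] by simp
qed

section \<open>The quotient by the lattice and its invariant measure\<close>

abbreviation q :: "'g \<Rightarrow> 'g set" where "q \<equiv> left_coset \<Gamma>"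

lemma q_eq_iff: "q x = q y \<longleftrightarrow> - x + y \<in> \<Gamma>"
proof
  assume "q x = q y"
  moreover have "y \<in> q y" unfolding left_coset_def using zero_mem by force
  ultimately obtain \<gamma> where "\<gamma> \<in> \<Gamma>" "y = x + \<gamma>" unfolding left_coset_def by blast
  then show "- x + y \<in> \<Gamma>" by simp
next
  assume *: "- x + y \<in> \<Gamma>"
  have sub: "q b \<subseteq> q a" if "- a + b \<in> \<Gamma>" for a b
  proof
    fix z assume "z \<in> q b"
    then obtain \<gamma> where "\<gamma> \<in> \<Gamma>" "z = b + \<gamma>" unfolding left_coset_def by blast
    then show "z \<in> q a" unfolding left_coset_def
      using add_mem[OF that, of \<gamma>] by (intro image_eqI[of _ _ "- a + b + \<gamma>"]) (simp_all add: add.assoc)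
  qed
  have "- y + x = - (- x + y)" by (simp only: minus_add minus_minus)
  then have "- y + x \<in> \<Gamma>" using minus_mem[OF *] by (simp only:)
  then show "q x = q y" using sub[OF *] sub by blast
qed

lemma q_shift: "\<gamma> \<in> \<Gamma> \<Longrightarrow> q (x + \<gamma>) = q x"
  by (simp add: q_eq_iff[symmetric] q_eq_iff minus_mem minus_add add.assoc)

definition rep :: "'g set \<Rightarrow> 'g" where "rep C = (THE x. x \<in> D \<and> q x = C)"

lemma rep_q: "rep (q x) = x + \<kappa> x"
  unfolding rep_def
proof (rule the_equality)
  show "x + \<kappa> x \<in> D \<and> q (x + \<kappa> x) = q x" using \<kappa>_D q_shift[OF \<kappa>_mem] by simp
  fix y assume y: "y \<in> D \<and> q y = q x"
  then have "- x + y \<in> \<Gamma>" using q_eq_iff[of x y] by simp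
  then have "\<kappa> x = - x + y" using y by (intro \<kappa>_eq) simp_all
  then show "y = x + \<kappa> x" by simp
qed

lemma rep_q_D: "x \<in> D \<Longrightarrow> rep (q x) = x" by (simp add: rep_q \<kappa>_zero)

lemma openin_coset: "openin (coset_topology \<Gamma>) U \<longleftrightarrow> U \<subseteq> range q \<and> open (q -` U)"
  unfolding coset_topology_def by (simp add: topology_inverse'[OF istopology_coset_topology])

lemma space_coset_borel: "space (coset_borel \<Gamma>) = range q"
  unfolding coset_borel_def by (rule space_measure_of) (auto simp: openin_coset)

lemma sets_coset_borel: "sets (coset_borel \<Gamma>) = sigma_sets (range q) {U. openin (coset_topology \<Gamma>) U}"
  unfolding coset_borel_def by (rule sets_measure_of) (auto simp: openin_coset)

lemma saturation:
  "q -` (q ` A) = (\<Union>\<gamma>\<in>\<Gamma>. (\<lambda>x. x + \<gamma>) -` A)"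
proof (intro equalityI subsetI)
  fix x assume "x \<in> q -` q ` A"
  then obtain a where a: "a \<in> A" "q x = q a" by blast
  then have "- x + a \<in> \<Gamma>" by (simp add: q_eq_iff)
  moreover have "x + (- x + a) \<in> A" using a(1) by simp
  ultimately show "x \<in> (\<Union>\<gamma>\<in>\<Gamma>. (\<lambda>x. x + \<gamma>) -` A)" by blast
next
  fix x assume "x \<in> (\<Union>\<gamma>\<in>\<Gamma>. (\<lambda>x. x + \<gamma>) -` A)"
  then obtain \<gamma> where "\<gamma> \<in> \<Gamma>" "x + \<gamma> \<in> A" by blast
  then show "x \<in> q -` q ` A" using q_shift[of \<gamma> x] by (metis imageI vimageI2)
qed

text \<open>The quotient map is a local homeomorphism, so that it maps Borel sets to Borel sets.\<close>

lemma coset_borelI: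
  assumes B: "B \<subseteq> range q" and borel: "q -` B \<in> sets borel"
  shows "B \<in> sets (coset_borel \<Gamma>)"
proof -
  obtain W where W: "open W" "0 \<in> W"
    and inj: "\<And>x a b. - x + a \<in> W \<Longrightarrow> - x + b \<in> W \<Longrightarrow> - a + b \<in> \<Gamma> \<Longrightarrow> a = b"
    using injective_nhd by blast
  define V where "V x = (\<lambda>y. - x + y) -` W" for x
  have V: "open (V x)" for x unfolding V_def by (rule open_group_vimage(1)[OF W(1)])
  have V_mem: "x \<in> V x" for x using W(2) by (simp add: V_def)
  obtain \<F> where \<F>: "\<F> \<subseteq> range V" "countable \<F>" "\<Union>\<F> = \<Union>(range V)"
    using Lindelof[of "range V"] V by blast
  \<comment> \<open>Inside \<open>U\<close> the quotient map is injective, so that its image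
    commutes with complements and the class of sets with measurable image is a
    sigma-algebra.\<close>
  have loc: "q ` (A \<inter> U) \<in> sets (coset_borel \<Gamma>)" if A: "A \<in> sets borel" and U: "U \<in> \<F>" for A U
  proof -
    have "U \<in> range V" using \<F>(1) U by (rule subsetD)
    then obtain x where x: "U = V x" by blast
    have injU: "a = b" if "a \<in> U" "b \<in> U" "q a = q b" for a b
      using that inj[of x a b] unfolding x V_def q_eq_iff by simp
    have open_q: "q ` O' \<in> sets (coset_borel \<Gamma>)" if "open O'" for O'
    proof -
      have "open (q -` (q ` O'))"
        unfolding saturation by (intro open_UN ballI open_group_vimage(2) that)
      then have "openin (coset_topology \<Gamma>) (q ` O')" by (auto simp: openin_coset)
      then show ?thesis unfolding sets_coset_borel by (intro sigma_sets.Basic) simp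
    qed
    have opU: "open U" using V x by simp
    have "A \<in> sigma_sets UNIV {S. open S}" using A by (simp add: borel_def)
    then show ?thesis
    proof (induction rule: sigma_sets.induct)
      case (Basic A)
      then show ?case using opU by (intro open_q open_Int) simp_all
    next
      case Empty show ?case by simp
    next
      case (Compl A)
      have "inj_on q U" by (rule inj_onI) (rule injU)
      moreover have "(UNIV - A) \<inter> U = U - A \<inter> U" by blast
      ultimately have "q ` ((UNIV - A) \<inter> U) = q ` U - q ` (A \<inter> U)"
        using inj_on_image_set_diff[of q U U "A \<inter> U"] by simp
      then show ?case using Compl.IH open_q[OF opU] by simp
    next
      case (Union A)
      have "q ` ((\<Union>i. A i) \<inter> U) = (\<Union>i. q ` (A i \<inter> U))" by blast
      then show ?case using Union.IH by simp
    qed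
  qed
  have "\<Union>\<F> = UNIV" using \<F>(3) V_mem by blast
  have "B = (\<Union>U\<in>\<F>. q ` (q -` B \<inter> U))"
  proof (intro equalityI subsetI)
    fix C assume C: "C \<in> B"
    then obtain x where x: "C = q x" using B by blast
    have "x \<in> \<Union>\<F>" using \<open>\<Union>\<F> = UNIV\<close> by simp
    then obtain U where U: "U \<in> \<F>" "x \<in> U" by (rule UnionE)
    have "C \<in> q ` (q -` B \<inter> U)" using C U(2) x by simp
    then show "C \<in> (\<Union>U\<in>\<F>. q ` (q -` B \<inter> U))" using U(1) by (rule UN_I[rotated])
  qed blast
  also have "\<dots> \<in> sets (coset_borel \<Gamma>)"
    using \<F>(2) loc[OF borel] by (intro sets.countable_UN') auto
  finally show ?thesis .
qed

lemma rep_measurable: "rep \<in> coset_borel \<Gamma> \<rightarrow>\<^sub>M borel"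
proof (rule measurableI)
  fix A :: "'g set" assume A: "A \<in> sets borel"
  have eq: "rep -` A \<inter> space (coset_borel \<Gamma>) = q ` (A \<inter> D)"
  proof (intro equalityI subsetI)
    fix C assume "C \<in> rep -` A \<inter> space (coset_borel \<Gamma>)"
    then obtain x where x: "C = q x" "x + \<kappa> x \<in> A" by (auto simp: space_coset_borel rep_q)
    then have "C = q (x + \<kappa> x)" by (simp add: q_shift \<kappa>_mem)
    then show "C \<in> q ` (A \<inter> D)" using x(2) \<kappa>_D by blast
  qed (auto simp: space_coset_borel rep_q_D)
  show "rep -` A \<inter> space (coset_borel \<Gamma>) \<in> sets (coset_borel \<Gamma>)"
    unfolding eq
  proof (rule coset_borelI)
    show "q -` q ` (A \<inter> D) \<in> sets borel"
      unfolding saturation using vimage_right_borel[of "A \<inter> D"] A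
      by (intro sets.countable_UN' countable_lattice) auto
  qed blast
qed simp

abbreviation M :: "'g set measure" where "M \<equiv> coset_measure \<nu> \<Gamma> D"

lemma sets_M [simp, measurable_cong]: "sets M = sets (coset_borel \<Gamma>)" by (simp add: coset_measure_def)

lemma space_M: "space M = range q" by (simp add: coset_measure_def space_coset_borel)

lemma q_measurable_D: "q \<in> restrict_space \<nu> D \<rightarrow>\<^sub>M coset_borel \<Gamma>"
  by (rule measurable_restrict_space1)
    (simp only: measurable_cong_sets[OF sets_haar refl] left_coset_measurable)

lemma emeasure_M:
  assumes "B \<in> sets (coset_borel \<Gamma>)" shows "emeasure M B = emeasure \<nu> (D \<inter> q -` B)"
proof -
  have "emeasure M B = emeasure (restrict_space \<nu> D) (q -` B \<inter> D)"
    unfolding coset_measure_def using assms q_measurable_D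
    by (subst emeasure_distr) (simp_all add: space_restrict_space)
  also have "\<dots> = emeasure \<nu> (q -` B \<inter> D)"
    by (subst emeasure_restrict_space) auto
  finally show ?thesis by (simp add: Int_commute)
qed

lemma prob_M: "prob_space M"
  by (rule prob_spaceI) (simp only: emeasure_space_coset_measure[OF sets_haar D_borel] D_measure)

lemma nn_integral_M:
  assumes f: "f \<in> borel_measurable (coset_borel \<Gamma>)"
  shows "(\<integral>\<^sup>+C. f C \<partial>M) = (\<integral>\<^sup>+x\<in>D. f (q x) \<partial>\<nu>)"
  unfolding coset_measure_def
  by (subst nn_integral_distr[OF q_measurable_D]) (use f in \<open>simp_all add: nn_integral_restrict_space\<close>)

lemma q_vimage_borel: "B \<in> sets (coset_borel \<Gamma>) \<Longrightarrow> q -` B \<in> sets borel"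
  using measurable_sets[OF left_coset_measurable, of B] by simp

text \<open>The quotient measure sees only the part of the preimage in \<open>D\<close>. The
  preimage is invariant under the lattice, so its parts in the countably many other translates of
  \<open>D\<close> are right translates of that null set.\<close>

lemma AE_M_lift:
  assumes "AE C in M. P C" shows "AE x in \<nu>. P (q x)"
proof -
  obtain N where N: "N \<in> null_sets M" "{C\<in>space M. \<not> P C} \<subseteq> N"
    using assms unfolding eventually_ae_filter by auto
  then have NM: "N \<in> sets (coset_borel \<Gamma>)" by auto
  have null: "emeasure \<nu> (D \<inter> q -` N) = 0" using N(1) emeasure_M[OF NM] by auto
  have "emeasure \<nu> (q -` N \<inter> (\<lambda>x. x + \<gamma>) -` D) = 0" if \<gamma>: "\<gamma> \<in> \<Gamma>" for \<gamma>
  proof -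
    have "q -` N \<inter> (\<lambda>x. x + \<gamma>) -` D = (\<lambda>x. x + \<gamma>) -` (D \<inter> q -` N)"
      using q_shift[OF \<gamma>] by auto
    then show ?thesis using emeasure_right[of "D \<inter> q -` N" \<gamma>] q_vimage_borel[OF NM] null by simp
  qed
  then have "(\<integral>\<^sup>+\<gamma>. emeasure \<nu> (q -` N \<inter> (\<lambda>x. x + \<gamma>) -` D) \<partial>count_space \<Gamma>) = (\<integral>\<^sup>+\<gamma>. 0 \<partial>count_space \<Gamma>)"
    by (intro nn_integral_cong) simp
  then have "emeasure \<nu> (q -` N) = 0"
    using emeasure_domain_decomposition[OF q_vimage_borel[OF NM] D_borel fd] by simp
  then have "q -` N \<in> null_sets \<nu>" using q_vimage_borel[OF NM] by auto
  then show ?thesis by (rule AE_I') (use N(2) in \<open>auto simp: space_M\<close>)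
qed

definition translate :: "'g \<Rightarrow> 'g set \<Rightarrow> 'g set" where "translate g C = q (g + rep C)"

lemma translate_measurable: "translate g \<in> coset_borel \<Gamma> \<rightarrow>\<^sub>M coset_borel \<Gamma>"
  unfolding translate_def
  by (rule measurable_compose[OF measurable_compose[OF rep_measurable borel_translations(2)] left_coset_measurable])

lemma translate_q: "translate g (q x) = q (g + x)"
  unfolding translate_def rep_q using q_shift[OF \<kappa>_mem, of "g + x"] by (simp add: add.assoc)

text \<open>Left invariance replaces \<open>D\<close> by a left translate, which is another
  fundamental domain; \<open>domain_measure_unique\<close> for the invariant preimage of
  \<open>B\<close> restores \<open>D\<close>.\<close>

lemma distr_translate: "distr M M (translate g) = M"
proof (rule measure_eqI)
  fix B assume "B \<in> sets (distr M M (translate g))"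
  then have B: "B \<in> sets (coset_borel \<Gamma>)" by simp
  have T: "translate g \<in> M \<rightarrow>\<^sub>M M"
    by (simp only: measurable_cong_sets[OF sets_M sets_M] translate_measurable)
  define X where "X = q -` B"
  have X: "X \<in> sets borel" unfolding X_def by (rule q_vimage_borel[OF B])
  have X_inv: "x + \<gamma> \<in> X \<longleftrightarrow> x \<in> X" if "\<gamma> \<in> \<Gamma>" for x \<gamma> using q_shift[OF that] by (simp add: X_def)
  have "emeasure (distr M M (translate g)) B = emeasure M (translate g -` B \<inter> space M)"
    using B by (simp add: emeasure_distr[OF T])
  also have "\<dots> = emeasure \<nu> (D \<inter> q -` (translate g -` B \<inter> space M))"
    using measurable_sets[OF T, of B] B by (intro emeasure_M) simp
  also have "D \<inter> q -` (translate g -` B \<inter> space M) = D \<inter> (\<lambda>x. g + x) -` X"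
    by (auto simp: X_def translate_q space_M)
  also have "emeasure \<nu> \<dots> = emeasure \<nu> ((\<lambda>y. - g + y) -` (D \<inter> (\<lambda>x. g + x) -` X))"
    using vimage_left_borel[OF X] by (intro left_invariant[symmetric]) simp
  also have "(\<lambda>y. - g + y) -` (D \<inter> (\<lambda>x. g + x) -` X) = (\<lambda>y. - g + y) -` D \<inter> X"
    by auto
  also have "emeasure \<nu> \<dots> = emeasure \<nu> (D \<inter> X)"
    by (rule domain_measure_unique[OF vimage_left_borel[OF D_borel] fundamental_domain_translate[OF fd] X X_inv])
  finally show "emeasure (distr M M (translate g)) B = emeasure M B" by (simp add: emeasure_M[OF B] X_def)
qed simp

end

section \<open>Descent to the factors\<close>

text \<open>If \<open>U\<close> were null, all its left translates would be null; countably many of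
  them cover the group by Lindelof.\<close>

lemma (in biinvariant_haar) open_positive:
  assumes U: "open U" "U \<noteq> {}" shows "emeasure \<nu> U \<noteq> 0"
proof
  assume null: "emeasure \<nu> U = 0"
  obtain u where u: "u \<in> U" using U(2) by blast
  define V where "V g = (\<lambda>x. g + x) -` U" for g
  have V: "open (V g)" for g unfolding V_def by (rule open_group_vimage(1)[OF U(1)])
  obtain \<F> where \<F>: "\<F> \<subseteq> range V" "countable \<F>" "\<Union>\<F> = \<Union>(range V)"
    using Lindelof[of "range V"] V by blast
  have "x \<in> V (u + - x)" for x using u by (simp add: V_def add.assoc)
  then have "\<Union>\<F> = UNIV" using \<F>(3) by blast
  moreover have "(\<Union>T\<in>\<F>. T) \<in> null_sets \<nu>"
  proof (rule null_sets_UN'[OF \<F>(2)])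
    fix T assume "T \<in> \<F>"
    then have "T \<in> range V" using \<F>(1) by blast
    then obtain g where "T = V g" by blast
    then have "emeasure \<nu> T = 0" "T \<in> sets \<nu>" using left_invariant[of U g] U(1) null V[of g] by (simp_all add: V_def)
    then show "T \<in> null_sets \<nu>" by (rule null_setsI)
  qed
  ultimately have "emeasure \<nu> UNIV = 0" by auto
  then show False using haar by (simp add: haar_measure_def)
qed

text \<open>Used for a projection and a slab \<open>S\<close> that is compact in the complementary
  direction. The map \<open>s\<close> embeds the factor, and translations by its values preserve the
  slab, so invariance passes to the image measure.\<close>

lemma (in biinvariant_haar) marginal_haar:
  fixes \<pi> :: "'g \<Rightarrow> 'h::{topological_group_add, t2_space, second_countable_topology}"
  assumes lc': "locally_compact_space (euclidean :: 'h topology)" and S: "S \<in> sets borel"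
    and \<pi>: "continuous_on UNIV \<pi>"
    and right: "\<And>x h. \<pi> (x + s h) = \<pi> x + h" "\<And>x h. x + s h \<in> S \<longleftrightarrow> x \<in> S"
    and left: "\<And>x h. \<pi> (s h + x) = h + \<pi> x" "\<And>x h. s h + x \<in> S \<longleftrightarrow> x \<in> S"
    and fin: "\<And>C. compact C \<Longrightarrow> emeasure \<nu> (\<pi> -` C \<inter> S) < \<infinity>" and nz: "emeasure \<nu> S \<noteq> 0"
  shows "biinvariant_haar (distr (restrict_space \<nu> S) borel \<pi>)"
proof -
  define m where "m = distr (restrict_space \<nu> S) borel \<pi>"
  have \<pi>M: "\<pi> \<in> borel_measurable borel" by (rule borel_measurable_continuous_onI[OF \<pi>])
  have \<pi>S: "\<pi> \<in> restrict_space \<nu> S \<rightarrow>\<^sub>M borel"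
    by (rule measurable_restrict_space1) (simp only: measurable_cong_sets[OF sets_haar refl] \<pi>M)
  have vim: "\<pi> -` A \<inter> S \<in> sets borel" if "A \<in> sets borel" for A
    by (rule sets.Int[OF measurable_sets_borel[OF \<pi>M that] S])
  have em: "emeasure m A = emeasure \<nu> (\<pi> -` A \<inter> S)" if "A \<in> sets borel" for A
    unfolding m_def using that S by (simp add: emeasure_distr[OF \<pi>S] space_restrict_space emeasure_restrict_space)
  have r: "emeasure m ((\<lambda>x. x + g) -` A) = emeasure m A" if A: "A \<in> sets borel" for A g
  proof -
    have "emeasure m ((\<lambda>x. x + g) -` A) = emeasure \<nu> (\<pi> -` ((\<lambda>x. x + g) -` A) \<inter> S)"
      by (rule em[OF measurable_sets_borel[OF borel_translations(1) A]])
    also have "\<pi> -` ((\<lambda>x. x + g) -` A) \<inter> S = (\<lambda>x. x + s g) -` (\<pi> -` A \<inter> S)"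
      using right by auto
    also have "emeasure \<nu> \<dots> = emeasure \<nu> (\<pi> -` A \<inter> S)" by (rule emeasure_right[OF vim[OF A]])
    finally show ?thesis by (simp add: em[OF A])
  qed
  have l: "emeasure m ((\<lambda>x. g + x) -` A) = emeasure m A" if A: "A \<in> sets borel" for A g
  proof -
    have "emeasure m ((\<lambda>x. g + x) -` A) = emeasure \<nu> (\<pi> -` ((\<lambda>x. g + x) -` A) \<inter> S)"
      by (rule em[OF measurable_sets_borel[OF borel_translations(2) A]])
    also have "\<pi> -` ((\<lambda>x. g + x) -` A) \<inter> S = (\<lambda>x. s g + x) -` (\<pi> -` A \<inter> S)"
      using left by auto
    also have "emeasure \<nu> \<dots> = emeasure \<nu> (\<pi> -` A \<inter> S)" by (rule left_invariant[OF vim[OF A]])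
    finally show ?thesis by (simp add: em[OF A])
  qed
  have "haar_measure m"
    unfolding haar_measure_def
  proof (intro conjI allI ballI impI)
    show "sets m = sets borel" by (simp add: m_def)
    fix g :: 'h and A :: "'h set" assume A: "A \<in> sets borel"
    have "(\<lambda>x. x + g) ` A = (\<lambda>x. x + - g) -` A"
    proof safe
      fix x assume "x + - g \<in> A"
      then show "x \<in> (\<lambda>x. x + g) ` A" by (intro image_eqI[of _ _ "x + - g"]) (simp_all add: add.assoc)
    qed (simp add: add.assoc)
    then show "emeasure m ((\<lambda>x. x + g) ` A) = emeasure m A" using r[OF A, of "- g"] by simp
  next
    fix K :: "'h set" assume K: "compact K"
    show "emeasure m K < \<infinity>" using fin[OF K] em[OF compact_borel[OF K]] by simp
  next
    show "emeasure m UNIV \<noteq> 0" using em[of UNIV] nz by simp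
  qed
  then have "biinvariant_haar m" using lc' l by unfold_locales
  then show ?thesis by (simp add: m_def)
qed

text \<open>No product formula for \<open>\<nu>\<close> is available. For every \<open>x\<close>,
  almost all \<open>z\<close> keep \<open>x + z\<close> outside the null set; Fubini fixes one
  \<open>z\<close> for almost all \<open>x\<close> in the product of \<open>m1\<close> and
  \<open>m2\<close>, and right invariance in each factor removes \<open>z\<close>.\<close>

lemma AE_product:
  fixes \<nu> :: "('a::{topological_group_add, t2_space, second_countable_topology} \<times>
    'b::{topological_group_add, t2_space, second_countable_topology}) measure"
  assumes \<nu>: "biinvariant_haar \<nu>" and m1: "biinvariant_haar m1" and m2: "biinvariant_haar m2"
    and ae: "AE x in \<nu>. P (fst x) (snd x)"
  shows "AE x1 in m1. AE x2 in m2. P x1 x2"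
proof -
  interpret \<nu>: biinvariant_haar \<nu> by (rule \<nu>)
  interpret m1: biinvariant_haar m1 by (rule m1)
  interpret m2: biinvariant_haar m2 by (rule m2)
  interpret m12: pair_sigma_finite m1 m2 ..
  interpret m12\<nu>: pair_sigma_finite "m1 \<Otimes>\<^sub>M m2" \<nu> ..
  obtain N where N: "N \<in> null_sets \<nu>" "{x. \<not> P (fst x) (snd x)} \<subseteq> N"
    using ae unfolding eventually_ae_filter by auto
  then have NM: "N \<in> sets borel" by auto
  have notN: "AE x in \<nu>. x \<notin> N" by (rule AE_not_in[OF N(1)])
  have sets12: "sets (m1 \<Otimes>\<^sub>M m2) = sets (borel :: ('a \<times> 'b) measure)"
    by (simp add: borel_prod[symmetric] cong: sets_pair_measure_cong)
  have sets12\<nu>: "sets ((m1 \<Otimes>\<^sub>M m2) \<Otimes>\<^sub>M \<nu>) = sets ((borel :: ('a \<times> 'b) measure) \<Otimes>\<^sub>M borel)"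
    by (intro sets_pair_measure_cong sets12 \<nu>.sets_haar)
  have "{z \<in> space ((m1 \<Otimes>\<^sub>M m2) \<Otimes>\<^sub>M \<nu>). fst z + snd z \<notin> N} \<in> sets ((m1 \<Otimes>\<^sub>M m2) \<Otimes>\<^sub>M \<nu>)"
  proof -
    have "(\<lambda>z. fst z + snd z) \<in> (borel :: ('a \<times> 'b) measure) \<Otimes>\<^sub>M borel \<rightarrow>\<^sub>M borel"
      by (rule borel_group_ops(1)[OF measurable_fst measurable_snd])
    from measurable_sets[OF this, of "- N"]
    have "(\<lambda>z. fst z + snd z) -` (- N) \<in> sets ((borel :: ('a \<times> 'b) measure) \<Otimes>\<^sub>M borel)"
      using NM by (simp add: space_pair_measure)
    moreover have "{z \<in> space ((m1 \<Otimes>\<^sub>M m2) \<Otimes>\<^sub>M \<nu>). fst z + snd z \<notin> N} = (\<lambda>z. fst z + snd z) -` (- N)"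
      by (auto simp: space_pair_measure)
    ultimately show ?thesis by (simp only: sets12\<nu>)
  qed
  moreover have "AE x in m1 \<Otimes>\<^sub>M m2. AE z in \<nu>. x + z \<notin> N"
    by (rule AE_I2) (rule \<nu>.AE_left[OF notN])
  ultimately have "AE z in \<nu>. AE x in m1 \<Otimes>\<^sub>M m2. x + z \<notin> N"
    using m12\<nu>.AE_commute[of "\<lambda>x z. x + z \<notin> N"] by simp
  then obtain z where "AE x in m1 \<Otimes>\<^sub>M m2. x + z \<notin> N" using \<nu>.AE_ex by blast
  then have "AE x1 in m1. AE x2 in m2. (x1, x2) + z \<notin> N" by (rule m12.AE_pair)
  then have "AE x1 in m1. AE x2 in m2. (x1 + fst z, x2 + snd z) \<notin> N" by (simp add: plus_prod_def)
  then have "AE x1 in m1. AE x2 in m2. ((x1 + - fst z) + fst z, x2 + snd z) \<notin> N" by (rule m1.AE_right)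
  then have "AE x1 in m1. AE x2 in m2. (x1, x2 + snd z) \<notin> N" by (simp only: add.assoc left_minus add_0_right)
  then have "AE x1 in m1. AE x2 in m2. (x1, x2) \<notin> N"
  proof (rule eventually_mono)
    fix x1 assume "AE x2 in m2. (x1, x2 + snd z) \<notin> N"
    then have "AE x2 in m2. (x1, (x2 + - snd z) + snd z) \<notin> N" by (rule m2.AE_right)
    then show "AE x2 in m2. (x1, x2) \<notin> N" by (simp only: add.assoc left_minus add_0_right)
  qed
  then show ?thesis
  proof (rule eventually_mono)
    fix x1 assume "AE x2 in m2. (x1, x2) \<notin> N"
    then show "AE x2 in m2. P x1 x2"
    proof (rule eventually_mono)
      fix x2 assume "(x1, x2) \<notin> N"
      then have "(x1, x2) \<notin> {x. \<not> P (fst x) (snd x)}" using N(2) by blast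
      then show "P x1 x2" by simp
    qed
  qed
qed

text \<open>
  By separability the map varies little on a set of positive measure. Steinhaus' theorem provides a
  neighbourhood of small translations, and the dense subgroup moves that set to almost all points.
\<close>

lemma (in biinvariant_haar) equivariant_essentially_uniformly_continuous:
  fixes F :: "'g \<Rightarrow> 'v::real_normed_vector"
  assumes F: "strongly_measurable borel F" and dense: "closure S = UNIV"
    and eq: "\<And>s. s \<in> S \<Longrightarrow> \<exists>T. (\<forall>u v. norm (T u - T v) = norm (u - v)) \<and> (AE x in \<nu>. F (x + s) = T (F x))"
    and e: "0 < e"
  shows "\<exists>W. open W \<and> 0 \<in> W \<and> (\<forall>w\<in>W. AE x in \<nu>. norm (F (- w + x) - F x) \<le> e)"
proof -
  obtain C where C: "countable C" "range F \<subseteq> closure C"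
    using F unfolding strongly_measurable_def by auto
  \<comment> \<open>Countably many of these sets cover the group, so one is not null; two points of
    the same set have values less than \<open>e\<close> apart.\<close>
  define E where "E c = {x. norm (F x - c) < e / 2}" for c
  have diffM: "(\<lambda>x. norm (F x - c)) \<in> borel_measurable borel" for c
    by (intro strongly_measurable_norm strongly_measurable_diff F strongly_measurable_const)
  have E: "E c \<in> sets borel" for c
  proof -
    have "{x \<in> space borel. norm (F x - c) < e / 2} \<in> sets borel"
      using diffM[of c] unfolding borel_measurable_iff_less by blast
    then show ?thesis by (simp add: E_def)
  qed
  have cover: "(\<Union>c\<in>C. E c) = UNIV"
  proof (intro equalityI subsetI UNIV_I)
    fix x :: 'g
    have "F x \<in> closure C" "0 < e / 2" using C(2) e by auto
    then obtain c where "c \<in> C" "dist c (F x) < e / 2" unfolding closure_approachable by blast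
    then show "x \<in> (\<Union>c\<in>C. E c)" by (auto simp: E_def dist_norm norm_minus_commute)
  qed
  have "\<exists>c\<in>C. emeasure \<nu> (E c) \<noteq> 0"
  proof (rule ccontr)
    assume "\<not> ?thesis"
    then have "(\<Union>c\<in>C. E c) \<in> null_sets \<nu>"
      using E by (intro null_sets_UN' C(1) null_setsI) simp_all
    then have "emeasure \<nu> UNIV = 0" unfolding cover by (rule null_setsD1)
    then show False using haar by (simp add: haar_measure_def)
  qed
  then obtain c where c: "emeasure \<nu> (E c) \<noteq> 0" by blast
  have "emeasure \<nu> (E c \<inter> E c) \<noteq> 0" using c by simp
  from overlap_open[OF E E this] obtain W where W: "open W" "0 \<in> W"
    and pos: "\<And>w. w \<in> W \<Longrightarrow> emeasure \<nu> {x\<in>E c. - w + x \<in> E c} \<noteq> 0" by blast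
  have "AE x in \<nu>. norm (F (- w + x) - F x) \<le> e" if w: "w \<in> W" for w
  proof -
    \<comment> \<open>If the bad set \<open>B\<close> were not null, some \<open>s\<close> would
      move a non-null part of it into \<open>A\<close>. There the two values differ by less than
      \<open>e\<close>, while the isometry belonging to \<open>s\<close> preserves their
      difference.\<close>
    define A where "A = {x\<in>E c. - w + x \<in> E c}"
    define B where "B = {x. e < norm (F (- w + x) - F x)}"
    have "A = E c \<inter> (\<lambda>x. - w + x) -` E c" unfolding A_def by auto
    then have AM: "A \<in> sets borel" using E measurable_sets_borel[OF borel_translations(2) E] by simp
    have "(\<lambda>x. norm (F (- w + x) - F x)) \<in> borel_measurable borel"
      by (intro strongly_measurable_norm strongly_measurable_diff F strongly_measurable_compose[OF F borel_translations(2)])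
    then have BM: "B \<in> sets borel" unfolding B_def by (simp add: borel_measurable_iff_greater)
    have "emeasure \<nu> B = 0"
    proof (rule ccontr)
      assume "emeasure \<nu> B \<noteq> 0"
      then obtain s where s: "s \<in> S" "emeasure \<nu> {x\<in>B. x + s \<in> A} \<noteq> 0"
        using dense_translates_overlap[OF AM _ BM _ dense] pos[OF w] unfolding A_def by blast
      obtain T where T: "\<And>u v. norm (T u - T v) = norm (u - v)" "AE x in \<nu>. F (x + s) = T (F x)"
        using eq[OF s(1)] by blast
      have "AE x in \<nu>. F ((- w + x) + s) = T (F (- w + x))" by (rule AE_left[OF T(2)])
      with T(2) have "AE x in \<nu>. x \<notin> {x\<in>B. x + s \<in> A}"
      proof eventually_elim
        case (elim x)
        show ?case
        proof
          assume "x \<in> {x\<in>B. x + s \<in> A}"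
          then have x: "e < norm (F (- w + x) - F x)" "norm (F (x + s) - c) < e / 2"
            "norm (F (- w + x + s) - c) < e / 2"
            by (auto simp: A_def B_def E_def add.assoc)
          have "norm (F (- w + x) - F x) = norm (F (- w + x + s) - F (x + s))"
            by (simp only: elim T(1))
          also have "\<dots> \<le> norm (F (- w + x + s) - c) + norm (F (x + s) - c)" by norm
          finally show False using x by linarith
        qed
      qed
      moreover have "{x\<in>B. x + s \<in> A} \<in> sets \<nu>"
      proof -
        have "{x\<in>B. x + s \<in> A} = B \<inter> (\<lambda>x. x + s) -` A" by auto
        then show ?thesis using BM measurable_sets_borel[OF borel_translations(1) AM] by simp
      qed
      ultimately show False using s(2) AE_iff_null_sets by blast
    qed
    then have "B \<in> null_sets \<nu>" using BM by (intro null_setsI) simp_all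
    then have "AE x in \<nu>. x \<notin> B" by (rule AE_not_in)
    then show ?thesis by (simp add: B_def not_less)
  qed
  then show ?thesis using W by blast
qed

text \<open>On the orbit of one well chosen base point \<open>x0\<close>, the almost everywhere
  equivariance holds exactly. The increments of \<open>F\<close> along this orbit form a cocycle,
  and essential uniform continuity of \<open>F\<close> becomes true uniform continuity on the orbit.
  The vector \<open>v\<close> is \<open>F x0\<close>.\<close>

lemma descended_cocycle:
  fixes \<Gamma> :: "'g::{group_add, topological_space} set"
    and \<pi> :: "'g \<Rightarrow> 'h::{topological_group_add, t2_space, second_countable_topology}"
    and F :: "'h \<Rightarrow> 'v::banach"
  assumes m: "biinvariant_haar m" and ds: "dense_subgroup \<Gamma> \<pi>" and count: "countable \<Gamma>"
    and \<rho>: "isometric_module sc \<Gamma> UNIV \<rho>" and F: "strongly_measurable borel F"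
    and eq: "\<And>\<gamma>. \<gamma> \<in> \<Gamma> \<Longrightarrow> AE y in m. F (y + \<pi> \<gamma>) = \<rho> (- \<gamma>) (F y) + e \<gamma>"
  shows "\<exists>v c. dense_subgroup.unif \<Gamma> \<pi> c \<and>
    (\<forall>\<gamma>\<in>\<Gamma>. \<forall>\<delta>\<in>\<Gamma>. c (\<gamma> + \<delta>) = c \<gamma> + \<rho> \<gamma> (c \<delta>)) \<and> (\<forall>\<gamma>\<in>\<Gamma>. c \<gamma> = \<rho> \<gamma> v - v + e (- \<gamma>))"
proof -
  interpret m: biinvariant_haar m by (rule m)
  interpret ds: dense_subgroup \<Gamma> \<pi> by (rule ds)
  note \<rho>' = \<rho>[unfolded isometric_module_def]
  have \<rho>_add: "\<rho> \<gamma> (v + w) = \<rho> \<gamma> v + \<rho> \<gamma> w" and \<rho>_norm: "norm (\<rho> \<gamma> v) = norm v" if "\<gamma> \<in> \<Gamma>" for \<gamma> v w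
    using \<rho>' that by auto
  have \<rho>_diff: "\<rho> \<gamma> (v - w) = \<rho> \<gamma> v - \<rho> \<gamma> w" if "\<gamma> \<in> \<Gamma>" for \<gamma> v w
    using \<rho>_add[OF that, of "v - w" w] by (simp add: algebra_simps)
  have T: "\<exists>T. (\<forall>u v. norm (T u - T v) = norm (u - v)) \<and> (AE x in m. F (x + s) = T (F x))"
    if s: "s \<in> \<pi> ` \<Gamma>" for s
  proof -
    obtain \<gamma> where \<gamma>: "\<gamma> \<in> \<Gamma>" "s = \<pi> \<gamma>" using s by blast
    have "norm ((\<rho> (- \<gamma>) u + e \<gamma>) - (\<rho> (- \<gamma>) v + e \<gamma>)) = norm (u - v)" for u v
      using \<rho>_norm[OF ds.minus_mem[OF \<gamma>(1)], of "u - v"] by (simp add: \<rho>_diff ds.minus_mem \<gamma>(1))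
    then show ?thesis using eq[OF \<gamma>(1)] \<gamma>(2) by (intro exI[of _ "\<lambda>u. \<rho> (- \<gamma>) u + e \<gamma>"]) simp
  qed
  have "\<forall>n. \<exists>W. open W \<and> 0 \<in> W \<and> (\<forall>w\<in>W. AE x in m. norm (F (- w + x) - F x) \<le> inverse (real (Suc n)))"
    using m.equivariant_essentially_uniformly_continuous[OF F ds.dense T] by simp
  from choice[OF this] obtain W where "\<forall>n. open (W n) \<and> 0 \<in> W n \<and>
      (\<forall>w\<in>W n. AE x in m. norm (F (- w + x) - F x) \<le> inverse (real (Suc n)))" ..
  then have W: "\<And>n. open (W n)" "\<And>n. 0 \<in> W n"
    and W_ae: "\<And>n w. w \<in> W n \<Longrightarrow> AE x in m. norm (F (- w + x) - F x) \<le> inverse (real (Suc n))"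
    by blast+
  \<comment> \<open>Closeness is required for almost every small translation only, the form that
    Fubini can supply at a fixed point. Equivariance is required for all of the countable
    lattice.\<close>
  define good where "good x \<longleftrightarrow>
      (\<forall>n. AE w in m. w \<in> W n \<longrightarrow> norm (F (- w + x) - F x) \<le> inverse (real (Suc n))) \<and>
      (\<forall>\<gamma>\<in>\<Gamma>. F (x + \<pi> \<gamma>) = \<rho> (- \<gamma>) (F x) + e \<gamma>)" for x
  have "AE x in m. AE w in m. w \<in> W n \<longrightarrow> norm (F (- w + x) - F x) \<le> inverse (real (Suc n))" for n
  proof (rule m.AE_swap)
    have [measurable]: "W n \<in> sets borel" using W(1) by simp
    define d where "d z = norm (F (- fst z + snd z) - F (snd z))" for z :: "'h \<times> 'h"
    have [measurable]: "d \<in> borel_measurable (borel \<Otimes>\<^sub>M borel)"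
      unfolding d_def
    proof (intro strongly_measurable_norm strongly_measurable_diff)
      show "strongly_measurable (borel \<Otimes>\<^sub>M borel) (\<lambda>z. F (- fst z + snd z))"
        by (rule strongly_measurable_compose[OF F borel_group_ops(1)[OF borel_group_ops(2)[OF measurable_fst measurable_fst] measurable_snd]])
      show "strongly_measurable (borel \<Otimes>\<^sub>M borel) (\<lambda>z. F (snd z))"
        by (rule strongly_measurable_compose[OF F measurable_snd])
    qed
    have "Measurable.pred (borel \<Otimes>\<^sub>M borel) (\<lambda>z. fst z \<in> W n \<longrightarrow> d z \<le> inverse (real (Suc n)))"
      by measurable
    then show "Measurable.pred (borel \<Otimes>\<^sub>M borel) (\<lambda>(w, x). w \<in> W n \<longrightarrow> norm (F (- w + x) - F x) \<le> inverse (real (Suc n)))"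
      by (simp add: d_def case_prod_unfold)
    show "AE x in m. w \<in> W n \<longrightarrow> norm (F (- w + x) - F x) \<le> inverse (real (Suc n))" for w
      using W_ae[of w n] by (cases "w \<in> W n") simp_all
  qed
  moreover have "AE x in m. \<forall>\<gamma>\<in>\<Gamma>. F (x + \<pi> \<gamma>) = \<rho> (- \<gamma>) (F x) + e \<gamma>"
    using eq by (simp add: AE_ball_countable[OF count])
  ultimately have good_ae: "AE x in m. good x"
    unfolding good_def by (simp add: AE_all_countable AE_conj_iff)
  have "AE x in m. good (x + \<pi> \<gamma>)" for \<gamma> by (rule m.AE_right[OF good_ae])
  then have "AE x in m. \<forall>\<gamma>\<in>\<Gamma>. good (x + \<pi> \<gamma>)" by (simp add: AE_ball_countable[OF count])
  then obtain x0 where x0: "\<And>\<gamma>. \<gamma> \<in> \<Gamma> \<Longrightarrow> good (x0 + \<pi> \<gamma>)" using m.AE_ex by blast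
  have good_x0: "good x0" using x0[OF ds.zero_mem] by (simp add: ds.\<pi>_zero)
  \<comment> \<open>The translations that are small for both points leave an open, hence non-null,
    set of common points \<open>z\<close>, and the values at both points are close to the value at
    some such \<open>z\<close>.\<close>
  have close: "norm (F x - F y) \<le> 2 * inverse (real (Suc n))"
    if x: "good x" and y: "good y" and xy: "y + - x \<in> W n" for x y n
  proof (rule ccontr)
    assume far: "\<not> ?thesis"
    define O' where "O' = (\<lambda>z. x + - z) -` W n \<inter> (\<lambda>z. y + - z) -` W n"
    have near: "AE z in m. x + - z \<in> W n \<longrightarrow> norm (F z - F x) \<le> inverse (real (Suc n))" if "good x" for x
    proof -
      have "AE w in m. w \<in> W n \<longrightarrow> norm (F (- w + x) - F x) \<le> inverse (real (Suc n))"
        using that by (simp add: good_def)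
      then have "AE w in m. x + w \<in> W n \<longrightarrow> norm (F (- (x + w) + x) - F x) \<le> inverse (real (Suc n))"
        by (rule m.AE_left)
      then have "AE z in m. x + - z \<in> W n \<longrightarrow> norm (F (- (x + - z) + x) - F x) \<le> inverse (real (Suc n))"
        by (rule m.AE_uminus)
      moreover have "- (x + - z) + x = z" for z
        by (simp only: minus_add minus_minus add.assoc left_minus add_0_right)
      ultimately show ?thesis by (simp only:)
    qed
    have "open O'"
      unfolding O'_def by (intro open_Int open_vimage[OF W(1)] continuous_intros)
    moreover have "x \<in> O'" unfolding O'_def using W(2) xy by simp
    ultimately have pos: "emeasure m O' \<noteq> 0" using m.open_positive by blast
    have "AE z in m. z \<notin> O'"
      using near[OF x] near[OF y]
    proof eventually_elim
      case (elim z)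
      show ?case
      proof
        assume "z \<in> O'"
        then have "norm (F z - F x) \<le> inverse (real (Suc n))" "norm (F z - F y) \<le> inverse (real (Suc n))"
          using elim by (auto simp: O'_def)
        then have "norm (F x - F y) \<le> inverse (real (Suc n)) + inverse (real (Suc n))" by norm
        then show False using far by simp
      qed
    qed
    then have "O' \<in> null_sets m" using \<open>open O'\<close> by (subst AE_iff_null_sets) simp_all
    then show False using pos null_setsD1 by blast
  qed
  \<comment> \<open>The minus sign turns right equivariance of \<open>F\<close> into the left
    cocycle identity.\<close>
  define c where "c \<gamma> = F (x0 + - \<pi> \<gamma>) - F x0" for \<gamma>
  have good_minus: "good (x0 + - \<pi> \<gamma>)" if "\<gamma> \<in> \<Gamma>" for \<gamma>
    using x0[OF ds.minus_mem[OF that]] by (simp only: ds.\<pi>_minus)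
  have shift: "F (x + - \<pi> \<gamma>) = \<rho> \<gamma> (F x) + e (- \<gamma>)" if "good x" "\<gamma> \<in> \<Gamma>" for x \<gamma>
  proof -
    have "F (x + \<pi> (- \<gamma>)) = \<rho> (- (- \<gamma>)) (F x) + e (- \<gamma>)"
      using that(1) ds.minus_mem[OF that(2)] unfolding good_def by blast
    then show ?thesis by (simp only: ds.\<pi>_minus minus_minus)
  qed
  have c_eq: "c \<gamma> = \<rho> \<gamma> (F x0) - F x0 + e (- \<gamma>)" if "\<gamma> \<in> \<Gamma>" for \<gamma>
    using shift[OF good_x0 that] by (simp add: c_def)
  have c_coc: "c (\<gamma> + \<delta>) = c \<gamma> + \<rho> \<gamma> (c \<delta>)" if "\<gamma> \<in> \<Gamma>" "\<delta> \<in> \<Gamma>" for \<gamma> \<delta>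
  proof -
    have "x0 + - \<pi> (\<gamma> + \<delta>) = (x0 + - \<pi> \<delta>) + - \<pi> \<gamma>"
      by (simp only: ds.hom minus_add add.assoc)
    then have "c (\<gamma> + \<delta>) = \<rho> \<gamma> (F (x0 + - \<pi> \<delta>)) + e (- \<gamma>) - F x0"
      using shift[OF good_minus[OF that(2)] that(1)] by (simp only: c_def)
    also have "F (x0 + - \<pi> \<delta>) = c \<delta> + F x0" unfolding c_def by simp
    also have "\<rho> \<gamma> (c \<delta> + F x0) + e (- \<gamma>) - F x0 = c \<gamma> + \<rho> \<gamma> (c \<delta>)"
      by (simp add: \<rho>_add[OF that(1)] c_eq[OF that(1)])
    finally show ?thesis .
  qed
  have "ds.unif c"
    unfolding ds.unif_def
  proof (intro allI impI)
    fix r :: real assume "0 < r"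
    then obtain n where n: "inverse (real (Suc n)) < r / 2" using reals_Archimedean[of "r / 2"] by auto
    show "\<exists>U. open U \<and> 0 \<in> U \<and> (\<forall>\<gamma>\<in>\<Gamma>. \<forall>\<delta>\<in>\<Gamma>. - \<pi> \<gamma> + \<pi> \<delta> \<in> U \<longrightarrow> norm (c \<gamma> - c \<delta>) \<le> r)"
    \<comment> \<open>\<open>close\<close> is stated for right differences on the orbit,
      \<open>unif\<close> for left differences in the factor. They differ by conjugation with the
      fixed point \<open>x0\<close>.\<close>
    proof (intro exI[of _ "(\<lambda>u. x0 + u + - x0) -` W n"] conjI ballI impI)
      show "open ((\<lambda>u. x0 + u + - x0) -` W n)"
        by (intro open_vimage[OF W(1)] continuous_intros)
      show "0 \<in> (\<lambda>u. x0 + u + - x0) -` W n" using W(2) by simp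
      fix \<gamma> \<delta> assume \<gamma>: "\<gamma> \<in> \<Gamma>" and \<delta>: "\<delta> \<in> \<Gamma>" and "- \<pi> \<gamma> + \<pi> \<delta> \<in> (\<lambda>u. x0 + u + - x0) -` W n"
      then have "x0 + (- \<pi> \<gamma> + \<pi> \<delta>) + - x0 \<in> W n" by simp
      also have "x0 + (- \<pi> \<gamma> + \<pi> \<delta>) + - x0 = (x0 + - \<pi> \<gamma>) + - (x0 + - \<pi> \<delta>)"
        by (simp only: minus_add minus_minus add.assoc)
      finally have "norm (F (x0 + - \<pi> \<delta>) - F (x0 + - \<pi> \<gamma>)) \<le> 2 * inverse (real (Suc n))"
        by (rule close[OF good_minus[OF \<delta>] good_minus[OF \<gamma>]])
      moreover have "norm (F (x0 + - \<pi> \<delta>) - F (x0 + - \<pi> \<gamma>)) = norm (c \<gamma> - c \<delta>)"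
        by (simp add: c_def norm_minus_commute)
      ultimately show "norm (c \<gamma> - c \<delta>) \<le> r" using n by linarith
    qed
  qed
  then show ?thesis using c_coc c_eq by blast
qed

text \<open>The hypothesis \<open>mixed\<close> says that a mixed second difference vanishes. A base
  point reduces this to a sum of functions of one coordinate each, and separation of variables makes
  each summand equivariant up to a constant. The two resulting cocycles are extended to the factors
  separately.\<close>

lemma left_coset_equivariant_splits:
  fixes sc :: "'k::{real_normed_field, euclidean_space} \<Rightarrow> 'v::banach \<Rightarrow> 'v"
    and \<Gamma> D :: "('a::{topological_group_add, t2_space, second_countable_topology} \<times>
      'b::{topological_group_add, t2_space, second_countable_topology}) set"
  assumes lat: "lattice_domain \<nu> \<Gamma> D"
    and lc1: "locally_compact_space (euclidean :: 'a topology)"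
    and lc2: "locally_compact_space (euclidean :: 'b topology)"
    and dense1: "closure (fst ` \<Gamma>) = UNIV" and dense2: "closure (snd ` \<Gamma>) = UNIV"
    and sc: "scalar_mult sc" and \<rho>: "isometric_module sc \<Gamma> UNIV \<rho>"
    and F: "strongly_measurable borel F"
    and equiv: "\<And>x \<gamma>. \<gamma> \<in> \<Gamma> \<Longrightarrow> F (x + \<gamma>) = \<rho> (- \<gamma>) (F x) + c (- \<gamma>)"
    and mixed: "\<And>g. AE x in \<nu>. F (g + x) = F ((fst g, 0) + x) + F ((0, snd g) + x) - F x"
  shows "\<exists>V1 V2 \<sigma>1 \<sigma>2 b1 b2 v.
    closed_subspace sc V1 \<and> (\<forall>\<gamma>\<in>\<Gamma>. \<rho> \<gamma> ` V1 \<subseteq> V1) \<and> extends_through sc \<Gamma> \<rho> fst V1 \<sigma>1 \<and>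
    closed_subspace sc V2 \<and> (\<forall>\<gamma>\<in>\<Gamma>. \<rho> \<gamma> ` V2 \<subseteq> V2) \<and> extends_through sc \<Gamma> \<rho> snd V2 \<sigma>2 \<and>
    b1 \<in> cocycles UNIV V1 \<sigma>1 \<and> b2 \<in> cocycles UNIV V2 \<sigma>2 \<and>
    (\<forall>g\<in>\<Gamma>. \<forall>h\<in>\<Gamma>. c h - c g - (b1 g h + b2 g h) = \<rho> h v - \<rho> g v) \<and>
    (\<forall>g h g' h'. fst g = fst g' \<and> fst h = fst h' \<longrightarrow> b1 g h = b1 g' h') \<and>
    (\<forall>g h g' h'. snd g = snd g' \<and> snd h = snd h' \<longrightarrow> b2 g h = b2 g' h')"
proof -
  interpret lattice_domain \<nu> \<Gamma> D by (rule lat)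
  have bi: "biinvariant_haar \<nu>" by unfold_locales
  have fst_cont: "continuous_on UNIV (fst :: 'a \<times> 'b \<Rightarrow> 'a)" and snd_cont: "continuous_on UNIV (snd :: 'a \<times> 'b \<Rightarrow> 'b)"
    by (intro continuous_on_fst continuous_on_snd continuous_on_id)+
  obtain U1 K1 where K1: "open U1" "compact K1" "(0 :: 'a) \<in> U1" "U1 \<subseteq> K1"
    using locally_compact_nhd[OF lc1 open_UNIV, of 0] by blast
  obtain U2 K2 where K2: "open U2" "compact K2" "(0 :: 'b) \<in> U2" "U2 \<subseteq> K2"
    using locally_compact_nhd[OF lc2 open_UNIV, of 0] by blast
  \<comment> \<open>A compact \<open>K2\<close> with interior points gives a slab of positive
    measure, while compact sets of the first factor cut it in compact boxes of finite
    measure.\<close>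
  have "\<exists>m1 :: 'a measure. biinvariant_haar m1"
  proof
    have eq: "fst -` C \<inter> (UNIV \<times> K2) = C \<times> K2" for C :: "'a set" by auto
    have "emeasure \<nu> (UNIV \<times> U2) \<noteq> 0"
      using K2 by (intro open_positive open_Times) auto
    moreover have "UNIV \<times> K2 \<in> sets (borel :: ('a \<times> 'b) measure)"
      using compact_imp_closed[OF K2(2)] by (intro borel_closed closed_Times) simp_all
    moreover from this have "emeasure \<nu> (UNIV \<times> U2) \<le> emeasure \<nu> (UNIV \<times> K2)"
      using K2(4) by (intro emeasure_mono) auto
    ultimately show "biinvariant_haar (distr (restrict_space \<nu> (UNIV \<times> K2)) borel fst)"
      using K2(2) compact_finite[OF compact_Times]
      by (intro marginal_haar[where s = "\<lambda>h. (h, 0)"] lc1 fst_cont) (auto simp: eq)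
  qed
  then obtain m1 :: "'a measure" where m1: "biinvariant_haar m1" by blast
  have "\<exists>m2 :: 'b measure. biinvariant_haar m2"
  proof
    have eq: "snd -` C \<inter> (K1 \<times> UNIV) = K1 \<times> C" for C :: "'b set" by auto
    have "emeasure \<nu> (U1 \<times> UNIV) \<noteq> 0"
      using K1 by (intro open_positive open_Times) auto
    moreover have "K1 \<times> UNIV \<in> sets (borel :: ('a \<times> 'b) measure)"
      using compact_imp_closed[OF K1(2)] by (intro borel_closed closed_Times) simp_all
    moreover from this have "emeasure \<nu> (U1 \<times> UNIV) \<le> emeasure \<nu> (K1 \<times> UNIV)"
      using K1(4) by (intro emeasure_mono) auto
    ultimately show "biinvariant_haar (distr (restrict_space \<nu> (K1 \<times> UNIV)) borel snd)"
      using K1(2) compact_finite[OF compact_Times]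
      by (intro marginal_haar[where s = "\<lambda>h. (0, h)"] lc2 snd_cont) (auto simp: eq)
  qed
  then obtain m2 :: "'b measure" where m2: "biinvariant_haar m2" by blast
  interpret m1: biinvariant_haar m1 by (rule m1)
  interpret m2: biinvariant_haar m2 by (rule m2)
  \<comment> \<open>The null set in \<open>mixed\<close> depends on \<open>g\<close>; after the swap
    one base point \<open>a\<close> serves almost every \<open>g\<close>.\<close>
  have "AE x in \<nu>. AE g in \<nu>. F (g + x) = F ((fst g, 0) + x) + F ((0, snd g) + x) - F x"
  proof (rule AE_swap)
    define d where "d z = norm (F (fst z + snd z) - (F ((fst (fst z), 0) + snd z) + F ((0, snd (fst z)) + snd z) - F (snd z)))"
      for z :: "('a \<times> 'b) \<times> ('a \<times> 'b)"
    have fM: "(\<lambda>g. (fst g, 0)) \<in> borel_measurable (borel :: ('a \<times> 'b) measure)"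
      "(\<lambda>g. (0, snd g)) \<in> borel_measurable (borel :: ('a \<times> 'b) measure)"
      by (intro borel_measurable_continuous_onI continuous_on_Pair fst_cont snd_cont continuous_on_const)+
    have sm: "strongly_measurable (borel \<Otimes>\<^sub>M borel) (\<lambda>z. F (f (fst z) + snd z))"
      if "f \<in> borel_measurable borel" for f :: "'a \<times> 'b \<Rightarrow> 'a \<times> 'b"
      by (rule strongly_measurable_compose[OF F borel_group_ops(1)[OF measurable_compose[OF measurable_fst that] measurable_snd]])
    have [measurable]: "d \<in> borel_measurable (borel \<Otimes>\<^sub>M borel)"
      unfolding d_def
      by (intro strongly_measurable_norm strongly_measurable_diff strongly_measurable_add
          sm[of "\<lambda>g. g", simplified] sm[OF fM(1)] sm[OF fM(2)] strongly_measurable_compose[OF F measurable_snd])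
    have "Measurable.pred (borel \<Otimes>\<^sub>M borel) (\<lambda>z. d z = 0)" by measurable
    then show "Measurable.pred (borel \<Otimes>\<^sub>M borel) (\<lambda>(g, x). F (g + x) = F ((fst g, 0) + x) + F ((0, snd g) + x) - F x)"
      by (simp only: d_def case_prod_unfold norm_eq_zero right_minus_eq)
  qed (rule mixed)
  then obtain a where "AE g in \<nu>. F (g + a) = F ((fst g, 0) + a) + F ((0, snd g) + a) - F a" using AE_ex by blast
  then have "AE g in \<nu>. F ((g + - a) + a) = F ((fst (g + - a), 0) + a) + F ((0, snd (g + - a)) + a) - F a"
    by (rule AE_right)
  moreover have "(g + - a) + a = g" "(fst (g + - a), 0) + a = (fst g, snd a)" "(0, snd (g + - a)) + a = (fst a, snd g)" for g
    by (simp_all add: prod_eq_iff add.assoc)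
  ultimately have split0: "AE g in \<nu>. F g = F (fst g, snd a) + F (fst a, snd g) - F a" by (simp only:)
  \<comment> \<open>The constant \<open>F a\<close>, counted twice along the two coordinate slices,
    is removed from the first summand.\<close>
  define F1 where "F1 y = F (y, snd a) - F a" for y
  define F2 where "F2 y = F (fst a, y)" for y
  have split: "AE g in \<nu>. F g = F1 (fst g) + F2 (snd g)"
    using split0 by (rule eventually_mono) (simp add: F1_def F2_def)
  have F1: "strongly_measurable borel F1"
    unfolding F1_def
    by (intro strongly_measurable_diff strongly_measurable_const strongly_measurable_compose[OF F]
        borel_measurable_continuous_onI continuous_on_Pair continuous_on_id continuous_on_const)
  have F2: "strongly_measurable borel F2"
    unfolding F2_def
    by (intro strongly_measurable_compose[OF F]
        borel_measurable_continuous_onI continuous_on_Pair continuous_on_id continuous_on_const)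
  note \<rho>' = \<rho>[unfolded isometric_module_def]
  have \<rho>_add: "\<rho> \<gamma> (v + w) = \<rho> \<gamma> v + \<rho> \<gamma> w" if "\<gamma> \<in> \<Gamma>" for \<gamma> v w using \<rho>' that by auto
  have "\<exists>e. (AE y in m1. F1 (y + fst \<gamma>) = \<rho> (- \<gamma>) (F1 y) + (c (- \<gamma>) - e)) \<and>
      (AE y in m2. F2 (y + snd \<gamma>) = \<rho> (- \<gamma>) (F2 y) + e)" if \<gamma>: "\<gamma> \<in> \<Gamma>" for \<gamma>
  proof -
    have "AE y in \<nu>. F (y + \<gamma>) = F1 (fst (y + \<gamma>)) + F2 (snd (y + \<gamma>))" by (rule AE_right[OF split])
    with split have "AE y in \<nu>. F1 (fst y + fst \<gamma>) + F2 (snd y + snd \<gamma>) = \<rho> (- \<gamma>) (F1 (fst y) + F2 (snd y)) + c (- \<gamma>)"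
    proof eventually_elim
      case (elim y)
      have "F1 (fst y + fst \<gamma>) + F2 (snd y + snd \<gamma>) = F (y + \<gamma>)" using elim(2) by simp
      also have "\<dots> = \<rho> (- \<gamma>) (F y) + c (- \<gamma>)" by (rule equiv[OF \<gamma>])
      finally show ?case by (simp only: elim(1))
    qed
    from AE_product[OF bi m1 m2 this]
    have ae: "AE y1 in m1. AE y2 in m2. F1 (y1 + fst \<gamma>) + F2 (y2 + snd \<gamma>) = \<rho> (- \<gamma>) (F1 y1 + F2 y2) + c (- \<gamma>)" .
    then obtain z where z: "AE y2 in m2. F1 (z + fst \<gamma>) + F2 (y2 + snd \<gamma>) = \<rho> (- \<gamma>) (F1 z + F2 y2) + c (- \<gamma>)"
      using m1.AE_ex by blast
    \<comment> \<open>After the variables are separated, one side depends on the first coordinate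
      only and the other on the second, so both are constant; \<open>e\<close> is that constant read
      at the slice through \<open>z\<close>.\<close>
    define e where "e = \<rho> (- \<gamma>) (F1 z) + c (- \<gamma>) - F1 (z + fst \<gamma>)"
    have 2: "AE y in m2. F2 (y + snd \<gamma>) = \<rho> (- \<gamma>) (F2 y) + e"
      using z by (rule eventually_mono) (simp add: e_def \<rho>_add[OF minus_mem[OF \<gamma>]] algebra_simps eq_diff_eq)
    have "AE y in m1. F1 (y + fst \<gamma>) = \<rho> (- \<gamma>) (F1 y) + (c (- \<gamma>) - e)"
      using ae
    proof (rule eventually_mono)
      fix y assume "AE y2 in m2. F1 (y + fst \<gamma>) + F2 (y2 + snd \<gamma>) = \<rho> (- \<gamma>) (F1 y + F2 y2) + c (- \<gamma>)"
      with 2 have "AE y2 in m2. F1 (y + fst \<gamma>) = \<rho> (- \<gamma>) (F1 y) + (c (- \<gamma>) - e)"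
      proof eventually_elim
        case (elim y2)
        have "F1 (y + fst \<gamma>) + (\<rho> (- \<gamma>) (F2 y2) + e) = \<rho> (- \<gamma>) (F1 y) + \<rho> (- \<gamma>) (F2 y2) + c (- \<gamma>)"
          using elim(2) by (simp only: elim(1) \<rho>_add[OF minus_mem[OF \<gamma>]])
        then show ?case by (simp add: algebra_simps eq_diff_eq)
      qed
      then show "F1 (y + fst \<gamma>) = \<rho> (- \<gamma>) (F1 y) + (c (- \<gamma>) - e)" using m2.AE_ex by blast
    qed
    then show ?thesis using 2 by blast
  qed
  then have "\<forall>\<gamma>\<in>\<Gamma>. \<exists>e. (AE y in m1. F1 (y + fst \<gamma>) = \<rho> (- \<gamma>) (F1 y) + (c (- \<gamma>) - e)) \<and>
      (AE y in m2. F2 (y + snd \<gamma>) = \<rho> (- \<gamma>) (F2 y) + e)" by (rule ballI)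
  from bchoice[OF this] obtain e where
    e: "\<forall>\<gamma>\<in>\<Gamma>. (AE y in m1. F1 (y + fst \<gamma>) = \<rho> (- \<gamma>) (F1 y) + (c (- \<gamma>) - e \<gamma>)) \<and>
      (AE y in m2. F2 (y + snd \<gamma>) = \<rho> (- \<gamma>) (F2 y) + e \<gamma>)" ..
  have e1: "AE y in m1. F1 (y + fst \<gamma>) = \<rho> (- \<gamma>) (F1 y) + (c (- \<gamma>) - e \<gamma>)"
    and e2: "AE y in m2. F2 (y + snd \<gamma>) = \<rho> (- \<gamma>) (F2 y) + e \<gamma>" if "\<gamma> \<in> \<Gamma>" for \<gamma>
    using bspec[OF e that] by simp_all
  have ds1: "dense_subgroup \<Gamma> (fst :: 'a \<times> 'b \<Rightarrow> 'a)" and ds2: "dense_subgroup \<Gamma> (snd :: 'a \<times> 'b \<Rightarrow> 'b)"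
    using subgroup dense1 dense2 by unfold_locales simp_all
  \<comment> \<open>The constants of the first summand are
    \<open>c (- \<gamma>) - e \<gamma>\<close>; \<open>descended_cocycle\<close> evaluates them at
    \<open>- \<gamma>\<close>, whence the double minus. In the sum with the second summand the terms
    with \<open>e\<close> cancel.\<close>
  have "\<exists>v1 c1. dense_subgroup.unif \<Gamma> fst c1 \<and>
      (\<forall>\<gamma>\<in>\<Gamma>. \<forall>\<delta>\<in>\<Gamma>. c1 (\<gamma> + \<delta>) = c1 \<gamma> + \<rho> \<gamma> (c1 \<delta>)) \<and>
      (\<forall>\<gamma>\<in>\<Gamma>. c1 \<gamma> = \<rho> \<gamma> v1 - v1 + (c (- (- \<gamma>)) - e (- \<gamma>)))"
    by (rule descended_cocycle[OF m1 ds1 countable_lattice \<rho> F1 e1])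
  then obtain v1 c1 where c1': "dense_subgroup.unif \<Gamma> fst c1 \<and>
      (\<forall>\<gamma>\<in>\<Gamma>. \<forall>\<delta>\<in>\<Gamma>. c1 (\<gamma> + \<delta>) = c1 \<gamma> + \<rho> \<gamma> (c1 \<delta>)) \<and>
      (\<forall>\<gamma>\<in>\<Gamma>. c1 \<gamma> = \<rho> \<gamma> v1 - v1 + (c (- (- \<gamma>)) - e (- \<gamma>)))" by blast
  then have c1: "dense_subgroup.unif \<Gamma> fst c1"
      "\<And>\<gamma> \<delta>. \<gamma> \<in> \<Gamma> \<Longrightarrow> \<delta> \<in> \<Gamma> \<Longrightarrow> c1 (\<gamma> + \<delta>) = c1 \<gamma> + \<rho> \<gamma> (c1 \<delta>)"
      "\<And>\<gamma>. \<gamma> \<in> \<Gamma> \<Longrightarrow> c1 \<gamma> = \<rho> \<gamma> v1 - v1 + (c (- (- \<gamma>)) - e (- \<gamma>))"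
    by simp_all
  have "\<exists>v2 c2. dense_subgroup.unif \<Gamma> snd c2 \<and>
      (\<forall>\<gamma>\<in>\<Gamma>. \<forall>\<delta>\<in>\<Gamma>. c2 (\<gamma> + \<delta>) = c2 \<gamma> + \<rho> \<gamma> (c2 \<delta>)) \<and>
      (\<forall>\<gamma>\<in>\<Gamma>. c2 \<gamma> = \<rho> \<gamma> v2 - v2 + e (- \<gamma>))"
    by (rule descended_cocycle[OF m2 ds2 countable_lattice \<rho> F2 e2])
  then obtain v2 c2 where c2': "dense_subgroup.unif \<Gamma> snd c2 \<and>
      (\<forall>\<gamma>\<in>\<Gamma>. \<forall>\<delta>\<in>\<Gamma>. c2 (\<gamma> + \<delta>) = c2 \<gamma> + \<rho> \<gamma> (c2 \<delta>)) \<and>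
      (\<forall>\<gamma>\<in>\<Gamma>. c2 \<gamma> = \<rho> \<gamma> v2 - v2 + e (- \<gamma>))" by blast
  then have c2: "dense_subgroup.unif \<Gamma> snd c2"
      "\<And>\<gamma> \<delta>. \<gamma> \<in> \<Gamma> \<Longrightarrow> \<delta> \<in> \<Gamma> \<Longrightarrow> c2 (\<gamma> + \<delta>) = c2 \<gamma> + \<rho> \<gamma> (c2 \<delta>)"
      "\<And>\<gamma>. \<gamma> \<in> \<Gamma> \<Longrightarrow> c2 \<gamma> = \<rho> \<gamma> v2 - v2 + e (- \<gamma>)"
    by simp_all
  obtain V1 \<sigma>1 b1 where b1: "closed_subspace sc V1 \<and> (\<forall>\<gamma>\<in>\<Gamma>. \<rho> \<gamma> ` V1 \<subseteq> V1) \<and> extends_through sc \<Gamma> \<rho> fst V1 \<sigma>1"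
      "b1 \<in> cocycles UNIV V1 \<sigma>1" "\<forall>g\<in>\<Gamma>. \<forall>h\<in>\<Gamma>. b1 g h = c1 h - c1 g"
      "\<forall>g h g' h'. fst g = fst g' \<and> fst h = fst h' \<longrightarrow> b1 g h = b1 g' h'"
    using dense_subgroup.extension_exists[OF ds1 sc \<rho> fst_cont c1(1,2)] by blast
  obtain V2 \<sigma>2 b2 where b2: "closed_subspace sc V2 \<and> (\<forall>\<gamma>\<in>\<Gamma>. \<rho> \<gamma> ` V2 \<subseteq> V2) \<and> extends_through sc \<Gamma> \<rho> snd V2 \<sigma>2"
      "b2 \<in> cocycles UNIV V2 \<sigma>2" "\<forall>g\<in>\<Gamma>. \<forall>h\<in>\<Gamma>. b2 g h = c2 h - c2 g"
      "\<forall>g h g' h'. snd g = snd g' \<and> snd h = snd h' \<longrightarrow> b2 g h = b2 g' h'"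
    using dense_subgroup.extension_exists[OF ds2 sc \<rho> snd_cont c2(1,2)] by blast
  have \<rho>_minus: "\<rho> \<gamma> (- v) = - \<rho> \<gamma> v" if "\<gamma> \<in> \<Gamma>" for \<gamma> v
  proof -
    have "\<rho> \<gamma> 0 = 0" using \<rho>_add[OF that, of 0 0] by simp
    then show ?thesis using \<rho>_add[OF that, of v "- v"] by (simp add: eq_neg_iff_add_eq_0 add.commute)
  qed
  \<comment> \<open>\<open>c1 + c2\<close> exceeds \<open>c\<close> by the coboundary of
    \<open>v1 + v2\<close>; the witness has the opposite sign because \<open>c\<close> comes first
    in the difference.\<close>
  have coh: "\<forall>g\<in>\<Gamma>. \<forall>h\<in>\<Gamma>. c h - c g - (b1 g h + b2 g h) = \<rho> h (- (v1 + v2)) - \<rho> g (- (v1 + v2))"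
  proof (intro ballI)
    fix g h assume g: "g \<in> \<Gamma>" and h: "h \<in> \<Gamma>"
    have sum: "c1 \<gamma> + c2 \<gamma> = \<rho> \<gamma> v1 - v1 + (\<rho> \<gamma> v2 - v2) + c \<gamma>" if "\<gamma> \<in> \<Gamma>" for \<gamma>
      using c1(3)[OF that] c2(3)[OF that] by simp
    have "b1 g h + b2 g h = (c1 h + c2 h) - (c1 g + c2 g)" using b1(3) b2(3) g h by simp
    also have "\<dots> = (\<rho> h v1 - v1 + (\<rho> h v2 - v2) + c h) - (\<rho> g v1 - v1 + (\<rho> g v2 - v2) + c g)"
      by (simp only: sum[OF g] sum[OF h])
    finally show "c h - c g - (b1 g h + b2 g h) = \<rho> h (- (v1 + v2)) - \<rho> g (- (v1 + v2))"
      by (simp only: \<rho>_minus[OF g] \<rho>_minus[OF h] \<rho>_add[OF g] \<rho>_add[OF h]) simp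
  qed
  show ?thesis
    by (rule exI[of _ V1], rule exI[of _ V2], rule exI[of _ \<sigma>1], rule exI[of _ \<sigma>2], rule exI[of _ b1],
        rule exI[of _ b2], rule exI[of _ "- (v1 + v2)"])
      (intro conjI coh b1(2,4) b2(2,4) b1(1)[THEN conjunct1] b1(1)[THEN conjunct2, THEN conjunct1]
        b1(1)[THEN conjunct2, THEN conjunct2] b2(1)[THEN conjunct1] b2(1)[THEN conjunct2, THEN conjunct1]
        b2(1)[THEN conjunct2, THEN conjunct2])
qed

section \<open>The induced affine action\<close>

locale induced_module = lattice_domain \<nu> \<Gamma> D
  for \<nu> :: "'g::{topological_group_add, t2_space, second_countable_topology} measure" and \<Gamma> D +
  fixes sc :: "'k::{real_normed_field, euclidean_space} \<Rightarrow> 'v::banach \<Rightarrow> 'v"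
    and \<rho> :: "'g \<Rightarrow> 'v \<Rightarrow> 'v" and p :: real
  assumes sc: "scalar_mult sc" and \<rho>: "isometric_module sc \<Gamma> UNIV \<rho>" and p_gt_1: "1 < p"
begin

sublocale L: Lebesgue_space M p
  using prob_M p_gt_1 by (simp add: Lebesgue_space_def Lebesgue_space_axioms_def)

lemma \<rho>_add: "\<gamma> \<in> \<Gamma> \<Longrightarrow> \<rho> \<gamma> (v + w) = \<rho> \<gamma> v + \<rho> \<gamma> w"
  and \<rho>_sc: "\<gamma> \<in> \<Gamma> \<Longrightarrow> \<rho> \<gamma> (sc a v) = sc a (\<rho> \<gamma> v)"
  and \<rho>_norm: "\<gamma> \<in> \<Gamma> \<Longrightarrow> norm (\<rho> \<gamma> v) = norm v"
  and \<rho>_mult: "\<gamma> \<in> \<Gamma> \<Longrightarrow> \<delta> \<in> \<Gamma> \<Longrightarrow> \<rho> (\<gamma> + \<delta>) v = \<rho> \<gamma> (\<rho> \<delta> v)"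
  and \<rho>_zero: "\<rho> 0 v = v"
  using \<rho> unfolding isometric_module_def by auto

lemma \<rho>_diff: "\<gamma> \<in> \<Gamma> \<Longrightarrow> \<rho> \<gamma> (v - w) = \<rho> \<gamma> v - \<rho> \<gamma> w"
  using \<rho>_add[of \<gamma> "v - w" w] by (simp add: algebra_simps)

lemma \<rho>_0: "\<gamma> \<in> \<Gamma> \<Longrightarrow> \<rho> \<gamma> 0 = 0"
  using \<rho>_norm[of \<gamma> 0] by simp

lemma \<rho>_continuous: "\<gamma> \<in> \<Gamma> \<Longrightarrow> continuous_on UNIV (\<rho> \<gamma>)"
  by (rule continuous_on_iff[THEN iffD2]) (auto simp: dist_norm \<rho>_norm simp flip: \<rho>_diff)

text \<open>The inhomogeneous form of a 1-cocycle: the homogeneous \<open>b\<close> of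
  \<open>cocycles\<close> corresponds to \<open>c \<gamma> = b 0 \<gamma>\<close>.\<close>

definition cocycle :: "('g \<Rightarrow> 'v) \<Rightarrow> bool" where
  "cocycle c \<longleftrightarrow> (\<forall>\<gamma>\<in>\<Gamma>. \<forall>\<delta>\<in>\<Gamma>. c (\<gamma> + \<delta>) = c \<gamma> + \<rho> \<gamma> (c \<delta>))"

lemma cocycleD: "cocycle c \<Longrightarrow> \<gamma> \<in> \<Gamma> \<Longrightarrow> \<delta> \<in> \<Gamma> \<Longrightarrow> c (\<gamma> + \<delta>) = c \<gamma> + \<rho> \<gamma> (c \<delta>)"
  by (simp add: cocycle_def)

lemma cocycle_at_zero: "cocycle c \<Longrightarrow> c 0 = 0"
  using cocycleD[of c 0 0] zero_mem by (simp add: \<rho>_zero)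

lemma cocycle_zero: "cocycle (\<lambda>_. 0)" by (simp add: cocycle_def \<rho>_0)

text \<open>A cocycle makes \<open>\<Gamma>\<close> act on the module by the affine isometries that
  send \<open>v\<close> to \<open>c \<gamma> + \<rho> \<gamma> v\<close>. On \<open>D\<close> the
  lift is \<open>\<eta>\<close> composed with \<open>q\<close>, and the affine map of
  \<open>\<kappa> x\<close> continues it to all other points.\<close>

definition lift :: "('g \<Rightarrow> 'v) \<Rightarrow> ('g set \<Rightarrow> 'v) \<Rightarrow> 'g \<Rightarrow> 'v" where
  "lift c \<eta> x = c (\<kappa> x) + \<rho> (\<kappa> x) (\<eta> (q x))"

text \<open>Left translation of the lift, read off again on \<open>D\<close>. The zero cocycle gives
  the induced representation, and \<open>act c g\<close> differs from it by the displacement of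
  0.\<close>

definition act :: "('g \<Rightarrow> 'v) \<Rightarrow> 'g \<Rightarrow> ('g set \<Rightarrow> 'v) \<Rightarrow> 'g set \<Rightarrow> 'v" where
  "act c g \<eta> C = lift c \<eta> (- g + rep C)"

abbreviation lin :: "'g \<Rightarrow> ('g set \<Rightarrow> 'v) \<Rightarrow> 'g set \<Rightarrow> 'v" where "lin \<equiv> act (\<lambda>_. 0)"

lemma lift_equivariant:
  assumes c: "cocycle c" and \<gamma>: "\<gamma> \<in> \<Gamma>"
  shows "lift c \<eta> (x + \<gamma>) = \<rho> (- \<gamma>) (lift c \<eta> x) + c (- \<gamma>)"
  unfolding lift_def \<kappa>_shift[OF \<gamma>] q_shift[OF \<gamma>] cocycleD[OF c minus_mem[OF \<gamma>] \<kappa>_mem]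
    \<rho>_mult[OF minus_mem[OF \<gamma>] \<kappa>_mem] \<rho>_add[OF minus_mem[OF \<gamma>]]
  by (simp add: algebra_simps)

text \<open>On lifts the affine action is plain left translation, by equivariance. The group law
  \<open>act_act\<close> and all later computations with second differences rest on this.\<close>

lemma lift_act:
  assumes c: "cocycle c" shows "lift c (act c g \<eta>) x = lift c \<eta> (- g + x)"
proof -
  let ?k = "\<kappa> x"
  have "lift c (act c g \<eta>) x = c ?k + \<rho> ?k (lift c \<eta> ((- g + x) + ?k))"
    unfolding lift_def[of c "act c g \<eta>"] act_def rep_q by (simp only: add.assoc)
  also have "\<dots> = c ?k + \<rho> ?k (c (- ?k)) + \<rho> ?k (\<rho> (- ?k) (lift c \<eta> (- g + x)))"
    unfolding lift_equivariant[OF c \<kappa>_mem] \<rho>_add[OF \<kappa>_mem] by simp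
  also have "\<dots> = c (?k + - ?k) + \<rho> (?k + - ?k) (lift c \<eta> (- g + x))"
    by (simp only: cocycleD[OF c \<kappa>_mem minus_mem[OF \<kappa>_mem]] \<rho>_mult[OF \<kappa>_mem minus_mem[OF \<kappa>_mem]])
  finally show ?thesis by (simp add: cocycle_at_zero[OF c] \<rho>_zero)
qed

lemma act_act: "cocycle c \<Longrightarrow> act c g (act c h \<eta>) = act c (g + h) \<eta>"
  unfolding act_def[of c g] act_def[of c "g + h"]
  by (rule ext) (simp only: lift_act minus_add add.assoc)

lemma rep_space: "C \<in> space M \<Longrightarrow> rep C \<in> D" "C \<in> space M \<Longrightarrow> q (rep C) = C"
  unfolding space_M by (auto simp: rep_q \<kappa>_D q_shift \<kappa>_mem)

lemma act_zero: "cocycle c \<Longrightarrow> C \<in> space M \<Longrightarrow> act c 0 \<eta> C = \<eta> C"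
  by (simp add: act_def lift_def \<kappa>_zero rep_space cocycle_at_zero \<rho>_zero)

lemma lift_diff: "lift c \<eta> x - lift c \<xi> x = lift (\<lambda>_. 0) (\<lambda>C. \<eta> C - \<xi> C) x"
  by (simp add: lift_def \<rho>_diff[OF \<kappa>_mem])

lemma act_diff: "act c g \<eta> C - act c g \<xi> C = lin g (\<lambda>C. \<eta> C - \<xi> C) C"
  by (simp add: act_def lift_diff)

lemma act_eq: "act c g \<eta> C = act c g (\<lambda>_. 0) C + lin g \<eta> C"
  by (simp add: act_def lift_def \<rho>_0[OF \<kappa>_mem])

lemma lin_add: "lin g (\<lambda>C. \<eta> C + \<xi> C) = (\<lambda>C. lin g \<eta> C + lin g \<xi> C)"
  by (simp add: act_def lift_def \<rho>_add[OF \<kappa>_mem] fun_eq_iff)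

lemma lin_sc: "lin g (\<lambda>C. sc a (\<eta> C)) = (\<lambda>C. sc a (lin g \<eta> C))"
  by (simp add: act_def lift_def \<rho>_sc[OF \<kappa>_mem] fun_eq_iff)

lemma lin_scaleR: "lin g (\<lambda>C. r *\<^sub>R \<eta> C) = (\<lambda>C. r *\<^sub>R lin g \<eta> C)"
proof -
  have "sc (of_real r) v = r *\<^sub>R v" for v using sc by (simp add: scalar_mult_def)
  then show ?thesis using lin_sc[of g "of_real r" \<eta>] by simp
qed

lemma lin_zero: "lin g (\<lambda>_. 0) = (\<lambda>_. 0)"
  by (simp add: act_def lift_def \<rho>_0[OF \<kappa>_mem] fun_eq_iff)

lemma induced_rep_eq: "induced_rep \<Gamma> D \<rho> g = lin g"
proof (intro ext)
  fix \<xi> C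
  have "induced_rep \<Gamma> D \<rho> g \<xi> C = \<rho> (\<kappa> (- g + rep C)) (\<xi> (q (- g + rep C + \<kappa> (- g + rep C))))"
    by (simp only: induced_rep_def Let_def domain_cocycle_eq rep_def)
  also have "\<dots> = lin g \<xi> C" by (simp only: q_shift[OF \<kappa>_mem] act_def lift_def add_0_left)
  finally show "induced_rep \<Gamma> D \<rho> g \<xi> C = lin g \<xi> C" .
qed

lemma lift_measurable:
  assumes \<eta>: "strongly_measurable M \<eta>" shows "strongly_measurable borel (lift c \<eta>)"
  unfolding lift_def[abs_def]
proof (rule strongly_measurable_cases[where f = "\<lambda>\<gamma> x. c \<gamma> + \<rho> \<gamma> (\<eta> (q x))", OF _ \<kappa>_measurable countable_lattice])
  fix \<gamma> assume \<gamma>: "\<gamma> \<in> \<Gamma>"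
  have \<eta>': "strongly_measurable (coset_borel \<Gamma>) \<eta>"
    using \<eta> strongly_measurable_cong_sets[OF sets_M] by blast
  show "strongly_measurable borel (\<lambda>x. c \<gamma> + \<rho> \<gamma> (\<eta> (q x)))"
    by (rule strongly_measurable_add[OF strongly_measurable_const
          strongly_measurable_continuous[OF strongly_measurable_compose[OF \<eta>' left_coset_measurable] \<rho>_continuous[OF \<gamma>]]])
qed

lemma rep_measurable_M: "rep \<in> M \<rightarrow>\<^sub>M borel"
  by (simp only: measurable_cong_sets[OF sets_M refl] rep_measurable)

lemma act_measurable_joint:
  assumes \<eta>: "strongly_measurable M \<eta>" and j: "j \<in> borel_measurable Y"
  shows "strongly_measurable (Y \<Otimes>\<^sub>M M) (\<lambda>(y, C). act c (j y) \<eta> C)"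
proof -
  have "(\<lambda>z. - j (fst z) + rep (snd z)) \<in> borel_measurable (Y \<Otimes>\<^sub>M M)"
    by (rule borel_group_ops(1)[OF borel_group_ops(2)[OF measurable_compose[OF measurable_fst j] measurable_compose[OF measurable_fst j]]
          measurable_compose[OF measurable_snd rep_measurable_M]])
  from strongly_measurable_compose[OF lift_measurable[OF \<eta>] this, of c]
  show ?thesis by (simp add: act_def case_prod_unfold)
qed

lemma act_measurable:
  assumes \<eta>: "strongly_measurable M \<eta>" shows "strongly_measurable M (act c g \<eta>)"
  unfolding act_def[abs_def]
  by (rule strongly_measurable_compose[OF lift_measurable[OF \<eta>] measurable_compose[OF rep_measurable_M borel_translations(2)]])

text \<open>The pointwise norm is that of \<open>\<xi>\<close> composed with
  \<open>translate (- g)\<close>, since \<open>\<rho>\<close> is isometric, and this translation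
  preserves the measure on the quotient.\<close>

lemma lin_Lp:
  assumes \<xi>: "\<xi> \<in> Lp_space p M"
  shows "lin g \<xi> \<in> Lp_space p M" "Lp_norm p M (lin g \<xi>) = Lp_norm p M \<xi>"
proof -
  have T: "translate (- g) \<in> M \<rightarrow>\<^sub>M M"
    by (simp only: measurable_cong_sets[OF sets_M sets_M] translate_measurable)
  have eq: "norm (lin g \<xi> C) = norm (\<xi> (translate (- g) C))" for C
    by (simp add: act_def lift_def translate_def \<rho>_norm[OF \<kappa>_mem])
  have sm: "strongly_measurable M \<xi>" and int: "integrable M (\<lambda>C. norm (\<xi> C) powr p)"
    using \<xi> by (simp_all add: Lp_space_iff)
  have "integrable (distr M M (translate (- g))) (\<lambda>C. norm (\<xi> C) powr p)"
    unfolding distr_translate by (rule int)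
  then have "integrable M (\<lambda>C. norm (lin g \<xi> C) powr p)"
    unfolding eq by (subst (asm) integrable_distr_eq[OF T L.Lp_measurable[OF sm]])
  then show "lin g \<xi> \<in> Lp_space p M"
    unfolding Lp_space_iff using act_measurable[OF sm] by blast
  have "(\<integral>C. norm (lin g \<xi> C) powr p \<partial>M) = (\<integral>C. norm (\<xi> C) powr p \<partial>distr M M (translate (- g)))"
    unfolding eq by (rule integral_distr[OF T L.Lp_measurable[OF sm], symmetric])
  then show "Lp_norm p M (lin g \<xi>) = Lp_norm p M \<xi>" unfolding distr_translate Lp_norm_def by simp
qed

lemma dual_lin:
  assumes \<phi>: "\<phi> \<in> Lp_dual sc p M" shows "(\<lambda>\<xi>. \<phi> (lin g \<xi>)) \<in> Lp_dual sc p M"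
proof -
  obtain K where K: "\<And>f. f \<in> Lp_space p M \<Longrightarrow> norm (\<phi> f) \<le> K * Lp_norm p M f"
    using L.dual_bound[OF sc \<phi>] by blast
  have "\<phi> (lin g (\<lambda>C. \<xi> C + \<eta> C)) = \<phi> (lin g \<xi>) + \<phi> (lin g \<eta>)" if "\<xi> \<in> Lp_space p M" "\<eta> \<in> Lp_space p M" for \<xi> \<eta>
    unfolding lin_add by (rule L.dual_add[OF sc \<phi> lin_Lp(1)[OF that(1)] lin_Lp(1)[OF that(2)]])
  moreover have "\<phi> (lin g (\<lambda>C. sc a (\<xi> C))) = a * \<phi> (lin g \<xi>)" if "\<xi> \<in> Lp_space p M" for \<xi> a
    unfolding lin_sc using \<phi> lin_Lp(1)[OF that] by (simp add: Lp_dual_def)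
  moreover have "norm (\<phi> (lin g \<xi>)) \<le> K * Lp_norm p M \<xi>" if "\<xi> \<in> Lp_space p M" for \<xi>
    using K[OF lin_Lp(1)[OF that]] lin_Lp(2)[OF that] by simp
  ultimately show ?thesis unfolding Lp_dual_def by blast
qed

lemma zero_Lp: "(\<lambda>_. 0) \<in> Lp_space p M"
  by (rule L.Lp_const(1))

section \<open>Displacement and averages of the affine action\<close>

context
  fixes c :: "'g \<Rightarrow> 'v"
  assumes c: "cocycle c" and c_Lp: "\<And>g. act c g (\<lambda>_. 0) \<in> Lp_space p M"
begin

lemma act_Lp: "\<eta> \<in> Lp_space p M \<Longrightarrow> act c g \<eta> \<in> Lp_space p M"
  using L.Lp_add[OF c_Lp[of g] lin_Lp(1)[of \<eta> g]] by (simp add: act_eq[of c g \<eta>, abs_def])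

text \<open>The distance by which \<open>g\<close> moves 0. It is a subadditive and symmetric length
  function, and it controls the growth of the affine action because the linear part is
  isometric.\<close>

definition displacement :: "'g \<Rightarrow> real" where "displacement g = Lp_norm p M (act c g (\<lambda>_. 0))"

lemma act_norm_le: "\<eta> \<in> Lp_space p M \<Longrightarrow> Lp_norm p M (act c g \<eta>) \<le> displacement g + Lp_norm p M \<eta>"
  using L.Lp_norm_add[OF c_Lp[of g] lin_Lp(1)[of \<eta> g]] lin_Lp(2)[of \<eta> g]
  by (simp add: act_eq[of c g \<eta>, abs_def] displacement_def)

lemma displacement_add: "displacement (g + h) \<le> displacement g + displacement h"
  using act_norm_le[OF c_Lp[of h], of g] unfolding act_act[OF c] by (simp add: displacement_def)

lemma displacement_minus: "displacement (- g) = displacement g"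
proof -
  have "act c (- g) (\<lambda>_. 0) C = - lin (- g) (act c g (\<lambda>_. 0)) C" if "C \<in> space M" for C
    using act_eq[of c "- g" "act c g (\<lambda>_. 0)" C] act_zero[OF c that, of "\<lambda>_. 0"]
    by (simp add: act_act[OF c] eq_neg_iff_add_eq_0)
  then have "norm (act c (- g) (\<lambda>_. 0) C) = norm (lin (- g) (act c g (\<lambda>_. 0)) C)" if "C \<in> space M" for C
    using that by simp
  then have "displacement (- g) = Lp_norm p M (lin (- g) (act c g (\<lambda>_. 0)))"
    unfolding displacement_def using c_Lp[of "- g"] lin_Lp(1)[OF c_Lp[of g], of "- g"]
    by (intro L.Lp_norm_cong_AE AE_I2) (simp_all add: Lp_space_iff)
  then show ?thesis by (simp add: displacement_def lin_Lp(2)[OF c_Lp])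
qed

lemma displacement_measurable: "{g. displacement g \<le> r} \<in> sets borel"
proof (cases "0 \<le> r")
  case True
  define e where "e g = (\<integral>\<^sup>+C. ennreal (norm (act c g (\<lambda>_. 0) C) powr p) \<partial>M)" for g
  have "(\<lambda>z. norm (case z of (g, C) \<Rightarrow> act c g (\<lambda>_. 0) C)) \<in> borel_measurable (borel \<Otimes>\<^sub>M M)"
    by (rule strongly_measurable_norm[OF act_measurable_joint[where j = "\<lambda>g. g"]]) simp_all
  then have "(\<lambda>(g, C). ennreal (norm (act c g (\<lambda>_. 0) C) powr p)) \<in> borel_measurable (borel \<Otimes>\<^sub>M M)"
    by (simp add: case_prod_unfold)
  then have [measurable]: "e \<in> borel_measurable borel"
    unfolding e_def by (rule L.borel_measurable_nn_integral)
  have "displacement g \<le> r \<longleftrightarrow> e g \<le> ennreal (r powr p)" for g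
  proof -
    have "e g = ennreal (displacement g powr p)" unfolding e_def displacement_def by (rule L.Lp_nn_integral[OF c_Lp])
    moreover have "displacement g powr p \<le> r powr p \<longleftrightarrow> displacement g \<le> r"
    proof
      assume "displacement g powr p \<le> r powr p"
      then show "displacement g \<le> r" using True by (intro L.powr_le_powrD[of "displacement g" r]) (simp_all add: displacement_def)
    next
      assume "displacement g \<le> r"
      then show "displacement g powr p \<le> r powr p" using p_gt_1 by (intro powr_mono2) (simp_all add: displacement_def)
    qed
    ultimately show ?thesis by simp
  qed
  then have "{g. displacement g \<le> r} = {g \<in> space borel. e g \<le> ennreal (r powr p)}" by simp
  also have "\<dots> \<in> sets borel" by measurable
  finally show ?thesis .
next
  case False
  then have "\<not> displacement g \<le> r" for g unfolding displacement_def using Lp_norm_nonneg[of p M] by (meson order_trans)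
  then show ?thesis by simp
qed

text \<open>Steinhaus' theorem bounds this measurable length function near the neutral element.\<close>

lemma displacement_bounded:
  assumes K: "compact K" shows "\<exists>B. \<forall>g\<in>K. displacement g \<le> B"
proof -
  have "\<exists>n::nat. emeasure \<nu> {g. displacement g \<le> real n} \<noteq> 0"
  proof (rule ccontr)
    assume "\<not> ?thesis"
    then have "(\<Union>n::nat. {g. displacement g \<le> real n}) \<in> null_sets \<nu>"
      using displacement_measurable by (intro null_sets_UN null_setsI) simp_all
    moreover have "(\<Union>n::nat. {g. displacement g \<le> real n}) = UNIV" using real_arch_simple by auto
    ultimately have "emeasure \<nu> UNIV = 0" by auto
    then show False using haar by (simp add: haar_measure_def)
  qed
  then obtain n :: nat where n: "emeasure \<nu> {g. displacement g \<le> real n} \<noteq> 0" by blast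
  obtain W where W: "open W" "0 \<in> W" and W': "\<forall>w\<in>W. \<exists>x\<in>{g. displacement g \<le> real n}. - w + x \<in> {g. displacement g \<le> real n}"
    using steinhaus[OF displacement_measurable n] by blast
  have small: "displacement w \<le> 2 * real n" if w: "w \<in> W" for w
  proof -
    obtain x where x: "displacement x \<le> real n" "displacement (- w + x) \<le> real n" using W' w by blast
    \<comment> \<open>This writes \<open>w\<close> as the difference of two elements of displacement
      at most \<open>n\<close>, whence the factor 2.\<close>
    have "x + - (- w + x) = w" by (simp only: minus_add minus_minus add_minus_cancel)
    then show ?thesis using displacement_add[of x "- (- w + x)"] displacement_minus[of "- w + x"] x by simp
  qed
  define V where "V x = (\<lambda>y. - x + y) -` W" for x
  have V: "open (V x)" for x unfolding V_def by (rule open_group_vimage(1)[OF W(1)])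
  have "K \<subseteq> (\<Union>x\<in>K. V x)" using W(2) by (auto simp: V_def)
  then obtain T where T: "T \<subseteq> K" "finite T" "K \<subseteq> (\<Union>x\<in>T. V x)"
    by (rule compactE_image[OF K V])
  have "displacement g \<le> (\<Sum>x\<in>T. displacement x) + 2 * real n" if g: "g \<in> K" for g
  proof -
    obtain x where x: "x \<in> T" "- x + g \<in> W" using T(3) g unfolding V_def by blast
    have "displacement g \<le> displacement x + displacement (- x + g)" using displacement_add[of x "- x + g"] by simp
    moreover have "displacement x \<le> (\<Sum>x\<in>T. displacement x)"
      using T(2) x(1) by (intro member_le_sum) (simp_all add: displacement_def)
    ultimately show ?thesis using small[OF x(2)] by linarith
  qed
  then show ?thesis by blast
qed

context
  fixes \<mu> :: "'y measure" and j :: "'y \<Rightarrow> 'g" and K :: "'g set"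
  assumes \<mu>: "prob_space \<mu>" and j: "j \<in> borel_measurable \<mu>" and K: "compact K" and ae_K: "AE y in \<mu>. j y \<in> K"
begin

text \<open>The measure lives on a parameter space with a map \<open>j\<close> into the group. Thus
  one statement serves the measures on both factors and their product.\<close>

lemma act_dual_integrable:
  assumes \<eta>: "\<eta> \<in> Lp_space p M" and \<phi>: "\<phi> \<in> Lp_dual sc p M"
  shows "integrable \<mu> (\<lambda>y. \<phi> (act c (j y) \<eta>))"
proof -
  interpret \<mu>: prob_space \<mu> by (rule \<mu>)
  obtain B where B: "\<And>g. g \<in> K \<Longrightarrow> displacement g \<le> B" using displacement_bounded[OF K] by blast
  obtain C where C: "0 \<le> C" "\<And>f. f \<in> Lp_space p M \<Longrightarrow> norm (\<phi> f) \<le> C * Lp_norm p M f"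
    using L.dual_bound[OF sc \<phi>] by blast
  have sm: "strongly_measurable M \<eta>" using \<eta> by (simp add: Lp_space_iff)
  show ?thesis
  proof (rule \<mu>.integrable_const_bound)
    show "AE y in \<mu>. norm (\<phi> (act c (j y) \<eta>)) \<le> C * (B + Lp_norm p M \<eta>)"
      using ae_K
    proof (rule eventually_mono)
      fix y assume y: "j y \<in> K"
      have "norm (\<phi> (act c (j y) \<eta>)) \<le> C * Lp_norm p M (act c (j y) \<eta>)" by (rule C(2)[OF act_Lp[OF \<eta>]])
      also have "\<dots> \<le> C * (B + Lp_norm p M \<eta>)"
        using act_norm_le[OF \<eta>, of "j y"] B[OF y] C(1) by (intro mult_left_mono) linarith+
      finally show "norm (\<phi> (act c (j y) \<eta>)) \<le> C * (B + Lp_norm p M \<eta>)" .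
    qed
    show "(\<lambda>y. \<phi> (act c (j y) \<eta>)) \<in> borel_measurable \<mu>"
      by (rule L.dual_measurable[OF sc \<mu> act_measurable_joint[OF sm j] act_Lp[OF \<eta>] \<phi>])
  qed
qed

text \<open>The compact carrier bounds the displacement, so the weak integral exists and the choice
  made in \<open>average\<close> has a witness.\<close>

lemma average_act:
  assumes \<eta>: "\<eta> \<in> Lp_space p M"
  shows "average sc p M \<mu> (\<lambda>y. act c (j y)) \<eta> \<in> Lp_space p M"
    and "\<phi> \<in> Lp_dual sc p M \<Longrightarrow>
      \<phi> (average sc p M \<mu> (\<lambda>y. act c (j y)) \<eta>) = (\<integral>y. \<phi> (act c (j y) \<eta>) \<partial>\<mu>)"
proof -
  obtain B where B: "\<And>g. g \<in> K \<Longrightarrow> displacement g \<le> B" using displacement_bounded[OF K] by blast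
  have sm: "strongly_measurable M \<eta>" using \<eta> by (simp add: Lp_space_iff)
  have "AE y in \<mu>. Lp_norm p M (act c (j y) \<eta>) \<le> B + Lp_norm p M \<eta>"
    using ae_K
  proof (rule eventually_mono)
    fix y assume "j y \<in> K"
    then show "Lp_norm p M (act c (j y) \<eta>) \<le> B + Lp_norm p M \<eta>"
      using act_norm_le[OF \<eta>, of "j y"] B[of "j y"] by linarith
  qed
  from L.weak_integral_exists[OF sc \<mu> act_measurable_joint[OF sm j] act_Lp[OF \<eta>] this]
  have "\<exists>\<zeta>. \<zeta> \<in> Lp_space p M \<and> (\<forall>\<phi>\<in>Lp_dual sc p M. \<phi> \<zeta> = (\<integral>y. \<phi> (act c (j y) \<eta>) \<partial>\<mu>))" by blast
  from someI_ex[OF this]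
  have *: "average sc p M \<mu> (\<lambda>y. act c (j y)) \<eta> \<in> Lp_space p M \<and>
    (\<forall>\<phi>\<in>Lp_dual sc p M. \<phi> (average sc p M \<mu> (\<lambda>y. act c (j y)) \<eta>) = (\<integral>y. \<phi> (act c (j y) \<eta>) \<partial>\<mu>))"
    unfolding average_def .
  show "average sc p M \<mu> (\<lambda>y. act c (j y)) \<eta> \<in> Lp_space p M" using * by blast
  show "\<phi> \<in> Lp_dual sc p M \<Longrightarrow>
      \<phi> (average sc p M \<mu> (\<lambda>y. act c (j y)) \<eta>) = (\<integral>y. \<phi> (act c (j y) \<eta>) \<partial>\<mu>)"
    using * by blast
qed

end

end

lemma zero_cocycle_Lp: "lin g (\<lambda>_. 0) \<in> Lp_space p M"
  by (simp add: lin_zero zero_Lp)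

text \<open>For \<open>x\<close> in \<open>D\<close>, the lattice element
  \<open>\<kappa> (- g + x)\<close> lies in a compact set built from \<open>g\<close> and the
  closure of \<open>D\<close>. It therefore takes finitely many values, and the cocycle is bounded
  on them.\<close>

lemma integrable_of_compact_domain:
  assumes D: "compact (closure D)"
  shows "act c g (\<lambda>_. 0) \<in> Lp_space p M"
proof -
  have "compact ((\<lambda>(x, d). - x + g + d) ` (closure D \<times> closure D))"
    by (rule compact_continuous_image[OF _ compact_Times[OF D D]])
      (simp add: case_prod_unfold, intro continuous_intros)
  then have fin: "finite (\<Gamma> \<inter> (\<lambda>(x, d). - x + g + d) ` (closure D \<times> closure D))" (is "finite ?S")
    by (rule finite_Int_compact)
  have mem: "\<kappa> (- g + x) \<in> ?S" if x: "x \<in> D" for x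
  proof -
    define d where "d = - g + x + \<kappa> (- g + x)"
    have "d \<in> D" unfolding d_def by (rule \<kappa>_D)
    moreover have "\<kappa> (- g + x) = - x + g + d"
      unfolding d_def by (simp only: add.assoc add_minus_cancel minus_add_cancel)
    ultimately have "\<kappa> (- g + x) \<in> (\<lambda>(x, d). - x + g + d) ` (closure D \<times> closure D)"
      using x closure_subset[of D] by (intro image_eqI[of _ _ "(x, d)"]) auto
    then show ?thesis using \<kappa>_mem by blast
  qed
  define B where "B = (\<Sum>\<gamma>\<in>?S. norm (c \<gamma>))"
  show ?thesis
  proof (rule L.Lp_dominated(1)[OF act_measurable[OF strongly_measurable_const] L.Lp_const(1)[of "B"]])
    have "norm (act c g (\<lambda>_. 0) C) \<le> B" if "C \<in> space M" for C
    proof -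
      have "norm (c (\<kappa> (- g + rep C))) \<le> B"
        unfolding B_def by (rule member_le_sum[OF mem[OF rep_space(1)[OF that]] _ fin]) simp
      then show ?thesis by (simp add: act_def lift_def \<rho>_0[OF \<kappa>_mem])
    qed
    moreover have "0 \<le> B" unfolding B_def by (rule sum_nonneg) simp
    ultimately show "AE C in M. norm (act c g (\<lambda>_. 0) C) \<le> norm B" by (intro AE_I2) simp
  qed
qed

text \<open>By the cocycle identity and isometry, \<open>c\<close> grows at most linearly in the
  word length, so p-integrability of the word length suffices.\<close>

lemma integrable_of_p_integrable_domain:
  assumes c: "cocycle c" and D: "p_integrable_domain p \<nu> \<Gamma> D"
  shows "act c g (\<lambda>_. 0) \<in> Lp_space p M"
proof -
  obtain S where S: "finite S" "generates S \<Gamma>"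
    and int: "\<And>g. (\<integral>\<^sup>+x\<in>D. ennreal (real (word_length S (domain_cocycle \<Gamma> D g x)) powr p) \<partial>\<nu>) < \<infinity>"
    using D unfolding p_integrable_domain_def by blast
  define S' where "S' = S \<union> uminus ` S"
  have \<Gamma>_eq: "\<Gamma> = {sum_list xs | xs. set xs \<subseteq> S'}" using S(2) unfolding generates_def S'_def .
  \<comment> \<open>The sum over the finitely many generators and their inverses serves as a common
    bound for the norm of \<open>c\<close> on them.\<close>
  define B where "B = (\<Sum>s\<in>S'. norm (c s))"
  have B: "0 \<le> B" unfolding B_def by (rule sum_nonneg) simp
  have S'_mem: "s \<in> \<Gamma>" "norm (c s) \<le> B" if "s \<in> S'" for s
  proof -
    have "sum_list [s] \<in> {sum_list xs | xs. set xs \<subseteq> S'}" using that by (intro CollectI exI[of _ "[s]"]) simp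
    then show "s \<in> \<Gamma>" using \<Gamma>_eq by simp
    show "norm (c s) \<le> B" unfolding B_def using S(1) that by (intro member_le_sum) (simp_all add: S'_def)
  qed
  have word: "sum_list xs \<in> \<Gamma> \<and> norm (c (sum_list xs)) \<le> B * real (length xs)" if "set xs \<subseteq> S'" for xs
    using that
  proof (induction xs)
    case Nil then show ?case by (simp add: zero_mem cocycle_at_zero[OF c])
  next
    case (Cons s xs)
    then have s: "s \<in> S'" and IH: "sum_list xs \<in> \<Gamma>" "norm (c (sum_list xs)) \<le> B * real (length xs)" by auto
    have "norm (c (s + sum_list xs)) \<le> norm (c s) + norm (c (sum_list xs))"
      unfolding cocycleD[OF c S'_mem(1)[OF s] IH(1)]
      using norm_triangle_ineq[of "c s" "\<rho> s (c (sum_list xs))"] by (simp add: \<rho>_norm S'_mem(1)[OF s])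
    also have "\<dots> \<le> B + B * real (length xs)" using S'_mem(2)[OF s] IH(2) by (rule add_mono)
    finally show ?case using add_mem[OF S'_mem(1)[OF s] IH(1)] by (simp add: algebra_simps)
  qed
  have len: "norm (c \<gamma>) \<le> B * real (word_length S \<gamma>)" if "\<gamma> \<in> \<Gamma>" for \<gamma>
  proof -
    have "\<gamma> \<in> {sum_list xs | xs. set xs \<subseteq> S'}" using that unfolding \<Gamma>_eq .
    then obtain xs0 where "set xs0 \<subseteq> S'" "sum_list xs0 = \<gamma>" by blast
    then have "\<exists>n xs. length xs = n \<and> set xs \<subseteq> S \<union> uminus ` S \<and> sum_list xs = \<gamma>" by (auto simp: S'_def)
    from LeastI_ex[OF this] obtain xs where "length xs = word_length S \<gamma>" "set xs \<subseteq> S'" "sum_list xs = \<gamma>"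
      unfolding word_length_def S'_def by blast
    then show ?thesis using word[of xs] by simp
  qed
  have sm: "strongly_measurable M (act c g (\<lambda>_. 0))" by (rule act_measurable[OF strongly_measurable_const])
  have smC: "(\<lambda>C. ennreal (norm (act c g (\<lambda>_. 0) C) powr p)) \<in> borel_measurable (coset_borel \<Gamma>)"
    using measurable_compose[OF L.Lp_measurable[OF sm] measurable_ennreal]
    by (simp only: measurable_cong_sets[OF sets_M refl])
  have wl: "(\<lambda>x. ennreal (real (word_length S (\<kappa> (- g + x))) powr p)) \<in> borel_measurable \<nu>"
  proof -
    have "(\<lambda>\<gamma>. ennreal (real (word_length S \<gamma>) powr p)) \<in> borel_measurable (count_space \<Gamma>)" by simp
    from measurable_compose[OF measurable_compose[OF borel_translations(2) \<kappa>_measurable] this]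
    show ?thesis by (simp only: measurable_cong_sets[OF sets_haar refl])
  qed
  have "(\<integral>\<^sup>+C. ennreal (norm (act c g (\<lambda>_. 0) C) powr p) \<partial>M) =
      (\<integral>\<^sup>+x. ennreal (norm (act c g (\<lambda>_. 0) (q x)) powr p) * indicator D x \<partial>\<nu>)"
    by (rule nn_integral_M[OF smC])
  also have "\<dots> \<le> (\<integral>\<^sup>+x. ennreal (B powr p) * (ennreal (real (word_length S (\<kappa> (- g + x))) powr p) * indicator D x) \<partial>\<nu>)"
  proof (rule nn_integral_mono)
    fix x
    show "ennreal (norm (act c g (\<lambda>_. 0) (q x)) powr p) * indicator D x \<le>
        ennreal (B powr p) * (ennreal (real (word_length S (\<kappa> (- g + x))) powr p) * indicator D x)"
    proof (cases "x \<in> D")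
      case True
      have "norm (act c g (\<lambda>_. 0) (q x)) \<le> B * real (word_length S (\<kappa> (- g + x)))"
        using len[OF \<kappa>_mem] by (simp add: act_def lift_def \<rho>_0[OF \<kappa>_mem] rep_q_D[OF True])
      then have "norm (act c g (\<lambda>_. 0) (q x)) powr p \<le> (B * real (word_length S (\<kappa> (- g + x)))) powr p"
        using p_gt_1 by (intro powr_mono2) simp_all
      also have "\<dots> = B powr p * real (word_length S (\<kappa> (- g + x))) powr p" by (rule powr_mult)
      finally show ?thesis using True by (simp add: ennreal_leI flip: ennreal_mult)
    qed simp
  qed
  also have "\<dots> = ennreal (B powr p) * (\<integral>\<^sup>+x. ennreal (real (word_length S (\<kappa> (- g + x))) powr p) * indicator D x \<partial>\<nu>)"
    using wl by (intro nn_integral_cmult borel_measurable_times_ennreal borel_measurable_indicator) simp_all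
  also have "\<dots> < \<infinity>"
    using int[of "- g"] by (simp add: domain_cocycle_eq ennreal_mult_less_top)
  finally have "(\<integral>\<^sup>+C. ennreal (norm (act c g (\<lambda>_. 0) C) powr p) \<partial>M) < \<infinity>" .
  then show ?thesis
    unfolding Lp_space_iff using sm L.Lp_measurable[OF sm] by (auto intro!: integrableI_nonneg)
qed

lemma act_cong_AE:
  assumes \<eta>: "\<eta> \<in> Lp_space p M" and \<xi>: "\<xi> \<in> Lp_space p M" and eq: "AE C in M. \<eta> C = \<xi> C"
  shows "AE C in M. act c g \<eta> C = act c g \<xi> C"
proof -
  have d: "(\<lambda>C. \<eta> C - \<xi> C) \<in> Lp_space p M" by (rule L.Lp_diff(1)[OF \<eta> \<xi>])
  have "Lp_norm p M (\<lambda>C. \<eta> C - \<xi> C) = 0"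
    using L.Lp_norm_eq_0_iff[OF d] eq by simp
  then have "Lp_norm p M (lin g (\<lambda>C. \<eta> C - \<xi> C)) = 0" by (simp only: lin_Lp(2)[OF d])
  then have "AE C in M. lin g (\<lambda>C. \<eta> C - \<xi> C) C = 0"
    using L.Lp_norm_eq_0_iff[OF lin_Lp(1)[OF d]] by blast
  then show ?thesis
  proof (rule eventually_mono)
    fix C assume "lin g (\<lambda>C. \<eta> C - \<xi> C) C = 0"
    then show "act c g \<eta> C = act c g \<xi> C" using act_diff[of c g \<eta> C \<xi>] by simp
  qed
qed

abbreviation mean :: "('g \<Rightarrow> 'v) \<Rightarrow> 'y measure \<Rightarrow> ('y \<Rightarrow> 'g) \<Rightarrow> ('g set \<Rightarrow> 'v) \<Rightarrow> 'g set \<Rightarrow> 'v" where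
  "mean c \<mu> j \<equiv> average sc p M \<mu> (\<lambda>y. act c (j y))"

context
  fixes \<mu> :: "'y measure" and j :: "'y \<Rightarrow> 'g" and K :: "'g set"
  assumes \<mu>: "prob_space \<mu>" and j: "j \<in> borel_measurable \<mu>" and K: "compact K" and ae_K: "AE y in \<mu>. j y \<in> K"
begin

lemmas mean_Lp = average_act(1)[OF _ _ \<mu> j K ae_K]
  and dual_mean = average_act(2)[OF _ _ \<mu> j K ae_K]
  and dual_integrable = act_dual_integrable[OF _ _ \<mu> j K ae_K]

lemmas lin_mean_Lp = mean_Lp[OF cocycle_zero zero_cocycle_Lp]
  and dual_lin_mean = dual_mean[OF cocycle_zero zero_cocycle_Lp]

lemma mean_scaleR:
  assumes \<xi>: "\<xi> \<in> Lp_space p M"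
  shows "AE C in M. mean (\<lambda>_. 0) \<mu> j (\<lambda>C. r *\<^sub>R \<xi> C) C = r *\<^sub>R mean (\<lambda>_. 0) \<mu> j \<xi> C"
proof (rule L.dual_separates[OF sc])
  have r: "(\<lambda>C. r *\<^sub>R \<xi> C) \<in> Lp_space p M" by (rule L.Lp_scaleR(1)[OF \<xi>])
  show "mean (\<lambda>_. 0) \<mu> j (\<lambda>C. r *\<^sub>R \<xi> C) \<in> Lp_space p M" by (rule lin_mean_Lp[OF r])
  show "(\<lambda>C. r *\<^sub>R mean (\<lambda>_. 0) \<mu> j \<xi> C) \<in> Lp_space p M" by (rule L.Lp_scaleR(1)[OF lin_mean_Lp[OF \<xi>]])
  fix \<phi> :: "('g set \<Rightarrow> 'v) \<Rightarrow> 'k" assume \<phi>: "\<phi> \<in> Lp_dual sc p M"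
  have "\<phi> (mean (\<lambda>_. 0) \<mu> j (\<lambda>C. r *\<^sub>R \<xi> C)) = (\<integral>y. r *\<^sub>R \<phi> (lin (j y) \<xi>) \<partial>\<mu>)"
    unfolding dual_lin_mean[OF r \<phi>] lin_scaleR L.dual_scaleR[OF sc \<phi> lin_Lp(1)[OF \<xi>]] ..
  also have "\<dots> = \<phi> (\<lambda>C. r *\<^sub>R mean (\<lambda>_. 0) \<mu> j \<xi> C)"
    unfolding L.dual_scaleR[OF sc \<phi> lin_mean_Lp[OF \<xi>]] dual_lin_mean[OF \<xi> \<phi>] by (rule integral_scaleR_right)
  finally show "\<phi> (mean (\<lambda>_. 0) \<mu> j (\<lambda>C. r *\<^sub>R \<xi> C)) = \<phi> (\<lambda>C. r *\<^sub>R mean (\<lambda>_. 0) \<mu> j \<xi> C)" .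
qed

context
  fixes c :: "'g \<Rightarrow> 'v"
  assumes c: "cocycle c" and c_Lp: "\<And>g. act c g (\<lambda>_. 0) \<in> Lp_space p M"
begin

text \<open>\<open>average\<close> chooses separately for each function, so compatibility with
  equality almost everywhere has to be recovered through the functionals.\<close>

lemma mean_cong:
  assumes \<eta>: "\<eta> \<in> Lp_space p M" and \<xi>: "\<xi> \<in> Lp_space p M" and eq: "AE C in M. \<eta> C = \<xi> C"
  shows "AE C in M. mean c \<mu> j \<eta> C = mean c \<mu> j \<xi> C"
proof (rule L.dual_separates[OF sc mean_Lp[OF c c_Lp \<eta>] mean_Lp[OF c c_Lp \<xi>]])
  fix \<phi> :: "('g set \<Rightarrow> 'v) \<Rightarrow> 'k" assume \<phi>: "\<phi> \<in> Lp_dual sc p M"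
  have "\<phi> (act c (j y) \<eta>) = \<phi> (act c (j y) \<xi>)" for y
    by (rule L.dual_cong_AE[OF sc \<phi> act_Lp[OF c c_Lp \<eta>] act_Lp[OF c c_Lp \<xi>] act_cong_AE[OF \<eta> \<xi> eq]])
  then show "\<phi> (mean c \<mu> j \<eta>) = \<phi> (mean c \<mu> j \<xi>)"
    by (simp only: dual_mean[OF c c_Lp \<eta> \<phi>] dual_mean[OF c c_Lp \<xi> \<phi>])
qed

lemma mean_diff:
  assumes \<eta>: "\<eta> \<in> Lp_space p M" and \<xi>: "\<xi> \<in> Lp_space p M"
  shows "AE C in M. mean c \<mu> j \<eta> C - mean c \<mu> j \<xi> C = mean (\<lambda>_. 0) \<mu> j (\<lambda>C. \<eta> C - \<xi> C) C"
proof (rule L.dual_separates[OF sc])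
  have d: "(\<lambda>C. \<eta> C - \<xi> C) \<in> Lp_space p M" by (rule L.Lp_diff(1)[OF \<eta> \<xi>])
  show "(\<lambda>C. mean c \<mu> j \<eta> C - mean c \<mu> j \<xi> C) \<in> Lp_space p M"
    by (rule L.Lp_diff(1)[OF mean_Lp[OF c c_Lp \<eta>] mean_Lp[OF c c_Lp \<xi>]])
  show "mean (\<lambda>_. 0) \<mu> j (\<lambda>C. \<eta> C - \<xi> C) \<in> Lp_space p M" by (rule lin_mean_Lp[OF d])
  fix \<phi> :: "('g set \<Rightarrow> 'v) \<Rightarrow> 'k" assume \<phi>: "\<phi> \<in> Lp_dual sc p M"
  have "\<phi> (\<lambda>C. mean c \<mu> j \<eta> C - mean c \<mu> j \<xi> C) = (\<integral>y. \<phi> (act c (j y) \<eta>) \<partial>\<mu>) - (\<integral>y. \<phi> (act c (j y) \<xi>) \<partial>\<mu>)"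
    unfolding L.dual_diff[OF sc \<phi> mean_Lp[OF c c_Lp \<eta>] mean_Lp[OF c c_Lp \<xi>]]
      dual_mean[OF c c_Lp \<eta> \<phi>] dual_mean[OF c c_Lp \<xi> \<phi>] ..
  also have "\<dots> = (\<integral>y. \<phi> (act c (j y) \<eta>) - \<phi> (act c (j y) \<xi>) \<partial>\<mu>)"
    by (rule Bochner_Integration.integral_diff[symmetric, OF dual_integrable[OF c c_Lp \<eta> \<phi>] dual_integrable[OF c c_Lp \<xi> \<phi>]])
  also have "\<dots> = (\<integral>y. \<phi> (lin (j y) (\<lambda>C. \<eta> C - \<xi> C)) \<partial>\<mu>)"
    unfolding L.dual_diff[symmetric, OF sc \<phi> act_Lp[OF c c_Lp \<eta>] act_Lp[OF c c_Lp \<xi>]] act_diff ..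
  also have "\<dots> = \<phi> (mean (\<lambda>_. 0) \<mu> j (\<lambda>C. \<eta> C - \<xi> C))" by (rule dual_lin_mean[OF d \<phi>, symmetric])
  finally show "\<phi> (\<lambda>C. mean c \<mu> j \<eta> C - mean c \<mu> j \<xi> C) = \<phi> (mean (\<lambda>_. 0) \<mu> j (\<lambda>C. \<eta> C - \<xi> C))" .
qed

text \<open>The affine map of \<open>g\<close> is a constant plus a linear isometry. The constant
  passes under the integral because the measure has mass one, the linear part because its
  composition with \<open>\<phi>\<close> is again a functional.\<close>

lemma dual_act_mean:
  assumes \<xi>: "\<xi> \<in> Lp_space p M" and \<phi>: "\<phi> \<in> Lp_dual sc p M"
  shows "\<phi> (act c g (mean c \<mu> j \<xi>)) = (\<integral>y. \<phi> (act c (g + j y) \<xi>) \<partial>\<mu>)"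
proof -
  interpret \<mu>: prob_space \<mu> by (rule \<mu>)
  have split: "\<phi> (act c g \<zeta>) = \<phi> (act c g (\<lambda>_. 0)) + \<phi> (lin g \<zeta>)" if "\<zeta> \<in> Lp_space p M" for \<zeta>
    unfolding act_eq[of c g \<zeta>, abs_def] by (rule L.dual_add[OF sc \<phi> c_Lp lin_Lp(1)[OF that]])
  note \<psi> = dual_lin[OF \<phi>, of g]
  have "\<phi> (act c g (mean c \<mu> j \<xi>)) = \<phi> (act c g (\<lambda>_. 0)) + (\<integral>y. \<phi> (lin g (act c (j y) \<xi>)) \<partial>\<mu>)"
    unfolding split[OF mean_Lp[OF c c_Lp \<xi>]] dual_mean[OF c c_Lp \<xi> \<psi>] ..
  also have "\<dots> = (\<integral>y. \<phi> (act c g (\<lambda>_. 0)) + \<phi> (lin g (act c (j y) \<xi>)) \<partial>\<mu>)"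
    using Bochner_Integration.integral_add[OF \<mu>.integrable_const dual_integrable[OF c c_Lp \<xi> \<psi>], of "\<phi> (act c g (\<lambda>_. 0))"]
    by (simp add: \<mu>.prob_space)
  also have "\<dots> = (\<integral>y. \<phi> (act c (g + j y) \<xi>) \<partial>\<mu>)"
    unfolding split[symmetric, OF act_Lp[OF c c_Lp \<xi>]] act_act[OF c] ..
  finally show ?thesis .
qed

text \<open>An element that commutes with all \<open>j y\<close> maps fixed points of the affine
  average to fixed points. In the difference of two fixed points the inhomogeneous parts cancel,
  leaving a fixed point of the linear average.\<close>

lemma mean_fixed_difference:
  assumes w: "w \<in> Lp_space p M" and fix_w: "AE C in M. mean c \<mu> j w C = w C" and comm: "\<And>y. g + j y = j y + g"
  shows "AE C in M. mean (\<lambda>_. 0) \<mu> j (\<lambda>C. act c g w C - w C) C = act c g w C - w C"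
proof -
  have gw: "act c g w \<in> Lp_space p M" by (rule act_Lp[OF c c_Lp w])
  have Bw: "mean c \<mu> j w \<in> Lp_space p M" by (rule mean_Lp[OF c c_Lp w])
  have "AE C in M. mean c \<mu> j (act c g w) C = act c g (mean c \<mu> j w) C"
  proof (rule L.dual_separates[OF sc mean_Lp[OF c c_Lp gw] act_Lp[OF c c_Lp Bw]])
    fix \<phi> :: "('g set \<Rightarrow> 'v) \<Rightarrow> 'k" assume \<phi>: "\<phi> \<in> Lp_dual sc p M"
    show "\<phi> (mean c \<mu> j (act c g w)) = \<phi> (act c g (mean c \<mu> j w))"
      unfolding dual_mean[OF c c_Lp gw \<phi>] dual_act_mean[OF w \<phi>] act_act[OF c] comm ..
  qed
  then show ?thesis
    using act_cong_AE[OF Bw w fix_w, of c g] fix_w mean_diff[OF gw w] by eventually_elim simp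
qed

end

end

end

section \<open>Fixed points of commuting averages\<close>

locale commuting_means = induced_module \<nu> \<Gamma> D sc \<rho> p
  for \<nu> :: "'g::{topological_group_add, t2_space, second_countable_topology} measure" and \<Gamma> D
    and sc :: "'k::{real_normed_field, euclidean_space} \<Rightarrow> 'v::banach \<Rightarrow> 'v" and \<rho> and p +
  fixes c :: "'g \<Rightarrow> 'v"
    and \<mu>1 :: "'y measure" and j1 :: "'y \<Rightarrow> 'g" and K1 :: "'g set"
    and \<mu>2 :: "'z measure" and j2 :: "'z \<Rightarrow> 'g" and K2 :: "'g set"
  assumes c: "cocycle c" and c_Lp: "\<And>g. act c g (\<lambda>_. 0) \<in> Lp_space p M"
    and m1: "prob_space \<mu>1" "j1 \<in> borel_measurable \<mu>1" "compact K1" "AE y in \<mu>1. j1 y \<in> K1"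
    and m2: "prob_space \<mu>2" "j2 \<in> borel_measurable \<mu>2" "compact K2" "AE y in \<mu>2. j2 y \<in> K2"
    and comm: "\<And>y z. j1 y + j2 z = j2 z + j1 y"
    and contraction: "Lp_opnorm p M (mean (\<lambda>_. 0) \<mu>1 j1 \<circ> mean (\<lambda>_. 0) \<mu>2 j2) < 1"
begin

abbreviation "A1 \<equiv> mean (\<lambda>_. 0) \<mu>1 j1"
abbreviation "A2 \<equiv> mean (\<lambda>_. 0) \<mu>2 j2"
abbreviation "B1 \<equiv> mean c \<mu>1 j1"
abbreviation "B2 \<equiv> mean c \<mu>2 j2"

lemmas A1_Lp = lin_mean_Lp[OF m1]
  and A2_Lp = lin_mean_Lp[OF m2]
  and B1_Lp = mean_Lp[OF m1 c c_Lp]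
  and B2_Lp = mean_Lp[OF m2 c c_Lp]

lemma Lp_norm_cong:
  "\<eta> \<in> Lp_space p M \<Longrightarrow> \<xi> \<in> Lp_space p M \<Longrightarrow> AE C in M. \<eta> C = \<xi> C \<Longrightarrow> Lp_norm p M \<eta> = Lp_norm p M \<xi>"
  by (rule L.Lp_norm_cong_AE) (auto simp: Lp_space_iff)

definition rate :: real where "rate = enn2real (Lp_opnorm p M (A1 \<circ> A2))"

lemma ennreal_rate: "ennreal rate = Lp_opnorm p M (A1 \<circ> A2)"
  unfolding rate_def using contraction by (simp add: order.strict_trans[OF _ ennreal_one_less_top])

lemma rate: "0 \<le> rate" "rate < 1"
proof -
  show "0 \<le> rate" by (simp add: rate_def)
  show "rate < 1" using contraction ennreal_less_iff[of rate 1] \<open>0 \<le> rate\<close> by (simp add: ennreal_rate)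
qed

text \<open>\<open>Lp_opnorm\<close> is a supremum over the unit ball, and homogeneity, valid almost
  everywhere, extends the bound to all functions.\<close>

lemma A_bound:
  assumes \<xi>: "\<xi> \<in> Lp_space p M" shows "Lp_norm p M (A1 (A2 \<xi>)) \<le> rate * Lp_norm p M \<xi>"
proof (rule field_le_epsilon)
  fix e :: real assume e: "0 < e"
  \<comment> \<open>The added \<open>e\<close> keeps the scale positive when the norm of
    \<open>\<xi>\<close> is zero.\<close>
  let ?t = "Lp_norm p M \<xi> + e"
  have t: "0 < ?t" using Lp_norm_nonneg[of p M \<xi>] e by linarith
  let ?\<xi> = "\<lambda>C. inverse ?t *\<^sub>R \<xi> C"
  have \<xi>': "?\<xi> \<in> Lp_space p M" by (rule L.Lp_scaleR(1)[OF \<xi>])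
  have "Lp_norm p M ?\<xi> \<le> 1" unfolding L.Lp_scaleR(2)[OF \<xi>] using t e by (simp add: field_simps)
  then have "ennreal (Lp_norm p M ((A1 \<circ> A2) ?\<xi>)) \<le> Lp_opnorm p M (A1 \<circ> A2)"
    unfolding Lp_opnorm_def using \<xi>' by (intro SUP_upper) simp
  also have "\<dots> = ennreal rate" by (rule ennreal_rate[symmetric])
  finally have le: "Lp_norm p M (A1 (A2 ?\<xi>)) \<le> rate" using rate(1) by simp
  have s: "(\<lambda>C. inverse ?t *\<^sub>R A2 \<xi> C) \<in> Lp_space p M" by (rule L.Lp_scaleR(1)[OF A2_Lp[OF \<xi>]])
  have s': "(\<lambda>C. inverse ?t *\<^sub>R A1 (A2 \<xi>) C) \<in> Lp_space p M" by (rule L.Lp_scaleR(1)[OF A1_Lp[OF A2_Lp[OF \<xi>]]])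
  have "AE C in M. A1 (A2 ?\<xi>) C = inverse ?t *\<^sub>R A1 (A2 \<xi>) C"
    using mean_cong[OF m1 cocycle_zero zero_cocycle_Lp A2_Lp[OF \<xi>'] s mean_scaleR[OF m2 \<xi>]]
      mean_scaleR[OF m1 A2_Lp[OF \<xi>], of "inverse ?t"] by eventually_elim simp
  from Lp_norm_cong[OF A1_Lp[OF A2_Lp[OF \<xi>']] s' this]
  have "Lp_norm p M (A1 (A2 ?\<xi>)) = inverse ?t * Lp_norm p M (A1 (A2 \<xi>))"
    unfolding L.Lp_scaleR(2)[OF A1_Lp[OF A2_Lp[OF \<xi>]]] using t by simp
  then have "Lp_norm p M (A1 (A2 \<xi>)) = ?t * Lp_norm p M (A1 (A2 ?\<xi>))" using t by (simp add: field_simps)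
  also have "\<dots> \<le> ?t * rate" using le t by (intro mult_left_mono) simp_all
  also have "\<dots> \<le> rate * Lp_norm p M \<xi> + e"
    using mult_right_mono[of rate 1 e] rate e by (simp add: algebra_simps)
  finally show "Lp_norm p M (A1 (A2 \<xi>)) \<le> rate * Lp_norm p M \<xi> + e" .
qed

lemma B_lipschitz:
  assumes \<eta>: "\<eta> \<in> Lp_space p M" and \<xi>: "\<xi> \<in> Lp_space p M"
  shows "Lp_norm p M (\<lambda>C. B1 (B2 \<eta>) C - B1 (B2 \<xi>) C) \<le> rate * Lp_norm p M (\<lambda>C. \<eta> C - \<xi> C)"
proof -
  have d: "(\<lambda>C. \<eta> C - \<xi> C) \<in> Lp_space p M" by (rule L.Lp_diff(1)[OF \<eta> \<xi>])
  have d2: "(\<lambda>C. B2 \<eta> C - B2 \<xi> C) \<in> Lp_space p M" by (rule L.Lp_diff(1)[OF B2_Lp[OF \<eta>] B2_Lp[OF \<xi>]])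
  have d1: "(\<lambda>C. B1 (B2 \<eta>) C - B1 (B2 \<xi>) C) \<in> Lp_space p M"
    by (rule L.Lp_diff(1)[OF B1_Lp[OF B2_Lp[OF \<eta>]] B1_Lp[OF B2_Lp[OF \<xi>]]])
  have "AE C in M. B1 (B2 \<eta>) C - B1 (B2 \<xi>) C = A1 (A2 (\<lambda>C. \<eta> C - \<xi> C)) C"
    using mean_diff[OF m1 c c_Lp B2_Lp[OF \<eta>] B2_Lp[OF \<xi>]]
      mean_cong[OF m1 cocycle_zero zero_cocycle_Lp d2 A2_Lp[OF d] mean_diff[OF m2 c c_Lp \<eta> \<xi>]]
    by eventually_elim simp
  from Lp_norm_cong[OF d1 A1_Lp[OF A2_Lp[OF d]] this] show ?thesis using A_bound[OF d] by simp
qed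

text \<open>Banach's iteration. The equality holds almost everywhere because the limit is determined
  only as a class.\<close>

lemma ex_fixed: "\<exists>w\<in>Lp_space p M. AE C in M. B1 (B2 w) C = w C"
proof -
  define X where "X n = ((\<lambda>\<eta>. B1 (B2 \<eta>)) ^^ n) (\<lambda>_. 0)" for n :: nat
  have X_Suc: "X (Suc n) = B1 (B2 (X n))" for n by (simp add: X_def)
  have X: "X n \<in> Lp_space p M" for n
  proof (induction n)
    case 0 show ?case by (simp add: X_def zero_Lp)
  next
    case (Suc n) then show ?case unfolding X_Suc by (intro B1_Lp B2_Lp)
  qed
  \<comment> \<open>The increments of the iteration decay geometrically; their series telescopes to
    the iterates, since \<open>X 0\<close> is zero.\<close>
  define \<xi> where "\<xi> n C = X (Suc n) C - X n C" for n C
  have \<xi>: "\<xi> n \<in> Lp_space p M" for n unfolding \<xi>_def[abs_def] by (rule L.Lp_diff(1)[OF X X])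
  have step: "Lp_norm p M (\<xi> (Suc n)) \<le> rate * Lp_norm p M (\<xi> n)" for n
    unfolding \<xi>_def[abs_def] X_Suc[of "Suc n"] using B_lipschitz[OF X X, of "Suc n" n] by (simp add: X_Suc)
  have geo: "Lp_norm p M (\<xi> n) \<le> Lp_norm p M (\<xi> 0) * rate ^ n" for n
  proof (induction n)
    case (Suc n)
    have "Lp_norm p M (\<xi> (Suc n)) \<le> rate * (Lp_norm p M (\<xi> 0) * rate ^ n)"
      by (rule order_trans[OF step mult_left_mono[OF Suc rate(1)]])
    then show ?case by (simp add: ac_simps)
  qed simp
  have "summable (\<lambda>n. Lp_norm p M (\<xi> n))"
  proof (rule summable_comparison_test'[where N = 0])
    show "summable (\<lambda>n. Lp_norm p M (\<xi> 0) * rate ^ n)"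
      using rate by (intro summable_mult summable_geometric) simp
    show "norm (Lp_norm p M (\<xi> n)) \<le> Lp_norm p M (\<xi> 0) * rate ^ n" for n using geo[of n] by simp
  qed
  from L.Lp_complete_series[OF \<xi> this] obtain w where w: "w \<in> Lp_space p M"
    and lim: "(\<lambda>n. Lp_norm p M (\<lambda>C. w C - (\<Sum>k<n. \<xi> k C))) \<longlonglongrightarrow> 0" by blast
  have "(\<Sum>k<n. \<xi> k C) = X n C" for n C
    unfolding \<xi>_def using sum_lessThan_telescope[of "\<lambda>k. X k C" n] by (simp add: X_def)
  then have lim: "(\<lambda>n. Lp_norm p M (\<lambda>C. w C - X n C)) \<longlonglongrightarrow> 0" using lim by simp
  have Sw: "B1 (B2 w) \<in> Lp_space p M" by (intro B1_Lp B2_Lp w)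
  have bound: "Lp_norm p M (\<lambda>C. B1 (B2 w) C - w C) \<le>
      rate * Lp_norm p M (\<lambda>C. w C - X n C) + Lp_norm p M (\<lambda>C. w C - X (Suc n) C)" for n
    using L.Lp_norm_triangle_diff[OF Sw X[of "Suc n"] w] B_lipschitz[OF w X[of n]]
      L.Lp_norm_minus_commute[of "X (Suc n)" w] by (simp add: X_Suc)
  have "(\<lambda>n. rate * Lp_norm p M (\<lambda>C. w C - X n C) + Lp_norm p M (\<lambda>C. w C - X (Suc n) C)) \<longlonglongrightarrow> rate * 0 + 0"
    by (intro tendsto_add tendsto_mult_left lim LIMSEQ_Suc)
  from LIMSEQ_le_const[OF this] bound
  have "Lp_norm p M (\<lambda>C. B1 (B2 w) C - w C) \<le> 0" by simp
  then have "Lp_norm p M (\<lambda>C. B1 (B2 w) C - w C) = 0"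
    using Lp_norm_nonneg[of p M "\<lambda>C. B1 (B2 w) C - w C"] by linarith
  then have "AE C in M. B1 (B2 w) C - w C = 0" using L.Lp_norm_eq_0_iff[OF L.Lp_diff(1)[OF Sw w]] by blast
  then show ?thesis using w by auto
qed

text \<open>Under a functional both compositions become iterated integrals over the two factors with
  the same integrand, by commutation of the group elements, and Fubini exchanges them.\<close>

lemma B_commute:
  assumes \<xi>: "\<xi> \<in> Lp_space p M" shows "AE C in M. B1 (B2 \<xi>) C = B2 (B1 \<xi>) C"
proof (rule L.dual_separates[OF sc B1_Lp[OF B2_Lp[OF \<xi>]] B2_Lp[OF B1_Lp[OF \<xi>]]])
  fix \<phi> :: "('g set \<Rightarrow> 'v) \<Rightarrow> 'k" assume \<phi>: "\<phi> \<in> Lp_dual sc p M"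
  interpret p1: prob_space \<mu>1 by (rule m1)
  interpret p2: prob_space \<mu>2 by (rule m2)
  interpret P: pair_prob_space \<mu>1 \<mu>2 ..
  \<comment> \<open>The sum map on the product space is carried by the compact set of sums of
    \<open>K1\<close> and \<open>K2\<close>, so that \<open>dual_integrable\<close> provides the
    integrability Fubini asks for.\<close>
  let ?j = "\<lambda>z. j1 (fst z) + j2 (snd z)" and ?K = "(\<lambda>z. fst z + snd z) ` (K1 \<times> K2)"
  have j: "?j \<in> borel_measurable (\<mu>1 \<Otimes>\<^sub>M \<mu>2)"
    by (rule borel_group_ops(1)[OF measurable_compose[OF measurable_fst m1(2)] measurable_compose[OF measurable_snd m2(2)]])
  have K: "compact ?K"
    by (rule compact_continuous_image[OF _ compact_Times[OF m1(3) m2(3)]]) (intro continuous_intros)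
  then have [measurable]: "?K \<in> sets borel" by (intro borel_closed compact_imp_closed)
  have ae: "AE z in \<mu>1 \<Otimes>\<^sub>M \<mu>2. ?j z \<in> ?K"
  proof (rule P.AE_pair_measure)
    show "{z \<in> space (\<mu>1 \<Otimes>\<^sub>M \<mu>2). ?j z \<in> ?K} \<in> sets (\<mu>1 \<Otimes>\<^sub>M \<mu>2)"
      using measurable_sets[OF j \<open>?K \<in> sets borel\<close>] by (simp add: vimage_def Int_def conj_commute)
    show "AE y in \<mu>1. AE z in \<mu>2. ?j (y, z) \<in> ?K"
      using m1(4)
    proof (rule eventually_mono)
      fix y assume y: "j1 y \<in> K1"
      show "AE z in \<mu>2. ?j (y, z) \<in> ?K"
        using m2(4)
      proof (rule eventually_mono)
        fix z assume "j2 z \<in> K2"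
        then show "?j (y, z) \<in> ?K" using y by (intro image_eqI[of _ _ "(j1 y, j2 z)"]) simp_all
      qed
    qed
  qed
  have int: "integrable (\<mu>1 \<Otimes>\<^sub>M \<mu>2) (\<lambda>(y, z). \<phi> (act c (j1 y + j2 z) \<xi>))"
    using dual_integrable[OF P.prob_space_axioms j K ae c c_Lp \<xi> \<phi>] by (simp add: case_prod_unfold)
  have "\<phi> (B1 (B2 \<xi>)) = (\<integral>y. (\<integral>z. \<phi> (act c (j1 y + j2 z) \<xi>) \<partial>\<mu>2) \<partial>\<mu>1)"
    unfolding dual_mean[OF m1 c c_Lp B2_Lp[OF \<xi>] \<phi>] dual_act_mean[OF m2 c c_Lp \<xi> \<phi>] ..
  also have "\<dots> = (\<integral>z. (\<integral>y. \<phi> (act c (j2 z + j1 y) \<xi>) \<partial>\<mu>1) \<partial>\<mu>2)"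
    using P.Fubini_integral[OF int] by (simp only: comm)
  also have "\<dots> = \<phi> (B2 (B1 \<xi>))"
    unfolding dual_mean[OF m2 c c_Lp B1_Lp[OF \<xi>] \<phi>] dual_act_mean[OF m1 c c_Lp \<xi> \<phi>] ..
  finally show "\<phi> (B1 (B2 \<xi>)) = \<phi> (B2 (B1 \<xi>))" .
qed

text \<open>As the averages commute, \<open>B1 w\<close> is again fixed by their composition. The
  contraction shrinks its distance to \<open>w\<close> strictly unless that distance is
  zero.\<close>

lemma ex_mean_fixed: "\<exists>w\<in>Lp_space p M. AE C in M. B1 w C = w C"
proof -
  obtain w where w: "w \<in> Lp_space p M" and fix_w: "AE C in M. B1 (B2 w) C = w C" using ex_fixed by blast
  note w1 = B1_Lp[OF w]
  have "AE C in M. B2 (B1 w) C = w C" using B_commute[OF w] fix_w by eventually_elim simp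
  from mean_cong[OF m1 c c_Lp B2_Lp[OF w1] w this]
  have *: "AE C in M. B1 (B2 (B1 w)) C - B1 (B2 w) C = B1 w C - w C"
    using fix_w by eventually_elim simp
  have "Lp_norm p M (\<lambda>C. B1 w C - w C) \<le> rate * Lp_norm p M (\<lambda>C. B1 w C - w C)"
    using Lp_norm_cong[OF L.Lp_diff(1)[OF B1_Lp[OF B2_Lp[OF w1]] B1_Lp[OF B2_Lp[OF w]]] L.Lp_diff(1)[OF w1 w] *]
      B_lipschitz[OF w1 w] by simp
  then have "(1 - rate) * Lp_norm p M (\<lambda>C. B1 w C - w C) \<le> 0" by (simp add: algebra_simps)
  then have "Lp_norm p M (\<lambda>C. B1 w C - w C) = 0"
    using rate(2) Lp_norm_nonneg[of p M "\<lambda>C. B1 w C - w C"] by (simp add: mult_le_0_iff)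
  then have "AE C in M. B1 w C - w C = 0" using L.Lp_norm_eq_0_iff[OF L.Lp_diff(1)[OF w1 w]] by blast
  then show ?thesis using w by auto
qed

end

theorem theorem4p20:
  fixes sc :: "'k::{real_normed_field, euclidean_space} \<Rightarrow> 'v::banach \<Rightarrow> 'v"
    and p :: real
    and \<Gamma> D :: "('a::{topological_group_add, t2_space, second_countable_topology} \<times>
                 'b::{topological_group_add, t2_space, second_countable_topology}) set"
    and \<nu> :: "('a \<times> 'b) measure"
    and \<rho> :: "'a \<times> 'b \<Rightarrow> 'v \<Rightarrow> 'v"
    and \<mu>1 :: "'a measure" and \<mu>2 :: "'b measure"
    and N1 :: "'a set" and N2 :: "'b set"
    and b :: "'a \<times> 'b \<Rightarrow> 'a \<times> 'b \<Rightarrow> 'v"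
  defines "M \<equiv> coset_measure \<nu> \<Gamma> D"
    and "R1 \<equiv> (\<lambda>g. induced_rep \<Gamma> D \<rho> (g, 0))"
    and "R2 \<equiv> (\<lambda>g. induced_rep \<Gamma> D \<rho> (0, g))"
  assumes "1 < p"
    and "locally_compact_space (euclidean :: 'a topology)"
    and "locally_compact_space (euclidean :: 'b topology)"
    and "haar_measure \<nu>"
    and "p_integrable_lattice p \<nu> \<Gamma>" and "irreducible_in_prod \<Gamma>"
    and "D \<in> sets borel" and "fundamental_domain \<Gamma> D" and "0 \<in> D"
    and "compact (closure D) \<or> p_integrable_domain p \<nu> \<Gamma> D"
    and "emeasure M (space M) = 1"
    and "scalar_mult sc" and "isometric_module sc \<Gamma> UNIV \<rho>"
    and "prob_space \<mu>1" and "sets \<mu>1 = sets baire"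
    and "prob_space \<mu>2" and "sets \<mu>2 = sets baire"
    and "N1 \<in> null_sets \<mu>1" and "\<exists>K. compact K \<and> - N1 \<subseteq> K"
    and "N2 \<in> null_sets \<mu>2" and "\<exists>K. compact K \<and> - N2 \<subseteq> K"
    and "Lp_opnorm p M (average sc p M \<mu>1 R1 \<circ> average sc p M \<mu>2 R2) < 1"
    and "Lp_fixed p M {average sc p M \<mu>1 R1} = Lp_fixed p M (range R1)"
    and "Lp_fixed p M {average sc p M \<mu>2 R2} = Lp_fixed p M (range R2)"
    and "b \<in> cocycles \<Gamma> UNIV \<rho>"
  shows "\<exists>V1 V2 \<sigma>1 \<sigma>2.
    closed_subspace sc V1 \<and> (\<forall>\<gamma>\<in>\<Gamma>. \<rho> \<gamma> ` V1 \<subseteq> V1) \<and> extends_through sc \<Gamma> \<rho> fst V1 \<sigma>1 \<and>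
    closed_subspace sc V2 \<and> (\<forall>\<gamma>\<in>\<Gamma>. \<rho> \<gamma> ` V2 \<subseteq> V2) \<and> extends_through sc \<Gamma> \<rho> snd V2 \<sigma>2 \<and>
    (\<exists>b1 \<in> cocycles UNIV V1 \<sigma>1. \<exists>b2 \<in> cocycles UNIV V2 \<sigma>2.
       cohomologous \<Gamma> UNIV \<rho> b (\<lambda>g h. b1 g h + b2 g h) \<and>
       (\<forall>g h g' h'. fst g = fst g' \<and> fst h = fst h' \<longrightarrow> b1 g h = b1 g' h') \<and>
       (\<forall>g h g' h'. snd g = snd g' \<and> snd h = snd h' \<longrightarrow> b2 g h = b2 g' h'))"
proof -
  note lc1 = assms(5) and lc2 = assms(6) and haar = assms(7)
  obtain sg: "add_subgroup \<Gamma>" and disc: "discrete \<Gamma>"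
    using assms(8) unfolding p_integrable_lattice_def lattice_in_def by blast
  have lc: "locally_compact_space (euclidean :: ('a \<times> 'b) topology)"
    using lc1 lc2 locally_compact_space_prod_topology[of "euclidean :: 'a topology" "euclidean :: 'b topology"] by simp
  have "sets \<nu> = sets borel" using haar by (simp add: haar_measure_def)
  then have "emeasure \<nu> D = 1" using emeasure_space_coset_measure assms(10,14) unfolding M_def by metis
  then have lat: "lattice_domain \<nu> \<Gamma> D"
    using haar lc sg disc assms(10,11) by (simp add: lattice_domain_def haar_def lattice_domain_axioms_def)
  then interpret induced_module \<nu> \<Gamma> D sc \<rho> p
    using assms(4,15,16) by (simp add: induced_module_def induced_module_axioms_def)
  define c where "c \<gamma> = b 0 \<gamma>" for \<gamma>
  have b_shift: "b (g + g1) (g + g2) = \<rho> g (b g1 g2)" and b_cyc: "b g g2 - b g1 g2 + b g1 g = 0"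
    if "g \<in> \<Gamma>" "g1 \<in> \<Gamma>" "g2 \<in> \<Gamma>" for g g1 g2
    using \<open>b \<in> cocycles \<Gamma> UNIV \<rho>\<close> that unfolding cocycles_def by blast+
  have b_eq: "b g h = c h - c g" if "g \<in> \<Gamma>" "h \<in> \<Gamma>" for g h
    using b_cyc[OF that(1) zero_mem that(2)] by (simp add: c_def algebra_simps add_eq_0_iff)
  have c: "cocycle c"
    unfolding cocycle_def
  proof (intro ballI)
    fix \<gamma> \<delta> assume *: "\<gamma> \<in> \<Gamma>" "\<delta> \<in> \<Gamma>"
    have "b \<gamma> (\<gamma> + \<delta>) = \<rho> \<gamma> (c \<delta>)" using b_shift[OF *(1) zero_mem *(2)] by (simp add: c_def)
    then show "c (\<gamma> + \<delta>) = c \<gamma> + \<rho> \<gamma> (c \<delta>)"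
      using b_eq[OF *(1) add_mem[OF *]] by (simp add: algebra_simps)
  qed
  \<comment> \<open>The two alternatives for \<open>D\<close> match the two integrability lemmas for
    the affine action.\<close>
  have c_Lp: "act c g (\<lambda>_. 0) \<in> Lp_space p (coset_measure \<nu> \<Gamma> D)" for g
    using assms(13) integrable_of_compact_domain integrable_of_p_integrable_domain[OF c] by blast
  have sets1: "sets \<mu>1 = sets borel" using assms(18) baire_eq_borel[OF lc1] by simp
  have sets2: "sets \<mu>2 = sets borel" using assms(20) baire_eq_borel[OF lc2] by simp
  define j1 :: "'a \<Rightarrow> 'a \<times> 'b" where "j1 y = (y, 0)" for y
  define j2 :: "'b \<Rightarrow> 'a \<times> 'b" where "j2 z = (0, z)" for z
  have "j1 \<in> borel_measurable borel" "j2 \<in> borel_measurable borel"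
    unfolding j1_def j2_def by (intro borel_measurable_continuous_onI continuous_intros)+
  then have j1: "j1 \<in> borel_measurable \<mu>1" and j2: "j2 \<in> borel_measurable \<mu>2"
    by (simp_all only: measurable_cong_sets[OF sets1 refl] measurable_cong_sets[OF sets2 refl])
  obtain K1 where K1: "compact K1" "- N1 \<subseteq> K1" using assms(22) by blast
  obtain K2 where K2: "compact K2" "- N2 \<subseteq> K2" using assms(24) by blast
  have ae1: "AE y in \<mu>1. j1 y \<in> K1 \<times> {0}"
    using AE_not_in[OF assms(21)] by (rule eventually_mono) (use K1(2) in \<open>auto simp: j1_def\<close>)
  have ae2: "AE z in \<mu>2. j2 z \<in> {0} \<times> K2"
    using AE_not_in[OF assms(23)] by (rule eventually_mono) (use K2(2) in \<open>auto simp: j2_def\<close>)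
  have R1: "R1 = (\<lambda>y. lin (j1 y))" and R2: "R2 = (\<lambda>z. lin (j2 z))"
    by (simp_all add: R1_def R2_def j1_def j2_def induced_rep_eq)
  have contr: "Lp_opnorm p (coset_measure \<nu> \<Gamma> D) (mean (\<lambda>_. 0) \<mu>1 j1 \<circ> mean (\<lambda>_. 0) \<mu>2 j2) < 1"
    using assms(25) unfolding R1 R2 M_def .
  have comm: "j1 y + j2 z = j2 z + j1 y" for y z by (simp add: j1_def j2_def)
  have K: "compact (K1 \<times> {0 :: 'b})" "compact ({0 :: 'a} \<times> K2)"
    using K1(1) K2(1) by (intro compact_Times; simp)+
  interpret commuting_means \<nu> \<Gamma> D sc \<rho> p c \<mu>1 j1 "K1 \<times> {0}" \<mu>2 j2 "{0} \<times> K2"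
    by (rule commuting_means.intro[OF induced_module_axioms
          commuting_means_axioms.intro[OF c c_Lp assms(17) j1 K(1) ae1 assms(19) j2 K(2) ae2 comm contr]])
  obtain w where w: "w \<in> Lp_space p (coset_measure \<nu> \<Gamma> D)"
    and fix_w: "AE C in coset_measure \<nu> \<Gamma> D. mean c \<mu>1 j1 w C = w C"
    using ex_mean_fixed by blast
  define F where "F = lift c w"
  have mixed: "AE x in \<nu>. F (g + x) = F ((fst g, 0) + x) + F ((0, snd g) + x) - F x" for g
  proof -
    \<comment> \<open>The sign is negative because \<open>act\<close> translates the lift by the
      inverse, so that the lift of \<open>\<zeta>\<close> is the increment of \<open>F\<close> under
      \<open>(0, snd g)\<close>.\<close>
    define \<zeta> where "\<zeta> C = act c (0, - snd g) w C - w C" for C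
    have \<zeta>: "\<zeta> \<in> Lp_space p (coset_measure \<nu> \<Gamma> D)"
      unfolding \<zeta>_def[abs_def] by (rule L.Lp_diff(1)[OF act_Lp[OF c c_Lp w] w])
    have "AE C in coset_measure \<nu> \<Gamma> D. mean (\<lambda>_. 0) \<mu>1 j1 \<zeta> C = \<zeta> C"
      unfolding \<zeta>_def[abs_def] by (rule mean_fixed_difference[OF m1 c c_Lp w fix_w]) (simp add: j1_def)
    then have "\<zeta> \<in> Lp_fixed p M {average sc p M \<mu>1 R1}"
      using \<zeta> unfolding Lp_fixed_def R1 M_def by blast
    then have "\<zeta> \<in> Lp_fixed p M (range R1)" unfolding assms(26) .
    then have "AE C in coset_measure \<nu> \<Gamma> D. R1 (- fst g) \<zeta> C = \<zeta> C"
      unfolding Lp_fixed_def M_def by blast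
    from AE_M_lift[OF this]
    have "AE x in \<nu>. lin (j1 (- fst g)) \<zeta> (left_coset \<Gamma> x) = \<zeta> (left_coset \<Gamma> x)" unfolding R1 .
    then show ?thesis
    proof (rule eventually_mono)
      fix x assume eq: "lin (j1 (- fst g)) \<zeta> (left_coset \<Gamma> x) = \<zeta> (left_coset \<Gamma> x)"
      have F_diff: "lift (\<lambda>_. 0) \<zeta> z = F ((0, snd g) + z) - F z" for z
        using lift_diff[of c "act c (0, - snd g) w" z w] lift_act[OF c, of "(0, - snd g)" w z]
        unfolding \<zeta>_def[abs_def] F_def by simp
      have "lift (\<lambda>_. 0) \<zeta> ((fst g, 0) + x) = lift (\<lambda>_. 0) (lin (j1 (- fst g)) \<zeta>) x"
        using lift_act[OF cocycle_zero, of "j1 (- fst g)" \<zeta> x] by (simp add: j1_def)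
      also have "\<dots> = lift (\<lambda>_. 0) \<zeta> x" by (simp only: lift_def[of "\<lambda>_. 0"] eq)
      \<comment> \<open>Invariance of the lifted increment under the first factor, written out: the
        increment of \<open>F\<close> in the second direction is the same at
        \<open>(fst g, 0) + x\<close> as at \<open>x\<close>.\<close>
      finally have "F ((0, snd g) + ((fst g, 0) + x)) - F ((fst g, 0) + x) = F ((0, snd g) + x) - F x"
        unfolding F_diff .
      moreover have "(0, snd g) + ((fst g, 0) + x) = g + x" by (cases g, cases x) simp
      ultimately show "F (g + x) = F ((fst g, 0) + x) + F ((0, snd g) + x) - F x"
        by (simp add: algebra_simps)
    qed
  qed
  have F: "strongly_measurable borel F"
    unfolding F_def using w by (intro lift_measurable) (simp add: Lp_space_iff)
  have dense: "closure (fst ` \<Gamma>) = UNIV" "closure (snd ` \<Gamma>) = UNIV"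
    using assms(9) by (simp_all add: irreducible_in_prod_def)
  have "\<exists>V1 V2 \<sigma>1 \<sigma>2 b1 b2 v.
    closed_subspace sc V1 \<and> (\<forall>\<gamma>\<in>\<Gamma>. \<rho> \<gamma> ` V1 \<subseteq> V1) \<and> extends_through sc \<Gamma> \<rho> fst V1 \<sigma>1 \<and>
    closed_subspace sc V2 \<and> (\<forall>\<gamma>\<in>\<Gamma>. \<rho> \<gamma> ` V2 \<subseteq> V2) \<and> extends_through sc \<Gamma> \<rho> snd V2 \<sigma>2 \<and>
    b1 \<in> cocycles UNIV V1 \<sigma>1 \<and> b2 \<in> cocycles UNIV V2 \<sigma>2 \<and>
    (\<forall>g\<in>\<Gamma>. \<forall>h\<in>\<Gamma>. c h - c g - (b1 g h + b2 g h) = \<rho> h v - \<rho> g v) \<and>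
    (\<forall>g h g' h'. fst g = fst g' \<and> fst h = fst h' \<longrightarrow> b1 g h = b1 g' h') \<and>
    (\<forall>g h g' h'. snd g = snd g' \<and> snd h = snd h' \<longrightarrow> b2 g h = b2 g' h')"
    by (rule left_coset_equivariant_splits[OF lat lc1 lc2 dense assms(15,16) F _ mixed])
      (simp add: F_def lift_equivariant[OF c])
  then obtain V1 V2 \<sigma>1 \<sigma>2 b1 b2 v where
    V1: "closed_subspace sc V1" "\<forall>\<gamma>\<in>\<Gamma>. \<rho> \<gamma> ` V1 \<subseteq> V1" "extends_through sc \<Gamma> \<rho> fst V1 \<sigma>1"
    and V2: "closed_subspace sc V2" "\<forall>\<gamma>\<in>\<Gamma>. \<rho> \<gamma> ` V2 \<subseteq> V2" "extends_through sc \<Gamma> \<rho> snd V2 \<sigma>2"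
    and b1: "b1 \<in> cocycles UNIV V1 \<sigma>1" and b2: "b2 \<in> cocycles UNIV V2 \<sigma>2"
    and coh: "\<forall>g\<in>\<Gamma>. \<forall>h\<in>\<Gamma>. c h - c g - (b1 g h + b2 g h) = \<rho> h v - \<rho> g v"
    and d1: "\<forall>g h g' h'. fst g = fst g' \<and> fst h = fst h' \<longrightarrow> b1 g h = b1 g' h'"
    and d2: "\<forall>g h g' h'. snd g = snd g' \<and> snd h = snd h' \<longrightarrow> b2 g h = b2 g' h'"
    by (elim exE conjE) (rule that)
  have "cohomologous \<Gamma> UNIV \<rho> b (\<lambda>g h. b1 g h + b2 g h)"
    unfolding cohomologous_def
  proof (intro bexI[of _ v] ballI UNIV_I)
    fix g h assume "g \<in> \<Gamma>" "h \<in> \<Gamma>"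
    then show "b g h - (b1 g h + b2 g h) = \<rho> h v - \<rho> g v" using coh by (simp only: b_eq)
  qed
  with d1 d2 b1 b2 have "\<exists>b1 \<in> cocycles UNIV V1 \<sigma>1. \<exists>b2 \<in> cocycles UNIV V2 \<sigma>2.
       cohomologous \<Gamma> UNIV \<rho> b (\<lambda>g h. b1 g h + b2 g h) \<and>
       (\<forall>g h g' h'. fst g = fst g' \<and> fst h = fst h' \<longrightarrow> b1 g h = b1 g' h') \<and>
       (\<forall>g h g' h'. snd g = snd g' \<and> snd h = snd h' \<longrightarrow> b2 g h = b2 g' h')"
    by (intro bexI[of _ b1] bexI[of _ b2] conjI)
  with V1 V2 show ?thesis by (intro exI[of _ V1] exI[of _ V2] exI[of _ \<sigma>1] exI[of _ \<sigma>2] conjI)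
qed

end
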